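(* Let $s\in\mathbb{N}_0$, let $\varphi\in H^s(\mathbb{R}^d)$ and $\widetilde\varphi\in H^{-s}(\mathbb{R}^d)$ have compact supports, and let $n\ge s$. Consider the conditions $$\lim_{t\to\mathbf{0}}\frac{1}{|t|^n}\left|1-\widehat\varphi(t)\overline{\widehat{\widetilde\varphi}(t)}\right|=0,\qquad \lim_{t\to\mathbf{0}}\frac{1}{|t|^{2n}}\sum_{k\in\mathbb{Z}^d,\,k\neq\mathbf{0}}(1+|t+k|^2)^r\,|\widehat\varphi(t+k)|^2=0\quad\text{for all } 0\le r\le s.\qquad( * )$$ 1. If $( * )$ holds, then the quasi-projection operator $Q_j(f)=\sum_{k\in\mathbb{Z}^d}\langle f,\widetilde\varphi_{jk}\rangle\varphi_{jk}$ provides simultaneous density order $(s,n)$ in the Schwartz class $\mathcal{S}$. 2. Suppose that $M$ is an isotropic dilation matrix. Then $Q_j$ provides simultaneous density order $(s,n)$ in $\mathcal{S}$ if and only if $( * )$ holds.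
   Context: $M\in\mathbb{Z}^{d\times d}$ is a fixed dilation matrix, i.e. all its eigenvalues are greater than 1 in modulus; $m=|\det M|$; $M^*$ is its (conjugate) transpose, $M^{*j}=(M^* )^j$, $M^{*-j}=(M^* )^{-j}$, and $\|\cdot\|$ is the operator norm of matrices induced by the Euclidean norm $|\cdot|$. A dilation matrix $M$ is called isotropic if all its eigenvalues are equal in modulus, to $\rho=\rho(M)=m^{1/d}$, and there are positive constants $C_1,C_2$ with $C_1\rho^j\le\|M^j\|\le C_2\rho^j$ for all $j\in\mathbb{Z}$. $\mathbb{N}_0=\mathbb{N}\cup\{0\}$ and $\mathbf{0}$ is the origin of $\mathbb{R}^d$. For a function (or tempered distribution) $g$ on $\mathbb{R}^d$, $g_{jk}(x)=m^{j/2}g(M^jx+k)$, $j\in\mathbb{Z}$, $k\in\mathbb{Z}^d$. The Fourier transform is $\widehat f(\xi)=\int_{\mathbb{R}^d}f(x)e^{-2\pi i(x,\xi)}dx$, extended to tempered distributions. $\mathcal{S}$ is the Schwartz class on $\mathbb{R}^d$. For real $s$, $H^s(\mathbb{R}^d)$ is the space of tempered distributions $f$ with $\|f\|_{H^s}^2=\int_{\mathbb{R}^d}|\widehat f(\xi)|^2(1+|\xi|^2)^s\,d\xi<\infty$. For $f\in H^s(\mathbb{R}^d)$, $g\in H^{-s}(\mathbb{R}^d)$ the pairing is $\langle f,g\rangle=\int_{\mathbb{R}^d}\widehat f(\xi)\overline{\widehat g(\xi)}\,d\xi$. The seminorm is $|f|_{H^r}^2=\int_{\mathbb{R}^d}|\xi|^{2r}|\widehat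 f(\xi)|^2d\xi$. Under the stated hypotheses on $\varphi,\widetilde\varphi$ the series defining $Q_j(f)$ converges unconditionally in $H^s(\mathbb{R}^d)$ for every $f\in H^s(\mathbb{R}^d)$ and $j\in\mathbb{Z}$. Definition. $Q_j$ provides simultaneous density order $(s,n)$ in $\mathcal{S}$ if for all $f\in\mathcal{S}$ $$\lim_{j\to+\infty}\|M^{*-j}\|^{-n}\sum_{r=0}^{s}\|M^{*j}\|^{-r}\left|f-\sum_{k\in\mathbb{Z}^d}\langle f,\widetilde\varphi_{jk}\rangle\varphi_{jk}\right|_{H^r}=0.$$ *)

theory Defs
  imports "HOL-Analysis.Analysis"
begin

section \<open>Dilation matrices\<close>

definition eigenvalue_of :: "complex ^ 'd ^ 'd \<Rightarrow> complex \<Rightarrow> bool" where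
  "eigenvalue_of A c \<longleftrightarrow> (\<exists>v. v \<noteq> 0 \<and> A *v v = c *s v)"

definition real_mat :: "int ^ 'd ^ 'd \<Rightarrow> real ^ 'd ^ 'd" where
  "real_mat M = map_matrix real_of_int M"

definition real_vec :: "int ^ 'd \<Rightarrow> real ^ 'd" where
  "real_vec k = (\<chi> i. real_of_int (k $ i))"

definition dilation_matrix :: "int ^ 'd ^ 'd \<Rightarrow> bool" where
  "dilation_matrix M \<longleftrightarrow> (\<forall>c. eigenvalue_of (map_matrix of_int M) c \<longrightarrow> cmod c > 1)"

definition absdet :: "int ^ 'd ^ 'd \<Rightarrow> real" where
  "absdet M = \<bar>det (real_mat M)\<bar>"

text \<open>Powers for the matrix product; \<open>^\<close> on \<open>real ^ 'd ^ 'd\<close> would be componentwise.\<close>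

primrec mat_pow :: "real ^ 'd ^ 'd \<Rightarrow> nat \<Rightarrow> real ^ 'd ^ 'd" where
  "mat_pow A 0 = mat 1"
| "mat_pow A (Suc k) = A ** mat_pow A k"

definition mat_powi :: "real ^ 'd ^ 'd \<Rightarrow> int \<Rightarrow> real ^ 'd ^ 'd" where
  "mat_powi A j = (if j \<ge> 0 then mat_pow A (nat j) else mat_pow (matrix_inv A) (nat (- j)))"

definition mat_norm :: "real ^ 'd ^ 'd \<Rightarrow> real" where
  "mat_norm A = onorm (\<lambda>x. A *v x)"

definition isotropic :: "int ^ 'd ^ 'd \<Rightarrow> bool" where
  "isotropic M \<longleftrightarrow>
     (let \<rho> = absdet M powr (1 / real CARD('d)) in
        (\<forall>c. eigenvalue_of (map_matrix of_int M) c \<longrightarrow> cmod c = \<rho>) \<and>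
        (\<exists>C1 > 0. \<exists>C2 > 0. \<forall>j :: int.
           C1 * \<rho> powi j \<le> mat_norm (mat_powi (real_mat M) j) \<and>
           mat_norm (mat_powi (real_mat M) j) \<le> C2 * \<rho> powi j))"


section \<open>Schwartz functions and tempered distributions\<close>

definition partial_deriv :: "'d \<Rightarrow> (real ^ 'd \<Rightarrow> complex) \<Rightarrow> real ^ 'd \<Rightarrow> complex" where
  "partial_deriv i f = (\<lambda>x. frechet_derivative f (at x) (axis i 1))"

text \<open>A multi-index is given as the list of the coordinates one differentiates in.\<close>

definition iter_partial :: "'d list \<Rightarrow> (real ^ 'd \<Rightarrow> complex) \<Rightarrow> real ^ 'd \<Rightarrow> complex" where
  "iter_partial is f = foldr partial_deriv is f"

definition schwartz :: "(real ^ 'd \<Rightarrow> complex) set" where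
  "schwartz = {f. \<forall>is. (\<forall>x. iter_partial is f differentiable (at x)) \<and>
                 (\<forall>N :: nat. bounded (range (\<lambda>x. (1 + norm x) ^ N *\<^sub>R iter_partial is f x)))}"

text \<open>Convergence to 0 in the topology of the Schwartz class, i.e. with respect to all seminorms
  \<open>sup\<^sub>x (1 + |x|)^N |D f(x)|\<close>, where \<open>D\<close> runs over the iterated partial derivatives.\<close>

definition schwartz_null :: "(nat \<Rightarrow> real ^ 'd \<Rightarrow> complex) \<Rightarrow> bool" where
  "schwartz_null \<psi> \<longleftrightarrow>
     (\<forall>is. \<forall>N :: nat. uniform_limit UNIV
        (\<lambda>l x. (1 + norm x) ^ N *\<^sub>R iter_partial is (\<psi> l) x) (\<lambda>_. 0) sequentially)"

type_synonym 'd distr = "(real ^ 'd \<Rightarrow> complex) \<Rightarrow> complex"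

text \<open>Continuous linear functionals on the (metrizable) Schwartz class. Functionals are total
  in HOL; the value 0 outside the Schwartz class makes equality of distributions the usual one.\<close>

definition tempered :: "'d::finite distr set" where
  "tempered = {T.
     (\<forall>\<psi>\<in>schwartz. \<forall>\<eta>\<in>schwartz. T (\<lambda>x. \<psi> x + \<eta> x) = T \<psi> + T \<eta>) \<and>
     (\<forall>c. \<forall>\<psi>\<in>schwartz. T (\<lambda>x. c * \<psi> x) = c * T \<psi>) \<and>
     (\<forall>\<psi>. (\<forall>l. \<psi> l \<in> schwartz) \<and> schwartz_null \<psi> \<longrightarrow> (\<lambda>l. T (\<psi> l)) \<longlonglongrightarrow> 0) \<and>
     (\<forall>\<psi>. \<psi> \<notin> schwartz \<longrightarrow> T \<psi> = 0)}"

definition distr_of :: "(real ^ 'd \<Rightarrow> complex) \<Rightarrow> 'd distr" where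
  "distr_of f = (\<lambda>\<psi>. if \<psi> \<in> schwartz then (LINT x|lborel. f x * \<psi> x) else 0)"

definition distr_diff :: "'d::finite distr \<Rightarrow> 'd distr \<Rightarrow> 'd distr" where
  "distr_diff S T = (\<lambda>\<psi>. S \<psi> - T \<psi>)"

definition vanishes_on :: "'d distr \<Rightarrow> (real ^ 'd) set \<Rightarrow> bool" where
  "vanishes_on T U \<longleftrightarrow>
     (\<forall>\<psi>\<in>schwartz. compact (closure {x. \<psi> x \<noteq> 0}) \<and> closure {x. \<psi> x \<noteq> 0} \<subseteq> U \<longrightarrow> T \<psi> = 0)"

definition distr_support :: "'d distr \<Rightarrow> (real ^ 'd) set" where
  "distr_support T = - \<Union> {U. open U \<and> vanishes_on T U}"

text \<open>The distribution \<open>x \<mapsto> T (A x + b)\<close>, for invertible \<open>A\<close>.\<close>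

definition distr_affine :: "real ^ 'd ^ 'd \<Rightarrow> real ^ 'd \<Rightarrow> 'd distr \<Rightarrow> 'd distr" where
  "distr_affine A b T = (\<lambda>\<psi>. T (\<lambda>y. \<psi> (matrix_inv A *v (y - b))) / \<bar>det A\<bar>)"

text \<open>\<open>g\<^sub>j\<^sub>k(x) = m^(j/2) g(M^j x + k)\<close>\<close>

definition dilate_shift :: "int ^ 'd ^ 'd \<Rightarrow> int \<Rightarrow> int ^ 'd \<Rightarrow> 'd distr \<Rightarrow> 'd distr" where
  "dilate_shift M j k g =
     (\<lambda>\<psi>. (absdet M powr (real_of_int j / 2)) *\<^sub>R
            distr_affine (mat_powi (real_mat M) j) (real_vec k) g \<psi>)"


section \<open>Fourier transform and Sobolev spaces\<close>

definition fourier :: "(real ^ 'd \<Rightarrow> complex) \<Rightarrow> real ^ 'd \<Rightarrow> complex" where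
  "fourier f \<xi> = (LINT x|lborel. f x * exp (- 2 * pi * \<i> * complex_of_real (x \<bullet> \<xi>)))"

definition distr_fourier :: "'d::finite distr \<Rightarrow> 'd distr" where
  "distr_fourier T = (\<lambda>\<psi>. if \<psi> \<in> schwartz then T (fourier \<psi>) else 0)"

text \<open>The distribution \<open>T\<close> is (integration against) the function \<open>g\<close>. Integrability against all
  Schwartz functions, e.g. a Gaussian, includes local integrability of \<open>g\<close>.\<close>

definition represents :: "(real ^ 'd \<Rightarrow> complex) \<Rightarrow> 'd distr \<Rightarrow> bool" where
  "represents g T \<longleftrightarrow> g \<in> borel_measurable lborel \<and>
     (\<forall>\<psi>\<in>schwartz. integrable lborel (\<lambda>x. g x * \<psi> x) \<and> T \<psi> = (LINT x|lborel. g x * \<psi> x))"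

text \<open>If the Fourier transform of a tempered distribution is a function, that function is determined
  up to null sets; the continuous representative is taken when there is one, and it is then unique.
  In particular the Fourier transform of a compactly supported distribution is a continuous
  (indeed entire) function, and its point values are meant in this sense.\<close>

definition ft :: "'d distr \<Rightarrow> real ^ 'd \<Rightarrow> complex" where
  "ft T = (if \<exists>g. represents g (distr_fourier T) \<and> continuous_on UNIV g
           then SOME g. represents g (distr_fourier T) \<and> continuous_on UNIV g
           else SOME g. represents g (distr_fourier T))"

definition sobolev :: "real \<Rightarrow> 'd::finite distr set" where
  "sobolev s = {T \<in> tempered. (\<exists>g. represents g (distr_fourier T)) \<and>
     integrable lborel (\<lambda>\<xi>. (cmod (ft T \<xi>))\<^sup>2 * (1 + (norm \<xi>)\<^sup>2) powr s)}"

definition sobolev_norm :: "real \<Rightarrow> 'd::finite distr \<Rightarrow> real" where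
  "sobolev_norm s T = sqrt (LINT \<xi>|lborel. (cmod (ft T \<xi>))\<^sup>2 * (1 + (norm \<xi>)\<^sup>2) powr s)"

definition sobolev_seminorm :: "nat \<Rightarrow> 'd::finite distr \<Rightarrow> real" where
  "sobolev_seminorm r T = sqrt (LINT \<xi>|lborel. norm \<xi> ^ (2 * r) * (cmod (ft T \<xi>))\<^sup>2)"

definition pairing :: "'d::finite distr \<Rightarrow> 'd distr \<Rightarrow> complex" where
  "pairing f g = (LINT \<xi>|lborel. ft f \<xi> * cnj (ft g \<xi>))"

text \<open>Unconditional convergence in \<open>H\<^sup>s\<close>, as convergence of the net of finite partial sums.\<close>

definition sobolev_has_sum :: "real \<Rightarrow> ('k \<Rightarrow> 'd::finite distr) \<Rightarrow> 'd distr \<Rightarrow> bool" where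
  "sobolev_has_sum s G S \<longleftrightarrow> S \<in> sobolev s \<and> (\<forall>k. G k \<in> sobolev s) \<and>
     ((\<lambda>F. sobolev_norm s (distr_diff S (\<lambda>\<psi>. \<Sum>k\<in>F. G k \<psi>))) \<longlongrightarrow> 0) (finite_subsets_at_top UNIV)"


section \<open>Quasi-projection operators\<close>

definition quasi_proj ::
  "int ^ 'd ^ 'd \<Rightarrow> nat \<Rightarrow> 'd distr \<Rightarrow> 'd distr \<Rightarrow> int \<Rightarrow> 'd distr \<Rightarrow> 'd distr" where
  "quasi_proj M s \<phi> \<phi>' j f = (THE S. sobolev_has_sum (real s)
     (\<lambda>k. \<lambda>\<psi>. pairing f (dilate_shift M j k \<phi>') * dilate_shift M j k \<phi> \<psi>) S)"

definition simultaneous_density_order ::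
  "int ^ 'd ^ 'd \<Rightarrow> 'd distr \<Rightarrow> 'd distr \<Rightarrow> nat \<Rightarrow> real \<Rightarrow> bool" where
  "simultaneous_density_order M \<phi> \<phi>' s n \<longleftrightarrow>
     (\<forall>f\<in>schwartz.
        ((\<lambda>j :: int. mat_norm (mat_powi (transpose (real_mat M)) (- j)) powr (- n) *
            (\<Sum>r = 0..s. mat_norm (mat_powi (transpose (real_mat M)) j) powr (- real r) *
               sobolev_seminorm r (distr_diff (distr_of f) (quasi_proj M s \<phi> \<phi>' j (distr_of f)))))
         \<longlongrightarrow> 0) at_top)"

text \<open>The conditions on \<open>\<phi>\<close> and \<open>\<phi>'\<close> at the origin. The lattice sum is taken in \<open>[0, \<infinity>]\<close>, so a divergent
  sum counts as \<open>\<infinity>\<close>.\<close>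

definition origin_conditions :: "'d::finite distr \<Rightarrow> 'd distr \<Rightarrow> nat \<Rightarrow> real \<Rightarrow> bool" where
  "origin_conditions \<phi> \<phi>' s n \<longleftrightarrow>
     ((\<lambda>t. 1 / norm t powr n * cmod (1 - ft \<phi> t * cnj (ft \<phi>' t))) \<longlongrightarrow> 0) (at 0) \<and>
     (\<forall>r \<le> s. ((\<lambda>t. ennreal (1 / norm t powr (2 * n)) *
         (\<Sum>\<^sub>\<infinity>k\<in>- {0}. ennreal ((1 + (norm (t + real_vec k))\<^sup>2) ^ r * (cmod (ft \<phi> (t + real_vec k)))\<^sup>2)))
         \<longlongrightarrow> 0) (at 0))"

end

theory Submission
  imports Defs "HOL-Real_Asymp.Real_Asymp" "HOL-Probability.Characteristic_Functions"
    "HOL-Computational_Algebra.Fundamental_Theorem_Algebra"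
begin

text \<open>On the Fourier side, with \<open>B = M\<^sup>*\<^sup>j\<close>, Poisson summation gives the error
  \<open>f^(B t) - \<phi>^(t) \<Sum>\<^sub>l u(t + l)\<close>, \<open>u(t) = f^(B t) cnj (\<phi>'^(t))\<close>, at the point \<open>B t\<close>. Tiling \<open>\<real>\<^sup>d\<close> by unit
  cubes, its weighted norm splits into integrals of \<open>|f^(B t)|\<^sup>2\<close> against \<open>|1 - \<phi>^ cnj \<phi>'^|\<^sup>2\<close>, against
  \<open>\<Phi> |\<phi>'^|\<^sup>2\<close> with \<open>\<Phi>(t) = \<Sum>\<^sub>k (1 + |t + k|\<^sup>2)\<^sup>s |\<phi>^(t + k)|\<^sup>2\<close> over \<open>k \<noteq> 0\<close>, and outside the cube. Compact
  supports make \<open>\<phi>^\<close>, \<open>\<phi>'^\<close> smooth and polynomially bounded and \<open>\<Phi>\<close> bounded, so a factor which is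
  \<open>o(|t|\<^sup>2\<^sup>n)\<close> at the origin yields the decay \<open>o(\<parallel>B\<^sup>-\<^sup>1\<parallel>\<^sup>2\<^sup>n)\<close>. Conversely, for \<open>f^\<close> equal to 1 near 0 and of
  compact support, the lattice sum of \<open>u\<close> has a single term, and for isotropic \<open>M\<close> the density order says
  that both factors have averages \<open>o(R\<^sup>2\<^sup>n)\<close> over the balls of radius \<open>R\<close>; since finite differences of
  high order are small, averages control point values.\<close>

section \<open>Smooth functions, multipliers and the Schwartz class\<close>

text \<open>Two obstacles shape the proof. First, \<open>ft\<close> and \<open>quasi_proj\<close>
  are defined by choice and by definite description, so point conditions at 0 make sense only
  through a continuous representative: T = uT for a Schwartz cutoff u shows that the Fourier
  transform of a compactly supported T equals its own convolution with a Schwartz function \<theta>.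
  Second, in the converse the lattice sum is known only on average. The same identity helps again:
  differences fall on \<theta>, so the N-th difference of \<phi>^ is O(|h|^N) in the weighted
  lattice norm, uniformly in the base point, and N > n makes this negligible against |t|^n. The
  sufficiency treats all r at once with the weight (1 + |t|^2)^s; the converse needs only r = 0,
  which controls 1 - \<phi>^ cnj \<phi>'^, and r = s, which controls the lattice sum. There isotropy
  makes the sets |Bt| \<le> 1 contain balls of comparable volume and keeps |B| |B^-1| bounded, so
  that the two kinds of powers in the density order can be exchanged. The lattice sum comes with the
  factor |\<phi>'^|^2; it can be divided out because the first condition forces \<phi>'^(0) \<noteq>
  0.\<close>

lemma iter_partial_Nil [simp]: "iter_partial [] f = f"
  by (simp add: iter_partial_def)

lemma iter_partial_Cons [simp]: "iter_partial (i # is) f = partial_deriv i (iter_partial is f)"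
  by (simp add: iter_partial_def)

lemma iter_partial_append: "iter_partial (as @ bs) f = iter_partial as (iter_partial bs f)"
  by (simp add: iter_partial_def)

lemma partial_deriv_eq:
  assumes "(f has_derivative f') (at x)"
  shows "partial_deriv i f x = f' (axis i 1)"
  using frechet_derivative_at[OF assms] by (simp add: partial_deriv_def)

lemma has_derivative_partial:
  fixes f :: "real ^ 'd \<Rightarrow> complex"
  assumes "f differentiable (at x)"
  shows "(f has_derivative (\<lambda>h. \<Sum>i\<in>UNIV. h $ i *\<^sub>R partial_deriv i f x)) (at x)"
proof -
  let ?D = "frechet_derivative f (at x)"
  have d: "(f has_derivative ?D) (at x)"
    using assms by (simp add: frechet_derivative_works)
  then have lin: "linear ?D"
    by (rule has_derivative_linear)
  have "?D h = (\<Sum>i\<in>UNIV. h $ i *\<^sub>R partial_deriv i f x)" for h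
  proof -
    have "?D h = ?D (\<Sum>i\<in>UNIV. h $ i *\<^sub>R axis i 1)"
      by (simp add: basis_expansion flip: scalar_mult_eq_scaleR)
    also have "... = (\<Sum>i\<in>UNIV. h $ i *\<^sub>R ?D (axis i 1))"
      by (simp add: linear_sum[OF lin] linear_cmul[OF lin])
    finally show ?thesis by (simp add: partial_deriv_def)
  qed
  then have "?D = (\<lambda>h. \<Sum>i\<in>UNIV. h $ i *\<^sub>R partial_deriv i f x)" by auto
  with d show ?thesis by simp
qed

lemma differentiable_derivative: "f differentiable (at x) ==> (f has_derivative frechet_derivative f (at x)) (at x)"
  by (simp add: frechet_derivative_works)

lemma partial_deriv_add:
  assumes "f differentiable (at x)" "g differentiable (at x)"
  shows "partial_deriv i (\<lambda>x. f x + g x) x = partial_deriv i f x + partial_deriv i g x"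
  using partial_deriv_eq[OF has_derivative_add[OF assms[THEN differentiable_derivative]]]
  by (simp add: partial_deriv_def)

lemma partial_deriv_mult:
  assumes "f differentiable (at x)" "g differentiable (at x)"
  shows "partial_deriv i (\<lambda>x. f x * g x) x = partial_deriv i f x * g x + f x * partial_deriv i g x"
  using partial_deriv_eq[OF has_derivative_mult[OF assms[THEN differentiable_derivative]]]
  by (simp add: partial_deriv_def)

lemma partial_deriv_const [simp]: "partial_deriv i (\<lambda>_. c) = (\<lambda>_. 0)"
  by (simp add: partial_deriv_def)

lemma partial_deriv_cmult:
  assumes "f differentiable (at x)"
  shows "partial_deriv i (\<lambda>x. c * f x) x = c * partial_deriv i f x"
  using partial_deriv_mult[of "\<lambda>_. c" x f i] assms by simp

lemma iter_partial_closed: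
  assumes "f \<in> X" "\<And>f i. f \<in> X ==> partial_deriv i f \<in> X"
  shows "iter_partial is f \<in> X"
  using assms by (induction "is") auto

definition smooth_fun :: "(real ^ 'd \<Rightarrow> complex) set" where
  "smooth_fun = {f. \<forall>is x. iter_partial is f differentiable (at x)}"

text \<open>The multipliers of the Schwartz class, often denoted by \<open>O\<^sub>M\<close>.\<close>

definition slow_fun :: "(real ^ 'd \<Rightarrow> complex) set" where
  "slow_fun = {f \<in> smooth_fun. \<forall>is. \<exists>N C. \<forall>x. cmod (iter_partial is f x) \<le> C * (1 + norm x) ^ N}"

text \<open>Induction over derivatives is replaced by exhibiting an invariant class: in this lemma
  and its two variants for \<open>slow_fun\<close> and \<open>schwartz\<close>, differentiability
  and bounds need only be checked for the members of a class closed under partial derivatives, not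
  for iterated derivatives.\<close>

lemma smooth_coinduct:
  assumes "f \<in> X" "\<And>f x. f \<in> X ==> f differentiable (at x)"
    "\<And>f i. f \<in> X ==> partial_deriv i f \<in> X"
  shows "f \<in> smooth_fun"
  using assms iter_partial_closed[of f X] by (auto simp: smooth_fun_def)

lemma slow_coinduct:
  assumes "f \<in> X" "\<And>f x. f \<in> X ==> f differentiable (at x)"
    "\<And>f i. f \<in> X ==> partial_deriv i f \<in> X"
    "\<And>f. f \<in> X ==> \<exists>N C. \<forall>x. cmod (f x) \<le> C * (1 + norm x) ^ N"
  shows "f \<in> slow_fun"
  using assms iter_partial_closed[of f X] smooth_coinduct[of f X] by (auto simp: slow_fun_def)

lemma schwartz_iff:
  "f \<in> schwartz \<longleftrightarrow> f \<in> smooth_fun \<and>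
     (\<forall>is N. \<exists>C. \<forall>x. (1 + norm x) ^ N * cmod (iter_partial is f x) \<le> C)"
  by (auto simp: schwartz_def smooth_fun_def bounded_iff)

lemma schwartz_coinduct:
  assumes "f \<in> X" "\<And>f x. f \<in> X ==> f differentiable (at x)"
    "\<And>f i. f \<in> X ==> partial_deriv i f \<in> X"
    "\<And>f N. f \<in> X ==> \<exists>C. \<forall>x. (1 + norm x) ^ N * cmod (f x) \<le> C"
  shows "f \<in> schwartz"
  using assms iter_partial_closed[of f X] smooth_coinduct[of f X] by (auto simp: schwartz_iff)

lemma smooth_differentiable: "f \<in> smooth_fun ==> f differentiable (at x)"
  unfolding smooth_fun_def by (auto dest: spec[of _ "[]"])

lemma iter_partial_snoc: "iter_partial (is @ [i]) f = iter_partial is (partial_deriv i f)"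
  by (simp add: iter_partial_append)

lemma smooth_partial_deriv:
  assumes "f \<in> smooth_fun" shows "partial_deriv i f \<in> smooth_fun"
  using assms unfolding smooth_fun_def by (auto simp flip: iter_partial_snoc)

lemma smooth_iter_partial: "f \<in> smooth_fun ==> iter_partial is f \<in> smooth_fun"
  by (rule iter_partial_closed) (auto intro: smooth_partial_deriv)

lemma slow_smooth: "f \<in> slow_fun ==> f \<in> smooth_fun"
  by (simp add: slow_fun_def)

lemma schwartz_smooth: "f \<in> schwartz ==> f \<in> smooth_fun"
  by (simp add: schwartz_iff)

lemma slow_bound:
  assumes "f \<in> slow_fun" obtains N C where "C \<ge> 0" "\<And>x. cmod (iter_partial is f x) \<le> C * (1 + norm x) ^ N"
proof -
  obtain N C where *: "\<And>x. cmod (iter_partial is f x) \<le> C * (1 + norm x) ^ N"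
    using assms by (force simp: slow_fun_def)
  have "0 \<le> C" using order_trans[OF norm_ge_zero *[of 0]] by simp
  with * show ?thesis using that by blast
qed

lemma schwartz_bound:
  assumes "f \<in> schwartz" obtains C where "C \<ge> 0" "\<And>x. (1 + norm x) ^ N * cmod (iter_partial is f x) \<le> C"
proof -
  obtain C where *: "\<And>x. (1 + norm x) ^ N * cmod (iter_partial is f x) \<le> C"
    using assms unfolding schwartz_iff by metis
  have "0 \<le> C" using order_trans[OF _ *[of 0]] by simp
  with * show ?thesis using that by blast
qed

lemma schwartz_bound0:
  assumes "f \<in> schwartz" obtains C where "C \<ge> 0" "\<And>x. cmod (f x) \<le> C / (1 + norm x) ^ N"
proof -
  obtain C where C: "C \<ge> 0" "\<And>x. (1 + norm x) ^ N * cmod (f x) \<le> C"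
    using schwartz_bound[OF assms, of N "[]"] by auto
  have "cmod (f x) \<le> C / (1 + norm x) ^ N" for x
  proof -
    have "0 < (1 + norm x) ^ N" by (simp add: add_pos_nonneg)
    then show ?thesis using C(2)[of x] by (simp add: pos_le_divide_eq mult.commute)
  qed
  with C(1) show ?thesis using that by blast
qed

lemma schwartz_partial_deriv:
  assumes "f \<in> schwartz" shows "partial_deriv i f \<in> schwartz"
  using assms unfolding schwartz_iff
  by (auto simp: smooth_partial_deriv simp flip: iter_partial_snoc)

lemma slow_partial_deriv:
  assumes "f \<in> slow_fun" shows "partial_deriv i f \<in> slow_fun"
  using assms unfolding slow_fun_def
  by (auto simp: smooth_partial_deriv simp flip: iter_partial_snoc)

lemma schwartz_slow:
  assumes "f \<in> schwartz" shows "f \<in> slow_fun"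
proof -
  have "\<exists>N C. \<forall>x. cmod (iter_partial is f x) \<le> C * (1 + norm x) ^ N" for "is"
  proof -
    obtain C where C: "\<And>x. (1 + norm x) ^ 0 * cmod (iter_partial is f x) \<le> C"
      using schwartz_bound[OF assms, of 0 "is"] by blast
    show ?thesis by (rule exI[of _ 0], rule exI[of _ C]) (use C in simp)
  qed
  then show ?thesis using assms by (simp add: slow_fun_def schwartz_smooth)
qed

text \<open>The ways of distributing a list of derivatives over two factors, listed with
  multiplicity; this makes the Leibniz rule a plain sum without binomial coefficients.\<close>

fun splits :: "'a list \<Rightarrow> ('a list \<times> 'a list) list" where
  "splits [] = [([], [])]"
| "splits (i # is) = map (\<lambda>(a, b). (i # a, b)) (splits is) @ map (\<lambda>(a, b). (a, i # b)) (splits is)"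

lemma sum_list_partial:
  assumes "\<And>e. e \<in> set es ==> F e differentiable (at x)"
  shows "(\<lambda>x. \<Sum>e\<leftarrow>es. F e x) differentiable (at x) \<and>
    partial_deriv i (\<lambda>x. \<Sum>e\<leftarrow>es. F e x) x = (\<Sum>e\<leftarrow>es. partial_deriv i (F e) x)"
  using assms by (induction es) (auto simp: partial_deriv_add)

lemma iter_partial_mult:
  assumes f: "f \<in> smooth_fun" and g: "g \<in> smooth_fun"
  shows "iter_partial is (\<lambda>x. f x * g x) =
    (\<lambda>x. \<Sum>e\<leftarrow>splits is. iter_partial (fst e) f x * iter_partial (snd e) g x)"
proof (induction "is")
  case Nil then show ?case by simp
next
  case (Cons i "is")
  have d: "iter_partial a f differentiable (at x)" "iter_partial a g differentiable (at x)" for a x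
    using f g by (auto simp: smooth_fun_def)
  have "partial_deriv i (\<lambda>x. \<Sum>e\<leftarrow>splits is. iter_partial (fst e) f x * iter_partial (snd e) g x) x
     = (\<Sum>e\<leftarrow>splits (i # is). iter_partial (fst e) f x * iter_partial (snd e) g x)" for x
    by (subst conjunct2[OF sum_list_partial])
       (auto simp: partial_deriv_mult d sum_list_addf o_def case_prod_unfold intro!: differentiable_mult)
  with Cons show ?case by auto
qed

lemma smooth_mult:
  assumes "f \<in> smooth_fun" "g \<in> smooth_fun"
  shows "(\<lambda>x. f x * g x) \<in> smooth_fun"
proof -
  have "iter_partial is (\<lambda>x. f x * g x) differentiable (at x)" for "is" x
    unfolding iter_partial_mult[OF assms]
    using assms by (intro conjunct1[OF sum_list_partial] differentiable_mult smooth_differentiable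
      smooth_iter_partial)
  then show ?thesis by (simp add: smooth_fun_def)
qed

lemma sum_list_closed:
  assumes "P (\<lambda>x. 0)" "\<And>f g. P f ==> P g ==> P (\<lambda>x. f x + g x)" "\<And>e. e \<in> set es ==> P (F e)"
  shows "P (\<lambda>x. \<Sum>e\<leftarrow>es. F e x)"
  using assms by (induction es) auto

lemma decay_add:
  assumes "\<exists>C. \<forall>x. (1 + norm x) ^ N * cmod (f x) \<le> C" "\<exists>C. \<forall>x. (1 + norm x) ^ N * cmod (g x) \<le> C"
  shows "\<exists>C. \<forall>x. (1 + norm x) ^ N * cmod (f x + g x) \<le> C"
proof -
  from assms obtain C D where C: "\<And>x. (1 + norm x) ^ N * cmod (f x) \<le> C"
    and D: "\<And>x. (1 + norm x) ^ N * cmod (g x) \<le> D" by blast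
  have "(1 + norm x) ^ N * cmod (f x + g x) \<le> C + D" for x
  proof -
    have "(1 + norm x) ^ N * cmod (f x + g x) \<le> (1 + norm x) ^ N * (cmod (f x) + cmod (g x))"
      by (intro mult_left_mono norm_triangle_ineq) auto
    with C[of x] D[of x] show ?thesis by (simp add: distrib_left)
  qed
  then show ?thesis by blast
qed

lemma slow_growth_add:
  assumes "\<exists>N C. \<forall>x. cmod (f x) \<le> C * (1 + norm x) ^ N" "\<exists>N C. \<forall>x. cmod (g x) \<le> C * (1 + norm x) ^ N"
  shows "\<exists>N C. \<forall>x. cmod (f x + g x) \<le> C * (1 + norm x) ^ N"
proof -
  from assms obtain N M C D where C: "\<And>x. cmod (f x) \<le> C * (1 + norm x) ^ N"
    and D: "\<And>x. cmod (g x) \<le> D * (1 + norm x) ^ M" by blast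
  have "C \<ge> 0" "D \<ge> 0" using order_trans[OF norm_ge_zero C[of 0]] order_trans[OF norm_ge_zero D[of 0]] by auto
  have "cmod (f x + g x) \<le> (C + D) * (1 + norm x) ^ (max N M)" for x
  proof -
    have "C * (1 + norm x) ^ N \<le> C * (1 + norm x) ^ max N M"
      "D * (1 + norm x) ^ M \<le> D * (1 + norm x) ^ max N M"
      using \<open>C \<ge> 0\<close> \<open>D \<ge> 0\<close> by (auto intro!: mult_left_mono power_increasing)
    then show ?thesis using C[of x] D[of x] norm_triangle_ineq[of "f x" "g x"]
      by (simp add: distrib_right)
  qed
  then show ?thesis by blast
qed

lemma slow_growth_mult:
  assumes "\<exists>N C. \<forall>x. cmod (f x) \<le> C * (1 + norm x) ^ N" "\<exists>N C. \<forall>x. cmod (g x) \<le> C * (1 + norm x) ^ N"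
  shows "\<exists>N C. \<forall>x. cmod (f x * g x) \<le> C * (1 + norm x) ^ N"
proof -
  from assms obtain N M C D where C: "\<And>x. cmod (f x) \<le> C * (1 + norm x) ^ N"
    and D: "\<And>x. cmod (g x) \<le> D * (1 + norm x) ^ M" by blast
  have "cmod (f x * g x) \<le> (C * D) * (1 + norm x) ^ (N + M)" for x
    using mult_mono[OF C[of x] D[of x]] order_trans[OF norm_ge_zero C[of x]]
    by (simp add: norm_mult power_add mult_ac)
  then show ?thesis by blast
qed

text \<open>By the Leibniz rule, a factor growing like (1 + |x|)^M is paid for with M extra powers
  in the seminorm of the Schwartz factor.\<close>

lemma schwartz_mult_slow:
  assumes "f \<in> schwartz" "g \<in> slow_fun"
  shows "(\<lambda>x. f x * g x) \<in> schwartz"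
proof -
  have sm: "f \<in> smooth_fun" "g \<in> smooth_fun"
    using assms by (auto intro: schwartz_smooth slow_smooth)
  have *: "\<exists>C. \<forall>x. (1 + norm x) ^ N * cmod (iter_partial as f x * iter_partial bs g x) \<le> C" for N as bs
  proof -
    obtain M D where D: "D \<ge> 0" "\<And>x. cmod (iter_partial bs g x) \<le> D * (1 + norm x) ^ M"
      using slow_bound[OF assms(2)] by metis
    obtain C where C: "C \<ge> 0" "\<And>x. (1 + norm x) ^ (N + M) * cmod (iter_partial as f x) \<le> C"
      using schwartz_bound[OF assms(1)] by metis
    have "(1 + norm x) ^ N * cmod (iter_partial as f x * iter_partial bs g x) \<le> C * D" for x
    proof -
      have "(1 + norm x) ^ N * cmod (iter_partial as f x * iter_partial bs g x)
        \<le> (1 + norm x) ^ N * (cmod (iter_partial as f x) * (D * (1 + norm x) ^ M))"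
        unfolding norm_mult by (intro mult_left_mono D) auto
      also have "... = ((1 + norm x) ^ (N + M) * cmod (iter_partial as f x)) * D"
        by (simp add: power_add)
      also have "... \<le> C * D" by (intro mult_right_mono C D)
      finally show ?thesis .
    qed
    then show ?thesis by blast
  qed
  have "\<exists>C. \<forall>x. (1 + norm x) ^ N * cmod (iter_partial is (\<lambda>x. f x * g x) x) \<le> C" for N "is"
    unfolding iter_partial_mult[OF sm]
    by (rule sum_list_closed[where P="\<lambda>f. \<exists>C. \<forall>x. (1 + norm x) ^ N * cmod (f x) \<le> C"])
       (use * in \<open>simp_all add: decay_add exI[of _ 0]\<close>)
  with smooth_mult[OF sm] show ?thesis by (simp add: schwartz_iff)
qed

lemma slow_mult:
  fixes f :: "real ^ 'd \<Rightarrow> complex"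
  assumes "f \<in> slow_fun" "g \<in> slow_fun"
  shows "(\<lambda>x. f x * g x) \<in> slow_fun"
proof -
  have sm: "f \<in> smooth_fun" "g \<in> smooth_fun"
    using assms by (auto intro: slow_smooth)
  have zero: "\<exists>N C. \<forall>x :: real ^ 'd. cmod 0 \<le> C * (1 + norm x) ^ N"
    by (intro exI[of _ 0]) simp
  have "\<exists>N C. \<forall>x. cmod (iter_partial is (\<lambda>x. f x * g x) x) \<le> C * (1 + norm x) ^ N" for "is"
    unfolding iter_partial_mult[OF sm]
    using assms
    by (intro sum_list_closed[where P="\<lambda>f. \<exists>N C. \<forall>x. cmod (f x) \<le> C * (1 + norm x) ^ N"]
       slow_growth_add slow_growth_mult zero) (auto simp: slow_fun_def)
  with smooth_mult[OF sm] show ?thesis by (simp add: slow_fun_def)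
qed

lemma iter_partial_add:
  assumes f: "f \<in> smooth_fun" and g: "g \<in> smooth_fun"
  shows "iter_partial is (\<lambda>x. f x + g x) = (\<lambda>x. iter_partial is f x + iter_partial is g x)"
proof (induction "is")
  case (Cons i "is")
  then show ?case using f g
    by (auto simp: partial_deriv_add smooth_differentiable smooth_iter_partial)
qed simp

lemma iter_partial_cmult:
  assumes f: "f \<in> smooth_fun"
  shows "iter_partial is (\<lambda>x. c * f x) = (\<lambda>x. c * iter_partial is f x)"
proof (induction "is")
  case (Cons i "is")
  then show ?case using f
    by (auto simp: partial_deriv_cmult smooth_differentiable smooth_iter_partial)
qed simp

lemma smooth_add:
  assumes "f \<in> smooth_fun" "g \<in> smooth_fun" shows "(\<lambda>x. f x + g x) \<in> smooth_fun"
  unfolding smooth_fun_def mem_Collect_eq iter_partial_add[OF assms]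
  using assms by (intro allI differentiable_add) (simp_all add: smooth_fun_def)

lemma smooth_const [simp]: "(\<lambda>_. c) \<in> smooth_fun"
  by (rule smooth_coinduct[where X="range (\<lambda>c _. c)"]) auto

lemma iter_partial_const: "iter_partial is (\<lambda>_. c) = (\<lambda>_. if is = [] then c else 0)"
  by (induction "is") auto

lemma slow_const [simp]: "(\<lambda>_ :: real ^ 'd. c) \<in> slow_fun"
proof -
  have "\<exists>N C. \<forall>x :: real ^ 'd. cmod (if is = [] then c else 0) \<le> C * (1 + norm x) ^ N" for "is" :: "'d list"
    by (rule exI[of _ 0], rule exI[of _ "cmod c"]) simp
  then show ?thesis by (simp add: slow_fun_def iter_partial_const)
qed

lemma slow_add:
  assumes "f \<in> slow_fun" "g \<in> slow_fun" shows "(\<lambda>x. f x + g x) \<in> slow_fun"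
proof -
  have "\<exists>N C. \<forall>x. cmod (iter_partial is f x + iter_partial is g x) \<le> C * (1 + norm x) ^ N" for "is"
    by (rule slow_growth_add) (use assms in \<open>simp_all add: slow_fun_def\<close>)
  then show ?thesis
    using assms by (simp add: slow_fun_def smooth_add iter_partial_add)
qed

lemma schwartz_add:
  assumes "f \<in> schwartz" "g \<in> schwartz" shows "(\<lambda>x. f x + g x) \<in> schwartz"
proof -
  have "\<exists>C. \<forall>x. (1 + norm x) ^ N * cmod (iter_partial is f x + iter_partial is g x) \<le> C" for "is" N
    by (rule decay_add) (use assms in \<open>simp_all add: schwartz_iff\<close>)
  then show ?thesis
    using assms by (simp add: schwartz_iff smooth_add iter_partial_add)
qed

lemma schwartz_cmult: "f \<in> schwartz ==> (\<lambda>x. c * f x) \<in> schwartz"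
  using schwartz_mult_slow[of f "\<lambda>_. c"] by (simp add: mult.commute)

lemma schwartz_zero [simp]: "(\<lambda>_. 0) \<in> schwartz"
  by (auto simp: schwartz_iff iter_partial_const)

lemma schwartz_uminus:
  assumes "f \<in> schwartz" shows "(\<lambda>x. - f x) \<in> schwartz"
  using schwartz_cmult[OF assms, of "-1"] by simp

lemma schwartz_diff:
  assumes "f \<in> schwartz" "g \<in> schwartz" shows "(\<lambda>x. f x - g x) \<in> schwartz"
  using schwartz_add[OF assms(1) schwartz_uminus[OF assms(2)]] by simp

lemma slow_diff:
  assumes "f \<in> slow_fun" "g \<in> slow_fun" shows "(\<lambda>x. f x - g x) \<in> slow_fun"
  using slow_add[OF assms(1) slow_mult[OF slow_const[of "-1"] assms(2)]] by simp

lemma schwartz_sum: "(\<And>i. i \<in> I ==> f i \<in> schwartz) ==> (\<lambda>x. \<Sum>i\<in>I. f i x) \<in> schwartz"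
  by (induction I rule: infinite_finite_induct) (auto intro: schwartz_add)

lemma smooth_continuous: "f \<in> smooth_fun ==> continuous_on A f"
  by (meson continuous_at_imp_continuous_on differentiable_imp_continuous_within smooth_differentiable)

lemma schwartz_continuous: "f \<in> schwartz ==> continuous_on A f"
  by (intro smooth_continuous schwartz_smooth)

lemma smooth_measurable [measurable_dest]: "f \<in> smooth_fun ==> f \<in> borel_measurable borel"
  by (intro borel_measurable_continuous_onI smooth_continuous)

lemma schwartz_measurable [measurable_dest]: "f \<in> schwartz ==> f \<in> borel_measurable borel"
  by (intro smooth_measurable schwartz_smooth)

lemma slow_measurable [measurable_dest]: "f \<in> slow_fun ==> f \<in> borel_measurable borel"
  by (intro smooth_measurable slow_smooth)

lemma has_derivative_coord:
  "((\<lambda>x. complex_of_real (x $ i)) has_derivative (\<lambda>h. complex_of_real (h $ i))) (at x)"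
  by (rule bounded_linear_imp_has_derivative)
     (rule bounded_linear_compose[OF bounded_linear_of_real bounded_linear_vec_nth])

lemma slow_coord: "(\<lambda>x :: real ^ 'd. complex_of_real (x $ i)) \<in> slow_fun"
proof -
  let ?f = "\<lambda>x :: real ^ 'd. complex_of_real (x $ i)"
  have p: "partial_deriv j ?f = (\<lambda>_. complex_of_real (axis j 1 $ i))" for j
    by (rule ext) (rule partial_deriv_eq[OF has_derivative_coord])
  have *: "f differentiable (at x) \<and> partial_deriv j f \<in> insert ?f (range (\<lambda>c _. c)) \<and>
       (\<exists>N C. \<forall>x. cmod (f x) \<le> C * (1 + norm x) ^ N)"
    if "f \<in> insert ?f (range (\<lambda>c _. c))" for f x j
    using that
  proof (elim insertE rangeE)
    assume f: "f = ?f"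
    have "\<bar>x $ i\<bar> \<le> 1 + norm x" for x :: "real ^ 'd"
      using component_le_norm_cart[of x i] by linarith
    then have "\<exists>N C. \<forall>x. cmod (?f x) \<le> C * (1 + norm x) ^ N"
      by (intro exI[of _ 1]) simp
    moreover have "?f differentiable (at x)"
      unfolding differentiable_def using has_derivative_coord by blast
    ultimately show ?thesis unfolding f by (simp add: p)
  next
    fix c assume "f = (\<lambda>_. c)"
    moreover have "\<exists>N C. \<forall>x :: real ^ 'd. cmod c \<le> C * (1 + norm x) ^ N"
      by (rule exI[of _ 0], rule exI[of _ "cmod c"]) simp
    ultimately show ?thesis by auto
  qed
  show ?thesis
    by (rule slow_coinduct[where X="insert ?f (range (\<lambda>c _. c))"]) (use * in blast)+
qed

section \<open>Characters and affine substitutions\<close>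

definition echar :: "real ^ 'd \<Rightarrow> real ^ 'd \<Rightarrow> complex" where
  "echar k x = exp (2 * pi * \<i> * complex_of_real (x \<bullet> k))"

lemma echar_cis: "echar k x = cis (2 * pi * (x \<bullet> k))"
  by (simp add: echar_def cis_conv_exp mult_ac)

lemma norm_echar [simp]: "cmod (echar k x) = 1"
  by (simp add: echar_cis)

lemma has_derivative_echar:
  "((\<lambda>x. c * echar k x) has_derivative (\<lambda>h. 2 * pi * \<i> * complex_of_real (h \<bullet> k) * (c * echar k x))) (at x)"
proof -
  have 1: "((\<lambda>x. complex_of_real (x \<bullet> k)) has_derivative (\<lambda>h. complex_of_real (h \<bullet> k))) (at x)"
    by (rule bounded_linear_imp_has_derivative)
      (rule bounded_linear_compose[OF bounded_linear_of_real bounded_linear_inner_left])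
  have 2: "((\<lambda>z. c * exp (2 * pi * \<i> * z)) has_field_derivative
     (2 * pi * \<i> * (c * echar k x))) (at (complex_of_real (x \<bullet> k)))"
    unfolding echar_def by (auto intro!: derivative_eq_intros)
  show ?thesis
    using has_derivative_compose[OF 1 2[unfolded has_field_derivative_def]]
    by (simp add: echar_def mult_ac)
qed

lemma slow_echar: "echar k \<in> slow_fun"
proof -
  let ?X = "range (\<lambda>c x. c * echar k x)"
  have p: "partial_deriv i (\<lambda>x. c * echar k x) = (\<lambda>x. (2 * pi * \<i> * complex_of_real (axis i 1 \<bullet> k) * c) * echar k x)" for i c
    by (rule ext) (simp add: partial_deriv_eq[OF has_derivative_echar])
  have *: "f differentiable (at x) \<and> partial_deriv j f \<in> ?X \<and>
       (\<exists>N C. \<forall>x. cmod (f x) \<le> C * (1 + norm x) ^ N)"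
    if "f \<in> ?X" for f x j
  proof -
    from that obtain c where f: "f = (\<lambda>x. c * echar k x)" by auto
    have "\<exists>N C. \<forall>x. cmod (f x) \<le> C * (1 + norm x) ^ N"
      unfolding f by (intro exI[of _ 0] exI[of _ "cmod c"]) (simp add: norm_mult)
    moreover have "f differentiable (at x)"
      unfolding f differentiable_def using has_derivative_echar by blast
    moreover have "partial_deriv j f \<in> ?X" unfolding f p by (rule rangeI)
    ultimately show ?thesis by simp
  qed
  have 1: "echar k \<in> ?X" by (rule image_eqI[of _ _ 1]) auto
  show ?thesis
    by (rule slow_coinduct[where X="?X", OF 1]) (use * in blast)+
qed

lemma echar_add: "echar k (x + y) = echar k x * echar k y"
  by (simp add: echar_def inner_add_left distrib_left exp_add)

lemma echar_add_left: "echar (k + l) x = echar k x * echar l x"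
  by (simp add: echar_def inner_add_right distrib_left exp_add)

lemma echar_commute: "echar k x = echar x k"
  by (simp add: echar_def inner_commute)

lemma cnj_echar: "cnj (echar k x) = echar (- k) x"
  by (simp add: echar_cis cis_cnj)

lemma echar_zero [simp]: "echar 0 x = 1" "echar k 0 = 1"
  by (simp_all add: echar_def)

lemma fourier_eq: "fourier f \<xi> = (LINT x|lborel. f x * echar (- \<xi>) x)"
  by (simp add: fourier_def echar_def)

lemma has_derivative_affine:
  fixes A :: "real ^ 'd ^ 'd"
  assumes "f differentiable (at (A *v x + b))"
  shows "((\<lambda>x. f (A *v x + b)) has_derivative
    (\<lambda>h. \<Sum>j\<in>UNIV. (A *v h) $ j *\<^sub>R partial_deriv j f (A *v x + b))) (at x)"
proof -
  have "((\<lambda>x. A *v x + b) has_derivative (\<lambda>h. A *v h)) (at x)"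
    using has_derivative_add[OF bounded_linear_imp_has_derivative[OF matrix_vector_mul_bounded_linear[of A]]
      has_derivative_const[of b]] by simp
  from has_derivative_compose[OF this has_derivative_partial[OF assms]] show ?thesis .
qed

text \<open>The chain rule only forms linear combinations of the partial derivatives of g, so the
  class of all g(Ax + b) with Schwartz g is closed under differentiation. Invertibility gives 1 +
  |x| \<le> K (1 + |Ax + b|), which transports the decay.\<close>

lemma schwartz_affine:
  fixes A :: "real ^ 'd ^ 'd"
  assumes A: "invertible A" and f: "f \<in> schwartz"
  shows "(\<lambda>x. f (A *v x + b)) \<in> schwartz"
proof (rule schwartz_coinduct[where X="{\<lambda>x. g (A *v x + b) | g. g \<in> schwartz}"])
  fix F assume "F \<in> {\<lambda>x. g (A *v x + b) | g. g \<in> schwartz}"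
  then obtain g where F: "F = (\<lambda>x. g (A *v x + b))" and g: "g \<in> schwartz" by auto
  have gd: "g differentiable (at x)" for x using g by (intro smooth_differentiable schwartz_smooth)
  show "F differentiable (at x)" for x
    unfolding F differentiable_def using has_derivative_affine[OF gd] by blast
  show "partial_deriv i F \<in> {\<lambda>x. g (A *v x + b) | g. g \<in> schwartz}" for i
  proof -
    let ?h = "\<lambda>x. \<Sum>j\<in>UNIV. complex_of_real ((A *v axis i 1) $ j) * partial_deriv j g x"
    have "partial_deriv i F = (\<lambda>x. ?h (A *v x + b))"
      unfolding F by (rule ext) (simp add: partial_deriv_eq[OF has_derivative_affine[OF gd]] scaleR_conv_of_real)
    moreover have "?h \<in> schwartz"
      using g by (intro schwartz_sum schwartz_cmult schwartz_partial_deriv)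
    ultimately show ?thesis by (intro CollectI exI[of _ ?h] conjI)
  qed
  fix N
  obtain B where B: "\<And>x. B *v (A *v x) = x"
    using A by (metis invertible_def matrix_vector_mul_assoc matrix_vector_mul_lid)
  let ?K = "1 + onorm ((*v) B) * (1 + norm b)"
  have oB: "onorm ((*v) B) \<ge> 0" by (intro onorm_pos_le matrix_vector_mul_bounded_linear)
  have K: "1 + norm x \<le> ?K * (1 + norm (A *v x + b))" for x
  proof -
    have "norm x = norm (B *v (A *v x))" by (simp add: B)
    also have "... \<le> onorm ((*v) B) * norm (A *v x)"
      by (rule onorm[OF matrix_vector_mul_bounded_linear])
    also have "... \<le> onorm ((*v) B) * (norm (A *v x + b) + norm b)"
      using norm_triangle_ineq4[of "A *v x + b" b] oB by (intro mult_left_mono) auto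
    also have "... \<le> onorm ((*v) B) * ((1 + norm b) * (1 + norm (A *v x + b)))"
      using oB by (intro mult_left_mono) (auto simp: algebra_simps)
    finally have "norm x \<le> onorm ((*v) B) * (1 + norm b) * (1 + norm (A *v x + b))"
      by (simp add: mult.assoc)
    then show ?thesis unfolding distrib_right mult_1 using norm_ge_zero[of "A *v x + b"] by linarith
  qed
  have K0: "?K \<ge> 0" using oB by simp
  obtain C where C: "C \<ge> 0" "\<And>y. (1 + norm y) ^ N * cmod (g y) \<le> C"
    using schwartz_bound[OF g, of N "[]"] by auto
  have "(1 + norm x) ^ N * cmod (F x) \<le> ?K ^ N * C" for x
  proof -
    have "(1 + norm x) ^ N * cmod (F x) \<le> (?K * (1 + norm (A *v x + b))) ^ N * cmod (F x)"
      by (intro mult_right_mono power_mono K) auto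
    also have "... = ?K ^ N * ((1 + norm (A *v x + b)) ^ N * cmod (g (A *v x + b)))"
      by (simp add: F power_mult_distrib)
    also have "... \<le> ?K ^ N * C" by (intro mult_left_mono C zero_le_power K0)
    finally show ?thesis .
  qed
  then show "\<exists>C. \<forall>x. (1 + norm x) ^ N * cmod (F x) \<le> C" by blast
qed (use f in auto)

lemma schwartz_uminus_arg:
  fixes f :: "real ^ 'd \<Rightarrow> complex"
  assumes "f \<in> schwartz" shows "(\<lambda>x. f (- x)) \<in> schwartz"
proof -
  have "invertible (matrix (uminus :: real ^ 'd \<Rightarrow> real ^ 'd))"
    unfolding invertible_def
    by (intro exI[of _ "matrix uminus"] conjI; subst matrix_compose[symmetric])
       (auto simp: o_def matrix_def mat_def axis_def vec_eq_iff linear_uminus)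
  from schwartz_affine[OF this assms, of 0] show ?thesis
    by (simp add: matrix_works linear_uminus)
qed

lemma iter_partial_scale:
  assumes f: "f \<in> smooth_fun"
  shows "iter_partial is (\<lambda>x. f (c *\<^sub>R x)) = (\<lambda>x. complex_of_real c ^ length is * iter_partial is f (c *\<^sub>R x))"
proof (induction "is")
  case (Cons i "is")
  let ?g = "iter_partial is f"
  have "((\<lambda>x. complex_of_real c ^ length is * ?g (c *\<^sub>R x)) has_derivative
      (\<lambda>h. complex_of_real c ^ length is * (\<Sum>j\<in>UNIV. (c *\<^sub>R h) $ j *\<^sub>R partial_deriv j ?g (c *\<^sub>R x)))) (at x)" for x
  proof -
    have "((\<lambda>x. c *\<^sub>R x) has_derivative (\<lambda>h. c *\<^sub>R h)) (at x)" by (auto intro!: derivative_eq_intros)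
    from has_derivative_compose[OF this has_derivative_partial[of ?g]] f
    show ?thesis by (intro has_derivative_mult_right) (auto simp: smooth_differentiable smooth_iter_partial)
  qed
  note p = partial_deriv_eq[OF this, of i]
  have "(\<Sum>j\<in>UNIV. (c *\<^sub>R axis i 1) $ j *\<^sub>R partial_deriv j ?g y) = c *\<^sub>R partial_deriv i ?g y" for y
    by (subst sum.remove[of _ i]) (auto simp: axis_def)
  with p show ?case
    by (auto simp: Cons fun_eq_iff scaleR_conv_of_real[where 'a=complex])
qed simp

lemma uniform_limit_zero_iff:
  "uniform_limit UNIV f (\<lambda>_. 0) F \<longleftrightarrow> (\<forall>e>0. \<forall>\<^sub>F l in F. \<forall>x. norm (f l x :: complex) < e)"
  by (simp add: uniform_limit_iff dist_norm)

text \<open>The growth bound on \<open>g l\<close> has to be uniform in \<open>l\<close>: then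
  multiplication costs a fixed number of powers of 1 + |x|, and the smallness of the seminorms of
  \<open>\<psi> l\<close> survives.\<close>

lemma schwartz_null_mult:
  assumes null: "schwartz_null \<psi>" and \<psi>: "\<And>l. \<psi> l \<in> schwartz" and g: "\<And>l. g l \<in> smooth_fun"
    and gb: "\<And>is. \<exists>N C. \<forall>l x. cmod (iter_partial is (g l) x) \<le> C * (1 + norm x) ^ N"
  shows "schwartz_null (\<lambda>l x. \<psi> l x * g l x)"
proof -
  let ?P = "\<lambda>N h. uniform_limit UNIV (\<lambda>(l::nat) x. (1 + norm x) ^ N *\<^sub>R (h l x :: complex)) (\<lambda>_. 0) sequentially"
  have base: "?P N (\<lambda>l x. iter_partial as (\<psi> l) x * iter_partial bs (g l) x)" for N as bs
  proof -
    obtain M C where C: "\<And>l x. cmod (iter_partial bs (g l) x) \<le> C * (1 + norm x) ^ M"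
      using gb by blast
    have "C \<ge> 0" using order_trans[OF norm_ge_zero C[of 0 0]] by simp
    show ?thesis unfolding uniform_limit_zero_iff
    proof safe
      fix e :: real assume "e > 0"
      then have "e / (C + 1) > 0" using \<open>C \<ge> 0\<close> by simp
      then have "\<forall>\<^sub>F l in sequentially. \<forall>x. norm ((1 + norm x) ^ (N + M) *\<^sub>R iter_partial as (\<psi> l) x) < e / (C + 1)"
        using null unfolding schwartz_null_def uniform_limit_zero_iff by blast
      then show "\<forall>\<^sub>F l in sequentially. \<forall>x. norm ((1 + norm x) ^ N *\<^sub>R (iter_partial as (\<psi> l) x * iter_partial bs (g l) x)) < e"
      proof (eventually_elim, safe)
        fix l x assume *: "\<forall>x. norm ((1 + norm x) ^ (N + M) *\<^sub>R iter_partial as (\<psi> l) x) < e / (C + 1)"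
        have "norm ((1 + norm x) ^ N *\<^sub>R (iter_partial as (\<psi> l) x * iter_partial bs (g l) x))
          \<le> (1 + norm x) ^ N * (cmod (iter_partial as (\<psi> l) x) * (C * (1 + norm x) ^ M))"
          unfolding norm_scaleR norm_mult by (auto intro!: mult_left_mono C)
        also have "... = norm ((1 + norm x) ^ (N + M) *\<^sub>R iter_partial as (\<psi> l) x) * C"
          by (simp add: power_add)
        also have "... \<le> e / (C + 1) * C"
          using * \<open>C \<ge> 0\<close> by (intro mult_right_mono) (auto intro: less_imp_le)
        also have "... < e" using \<open>e > 0\<close> \<open>C \<ge> 0\<close> by (simp add: field_simps)
        finally show "norm ((1 + norm x) ^ N *\<^sub>R (iter_partial as (\<psi> l) x * iter_partial bs (g l) x)) < e" .
      qed
    qed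
  qed
  have "?P N (\<lambda>l x. \<Sum>e\<leftarrow>splits is. iter_partial (fst e) (\<psi> l) x * iter_partial (snd e) (g l) x)" for N "is"
  proof (induction "splits is")
    case Nil then show ?case by (simp add: uniform_limit_zero_iff)
  next
    case (Cons e es)
    have "?P N (\<lambda>l x. \<Sum>e\<leftarrow>es. iter_partial (fst e) (\<psi> l) x * iter_partial (snd e) (g l) x)" for es
    proof (induction es)
      case Nil then show ?case by (simp add: uniform_limit_zero_iff)
    next
      case (Cons e es)
      from uniform_limit_add[OF base[of N "fst e" "snd e"] Cons] show ?case
        by (simp add: scaleR_add_right)
    qed
    then show ?case .
  qed
  then show ?thesis
    by (simp add: schwartz_null_def iter_partial_mult schwartz_smooth \<psi> g)
qed

section \<open>Flat functions and smooth cutoffs\<close>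

inductive_set alg :: "(real ^ 'd \<Rightarrow> complex) set \<Rightarrow> (real ^ 'd \<Rightarrow> complex) set" for A where
  alg_base: "f \<in> A ==> f \<in> alg A"
| alg_const: "(\<lambda>_. c) \<in> alg A"
| alg_add: "f \<in> alg A ==> g \<in> alg A ==> (\<lambda>x. f x + g x) \<in> alg A"
| alg_mult: "f \<in> alg A ==> g \<in> alg A ==> (\<lambda>x. f x * g x) \<in> alg A"

text \<open>By the sum and product rules the generated algebra is closed under partial derivatives
  as soon as it contains those of its generators, so it can serve as the invariant class in
  \<open>smooth_coinduct\<close>.\<close>

lemma alg_smooth:
  assumes f: "f \<in> alg A"
    and d: "\<And>f x. f \<in> A ==> f differentiable (at x)"
    and p: "\<And>f i. f \<in> A ==> partial_deriv i f \<in> alg A"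
  shows "f \<in> smooth_fun"
proof -
  have *: "(\<forall>x. f differentiable (at x)) \<and> (\<forall>i. partial_deriv i f \<in> alg A)" if "f \<in> alg A" for f
    using that
  proof induction
    case (alg_base f) then show ?case using d p by blast
  next
    case (alg_const c) then show ?case using alg.alg_const by simp
  next
    case (alg_add f g)
    then have "partial_deriv i (\<lambda>x. f x + g x) = (\<lambda>x. partial_deriv i f x + partial_deriv i g x)" for i
      by (simp add: fun_eq_iff partial_deriv_add)
    with alg_add show ?case by (auto intro!: alg.alg_add)
  next
    case (alg_mult f g)
    then have "partial_deriv i (\<lambda>x. f x * g x) = (\<lambda>x. partial_deriv i f x * g x + f x * partial_deriv i g x)" for i
      by (simp add: fun_eq_iff partial_deriv_mult)
    with alg_mult show ?case by (auto intro!: alg.alg_add[of "\<lambda>x. partial_deriv _ f x * g x"] alg.alg_mult)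
  qed
  show ?thesis by (rule smooth_coinduct[OF f]) (use * in auto)
qed

text \<open>For n = 0 this is the classical flat function. The power of x is included so that the
  family is closed under differentiation up to linear combinations.\<close>

definition flat_exp :: "nat \<Rightarrow> real \<Rightarrow> real" where
  "flat_exp n x = (if x \<le> 0 then 0 else exp (- 1 / x) / x ^ n)"

lemma flat_exp_derivative:
  "(flat_exp n has_real_derivative flat_exp (n + 2) x - real n * flat_exp (n + 1) x) (at x)"
proof -
  consider "x < 0" | "x > 0" | "x = 0" by linarith
  then show ?thesis
  proof cases
    case 1
    have "((\<lambda>_. 0) has_real_derivative 0) (at x)" by simp
    then have "(flat_exp n has_real_derivative 0) (at x)"
      by (rule has_field_derivative_transform_within_open[where S="{..<0}"])
         (use 1 in \<open>auto simp: flat_exp_def\<close>)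
    with 1 show ?thesis by (simp add: flat_exp_def)
  next
    case 2
    have "((\<lambda>x. exp (- 1 / x) / x ^ n) has_real_derivative
        flat_exp (n + 2) x - real n * flat_exp (n + 1) x) (at x)"
      using 2
      by (auto intro!: derivative_eq_intros simp: flat_exp_def divide_simps power_add)
         (cases n; simp add: algebra_simps power2_eq_square)
    then show ?thesis
      by (rule has_field_derivative_transform_within_open[where S="{0<..}"])
         (use 2 in \<open>auto simp: flat_exp_def\<close>)
  next
    \<comment> \<open>At the gluing point the difference quotient is
      \<open>flat_exp n h / h\<close>, which tends to 0 from the right because the exponential beats
      every power.\<close>
    case 3
    have "((\<lambda>h. flat_exp n h / h) \<longlongrightarrow> 0) (at_right 0)"
    proof (rule Lim_transform_eventually)
      show "((\<lambda>h::real. exp (- 1 / h) / h ^ n / h) \<longlongrightarrow> 0) (at_right 0)"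
        by real_asymp
      show "\<forall>\<^sub>F h in at_right 0. exp (- 1 / h) / h ^ n / h = flat_exp n h / h"
        by (auto simp: flat_exp_def eventually_at_filter)
    qed
    moreover have "((\<lambda>h. flat_exp n h / h) \<longlongrightarrow> 0) (at_left 0)"
      by (rule Lim_transform_eventually[of "\<lambda>_. 0"])
         (auto simp: flat_exp_def eventually_at_filter)
    ultimately have "((\<lambda>h. flat_exp n h / h) \<longlongrightarrow> 0) (at 0)"
      by (simp add: filterlim_split_at)
    with 3 show ?thesis by (simp add: DERIV_def flat_exp_def)
  qed
qed

text \<open>The standard smooth transition from 0 on x \<le> 0 to 1 on x \<ge> 1; the denominator is
  positive because x and 1 - x are never both nonpositive.\<close>

definition smooth_step :: "real \<Rightarrow> real" where
  "smooth_step x = flat_exp 0 x / (flat_exp 0 x + flat_exp 0 (1 - x))"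

lemma flat_exp_sum_pos: "flat_exp 0 x + flat_exp 0 (1 - x) > 0"
  by (auto simp: flat_exp_def intro: add_pos_pos)

lemma flat_exp_nonneg: "flat_exp n x \<ge> 0"
  by (simp add: flat_exp_def)

lemma smooth_step_range: "0 \<le> smooth_step x" "smooth_step x \<le> 1"
  using flat_exp_sum_pos[of x] flat_exp_nonneg[of 0 x] flat_exp_nonneg[of 0 "1 - x"]
  by (auto simp: smooth_step_def divide_le_eq)

lemma smooth_step_0: "x \<le> 0 ==> smooth_step x = 0"
  by (simp add: smooth_step_def flat_exp_def)

lemma smooth_step_1: "x \<ge> 1 ==> smooth_step x = 1"
  using flat_exp_sum_pos[of x] by (simp add: smooth_step_def flat_exp_def)

lemma has_derivative_coord_fun:
  fixes x :: "real ^ 'd"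
  assumes "(f has_real_derivative d) (at (c * x $ i + b))"
  shows "((\<lambda>x. complex_of_real (f (c * x $ i + b))) has_derivative
    (\<lambda>h. complex_of_real (d * (c * h $ i)))) (at x)"
proof -
  have "bounded_linear (\<lambda>h :: real ^ 'd. c * h $ i)"
    by (rule bounded_linear_compose[OF bounded_linear_mult_right bounded_linear_vec_nth])
  then have "((\<lambda>x. c * x $ i + b) has_derivative (\<lambda>h. c * h $ i)) (at x)"
    using has_derivative_add[OF bounded_linear_imp_has_derivative has_derivative_const[of b]] by simp
  from has_derivative_compose[OF this assms[unfolded has_field_derivative_def]]
  show ?thesis by (rule bounded_linear.has_derivative[OF bounded_linear_of_real])
qed

lemma smooth_smooth_step:
  "(\<lambda>x :: real ^ 'd. complex_of_real (smooth_step (c * x $ i + b))) \<in> smooth_fun"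
proof -
  define E :: "nat \<Rightarrow> real \<Rightarrow> real \<Rightarrow> real ^ 'd \<Rightarrow> complex"
    where "E n a e = (\<lambda>x. complex_of_real (flat_exp n (a * x $ i + e)))" for n a e
  define g where "g = (\<lambda>x. E 0 c b x + E 0 (- c) (1 - b) x)"
  \<comment> \<open>The reciprocal of the denominator joins the generators: its derivative is - r g'
    r, again a polynomial in the generators, so the quotient lies in the algebra.\<close>
  define r where "r = (\<lambda>x. inverse (g x))"
  let ?A = "insert r {E n a e | n a e. True}"
  have dE: "(E n a e has_derivative (\<lambda>h. complex_of_real
      ((flat_exp (n + 2) (a * x $ i + e) - real n * flat_exp (n + 1) (a * x $ i + e)) * (a * h $ i)))) (at x)" for n a e x
    unfolding E_def by (rule has_derivative_coord_fun[OF flat_exp_derivative])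
  have dE': "E n a e differentiable (at x)" for n a e x
    using dE differentiable_def by blast
  have pE: "partial_deriv j (E n a e) \<in> alg ?A" for j n a e
  proof -
    have "partial_deriv j (E n a e) = (\<lambda>x. (E (n + 2) a e x + (- of_nat n) * E (n + 1) a e x) * complex_of_real (a * axis j 1 $ i))"
      by (rule ext, subst partial_deriv_eq[OF dE]) (simp add: E_def)
    moreover have "(\<lambda>x. (E (n + 2) a e x + (- of_nat n) * E (n + 1) a e x) * complex_of_real (a * axis j 1 $ i)) \<in> alg ?A"
      by (intro alg_mult alg_add alg_const alg_base) auto
    ultimately show ?thesis by simp
  qed
  have gd: "g differentiable (at x)" for x
    unfolding g_def by (intro differentiable_add dE')
  have g0: "g x \<noteq> 0" for x
  proof -
    have "g x = complex_of_real (flat_exp 0 (c * x $ i + b) + flat_exp 0 (1 - (c * x $ i + b)))"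
      by (simp add: g_def E_def algebra_simps)
    then show ?thesis using flat_exp_sum_pos[of "c * x $ i + b"] by (simp del: of_real_add)
  qed
  have dr: "(r has_derivative (\<lambda>h. - (r x * frechet_derivative g (at x) h * r x))) (at x)" for x
    unfolding r_def by (intro Deriv.has_derivative_inverse g0 differentiable_derivative gd)
  have pg: "partial_deriv j g x = partial_deriv j (E 0 c b) x + partial_deriv j (E 0 (- c) (1 - b)) x" for j x
    unfolding g_def by (intro partial_deriv_add dE')
  have pr: "partial_deriv j r \<in> alg ?A" for j
  proof -
    have "partial_deriv j r = (\<lambda>x. (-1) * ((r x * (partial_deriv j (E 0 c b) x + partial_deriv j (E 0 (- c) (1 - b)) x)) * r x))"
      by (rule ext, subst partial_deriv_eq[OF dr])
         (simp add: pg[unfolded partial_deriv_def] mult_ac partial_deriv_def)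
    moreover have "(\<lambda>x. (-1) * ((r x * (partial_deriv j (E 0 c b) x + partial_deriv j (E 0 (- c) (1 - b)) x)) * r x)) \<in> alg ?A"
      by (intro alg_mult alg_add alg_const pE) (auto intro: alg_base)
    ultimately show ?thesis by simp
  qed
  have 1: "(\<lambda>x. complex_of_real (smooth_step (c * x $ i + b))) = (\<lambda>x. E 0 c b x * r x)"
    by (simp add: fun_eq_iff E_def r_def g_def smooth_step_def divide_inverse algebra_simps)
  have 2: "(\<lambda>x. E 0 c b x * r x) \<in> alg ?A"
    by (intro alg_mult alg_base) auto
  show ?thesis unfolding 1
  proof (rule alg_smooth[OF 2])
    fix f x assume "f \<in> ?A" then show "f differentiable (at x)"
      using dE' dr unfolding differentiable_def by blast
  next
    fix f j assume "f \<in> ?A" then show "partial_deriv j f \<in> alg ?A"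
      using pE pr by blast
  qed
qed

lemma smooth_prod: "(\<And>i. i \<in> I ==> f i \<in> smooth_fun) ==> (\<lambda>x. \<Prod>i\<in>I. f i x) \<in> smooth_fun"
  by (induction I rule: infinite_finite_induct) (auto intro: smooth_mult)

lemma iter_partial_vanish:
  assumes "open U" "\<And>x. x \<in> U ==> f x = 0" "x \<in> U"
  shows "iter_partial is f x = 0"
  using assms(3)
proof (induction "is" arbitrary: x)
  case Nil then show ?case using assms(2) by simp
next
  case (Cons i "is")
  have "((\<lambda>_. 0) has_derivative (\<lambda>_. 0)) (at x)" by simp
  then have "(iter_partial is f has_derivative (\<lambda>_. 0)) (at x)"
    by (rule has_derivative_transform_within_open[OF _ assms(1) Cons.prems]) (simp add: Cons.IH)
  from partial_deriv_eq[OF this, of i] show ?case by simp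
qed

lemma smooth_compact_support_schwartz:
  assumes f: "f \<in> smooth_fun" and R: "\<And>x. norm x > R ==> f x = 0"
  shows "f \<in> schwartz"
proof -
  have "\<exists>C. \<forall>x. (1 + norm x) ^ N * cmod (iter_partial is f x) \<le> C" for N "is"
  proof -
    let ?h = "\<lambda>x. (1 + norm x) ^ N * cmod (iter_partial is f x)"
    have "compact (?h ` cball 0 R)"
      by (intro compact_continuous_image continuous_intros smooth_continuous smooth_iter_partial f) simp
    then obtain C where "\<forall>x\<in>cball 0 R. ?h x \<le> C"
      by (auto dest!: compact_imp_bounded simp: bounded_iff abs_mult)
    then have C: "?h x \<le> C" if "norm x \<le> R" for x using that by simp
    have z: "iter_partial is f x = 0" if "norm x > R" for x
    proof (rule iter_partial_vanish[where U="- cball 0 R"])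
    qed (use R that in auto)
    have "?h x \<le> max C 0" for x
      using C[of x] z[of x] by (cases "norm x \<le> R") auto
    then show ?thesis by blast
  qed
  with f show ?thesis by (simp add: schwartz_iff)
qed

text \<open>A smooth approximation of the indicator of the open box from inside: 0 off the box, 1
  where every face is at distance at least 1/m, and convergent to the indicator as m grows.\<close>

definition box_cutoff :: "real \<Rightarrow> real ^ 'd \<Rightarrow> real ^ 'd \<Rightarrow> real ^ 'd \<Rightarrow> real" where
  "box_cutoff m a b x = (\<Prod>i\<in>UNIV. smooth_step (m * (x $ i - a $ i)) * smooth_step (m * (b $ i - x $ i)))"

lemma box_cutoff_range: "0 \<le> box_cutoff m a b x" "box_cutoff m a b x \<le> 1"
  by (auto simp: box_cutoff_def intro!: prod_nonneg prod_le_1 mult_le_one smooth_step_range mult_nonneg_nonneg)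

lemma box_cutoff_0: "m > 0 ==> x \<notin> box a b ==> box_cutoff m a b x = 0"
  by (force simp: box_cutoff_def mem_box_cart not_less intro!: smooth_step_0 mult_nonneg_nonpos)

lemma box_cutoff_1:
  assumes "\<And>i. m * (x $ i - a $ i) \<ge> 1" "\<And>i. m * (b $ i - x $ i) \<ge> 1"
  shows "box_cutoff m a b x = 1"
  using assms by (simp add: box_cutoff_def smooth_step_1)

lemma box_cutoff_schwartz:
  assumes "m > 0"
  shows "(\<lambda>x. complex_of_real (box_cutoff m a b x)) \<in> schwartz"
proof -
  have *: "(\<lambda>x. complex_of_real (smooth_step (m * (x $ i - a $ i)))) \<in> smooth_fun"
    "(\<lambda>x. complex_of_real (smooth_step (m * (b $ i - x $ i)))) \<in> smooth_fun" for i
    using smooth_smooth_step[of m i "- m * a $ i"] smooth_smooth_step[of "- m" i "m * b $ i"]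
    by (simp_all add: algebra_simps)
  have sm: "(\<lambda>x. complex_of_real (box_cutoff m a b x)) \<in> smooth_fun"
    unfolding box_cutoff_def of_real_prod of_real_mult
    by (intro smooth_prod smooth_mult *)
  obtain R where R: "\<And>x. x \<in> box a b ==> norm x \<le> R"
    using bounded_box[of a b] by (auto simp: bounded_iff)
  show ?thesis
    by (rule smooth_compact_support_schwartz[OF sm, of R])
       (use R box_cutoff_0[OF assms] in force)
qed

lemma cutoff_exists:
  fixes R :: real
  assumes "R > 0"
  obtains u :: "real ^ 'd \<Rightarrow> complex" and R' where "u \<in> schwartz" "\<And>x. norm x \<le> R ==> u x = 1"
    "\<And>x. norm x \<ge> R' ==> u x = 0" "\<And>x. cmod (u x) \<le> 1"
proof -
  define a :: "real ^ 'd" where "a = (\<chi> i. R + 1)"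
  obtain R' where R: "\<And>x. x \<in> box (- a) a ==> norm x \<le> R'"
    using bounded_box[of "- a" a] by (auto simp: bounded_iff)
  show ?thesis
  proof (rule that[of "\<lambda>x. complex_of_real (box_cutoff 1 (- a) a x)" "R' + 1"])
    show "complex_of_real (box_cutoff 1 (- a) a x) = 1" if "norm x \<le> R" for x
    proof -
      have "\<bar>x $ i\<bar> \<le> R" for i using component_le_norm_cart[of x i] that by linarith
      then have "x $ i \<le> R \<and> 0 \<le> x $ i + R" for i
        using abs_le_D1[of "x $ i" R] abs_le_D2[of "x $ i" R] by simp
      then show ?thesis
        by (subst box_cutoff_1) (auto simp: a_def)
    qed
    show "complex_of_real (box_cutoff 1 (- a) a x) = 0" if "norm x \<ge> R' + 1" for x
      using R[of x] that box_cutoff_0[of 1 x "- a" a] by force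
  qed (auto simp: box_cutoff_schwartz box_cutoff_range)
qed

section \<open>Integration on \<open>\<real>\<^sup>d\<close>\<close>

lemma det_matrix_inv:
  fixes A B :: "real ^ 'd ^ 'd"
  assumes "A ** B = mat 1" shows "det B = 1 / det A" "det A \<noteq> 0"
proof -
  have "det A * det B = 1" using assms det_mul[of A B] by (simp add: det_I)
  moreover from this show "det A \<noteq> 0" by auto
  ultimately show "det B = 1 / det A" by (simp add: field_simps)
qed

text \<open>The library's version of the following lemma assumes that the index type is well-ordered.\<close>

lemma measure_matrix_image:
  fixes A :: "real ^ 'd ^ 'd"
  assumes "det A \<noteq> 0" "S \<in> lmeasurable"
  shows "(*v) A ` S \<in> lmeasurable \<and> measure lebesgue ((*v) A ` S) = \<bar>det A\<bar> * measure lebesgue S"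
proof -
  \<comment> \<open>The nonsingularity assumption and the quantifier over S belong to the induction
    predicate: a product of matrices needs the claim for an image set, and a matrix with a zero row
    is excluded by its determinant.\<close>
  have "det A \<noteq> 0 \<longrightarrow> (\<forall>S\<in>lmeasurable. (*v) A ` S \<in> lmeasurable \<and>
      measure lebesgue ((*v) A ` S) = \<bar>det A\<bar> * measure lebesgue S)" (is "?P A")
  proof (rule induct_matrix_elementary_alt)
    fix A B :: "real ^ 'd ^ 'd" assume P: "?P A" "?P B"
    have "(*v) (A ** B) ` S = (*v) A ` (*v) B ` S" for S
      by (simp add: image_image matrix_vector_mul_assoc)
    with P show "?P (A ** B)" by (auto simp: det_mul abs_mult)
  next
    fix A :: "real ^ 'd ^ 'd" and i assume "row i A = 0"
    then show "?P A" by (simp add: det_zero_row)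
  next
    fix A :: "real ^ 'd ^ 'd" assume A: "\<And>i j. i \<noteq> j ==> A $ i $ j = 0"
    have "A *v x = (\<chi> i. A $ i $ i * x $ i)" for x
    proof -
      have "(\<Sum>j\<in>UNIV. A $ i $ j * x $ j) = A $ i $ i * x $ i" for i
        by (subst sum.remove[of _ i]) (auto simp: A intro!: sum.neutral)
      then show ?thesis by (simp add: matrix_vector_mult_def)
    qed
    then have "(*v) A = (\<lambda>x. \<chi> i. A $ i $ i * x $ i)" by auto
    then show "?P A"
      using measurable_stretch[of _ "\<lambda>i. A $ i $ i"] measure_stretch[of _ "\<lambda>i. A $ i $ i"] A
      by (simp add: det_diagonal)
  next
    fix m n :: 'd assume "m \<noteq> n"
    let ?t = "Transposition.transpose m n"
    let ?A = "\<chi> i j. (mat 1 :: real ^ 'd ^ 'd) $ i $ ?t j"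
    have Av: "?A *v x = (\<chi> i. x $ ?t i)" for x
    proof -
      have "(\<Sum>j\<in>UNIV. mat 1 $ i $ ?t j * x $ j) = x $ ?t i" for i
        by (subst sum.remove[of _ "?t i"])
           (auto simp: mat_def intro!: sum.neutral split: if_splits)
      then show ?thesis by (simp add: matrix_vector_mult_def)
    qed
    have AA: "?A *v (?A *v x) = x" for x unfolding Av by (simp add: vec_eq_iff)
    have det: "\<bar>det ?A\<bar> = 1"
      by (simp add: det_permute_columns permutes_swap_id sign_def abs_mult)
    have mb: "?A *v x \<in> cbox a b \<longleftrightarrow> x \<in> cbox (?A *v a) (?A *v b)" for x a b
      unfolding Av by (auto simp: mem_box_cart) (metis transpose_involutory)+
    have im: "(*v) ?A ` cbox a b = cbox (?A *v a) (?A *v b)" for a b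
    proof (intro set_eqI iffI)
      fix x assume "x \<in> (*v) ?A ` cbox a b"
      then obtain y where y: "y \<in> cbox a b" "x = ?A *v y" by blast
      then have "?A *v x \<in> cbox a b" by (simp only: AA)
      then show "x \<in> cbox (?A *v a) (?A *v b)" by (simp only: mb)
    next
      fix x assume "x \<in> cbox (?A *v a) (?A *v b)"
      then have "?A *v x \<in> cbox a b" by (simp only: mb)
      then have "?A *v (?A *v x) \<in> (*v) ?A ` cbox a b" by (rule imageI)
      then show "x \<in> (*v) ?A ` cbox a b" by (simp only: AA)
    qed
    have meq: "measure lebesgue (cbox (?A *v a) (?A *v b)) = measure lebesgue (cbox a b)" for a b
    proof (cases "cbox a b = {}")
      case True then show ?thesis unfolding im[symmetric] by simp
    next
      case False
      then have "cbox (?A *v a) (?A *v b) \<noteq> {}" unfolding im[symmetric] by simp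
      then have "measure lebesgue (cbox (?A *v a) (?A *v b)) = (\<Prod>i\<in>UNIV. b $ ?t i - a $ ?t i)"
        by (simp add: content_cbox_cart Av)
      also have "... = (\<Prod>i\<in>UNIV. b $ i - a $ i)"
        by (rule prod.reindex_bij_betw) (rule bij_transpose)
      finally show ?thesis using False by (simp add: content_cbox_cart)
    qed
    have meq': "measure lebesgue ((*v) ?A ` cbox a b) = 1 * measure lebesgue (cbox a b)" for a b
      unfolding im mult_1 by (rule meq)
    show "?P ?A"
    proof (intro impI ballI)
      fix S :: "(real ^ 'd) set" assume "S \<in> lmeasurable"
      from measure_linear_sufficient[where f="(*v) ?A" and m=1, OF matrix_vector_mul_linear this meq']
      show "(*v) ?A ` S \<in> lmeasurable \<and> measure lebesgue ((*v) ?A ` S) = \<bar>det ?A\<bar> * measure lebesgue S"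
        unfolding det abs_one by (elim conjE) (intro conjI, assumption, rule sym)
    qed
  next
    fix m n :: 'd assume "m \<noteq> n"
    let ?A = "(\<chi> i j. of_bool (i = m \<and> j = n \<or> i = j)) :: real ^ 'd ^ 'd"
    let ?f = "\<lambda>x :: real ^ 'd. \<chi> i. if i = m then x $ m + x $ n else x $ i"
    have Av: "?A *v x = ?f x" for x
    proof -
      have "(\<Sum>j\<in>UNIV. of_bool (i = m \<and> j = n \<or> i = j) * x $ j) = (if i = m then x $ m + x $ n else x $ i)" for i
      proof -
        have "(\<Sum>j\<in>UNIV. of_bool (i = m \<and> j = n \<or> i = j) * x $ j) =
          (\<Sum>j\<in>UNIV. (if j = i then x $ j else 0) + (if i = m \<and> j = n then x $ j else 0))"
          using \<open>m \<noteq> n\<close> by (intro sum.cong) auto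
        then show ?thesis by (auto simp: sum.distrib)
      qed
      then show ?thesis by (simp add: matrix_vector_mult_def)
    qed
    have det: "det ?A = 1"
    proof -
      have "?A = (\<chi> k. if k = m then row m (mat 1) + 1 *s row n (mat 1) else row k (mat 1))"
        using \<open>m \<noteq> n\<close> by (auto simp: vec_eq_iff row_def mat_def)
      then show ?thesis
        using det_row_operation[OF \<open>m \<noteq> n\<close>, of "mat 1 :: real ^ 'd ^ 'd" 1] by (simp add: det_I)
    qed
    have meq': "measure lebesgue ((*v) ?A ` cbox a b) = 1 * measure lebesgue (cbox a b)" for a b
    proof (cases "cbox a b = {}")
      case False
      \<comment> \<open>Translating by \<open>c\<close> moves the lower n-th coordinate of the box
        to 0, the normalisation under which the volume of a sheared box is known; translations do
        not change the volume.\<close>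
      define c :: "real ^ 'd" where "c = axis n (a $ n)"
      have ne: "cbox (a - c) (b - c) \<noteq> {}"
        using False by (auto simp: interval_ne_empty_cart)
      have "(*v) ?A ` cbox a b = (*v) ?A ` (+) c ` cbox (a - c) (b - c)"
        by (simp add: cbox_translation[symmetric])
      also have "... = (+) (?A *v c) ` ?f ` cbox (a - c) (b - c)"
        unfolding Av[symmetric] image_image by (simp add: matrix_vector_right_distrib)
      also have "measure lebesgue ... = measure lebesgue (?f ` cbox (a - c) (b - c))"
        by (rule measure_translation)
      also have "... = measure lebesgue (cbox (a - c) (b - c))"
        by (rule measure_shear_interval[OF \<open>m \<noteq> n\<close> ne]) (simp add: c_def)
      also have "... = measure lebesgue ((+) c ` cbox (a - c) (b - c))"
        by (rule measure_translation[symmetric])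
      also have "(+) c ` cbox (a - c) (b - c) = cbox a b"
        by (simp add: cbox_translation[symmetric])
      finally show ?thesis by simp
    qed simp
    show "?P ?A"
    proof (intro impI ballI)
      fix S :: "(real ^ 'd) set" assume "S \<in> lmeasurable"
      from measure_linear_sufficient[where f="(*v) ?A" and m=1, OF matrix_vector_mul_linear this meq']
      show "(*v) ?A ` S \<in> lmeasurable \<and> measure lebesgue ((*v) ?A ` S) = \<bar>det ?A\<bar> * measure lebesgue S"
        unfolding det abs_one by (elim conjE) (intro conjI, assumption, rule sym)
    qed
  qed
  with assms show ?thesis by blast
qed

text \<open>Lebesgue measure is determined by its values on boxes, and the preimage of a box is the
  image of a translated box under the inverse matrix, whose volume carries the factor 1/|det
  A|.\<close>

lemma lborel_affine_matrix:
  fixes A :: "real ^ 'd ^ 'd"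
  assumes "det A \<noteq> 0"
  shows "lborel = density (distr lborel borel (\<lambda>x. A *v x + b)) (\<lambda>_. ennreal \<bar>det A\<bar>)"
proof (rule lborel_eqI)
  fix l u :: "real ^ 'd"
  assume le: "\<And>b. b \<in> Basis ==> l \<bullet> b \<le> u \<bullet> b"
  obtain B where B: "B ** A = mat 1" "A ** B = mat 1"
    using assms invertible_det_nz[of A] by (auto simp: invertible_def)
  then have BA: "B *v (A *v x) = x" "A *v (B *v x) = x" for x
    by (simp_all add: matrix_vector_mul_assoc)
  have [measurable]: "(\<lambda>x. A *v x + b) \<in> borel \<rightarrow>\<^sub>M borel"
    by (intro borel_measurable_continuous_onI continuous_intros matrix_vector_mult_linear_continuous_on)
  have vi: "(\<lambda>x. A *v x + b) -` box l u = (*v) B ` box (l - b) (u - b)"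
  proof (intro set_eqI iffI)
    fix x assume "x \<in> (\<lambda>x. A *v x + b) -` box l u"
    then have "A *v x \<in> box (l - b) (u - b)"
      by (auto simp: mem_box_cart algebra_simps)
    then show "x \<in> (*v) B ` box (l - b) (u - b)" by (force simp: BA intro: rev_image_eqI)
  qed (auto simp: mem_box_cart BA algebra_simps)
  have op: "open ((\<lambda>x. A *v x + b) -` box l u)"
    by (intro open_vimage open_box continuous_intros matrix_vector_mult_linear_continuous_on)
  have lm: "(*v) B ` box (l - b) (u - b) \<in> lmeasurable"
    using measure_matrix_image[of B] det_matrix_inv[OF B(1)] by auto
  have m: "measure lebesgue ((*v) B ` box (l - b) (u - b)) = \<bar>det B\<bar> * (\<Prod>b\<in>Basis. (u - l) \<bullet> b)"
  proof -
    have "measure lebesgue ((*v) B ` box (l - b) (u - b)) = \<bar>det B\<bar> * measure lebesgue (box (l - b) (u - b))"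
      using measure_matrix_image[of B] det_matrix_inv[OF B(1)] by auto
    also have "measure lebesgue (box (l - b) (u - b)) = (\<Prod>b\<in>Basis. (u - l) \<bullet> b)"
      using le by (subst measure_completion) (auto simp: measure_lborel_box inner_diff_left)
    finally show ?thesis .
  qed
  have "emeasure (density (distr lborel borel (\<lambda>x. A *v x + b)) (\<lambda>_. ennreal \<bar>det A\<bar>)) (box l u)
      = ennreal \<bar>det A\<bar> * emeasure lborel ((\<lambda>x. A *v x + b) -` box l u)"
    by (simp add: emeasure_density emeasure_distr nn_integral_cmult_indicator)
  also have "emeasure lborel ((\<lambda>x. A *v x + b) -` box l u) = emeasure lebesgue ((\<lambda>x. A *v x + b) -` box l u)"
    using op by (simp add: emeasure_completion)
  also have "... = ennreal (\<bar>det B\<bar> * (\<Prod>b\<in>Basis. (u - l) \<bullet> b))"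
    using lm unfolding vi by (subst emeasure_eq_measure2) (auto simp: m fmeasurable_def)
  also have "ennreal \<bar>det A\<bar> * ... = ennreal (\<Prod>b\<in>Basis. (u - l) \<bullet> b)"
    using det_matrix_inv[OF B(2)] by (subst ennreal_mult[symmetric]) (auto intro!: prod_nonneg simp: le inner_diff_left abs_mult[symmetric])
  finally show "emeasure (density (distr lborel borel (\<lambda>x. A *v x + b)) (\<lambda>_. ennreal \<bar>det A\<bar>)) (box l u)
     = ennreal (\<Prod>b\<in>Basis. (u - l) \<bullet> b)" .
qed simp

lemma measurable_matrix_mult [measurable]: "(\<lambda>x. (A :: real ^ 'd ^ 'd) *v x) \<in> borel \<rightarrow>\<^sub>M borel"
  by (intro borel_measurable_continuous_onI continuous_intros matrix_vector_mult_linear_continuous_on)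

lemma nn_integral_affine_matrix:
  fixes A :: "real ^ 'd ^ 'd"
  assumes [measurable]: "f \<in> borel_measurable borel" and "det A \<noteq> 0"
  shows "(\<integral>\<^sup>+x. f x \<partial>lborel) = ennreal \<bar>det A\<bar> * (\<integral>\<^sup>+x. f (A *v x + b) \<partial>lborel)"
  by (subst lborel_affine_matrix[OF assms(2), of b])
     (simp add: nn_integral_density nn_integral_distr nn_integral_cmult)

lemma integral_affine_matrix:
  fixes A :: "real ^ 'd ^ 'd" and f :: "real ^ 'd \<Rightarrow> 'b :: {banach, second_countable_topology}"
  assumes [measurable]: "f \<in> borel_measurable borel" and "det A \<noteq> 0"
  shows "(LINT x|lborel. f x) = \<bar>det A\<bar> *\<^sub>R (LINT x|lborel. f (A *v x + b))"
    and "integrable lborel f \<longleftrightarrow> integrable lborel (\<lambda>x. f (A *v x + b))"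
proof -
  show "(LINT x|lborel. f x) = \<bar>det A\<bar> *\<^sub>R (LINT x|lborel. f (A *v x + b))"
    by (subst lborel_affine_matrix[OF assms(2), of b])
       (simp add: integral_density integral_distr)
  have "integrable lborel f \<longleftrightarrow> integrable lborel (\<lambda>x. \<bar>det A\<bar> *\<^sub>R f (A *v x + b))"
    by (subst lborel_affine_matrix[OF assms(2), of b])
       (simp add: integrable_density integrable_distr_eq)
  also have "... \<longleftrightarrow> integrable lborel (\<lambda>x. f (A *v x + b))"
    using assms(2) integrable_scaleR_right[of "1 / \<bar>det A\<bar>" lborel "\<lambda>x. \<bar>det A\<bar> *\<^sub>R f (A *v x + b)"]
    by (auto intro: integrable_scaleR_right)
  finally show "integrable lborel f \<longleftrightarrow> integrable lborel (\<lambda>x. f (A *v x + b))" .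
qed

lemma nn_integral_shift:
  fixes a :: "real ^ 'd"
  assumes "f \<in> borel_measurable borel"
  shows "(\<integral>\<^sup>+x. f (x + a) \<partial>lborel) = (\<integral>\<^sup>+x. f x \<partial>lborel)"
  using nn_integral_affine_matrix[OF assms, of "mat 1" a] by (simp add: det_I)

lemma integral_shift:
  fixes a :: "real ^ 'd" and f :: "real ^ 'd \<Rightarrow> 'b :: {banach, second_countable_topology}"
  assumes "f \<in> borel_measurable borel"
  shows "(LINT x|lborel. f (x + a)) = (LINT x|lborel. f x)"
    and "integrable lborel (\<lambda>x. f (x + a)) \<longleftrightarrow> integrable lborel f"
  using integral_affine_matrix[OF assms, of "mat 1" a] by (auto simp: det_I)

lemma one_plus_norm_pos [simp]: "0 < 1 + norm x" "1 + norm x \<noteq> 0" "0 \<le> 1 + norm x"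
  using norm_ge_zero[of x] by linarith+

text \<open>The shell n \<le> |x| \<le> n + 1 lies in a ball of volume O((n + 1)^d), so the exponent
  d + 2 leaves the summable 1/(n + 1)^2. This weight is the standard majorant from here on, for
  integrals and for lattice sums.\<close>

lemma integrable_weight: "integrable lborel (\<lambda>x :: real ^ 'd. 1 / (1 + norm x) ^ (CARD('d) + 2))"
proof (rule integrableI_bounded)
  let ?d = "CARD('d)" and ?V = "unit_ball_vol (CARD('d))"
  have le: "ennreal (norm (1 / (1 + norm x) ^ (?d + 2)))
     \<le> (\<Sum>n. ennreal (1 / (1 + real n) ^ (?d + 2)) * indicator (cball 0 (real n + 1)) x)" for x :: "real ^ 'd"
  proof -
    define n where "n = nat \<lfloor>norm x\<rfloor>"
    have n: "real n \<le> norm x" "norm x \<le> real n + 1" unfolding n_def using norm_ge_zero[of x] by linarith+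
    have "norm (1 / (1 + norm x) ^ (?d + 2)) \<le> 1 / (1 + real n) ^ (?d + 2)"
    proof -
      have "(1 + real n) ^ (?d + 2) \<le> (1 + norm x) ^ (?d + 2)"
        using n by (intro power_mono) auto
      then show ?thesis by (simp add: norm_divide norm_power frac_le del: power_Suc power_add)
    qed
    then have "ennreal (norm (1 / (1 + norm x) ^ (?d + 2))) \<le> ennreal (1 / (1 + real n) ^ (?d + 2)) * indicator (cball 0 (real n + 1)) x"
      using n by (auto intro!: ennreal_leI)
    also have "... \<le> (\<Sum>n. ennreal (1 / (1 + real n) ^ (?d + 2)) * indicator (cball 0 (real n + 1)) x)"
    proof -
      define F where "F m = ennreal (1 / (1 + real m) ^ (?d + 2)) * indicator (cball 0 (real m + 1)) x" for m
      have "F n \<le> (\<Sum>m. F m)" using sum_le_suminf[of F "{n}"] by simp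
      then show ?thesis by (simp only: F_def)
    qed
    finally show ?thesis .
  qed
  have "(\<integral>\<^sup>+x. ennreal (norm (1 / (1 + norm (x :: real ^ 'd)) ^ (?d + 2))) \<partial>lborel)
    \<le> (\<integral>\<^sup>+x. (\<Sum>n. ennreal (1 / (1 + real n) ^ (?d + 2)) * indicator (cball (0 :: real ^ 'd) (real n + 1)) x) \<partial>lborel)"
    by (intro nn_integral_mono le)
  also have "... = (\<Sum>n. \<integral>\<^sup>+x. ennreal (1 / (1 + real n) ^ (?d + 2)) * indicator (cball (0 :: real ^ 'd) (real n + 1)) x \<partial>lborel)"
    by (intro nn_integral_suminf borel_measurable_times_ennreal borel_measurable_indicator) simp_all
  also have "... = (\<Sum>n. ennreal (?V * (1 / (1 + real n) ^ 2)))"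
  proof (rule suminf_cong)
    fix n
    have "(\<integral>\<^sup>+x. ennreal (1 / (1 + real n) ^ (?d + 2)) * indicator (cball (0 :: real ^ 'd) (real n + 1)) x \<partial>lborel)
      = ennreal (1 / (1 + real n) ^ (?d + 2)) * ennreal (?V * (real n + 1) ^ ?d)"
      by (simp add: nn_integral_cmult_indicator emeasure_cball)
    also have "... = ennreal (?V * (1 / (1 + real n) ^ 2))"
    proof -
      have "1 / a ^ (?d + 2) * (?V * a ^ ?d) = ?V * (1 / a ^ 2)" if "a > 0" for a :: real
        using that by (simp add: power_add power2_eq_square)
      from this[of "1 + real n"] show ?thesis
        by (subst ennreal_mult[symmetric]) (simp_all add: add.commute del: power_add power_Suc)
    qed
    finally show "(\<integral>\<^sup>+x. ennreal (1 / (1 + real n) ^ (?d + 2)) * indicator (cball (0 :: real ^ 'd) (real n + 1)) x \<partial>lborel)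
      = ennreal (?V * (1 / (1 + real n) ^ 2))" .
  qed
  also have "... = ennreal (\<Sum>n. ?V * (1 / (1 + real n) ^ 2))"
  proof (rule suminf_ennreal2)
    have "summable (\<lambda>n. 1 / real (Suc n) ^ 2)"
      using inverse_power_summable[of 2, where 'a=real] by (subst summable_Suc_iff) (simp add: inverse_eq_divide)
    then show "summable (\<lambda>n. ?V * (1 / (1 + real n) ^ 2))"
      by (intro summable_mult) (simp add: add.commute)
  qed auto
  also have "... < \<infinity>" by simp
  finally show "(\<integral>\<^sup>+x. ennreal (norm (1 / (1 + norm (x :: real ^ 'd)) ^ (?d + 2))) \<partial>lborel) < \<infinity>" .
qed simp

lemma integrable_weight_bound:
  fixes f :: "real ^ 'd \<Rightarrow> 'b :: {banach, second_countable_topology}"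
  assumes "f \<in> borel_measurable borel" "\<And>x. norm (f x) \<le> C / (1 + norm x) ^ (CARD('d) + 2)"
  shows "integrable lborel f"
proof (rule Bochner_Integration.integrable_bound)
  show "integrable lborel (\<lambda>x :: real ^ 'd. C * (1 / (1 + norm x) ^ (CARD('d) + 2)))"
    by (intro integrable_mult_right integrable_weight)
  have "norm (f x) \<le> norm (C * (1 / (1 + norm x) ^ (CARD('d) + 2)))" for x
    using assms(2)[of x] abs_ge_self[of "C / (1 + norm x) ^ (CARD('d) + 2)"] by simp
  then show "AE x in lborel. norm (f x) \<le> norm (C * (1 / (1 + norm x) ^ (CARD('d) + 2)))" by simp
qed (use assms in simp)

lemma schwartz_slow_bound:
  assumes "f \<in> schwartz" and C: "\<And>x. norm (g x :: 'b :: real_normed_vector) \<le> C * (1 + norm x) ^ K"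
  obtains D where "D \<ge> 0" "\<And>x. cmod (f x) * norm (g x) \<le> D / (1 + norm x) ^ N"
proof -
  obtain E where E: "E \<ge> 0" "\<And>x. cmod (f x) \<le> E / (1 + norm x) ^ (N + K)"
    using schwartz_bound0[OF assms(1)] by metis
  have C0: "C \<ge> 0" using order_trans[OF norm_ge_zero C[of 0]] by simp
  have "cmod (f x) * norm (g x) \<le> E * C / (1 + norm x) ^ N" for x
  proof -
    have "cmod (f x) * norm (g x) \<le> E / (1 + norm x) ^ (N + K) * (C * (1 + norm x) ^ K)"
      by (intro mult_mono E C) (auto simp: E)
    also have "... = E * C / (1 + norm x) ^ N" by (simp add: power_add)
    finally show ?thesis .
  qed
  then show ?thesis using that[of "E * C"] E(1) C0 by simp
qed

lemma schwartz_integrable_bound: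
  assumes f: "f \<in> schwartz" and [measurable]: "g \<in> borel_measurable borel"
    and C: "\<And>x. cmod (g x) \<le> C * (1 + norm x) ^ K"
  shows "integrable lborel (\<lambda>x :: real ^ 'd. f x * g x)" "integrable lborel (\<lambda>x :: real ^ 'd. g x * f x)"
proof -
  note [measurable] = schwartz_measurable[OF f]
  obtain D where "\<And>x. cmod (f x) * norm (g x) \<le> D / (1 + norm x) ^ (CARD('d) + 2)"
    using schwartz_slow_bound[OF f C] by metis
  then show "integrable lborel (\<lambda>x :: real ^ 'd. f x * g x)"
    by (intro integrable_weight_bound[of _ D]) (auto simp: norm_mult)
  then show "integrable lborel (\<lambda>x :: real ^ 'd. g x * f x)" by (simp add: mult.commute)
qed

lemma schwartz_integrable: "f \<in> schwartz ==> integrable lborel f"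
  using schwartz_integrable_bound(1)[of f "\<lambda>_. 1" 1 0] by simp

lemma partial_mean_value:
  fixes f :: "real ^ 'd \<Rightarrow> complex"
  assumes f: "\<And>y. f differentiable (at y)" and B: "\<And>y i. norm (y - x) \<le> norm h ==> cmod (partial_deriv i f y) \<le> B"
  shows "cmod (f (x + h) - f x) \<le> real CARD('d) * B * norm h"
proof -
  have "norm (f (x + h) - f x) \<le> real CARD('d) * B * norm (x + h - x)"
  proof (rule differentiable_bound[where S="cball x (norm h)"])
    fix y assume y: "y \<in> cball x (norm h)"
    show "(f has_derivative (\<lambda>h. \<Sum>i\<in>UNIV. h $ i *\<^sub>R partial_deriv i f y)) (at y within cball x (norm h))"
      using has_derivative_partial[OF f] has_derivative_at_withinI by blast
    show "onorm (\<lambda>h. \<Sum>i\<in>UNIV. h $ i *\<^sub>R partial_deriv i f y) \<le> real CARD('d) * B"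
    proof (rule onorm_le)
      fix k :: "real ^ 'd"
      have "norm (\<Sum>i\<in>UNIV. k $ i *\<^sub>R partial_deriv i f y) \<le> (\<Sum>i\<in>(UNIV::'d set). norm k * B)"
        using y by (intro order_trans[OF norm_sum] sum_mono)
           (auto intro!: mult_mono B component_le_norm_cart simp: dist_norm norm_minus_commute)
      then show "norm (\<Sum>i\<in>UNIV. k $ i *\<^sub>R partial_deriv i f y) \<le> real CARD('d) * B * norm k"
        by (simp add: mult_ac)
    qed
  qed (auto simp: dist_norm)
  then show ?thesis by simp
qed

lemma one_plus_norm_shift:
  fixes x y :: "'a :: real_normed_vector"
  assumes "norm (y - x) \<le> 1"
  shows "1 + norm x \<le> 2 * (1 + norm y)"
proof -
  have "norm x \<le> norm y + norm (x - y)" by (rule norm_triangle_sub)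
  with assms have "norm x \<le> norm y + 1" by (simp add: norm_minus_commute)
  then show ?thesis by (rule order_trans[OF add_left_mono]) simp
qed

lemma weight_shift:
  fixes x y :: "'a :: real_normed_vector"
  assumes "norm (y - x) \<le> 1"
  shows "1 / (1 + norm y) ^ N \<le> 2 ^ N / (1 + norm x) ^ N"
proof -
  have "(1 + norm x) ^ N \<le> (2 * (1 + norm y)) ^ N"
    by (intro power_mono one_plus_norm_shift assms) simp
  then have "(1 + norm x) ^ N \<le> 2 ^ N * (1 + norm y) ^ N" by (simp only: power_mult_distrib)
  then show ?thesis by (simp add: divide_simps)
qed

lemma schwartz_uniform_bound:
  fixes F :: "'d \<Rightarrow> real ^ 'd \<Rightarrow> complex"
  assumes "\<And>i. F i \<in> schwartz"
  obtains C where "C \<ge> 0" "\<And>i x. cmod (F i x) \<le> C / (1 + norm x) ^ N"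
proof -
  have "\<exists>C\<ge>0. \<forall>x. cmod (F i x) \<le> C / (1 + norm x) ^ N" for i
    using schwartz_bound0[OF assms[of i]] by metis
  then obtain C where C: "\<And>i. C i \<ge> 0" "\<And>i x. cmod (F i x) \<le> C i / (1 + norm x) ^ N" by metis
  have "cmod (F i x) \<le> (\<Sum>i\<in>UNIV. C i) / (1 + norm x) ^ N" for i x
    by (rule order_trans[OF C(2)]) (auto intro!: divide_right_mono member_le_sum C)
  then show ?thesis using that[of "\<Sum>i\<in>UNIV. C i"] C by (simp add: sum_nonneg)
qed

lemma schwartz_first_order:
  fixes f :: "real ^ 'd \<Rightarrow> complex"
  assumes f: "f \<in> schwartz"
  obtains C where "C \<ge> 0" "\<And>x h. norm h \<le> 1 ==> cmod (f (x + h) - f x) \<le> norm h * (C / (1 + norm x) ^ N)"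
proof -
  obtain C where C: "C \<ge> 0" "\<And>i x. cmod (partial_deriv i f x) \<le> C / (1 + norm x) ^ N"
    using schwartz_uniform_bound[of "\<lambda>i. partial_deriv i f" N] schwartz_partial_deriv[OF f] by metis
  have "cmod (f (x + h) - f x) \<le> norm h * ((real CARD('d) * (C * 2 ^ N)) / (1 + norm x) ^ N)"
    if "norm h \<le> 1" for x h
  proof -
    have "cmod (partial_deriv i f y) \<le> C * (2 ^ N / (1 + norm x) ^ N)" if "norm (y - x) \<le> norm h" for y i
      using order_trans[OF C(2)[of i y], of "C * (2 ^ N / (1 + norm x) ^ N)"]
        mult_left_mono[OF weight_shift[of y x N] C(1)] that \<open>norm h \<le> 1\<close> by simp
    from partial_mean_value[OF smooth_differentiable[OF schwartz_smooth[OF f]] this]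
    show ?thesis by (simp add: mult_ac)
  qed
  then show ?thesis using that[of "real CARD('d) * (C * 2 ^ N)"] C(1) by simp
qed

text \<open>Obtained from the first order estimate for the partial derivatives. A remainder that is
  quadratic in h and decays in x is the majorant needed to differentiate integrals and lattice sums
  with respect to a shift.\<close>

lemma schwartz_second_order:
  fixes f :: "real ^ 'd \<Rightarrow> complex"
  assumes f: "f \<in> schwartz"
  obtains C where "C \<ge> 0" "\<And>x h. norm h \<le> 1 ==>
    cmod (f (x + h) - f x - (\<Sum>i\<in>UNIV. h $ i *\<^sub>R partial_deriv i f x)) \<le> (norm h)^2 * (C / (1 + norm x) ^ N)"
proof -
  have "\<exists>C\<ge>0. \<forall>x h. norm h \<le> 1 \<longrightarrow> cmod (partial_deriv i f (x + h) - partial_deriv i f x) \<le> norm h * (C / (1 + norm x) ^ N)" for i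
    using schwartz_first_order[OF schwartz_partial_deriv[OF f, of i]] by metis
  then obtain C where C: "\<And>i. C i \<ge> 0" "\<And>i x h. norm h \<le> 1 ==>
      cmod (partial_deriv i f (x + h) - partial_deriv i f x) \<le> norm h * (C i / (1 + norm x) ^ N)" by metis
  let ?C = "\<Sum>i\<in>UNIV. C i"
  have "cmod (f (x + h) - f x - (\<Sum>i\<in>UNIV. h $ i *\<^sub>R partial_deriv i f x)) \<le> (norm h)^2 * (?C / (1 + norm x) ^ N)"
    if h: "norm h \<le> 1" for x h
  proof -
    let ?f' = "\<lambda>y h. \<Sum>i\<in>UNIV. h $ i *\<^sub>R partial_deriv i f y"
    have "norm (f (x + h) - f x - ?f' x (x + h - x)) \<le> norm (x + h - x) * (norm h * (?C / (1 + norm x) ^ N))"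
    proof (rule differentiable_bound_linearization[where S="cball x (norm h)"])
      show "x + t *\<^sub>R (x + h - x) \<in> cball x (norm h)" if "t \<in> {0..1}" for t
        using that by (auto simp: dist_norm intro: mult_left_le_one_le)
      show "(f has_derivative ?f' y) (at y within cball x (norm h))" for y
        using has_derivative_partial[OF smooth_differentiable[OF schwartz_smooth[OF f]]] has_derivative_at_withinI by blast
      show "onorm (?f' y - ?f' x) \<le> norm h * (?C / (1 + norm x) ^ N)" if "y \<in> cball x (norm h)" for y
        unfolding fun_diff_def
      proof (rule onorm_le)
        fix k :: "real ^ 'd"
        have "norm (?f' y k - ?f' x k) \<le> (\<Sum>i\<in>UNIV. norm k * (norm h * (C i / (1 + norm x) ^ N)))"
          unfolding sum_subtractf[symmetric] scaleR_diff_right[symmetric]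
        proof (intro order_trans[OF norm_sum] sum_mono)
          fix i
          have "cmod (partial_deriv i f (x + (y - x)) - partial_deriv i f x) \<le> norm (y - x) * (C i / (1 + norm x) ^ N)"
            using that h by (intro C) (auto simp: dist_norm norm_minus_commute)
          also have "... \<le> norm h * (C i / (1 + norm x) ^ N)"
            using that C(1) by (intro mult_right_mono) (auto simp: dist_norm norm_minus_commute)
          finally show "norm (k $ i *\<^sub>R (partial_deriv i f y - partial_deriv i f x)) \<le> norm k * (norm h * (C i / (1 + norm x) ^ N))"
            unfolding norm_scaleR real_norm_def by (intro mult_mono component_le_norm_cart) auto
        qed
        also have "... = norm h * (?C / (1 + norm x) ^ N) * norm k"
          by (simp add: sum_distrib_left sum_distrib_right sum_divide_distrib mult_ac)
        finally show "norm (?f' y k - ?f' x k) \<le> norm h * (?C / (1 + norm x) ^ N) * norm k" .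
      qed
    qed auto
    then show ?thesis by (simp add: power2_eq_square mult_ac)
  qed
  then show ?thesis using that[of ?C] C by (simp add: sum_nonneg)
qed

text \<open>Integrating a quadratic remainder with an integrable factor \<open>D\<close> leaves
  O(|h|^2). The measure is arbitrary, so the lemma differentiates Fourier integrals, convolutions
  and lattice sums alike.\<close>

lemma has_derivative_parameter_integral:
  fixes K :: "real ^ 'd \<Rightarrow> 'a \<Rightarrow> complex"
  assumes K: "\<And>\<xi>. integrable M (K \<xi>)" and L: "\<And>i. integrable M (L i)" and D: "integrable M D"
    and le: "\<And>h x. norm h \<le> 1 ==> x \<in> space M ==>
      cmod (K (\<xi> + h) x - K \<xi> x - (\<Sum>i\<in>UNIV. h $ i *\<^sub>R L i x)) \<le> (norm h)^2 * D x"
  shows "((\<lambda>\<xi>. LINT x|M. K \<xi> x) has_derivative (\<lambda>h. \<Sum>i\<in>UNIV. h $ i *\<^sub>R (LINT x|M. L i x))) (at \<xi>)"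
  unfolding has_derivative_at
proof (rule conjI)
  show "bounded_linear (\<lambda>h :: real ^ 'd. \<Sum>i\<in>UNIV. h $ i *\<^sub>R (LINT x|M. L i x))"
    by (intro bounded_linear_sum bounded_linear_compose[OF bounded_linear_scaleR_left bounded_linear_vec_nth])
  let ?F = "\<lambda>\<xi>. LINT x|M. K \<xi> x" and ?D = "\<lambda>h. \<Sum>i\<in>UNIV. h $ i *\<^sub>R (LINT x|M. L i x)"
  have *: "norm (?F (\<xi> + h) - ?F \<xi> - ?D h) \<le> (norm h)^2 * (LINT x|M. D x)" if "norm h \<le> 1" for h
  proof -
    have "?F (\<xi> + h) - ?F \<xi> - ?D h = (LINT x|M. K (\<xi> + h) x - K \<xi> x - (\<Sum>i\<in>UNIV. h $ i *\<^sub>R L i x))"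
      using K L by simp
    also have "norm ... \<le> (LINT x|M. (norm h)^2 * D x)"
      using K L D le[OF that] by (intro integral_norm_bound[THEN order_trans] integral_mono) auto
    finally show ?thesis by simp
  qed
  have "((\<lambda>h. norm (?F (\<xi> + h) - ?F \<xi> - ?D h) / norm h) \<longlongrightarrow> 0) (at 0)"
  proof (rule Lim_null_comparison)
    show "\<forall>\<^sub>F h in at 0. norm (norm (?F (\<xi> + h) - ?F \<xi> - ?D h) / norm h) \<le> norm h * (LINT x|M. D x)"
      unfolding eventually_at
    proof (intro exI[of _ 1] conjI ballI impI)
      fix h :: "real ^ 'd" assume "h \<noteq> 0 \<and> dist h 0 < 1"
      then have "norm (?F (\<xi> + h) - ?F \<xi> - ?D h) \<le> (norm h)^2 * (LINT x|M. D x)" "norm h > 0"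
        using * by auto
      then show "norm (norm (?F (\<xi> + h) - ?F \<xi> - ?D h) / norm h) \<le> norm h * (LINT x|M. D x)"
        by (simp add: divide_le_eq power2_eq_square mult_ac)
    qed simp
    show "((\<lambda>h :: real ^ 'd. norm h * (LINT x|M. D x)) \<longlongrightarrow> 0) (at 0)"
      by (rule tendsto_mult_left_zero[OF tendsto_norm_zero[OF tendsto_ident_at]])
  qed
  then show "(\<lambda>h. norm (?F (\<xi> + h) - ?F \<xi> - ?D h) / norm h) \<midarrow>0\<rightarrow> 0" .
qed

section \<open>The Fourier transform on the Schwartz class\<close>

lemma sum_axis: "(\<Sum>j\<in>UNIV. (t *\<^sub>R axis i 1 :: real ^ 'd) $ j *\<^sub>R p j) = t *\<^sub>R (p i :: 'a :: real_vector)"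
  by (subst sum.remove[of _ i]) (auto simp: axis_def)

text \<open>Translation invariance: f(x + t e) - f(x) has integral 0, and by the second order
  estimate this integral is also t times that of the derivative, up to O(t^2).\<close>

lemma integral_partial_deriv:
  fixes f :: "real ^ 'd \<Rightarrow> complex"
  assumes f: "f \<in> schwartz"
  shows "(LINT x|lborel. partial_deriv i f x) = 0"
proof -
  let ?N = "CARD('d) + 2"
  obtain C where C: "C \<ge> 0" "\<And>x h. norm h \<le> 1 ==>
    cmod (f (x + h) - f x - (\<Sum>i\<in>UNIV. h $ i *\<^sub>R partial_deriv i f x)) \<le> (norm h)^2 * (C / (1 + norm x) ^ ?N)"
    using schwartz_second_order[OF f, of ?N] by blast
  define W where "W x = C * (1 / (1 + norm x) ^ ?N)" for x :: "real ^ 'd"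
  have intW: "integrable lborel W"
    unfolding W_def by (intro integrable_mult_right integrable_weight)
  let ?I = "LINT x|lborel. W x"
  let ?J = "LINT x|lborel. partial_deriv i f x"
  have intf: "integrable lborel f" and intp: "integrable lborel (partial_deriv i f)"
    using f by (auto intro: schwartz_integrable schwartz_partial_deriv)
  have [measurable]: "f \<in> borel_measurable borel" using f by measurable
  have le: "cmod ?J \<le> t * ?I" if t: "0 < t" "t \<le> 1" for t
  proof -
    let ?h = "t *\<^sub>R axis i 1 :: real ^ 'd"
    have nh: "norm ?h = t" using t by simp
    have "t *\<^sub>R ?J = - (LINT x|lborel. f (x + ?h) - f x - t *\<^sub>R partial_deriv i f x)"
      using intf intp integral_shift[of f ?h] by simp
    then have "norm (t *\<^sub>R ?J) = norm (LINT x|lborel. f (x + ?h) - f x - t *\<^sub>R partial_deriv i f x)"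
      by simp
    also have "... \<le> (LINT x|lborel. t^2 * W x)"
    proof (rule Bochner_Integration.integral_norm_bound_integral)
      show "integrable lborel (\<lambda>x. f (x + ?h) - f x - t *\<^sub>R partial_deriv i f x)"
        using intf intp integral_shift(2)[of f ?h] by simp
      show "integrable lborel (\<lambda>x. t^2 * W x)"
        by (intro integrable_mult_right intW)
      show "norm (f (x + ?h) - f x - t *\<^sub>R partial_deriv i f x) \<le> t^2 * W x" for x
        using C(2)[of ?h x] t unfolding sum_axis nh W_def by simp
    qed
    finally have "t * cmod ?J \<le> t * (t * ?I)"
      using t by (simp add: power2_eq_square mult.assoc)
    then show ?thesis using t by simp
  qed
  have "cmod ?J \<le> 0"
  proof (rule tendsto_lowerbound)
    show "((\<lambda>t. t * ?I) \<longlongrightarrow> 0) (at_right 0)"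
      by (rule tendsto_mult_left_zero[OF tendsto_ident_at])
    show "\<forall>\<^sub>F t in at_right 0. cmod ?J \<le> t * ?I"
      using le by (auto simp: eventually_at_right_field intro!: exI[of _ 1])
  qed simp
  then show ?thesis by simp
qed

lemma partial_deriv_echar: "partial_deriv i (echar k) x = 2 * pi * \<i> * complex_of_real (k $ i) * echar k x"
  using partial_deriv_eq[of "echar k" _ x i] has_derivative_echar[of 1 k x]
  by (simp add: inner_axis inner_commute)

lemma schwartz_echar: "f \<in> schwartz ==> (\<lambda>x. f x * echar k x) \<in> schwartz"
  by (intro schwartz_mult_slow slow_echar)

lemma fourier_partial_deriv:
  assumes f: "f \<in> schwartz"
  shows "fourier (partial_deriv i f) \<xi> = 2 * pi * \<i> * complex_of_real (\<xi> $ i) * fourier f \<xi>"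
proof -
  let ?c = "2 * pi * \<i> * complex_of_real (\<xi> $ i)"
  have "partial_deriv i (\<lambda>x. f x * echar (- \<xi>) x) x = partial_deriv i f x * echar (- \<xi>) x - ?c * (f x * echar (- \<xi>) x)" for x
    using f slow_echar[of "- \<xi>"]
    by (subst partial_deriv_mult) (auto simp: partial_deriv_echar schwartz_smooth slow_smooth smooth_differentiable)
  moreover have "(LINT x|lborel. partial_deriv i (\<lambda>x. f x * echar (- \<xi>) x) x) = 0"
    by (intro integral_partial_deriv schwartz_echar f)
  moreover have "integrable lborel (\<lambda>x. partial_deriv i f x * echar (- \<xi>) x)"
    "integrable lborel (\<lambda>x. f x * echar (- \<xi>) x)"
    using f by (auto intro!: schwartz_integrable schwartz_echar schwartz_partial_deriv)
  ultimately show ?thesis by (simp add: fourier_eq)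
qed

lemma norm_fourier_le: "cmod (fourier f \<xi>) \<le> (LINT x|lborel. cmod (f x))"
  unfolding fourier_eq using integral_norm_bound[of lborel "\<lambda>x. f x * echar (- \<xi>) x"]
  by (simp add: norm_mult)

text \<open>Each further power of |\<xi>| is traded for one more derivative of f. The finite set
  \<open>L\<close> and the constant \<open>C\<close> depend on \<open>N\<close> alone, so the
  estimate also yields continuity along null sequences in \<open>fourier_null\<close>.\<close>

lemma fourier_decay:
  "\<exists>L C. finite L \<and> C \<ge> 0 \<and> (\<forall>f\<in>schwartz. \<forall>b\<ge>0.
     (\<forall>is\<in>L. \<forall>x :: real ^ 'd. (1 + norm x) ^ (CARD('d) + 2) * cmod (iter_partial is f x) \<le> b) \<longrightarrow>
     (\<forall>\<xi>. (1 + norm \<xi>) ^ N * cmod (fourier f \<xi>) \<le> C * b))"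
proof (induction N)
  case 0
  let ?W = "\<lambda>x :: real ^ 'd. 1 / (1 + norm x) ^ (CARD('d) + 2)"
  have "cmod (fourier f \<xi>) \<le> (LINT x|lborel. ?W x) * b"
    if f: "f \<in> schwartz" and b: "\<forall>x :: real ^ 'd. (1 + norm x) ^ (CARD('d) + 2) * cmod (f x) \<le> b" for f b \<xi>
  proof -
    have "(LINT x|lborel. cmod (f x)) \<le> (LINT x|lborel. ?W x * b)"
    proof (rule integral_mono)
      show "integrable lborel (\<lambda>x. cmod (f x))"
        using f by (intro integrable_norm schwartz_integrable)
      show "integrable lborel (\<lambda>x. ?W x * b)"
        by (intro integrable_mult_left integrable_weight)
      show "cmod (f x) \<le> ?W x * b" for x
      proof -
        have "0 < (1 + norm x) ^ (CARD('d) + 2)" by simp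
        with b show ?thesis by (simp add: pos_le_divide_eq mult.commute del: power_add power_Suc)
      qed
    qed
    also have "... = (LINT x|lborel. ?W x) * b"
      by (rule integral_mult_left_zero)
    finally show ?thesis by (rule order_trans[OF norm_fourier_le])
  qed
  then show ?case
    by (intro exI[of _ "{[]}"] exI[of _ "LINT x|lborel. ?W x"]) (auto intro!: integral_nonneg)
next
  case (Suc N)
  then obtain L C where L: "finite L" "C \<ge> 0" and *: "\<And>f b \<xi>. f \<in> schwartz ==> b \<ge> 0 ==>
     \<forall>is\<in>L. \<forall>x :: real ^ 'd. (1 + norm x) ^ (CARD('d) + 2) * cmod (iter_partial is f x) \<le> b ==>
     (1 + norm \<xi>) ^ N * cmod (fourier f \<xi>) \<le> C * b" by metis
  let ?L = "L \<union> (\<lambda>(is, i). is @ [i]) ` (L \<times> UNIV)"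
  have "(1 + norm \<xi>) ^ Suc N * cmod (fourier f \<xi>) \<le> C * (1 + real CARD('d)) * b"
    if f: "f \<in> schwartz" and b: "b \<ge> 0" and
      le: "\<forall>is\<in>?L. \<forall>x :: real ^ 'd. (1 + norm x) ^ (CARD('d) + 2) * cmod (iter_partial is f x) \<le> b" for f b \<xi>
  proof -
    have 1: "(1 + norm \<xi>) ^ N * cmod (fourier f \<xi>) \<le> C * b"
      using le by (intro * f b) auto
    have 2: "(1 + norm \<xi>) ^ N * (\<bar>\<xi> $ i\<bar> * cmod (fourier f \<xi>)) \<le> C * b" for i
    proof -
      have "1 \<le> 2 * pi" using pi_gt3 by simp
      then have "1 * (\<bar>\<xi> $ i\<bar> * cmod (fourier f \<xi>)) \<le> (2 * pi) * (\<bar>\<xi> $ i\<bar> * cmod (fourier f \<xi>))"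
        by (intro mult_right_mono) auto
      also have "... = cmod (fourier (partial_deriv i f) \<xi>)"
        by (simp add: fourier_partial_deriv[OF f] norm_mult)
      finally have "(1 + norm \<xi>) ^ N * (\<bar>\<xi> $ i\<bar> * cmod (fourier f \<xi>)) \<le> (1 + norm \<xi>) ^ N * cmod (fourier (partial_deriv i f) \<xi>)"
        by (intro mult_left_mono) auto
      also have "... \<le> C * b"
      proof (rule *)
        show "\<forall>is\<in>L. \<forall>x. (1 + norm x) ^ (CARD('d) + 2) * cmod (iter_partial is (partial_deriv i f) x) \<le> b"
        proof (intro ballI allI)
          fix "is" and x :: "real ^ 'd" assume "is \<in> L"
          then have "is @ [i] \<in> ?L" by auto
          with le show "(1 + norm x) ^ (CARD('d) + 2) * cmod (iter_partial is (partial_deriv i f) x) \<le> b"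
            unfolding iter_partial_snoc[symmetric] by blast
        qed
      qed (use f b in \<open>auto intro: schwartz_partial_deriv\<close>)
      finally show ?thesis .
    qed
    have "(1 + norm \<xi>) * ((1 + norm \<xi>) ^ N * cmod (fourier f \<xi>))
      \<le> (1 + (\<Sum>i\<in>UNIV. \<bar>\<xi> $ i\<bar>)) * ((1 + norm \<xi>) ^ N * cmod (fourier f \<xi>))"
      using norm_le_l1_cart[of \<xi>] by (intro mult_right_mono) auto
    also have "... = (1 + norm \<xi>) ^ N * cmod (fourier f \<xi>) + (\<Sum>i\<in>UNIV. \<bar>\<xi> $ i\<bar> * ((1 + norm \<xi>) ^ N * cmod (fourier f \<xi>)))"
      unfolding distrib_right sum_distrib_right by simp
    also have "... = (1 + norm \<xi>) ^ N * cmod (fourier f \<xi>) + (\<Sum>i\<in>UNIV. (1 + norm \<xi>) ^ N * (\<bar>\<xi> $ i\<bar> * cmod (fourier f \<xi>)))"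
      by (simp add: mult_ac)
    also have "... \<le> C * b + (\<Sum>i\<in>(UNIV :: 'd set). C * b)"
      by (intro add_mono sum_mono 1 2)
    finally show ?thesis by (simp add: algebra_simps)
  qed
  then show ?case
    using L by (intro exI[of _ ?L] exI[of _ "C * (1 + real CARD('d))"]) auto
qed

lemma exp_second_order: "cmod (exp (- (\<i> * complex_of_real t)) - 1 + \<i> * complex_of_real t) \<le> t^2"
proof -
  have "exp (- (\<i> * complex_of_real t)) - 1 + \<i> * complex_of_real t = iexp (- t) - (\<Sum>k\<le>1. (\<i> * complex_of_real (- t)) ^ k / fact k)"
    by simp
  also have "cmod ... \<le> \<bar>- t\<bar> ^ Suc 1 / fact (Suc 1)"
    by (rule iexp_approx1)
  also have "... \<le> t^2" by (simp add: power2_eq_square)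
  finally show ?thesis .
qed

lemma has_derivative_fourier:
  fixes f :: "real ^ 'd \<Rightarrow> complex"
  assumes f: "f \<in> schwartz"
  shows "(fourier f has_derivative
    (\<lambda>h. \<Sum>i\<in>UNIV. h $ i *\<^sub>R fourier (\<lambda>x. f x * (- 2 * pi * \<i> * complex_of_real (x $ i))) \<xi>)) (at \<xi>)"
  unfolding fourier_eq[abs_def]
proof (rule has_derivative_parameter_integral)
  have cs: "(\<lambda>x. - 2 * pi * \<i> * complex_of_real (x $ i)) \<in> slow_fun" for i :: 'd
    by (intro slow_mult slow_const slow_coord)
  show "integrable lborel (\<lambda>x. f x * echar (- \<xi>) x)" for \<xi>
    by (intro schwartz_integrable schwartz_echar f)
  show "integrable lborel (\<lambda>x. f x * (- 2 * pi * \<i> * complex_of_real (x $ i)) * echar (- \<xi>) x)" for i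
    by (intro schwartz_integrable schwartz_echar schwartz_mult_slow f cs)
  have [measurable]: "f \<in> borel_measurable borel" using f by measurable
  show "integrable lborel (\<lambda>x. cmod (f x * of_real ((2 * pi * norm x)^2)))"
  proof (intro integrable_norm schwartz_integrable_bound(1)[OF f])
    show "cmod (of_real ((2 * pi * norm x)^2)) \<le> (2 * pi)^2 * (1 + norm x) ^ 2" for x :: "real ^ 'd"
      by (simp add: norm_mult norm_power power_mult_distrib power_mono)
  qed measurable
  fix h x :: "real ^ 'd"
  let ?t = "2 * pi * (x \<bullet> h)"
  have s: "(\<Sum>i\<in>UNIV. h $ i *\<^sub>R (f x * (- 2 * pi * \<i> * complex_of_real (x $ i)) * echar (- \<xi>) x))
    = f x * echar (- \<xi>) x * (- (\<i> * complex_of_real ?t))"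
    by (simp add: inner_vec_def sum_distrib_left scaleR_conv_of_real mult_ac sum_negf)
  have e: "echar (- (\<xi> + h)) x = echar (- \<xi>) x * exp (- (\<i> * complex_of_real ?t))"
    by (simp add: echar_def inner_add_right mult_exp_exp algebra_simps)
  have "cmod (f x * echar (- (\<xi> + h)) x - f x * echar (- \<xi>) x - f x * echar (- \<xi>) x * (- (\<i> * complex_of_real ?t)))
     = cmod (f x * echar (- \<xi>) x * (exp (- (\<i> * complex_of_real ?t)) - 1 + \<i> * complex_of_real ?t))"
    unfolding e by (simp add: algebra_simps)
  also have "... \<le> cmod (f x) * ?t^2"
    unfolding norm_mult norm_echar mult_1_right by (intro mult_left_mono exp_second_order) simp
  also have "... \<le> cmod (f x) * (2 * pi * (norm x * norm h))^2"
    unfolding power_mult_distrib[of "2 * pi"] power2_abs[of "x \<bullet> h", symmetric]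
    by (intro mult_left_mono power_mono Cauchy_Schwarz_ineq2) auto
  also have "... = (norm h)^2 * cmod (f x * of_real ((2 * pi * norm x)^2))"
    by (simp add: norm_mult norm_power power_mult_distrib mult_ac)
  finally show "cmod (f x * echar (- (\<xi> + h)) x - f x * echar (- \<xi>) x -
      (\<Sum>i\<in>UNIV. h $ i *\<^sub>R (f x * (- 2 * pi * \<i> * complex_of_real (x $ i)) * echar (- \<xi>) x)))
    \<le> (norm h)^2 * cmod (f x * of_real ((2 * pi * norm x)^2))"
    unfolding s .
qed

text \<open>Differentiating a Fourier transform multiplies f by a coordinate, up to a constant, so
  the Fourier transforms of Schwartz functions form an invariant class for
  \<open>schwartz_coinduct\<close>.\<close>

lemma fourier_schwartz:
  fixes f :: "real ^ 'd \<Rightarrow> complex"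
  assumes "f \<in> schwartz" shows "fourier f \<in> schwartz"
proof (rule schwartz_coinduct[where X="fourier ` schwartz"])
  fix F :: "real ^ 'd \<Rightarrow> complex" assume "F \<in> fourier ` schwartz"
  then obtain f :: "real ^ 'd \<Rightarrow> complex" where f: "f \<in> schwartz" and F: "F = fourier f" by auto
  show "F differentiable (at x)" for x
    unfolding F using has_derivative_fourier[OF f] differentiable_def by blast
  show "partial_deriv i F \<in> fourier ` schwartz" for i
  proof (rule image_eqI)
    show "partial_deriv i F = fourier (\<lambda>x. f x * (- 2 * pi * \<i> * complex_of_real (x $ i)))"
      unfolding F by (rule ext, subst partial_deriv_eq[OF has_derivative_fourier[OF f]])
        (use sum_axis[of 1] in simp)
    show "(\<lambda>x. f x * (- 2 * pi * \<i> * complex_of_real (x $ i))) \<in> schwartz"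
      by (intro schwartz_mult_slow f slow_mult slow_const slow_coord)
  qed
  fix N
  obtain L C where L: "finite L" and *: "\<And>f b \<xi>. f \<in> schwartz ==> b \<ge> 0 ==>
     \<forall>is\<in>L. \<forall>x :: real ^ 'd. (1 + norm x) ^ (CARD('d) + 2) * cmod (iter_partial is f x) \<le> b ==>
     (1 + norm \<xi>) ^ N * cmod (fourier f \<xi>) \<le> C * b"
    using fourier_decay[of N, where 'd='d] by metis
  have "\<exists>C\<ge>0. \<forall>x. (1 + norm x) ^ (CARD('d) + 2) * cmod (iter_partial is f x) \<le> C" for "is"
    using schwartz_bound[OF f] by metis
  then obtain B where B: "\<And>is. B is \<ge> 0" "\<And>is x. (1 + norm x) ^ (CARD('d) + 2) * cmod (iter_partial is f x) \<le> B is"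
    by metis
  have "(1 + norm \<xi>) ^ N * cmod (F \<xi>) \<le> C * (\<Sum>is\<in>L. B is)" for \<xi>
    unfolding F
  proof (rule *[OF f])
    show "\<forall>is\<in>L. \<forall>x. (1 + norm x) ^ (CARD('d) + 2) * cmod (iter_partial is f x) \<le> (\<Sum>is\<in>L. B is)"
    proof (intro ballI allI)
      fix "is" x assume "is \<in> L"
      then have "B is \<le> (\<Sum>is\<in>L. B is)" using L B by (intro member_le_sum) auto
      then show "(1 + norm x) ^ (CARD('d) + 2) * cmod (iter_partial is f x) \<le> (\<Sum>is\<in>L. B is)"
        by (rule order_trans[OF B(2)])
    qed
  qed (simp add: B sum_nonneg)
  then show "\<exists>C. \<forall>x. (1 + norm x) ^ N * cmod (F x) \<le> C" by blast
qed (use assms in auto)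

lemma fourier_null:
  fixes \<psi> :: "nat \<Rightarrow> real ^ 'd \<Rightarrow> complex"
  assumes null: "schwartz_null \<psi>" and \<psi>: "\<And>l. \<psi> l \<in> schwartz" and "e > 0"
  shows "\<forall>\<^sub>F l in sequentially. \<forall>\<xi>. (1 + norm \<xi>) ^ N * cmod (fourier (\<psi> l) \<xi>) \<le> e"
proof -
  obtain L C where L: "finite L" "C \<ge> 0" and *: "\<And>f b \<xi>. f \<in> schwartz ==> b \<ge> 0 ==>
     \<forall>is\<in>L. \<forall>x :: real ^ 'd. (1 + norm x) ^ (CARD('d) + 2) * cmod (iter_partial is f x) \<le> b ==>
     (1 + norm \<xi>) ^ N * cmod (fourier f \<xi>) \<le> C * b"
    using fourier_decay[of N, where 'd='d] by metis
  let ?b = "e / (C + 1)"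
  have b: "?b > 0" "C * ?b \<le> e" using L \<open>e > 0\<close> by (auto simp: field_simps)
  have "\<forall>\<^sub>F l in sequentially. \<forall>is\<in>L. \<forall>x. norm ((1 + norm x) ^ (CARD('d) + 2) *\<^sub>R iter_partial is (\<psi> l) x) < ?b"
    using null b unfolding schwartz_null_def uniform_limit_zero_iff by (intro eventually_ball_finite L) blast
  then show ?thesis
  proof eventually_elim
    case (elim l)
    have "(1 + norm \<xi>) ^ N * cmod (fourier (\<psi> l) \<xi>) \<le> C * ?b" for \<xi>
      using elim b by (intro * \<psi>) (auto simp: less_imp_le)
    with b show ?case by (meson order_trans)
  qed
qed

lemma fubini_bound:
  fixes K :: "real ^ 'd \<Rightarrow> real ^ 'd \<Rightarrow> complex"
  assumes [measurable]: "(\<lambda>(x, y). K x y) \<in> borel_measurable (lborel \<Otimes>\<^sub>M lborel)"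
    and f: "integrable lborel f" and g: "integrable lborel g"
    and le: "\<And>x y. cmod (K x y) \<le> f x * g y"
  shows "(LINT x|lborel. LINT y|lborel. K x y) = (LINT y|lborel. LINT x|lborel. K x y)"
proof (rule lborel_pair.Fubini_integral[symmetric])
  have [measurable]: "f \<in> borel_measurable borel" "g \<in> borel_measurable borel"
    using f g by auto
  have "integrable (lborel \<Otimes>\<^sub>M lborel) (\<lambda>(x, y). f x * g y)"
  proof (rule lborel_pair.Fubini_integrable)
    show "integrable lborel (\<lambda>x. LINT y|lborel. norm (case (x, y) of (x, y) \<Rightarrow> f x * g y))"
      using f g by (simp add: abs_mult)
    show "AE x in lborel. integrable lborel (\<lambda>y. case (x, y) of (x, y) \<Rightarrow> f x * g y)"
      using g by simp
  qed simp
  then show "integrable (lborel \<Otimes>\<^sub>M lborel) (\<lambda>(x, y). K x y)"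
  proof (rule Bochner_Integration.integrable_bound)
    have "norm (K x y) \<le> norm (f x * g y)" for x y
      using le[of x y] abs_ge_self[of "f x * g y"] by simp
    then show "AE z in lborel \<Otimes>\<^sub>M lborel. norm (case z of (x, y) \<Rightarrow> K x y) \<le> norm (case z of (x, y) \<Rightarrow> f x * g y)"
      by auto
  qed simp
qed

lemma measurable_echar [measurable]:
  assumes [measurable]: "f \<in> borel_measurable M" "g \<in> borel_measurable M"
  shows "(\<lambda>x. echar (f x :: real ^ 'd) (g x)) \<in> borel_measurable M"
  unfolding echar_def by measurable

lemma fourier_multiplication:
  fixes f g :: "real ^ 'd \<Rightarrow> complex"
  assumes f: "f \<in> schwartz" and g: "g \<in> schwartz"
  shows "(LINT x|lborel. f x * fourier g x) = (LINT x|lborel. fourier f x * g x)"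
proof -
  have [measurable]: "f \<in> borel_measurable borel" "g \<in> borel_measurable borel"
    using f g by (auto intro: schwartz_measurable)
  have "(LINT x|lborel. f x * fourier g x) = (LINT x|lborel. LINT y|lborel. f x * (g y * echar (- x) y))"
    by (simp add: fourier_eq)
  also have "... = (LINT y|lborel. LINT x|lborel. f x * (g y * echar (- x) y))"
    by (rule fubini_bound[of _ "\<lambda>x. cmod (f x)" "\<lambda>x. cmod (g x)"])
       (auto intro!: integrable_norm schwartz_integrable f g simp: norm_mult)
  also have "... = (LINT y|lborel. LINT x|lborel. g y * (f x * echar (- y) x))"
    by (simp add: echar_def inner_commute mult_ac)
  also have "... = (LINT y|lborel. fourier f y * g y)"
    by (simp add: fourier_eq mult.commute)
  finally show ?thesis .
qed

section \<open>Convolution with a Schwartz function\<close>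

text \<open>The growth condition under which a function defines a tempered distribution and can be
  convolved with Schwartz functions; Fourier transforms of elements of Sobolev spaces of any order
  satisfy it, see \<open>sobolev_slow_integrable\<close>.\<close>

definition slow_integrable :: "(real ^ 'd \<Rightarrow> complex) \<Rightarrow> bool" where
  "slow_integrable g \<longleftrightarrow> g \<in> borel_measurable borel \<and> (\<exists>K :: nat. integrable lborel (\<lambda>x. cmod (g x) / (1 + norm x) ^ K))"

definition conv :: "(real ^ 'd \<Rightarrow> complex) \<Rightarrow> (real ^ 'd \<Rightarrow> complex) \<Rightarrow> real ^ 'd \<Rightarrow> complex" where
  "conv g \<theta> \<xi> = (LINT \<eta>|lborel. g \<eta> * \<theta> (\<xi> - \<eta>))"

lemma one_plus_norm_mult:
  fixes x y :: "'a :: real_normed_vector"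
  shows "1 + norm x \<le> (1 + norm y) * (1 + norm (y - x))"
proof -
  have "norm x \<le> norm y + norm (y - x)"
    using norm_triangle_sub[of x y] by (simp add: norm_minus_commute)
  moreover have "0 \<le> norm y * norm (y - x)" by simp
  moreover have "(1 + norm y) * (1 + norm (y - x)) = 1 + norm y + norm (y - x) + norm y * norm (y - x)"
    by (simp add: algebra_simps)
  ultimately show ?thesis by linarith
qed

lemma weight_conv:
  fixes x y :: "'a :: real_normed_vector"
  shows "1 / (1 + norm (y - x)) ^ K \<le> (1 + norm y) ^ K * (1 / (1 + norm x) ^ K)"
proof -
  have "(1 + norm x) ^ K \<le> ((1 + norm y) * (1 + norm (y - x))) ^ K"
    by (intro power_mono one_plus_norm_mult) simp
  then have "(1 + norm x) ^ K \<le> (1 + norm y) ^ K * (1 + norm (y - x)) ^ K"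
    by (simp only: power_mult_distrib)
  then show ?thesis by (simp add: divide_simps)
qed

lemma conv_integrand_bound:
  assumes "cmod (\<theta> (\<xi> - \<eta>)) \<le> C / (1 + norm (\<xi> - \<eta>)) ^ K" "C \<ge> 0"
  shows "cmod (g \<eta> * \<theta> (\<xi> - \<eta>)) \<le> C * (1 + norm \<xi>) ^ K * (cmod (g \<eta>) / (1 + norm \<eta>) ^ K)"
proof -
  have "cmod (g \<eta> * \<theta> (\<xi> - \<eta>)) \<le> cmod (g \<eta>) * (C * (1 / (1 + norm (\<xi> - \<eta>)) ^ K))"
    unfolding norm_mult using assms by (intro mult_left_mono) auto
  also have "... \<le> cmod (g \<eta>) * (C * ((1 + norm \<xi>) ^ K * (1 / (1 + norm \<eta>) ^ K)))"
    using assms by (intro mult_left_mono weight_conv) auto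
  finally show ?thesis by (simp add: mult_ac)
qed

lemma slow_integrable_conv:
  assumes g: "slow_integrable g" and \<theta>: "\<theta> \<in> schwartz"
  shows "integrable lborel (\<lambda>\<eta>. g \<eta> * \<theta> (\<xi> - \<eta>))" "\<exists>N C. \<forall>\<xi>. cmod (conv g \<theta> \<xi>) \<le> C * (1 + norm \<xi>) ^ N"
proof -
  obtain K where K: "integrable lborel (\<lambda>x. cmod (g x) / (1 + norm x) ^ K)"
    and [measurable]: "g \<in> borel_measurable borel" using g by (auto simp: slow_integrable_def)
  note [measurable] = schwartz_measurable[OF \<theta>]
  obtain C where C: "C \<ge> 0" "\<And>x. cmod (\<theta> x) \<le> C / (1 + norm x) ^ K"
    using schwartz_bound0[OF \<theta>, of K] by blast
  have le: "cmod (g \<eta> * \<theta> (\<xi> - \<eta>)) \<le> C * (1 + norm \<xi>) ^ K * (cmod (g \<eta>) / (1 + norm \<eta>) ^ K)" for \<xi> \<eta>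
    by (rule conv_integrand_bound[of \<theta> \<xi> \<eta> C K g, OF C(2) C(1)])
  show int: "integrable lborel (\<lambda>\<eta>. g \<eta> * \<theta> (\<xi> - \<eta>))" for \<xi>
  proof (rule Bochner_Integration.integrable_bound)
    show "integrable lborel (\<lambda>\<eta>. C * (1 + norm \<xi>) ^ K * (cmod (g \<eta>) / (1 + norm \<eta>) ^ K))"
      by (intro integrable_mult_right K)
    show "AE \<eta> in lborel. norm (g \<eta> * \<theta> (\<xi> - \<eta>)) \<le> norm (C * (1 + norm \<xi>) ^ K * (cmod (g \<eta>) / (1 + norm \<eta>) ^ K))"
      using le[of _ \<xi>] C by (auto simp: abs_mult)
  qed measurable
  have "cmod (conv g \<theta> \<xi>) \<le> (C * (LINT \<eta>|lborel. cmod (g \<eta>) / (1 + norm \<eta>) ^ K)) * (1 + norm \<xi>) ^ K" for \<xi>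
  proof -
    have "cmod (conv g \<theta> \<xi>) \<le> (LINT \<eta>|lborel. C * (1 + norm \<xi>) ^ K * (cmod (g \<eta>) / (1 + norm \<eta>) ^ K))"
      unfolding conv_def
    proof (rule Bochner_Integration.integral_norm_bound_integral[OF int])
      show "integrable lborel (\<lambda>\<eta>. C * (1 + norm \<xi>) ^ K * (cmod (g \<eta>) / (1 + norm \<eta>) ^ K))"
        by (intro integrable_mult_right K)
    qed (rule le)
    also have "... = C * (1 + norm \<xi>) ^ K * (LINT \<eta>|lborel. cmod (g \<eta>) / (1 + norm \<eta>) ^ K)"
      by (rule integral_mult_right_zero)
    finally show ?thesis by (simp only: mult_ac)
  qed
  then show "\<exists>N C. \<forall>\<xi>. cmod (conv g \<theta> \<xi>) \<le> C * (1 + norm \<xi>) ^ N" by blast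
qed

lemma has_derivative_conv:
  assumes g: "slow_integrable g" and \<theta>: "\<theta> \<in> schwartz"
  shows "(conv g \<theta> has_derivative (\<lambda>h. \<Sum>i\<in>UNIV. h $ i *\<^sub>R conv g (partial_deriv i \<theta>) \<xi>)) (at \<xi>)"
proof -
  obtain K where K: "integrable lborel (\<lambda>x. cmod (g x) / (1 + norm x) ^ K)"
    and [measurable]: "g \<in> borel_measurable borel" using g by (auto simp: slow_integrable_def)
  obtain C where C: "C \<ge> 0" "\<And>x h. norm h \<le> 1 ==>
    cmod (\<theta> (x + h) - \<theta> x - (\<Sum>i\<in>UNIV. h $ i *\<^sub>R partial_deriv i \<theta> x)) \<le> (norm h)^2 * (C / (1 + norm x) ^ K)"
    using schwartz_second_order[OF \<theta>, of K] by blast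
  show ?thesis
    unfolding conv_def[abs_def]
  proof (rule has_derivative_parameter_integral)
  show "integrable lborel (\<lambda>\<eta>. g \<eta> * \<theta> (\<xi> - \<eta>))" for \<xi>
    by (rule slow_integrable_conv[OF g \<theta>])
  show "integrable lborel (\<lambda>\<eta>. g \<eta> * partial_deriv i \<theta> (\<xi> - \<eta>))" for i
    by (rule slow_integrable_conv[OF g schwartz_partial_deriv[OF \<theta>]])
  show "integrable lborel (\<lambda>\<eta>. C * (1 + norm \<xi>) ^ K * (cmod (g \<eta>) / (1 + norm \<eta>) ^ K))"
    by (intro integrable_mult_right K)
  fix h \<eta> :: "real ^ 'a" assume h: "norm h \<le> 1"
  let ?x = "\<xi> - \<eta>"
  have "g \<eta> * \<theta> (\<xi> + h - \<eta>) - g \<eta> * \<theta> ?x - (\<Sum>i\<in>UNIV. h $ i *\<^sub>R (g \<eta> * partial_deriv i \<theta> ?x))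
     = g \<eta> * (\<theta> (?x + h) - \<theta> ?x - (\<Sum>i\<in>UNIV. h $ i *\<^sub>R partial_deriv i \<theta> ?x))"
    by (simp add: algebra_simps sum_distrib_left)
  also have "cmod ... \<le> cmod (g \<eta>) * ((norm h)^2 * (C * (1 / (1 + norm ?x) ^ K)))"
    unfolding norm_mult using C(2)[OF h, of ?x] by (intro mult_left_mono) auto
  also have "... \<le> cmod (g \<eta>) * ((norm h)^2 * (C * ((1 + norm \<xi>) ^ K * (1 / (1 + norm \<eta>) ^ K))))"
    using C(1) by (intro mult_left_mono weight_conv) auto
  finally show "cmod (g \<eta> * \<theta> (\<xi> + h - \<eta>) - g \<eta> * \<theta> ?x - (\<Sum>i\<in>UNIV. h $ i *\<^sub>R (g \<eta> * partial_deriv i \<theta> ?x)))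
     \<le> (norm h)^2 * (C * (1 + norm \<xi>) ^ K * (cmod (g \<eta>) / (1 + norm \<eta>) ^ K))"
    by (simp add: mult_ac)
  qed
qed

text \<open>All derivatives fall on \<theta>, so a merely measurable \<open>g\<close> becomes
  smooth. This is the source of the smoothness of the Fourier transforms of compactly supported
  distributions.\<close>

lemma conv_slow:
  assumes g: "slow_integrable g" and \<theta>: "\<theta> \<in> schwartz"
  shows "conv g \<theta> \<in> slow_fun"
proof (rule slow_coinduct[where X="conv g ` schwartz"])
  fix F assume "F \<in> conv g ` schwartz"
  then obtain \<theta> where \<theta>: "\<theta> \<in> schwartz" and F: "F = conv g \<theta>" by auto
  show "F differentiable (at x)" for x
    unfolding F using has_derivative_conv[OF g \<theta>] differentiable_def by blast
  show "partial_deriv i F \<in> conv g ` schwartz" for i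
  proof (rule image_eqI)
    show "partial_deriv i F = conv g (partial_deriv i \<theta>)"
      unfolding F by (rule ext, subst partial_deriv_eq[OF has_derivative_conv[OF g \<theta>]])
        (use sum_axis[of 1] in simp)
  qed (rule schwartz_partial_deriv[OF \<theta>])
  show "\<exists>N C. \<forall>x. cmod (F x) \<le> C * (1 + norm x) ^ N"
    unfolding F by (rule slow_integrable_conv[OF g \<theta>])
qed (use \<theta> in auto)

lemma conv_duality:
  assumes g: "slow_integrable g" and \<theta>: "\<theta> \<in> schwartz" and \<psi>: "\<psi> \<in> schwartz"
  shows "(LINT y|lborel. g y * (LINT z|lborel. \<psi> z * \<theta> (z - y))) = (LINT z|lborel. conv g \<theta> z * \<psi> z)"
proof -
  obtain K where K: "integrable lborel (\<lambda>x. cmod (g x) / (1 + norm x) ^ K)"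
    and [measurable]: "g \<in> borel_measurable borel" using g by (auto simp: slow_integrable_def)
  note [measurable] = schwartz_measurable[OF \<theta>] schwartz_measurable[OF \<psi>]
  obtain C where C: "C \<ge> 0" "\<And>x. cmod (\<theta> x) \<le> C / (1 + norm x) ^ K"
    using schwartz_bound0[OF \<theta>, of K] by blast
  have "(LINT y|lborel. g y * (LINT z|lborel. \<psi> z * \<theta> (z - y)))
     = (LINT y|lborel. LINT z|lborel. g y * (\<psi> z * \<theta> (z - y)))"
    by simp
  also have "... = (LINT z|lborel. LINT y|lborel. g y * (\<psi> z * \<theta> (z - y)))"
  proof (rule fubini_bound[OF _ K])
    show "integrable lborel (\<lambda>z. cmod (\<psi> z * of_real (C * (1 + norm z) ^ K)))"
      by (intro integrable_norm schwartz_integrable_bound(1)[OF \<psi>, of _ C K])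
         (use C in \<open>auto simp: abs_mult simp del: of_real_mult of_real_power of_real_add\<close>)
    fix y z
    have "cmod (g y * (\<psi> z * \<theta> (z - y))) = cmod (\<psi> z) * cmod (g y * \<theta> (z - y))"
      by (simp add: norm_mult)
    also have "... \<le> cmod (\<psi> z) * (C * (1 + norm z) ^ K * (cmod (g y) / (1 + norm y) ^ K))"
      by (intro mult_left_mono conv_integrand_bound C) simp
    also have "... = cmod (g y) / (1 + norm y) ^ K * cmod (\<psi> z * of_real (C * (1 + norm z) ^ K))"
      using C(1) by (simp add: norm_mult abs_mult mult_ac del: of_real_mult of_real_power)
    finally show "cmod (g y * (\<psi> z * \<theta> (z - y))) \<le> cmod (g y) / (1 + norm y) ^ K * cmod (\<psi> z * of_real (C * (1 + norm z) ^ K))" .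
  qed measurable
  also have "... = (LINT z|lborel. LINT y|lborel. \<psi> z * (g y * \<theta> (z - y)))"
    by (simp add: mult_ac)
  also have "... = (LINT z|lborel. conv g \<theta> z * \<psi> z)"
    by (simp add: conv_def mult.commute)
  finally show ?thesis .
qed

text \<open>Boxes form a generator closed under intersections, so the sets over which the integral
  vanishes exhaust the Borel sets; the assumption on the total integral handles complements.\<close>

lemma integral_boxes_zero:
  fixes k :: "real ^ 'd \<Rightarrow> complex"
  assumes k: "integrable lborel k" and tot: "(LINT x|lborel. k x) = 0"
    and box: "\<And>a b. (LINT x|lborel. indicator (box a b) x *\<^sub>R k x) = 0"
  shows "AE x in lborel. k x = 0"
proof (rule sigma_finite_measure.density_zero[OF lborel.sigma_finite_measure_axioms k])
  fix A :: "(real ^ 'd) set" assume "A \<in> sets lborel"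
  then have A: "A \<in> sigma_sets UNIV (range (\<lambda>(a, b). box a b))"
    by (simp add: borel_eq_box)
  have "Int_stable (range (\<lambda>(a, b). box a b :: (real ^ 'd) set))"
    by (auto simp: Int_stable_def box_Int_box)
  moreover have "range (\<lambda>(a, b). box a b :: (real ^ 'd) set) \<subseteq> Pow UNIV" by simp
  ultimately have "A \<in> sets borel \<and> (LINT x|lborel. indicator A x *\<^sub>R k x) = 0"
    using A
  proof (induction rule: sigma_sets_induct_disjoint)
    case (basic A) then show ?case using box by auto
  next
    case empty then show ?case by simp
  next
    case (compl A)
    have "integrable lborel (\<lambda>x. indicator A x *\<^sub>R k x)"
      using k compl by (intro integrable_mult_indicator) auto
    moreover have "indicator (UNIV - A) x *\<^sub>R k x = k x - indicator A x *\<^sub>R k x" for x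
      by (simp add: indicator_def)
    ultimately show ?case using compl k tot by auto
  next
    case (union A)
    then have A: "A i \<in> sets lborel" for i by auto
    have "set_integrable lborel (\<Union>i. A i) k"
      unfolding set_integrable_def using k A by (intro integrable_mult_indicator sets.countable_UN) auto
    with lebesgue_integral_countable_add[of A lborel k] A union
    have "set_lebesgue_integral lborel (\<Union>i. A i) k = (\<Sum>i. set_lebesgue_integral lborel (A i) k)"
      by (auto simp: disjoint_family_on_def)
    then show ?case using union A by (auto simp: set_lebesgue_integral_def)
  qed
  then show "set_lebesgue_integral lborel A k = 0"
    by (simp add: set_lebesgue_integral_def)
qed

lemma box_cutoff_limit: "(\<lambda>m. box_cutoff (real (Suc m)) a b x) \<longlonglongrightarrow> indicator (box a b) (x :: real ^ 'd)"
proof (cases "x \<in> box a b")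
  case False
  then show ?thesis by (simp add: box_cutoff_0)
next
  case True
  have "\<forall>\<^sub>F m in sequentially. \<forall>i. real (Suc m) * (x $ i - a $ i) \<ge> 1 \<and> real (Suc m) * (b $ i - x $ i) \<ge> 1"
  proof (intro eventually_all_finite eventually_conj)
    fix i
    have "0 < x $ i - a $ i" "0 < b $ i - x $ i" using True by (auto simp: mem_box_cart)
    then have *: "filterlim (\<lambda>m. real (Suc m) * (x $ i - a $ i)) at_top sequentially"
      "filterlim (\<lambda>m. real (Suc m) * (b $ i - x $ i)) at_top sequentially"
      by real_asymp+
    show "\<forall>\<^sub>F m in sequentially. real (Suc m) * (x $ i - a $ i) \<ge> 1"
      using *(1) unfolding filterlim_at_top by blast
    show "\<forall>\<^sub>F m in sequentially. real (Suc m) * (b $ i - x $ i) \<ge> 1"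
      using *(2) unfolding filterlim_at_top by blast
  qed
  then have "\<forall>\<^sub>F m in sequentially. box_cutoff (real (Suc m)) a b x = indicator (box a b) x"
  proof eventually_elim
    case (elim m)
    then show ?case using True by (subst box_cutoff_1) auto
  qed
  then show ?thesis by (rule tendsto_eventually)
qed

text \<open>A cutoff \<open>u\<close> makes \<open>h\<close> integrable without changing it on a
  given ball. Products of \<open>u\<close> with box cutoffs are test functions, and dominated
  convergence passes from them to the indicators of boxes.\<close>

lemma schwartz_separates:
  fixes h :: "real ^ 'd \<Rightarrow> complex"
  assumes [measurable]: "h \<in> borel_measurable borel"
    and int: "\<And>\<psi>. \<psi> \<in> schwartz ==> integrable lborel (\<lambda>x. h x * \<psi> x)"
    and zero: "\<And>\<psi>. \<psi> \<in> schwartz ==> (LINT x|lborel. h x * \<psi> x) = 0"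
  shows "AE x in lborel. h x = 0"
proof -
  have *: "AE x in lborel. norm x \<le> real R \<longrightarrow> h x = 0" for R :: nat
  proof -
    have "real R + 1 > 0" by simp
    then obtain u :: "real ^ 'd \<Rightarrow> complex" and R' where u: "u \<in> schwartz" "\<And>x. norm x \<le> real R + 1 ==> u x = 1"
      "\<And>x. norm x \<ge> R' ==> u x = 0" "\<And>x. cmod (u x) \<le> 1"
      by (rule cutoff_exists) blast
    note [measurable] = schwartz_measurable[OF u(1)]
    have "AE x in lborel. h x * u x = 0"
    proof (rule integral_boxes_zero[OF int[OF u(1)] zero[OF u(1)]])
      fix a b :: "real ^ 'd"
      let ?c = "\<lambda>m x. box_cutoff (real (Suc m)) a b x"
      have cS: "(\<lambda>x. complex_of_real (?c m x)) \<in> schwartz" for m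
        by (rule box_cutoff_schwartz) simp
      have cm: "(\<lambda>x. complex_of_real (?c m x) * (h x * u x)) \<in> borel_measurable lborel" for m
        unfolding measurable_lborel2 by (intro borel_measurable_times schwartz_measurable cS u(1) assms(1))
      have "(\<lambda>m. LINT x|lborel. complex_of_real (?c m x) * (h x * u x)) \<longlonglongrightarrow>
        (LINT x|lborel. indicator (box a b) x *\<^sub>R (h x * u x))"
      proof (rule integral_dominated_convergence[where w="\<lambda>x. norm (h x * u x)"])
        show "AE x in lborel. (\<lambda>m. complex_of_real (?c m x) * (h x * u x)) \<longlonglongrightarrow> indicator (box a b) x *\<^sub>R (h x * u x)"
          unfolding scaleR_conv_of_real
          by (intro AE_I2 tendsto_mult tendsto_of_real box_cutoff_limit tendsto_const)
        show "AE x in lborel. norm (complex_of_real (?c m x) * (h x * u x)) \<le> norm (h x * u x)" for m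
        proof (rule AE_I2)
          fix x
          show "norm (complex_of_real (?c m x) * (h x * u x)) \<le> norm (h x * u x)"
            unfolding norm_mult[of "complex_of_real (?c m x)"] norm_of_real
            using box_cutoff_range[of "real (Suc m)" a b x] by (intro mult_left_le_one_le) auto
        qed
        show "integrable lborel (\<lambda>x. norm (h x * u x))" by (intro integrable_norm int u(1))
      qed (rule cm | use int[OF u(1)] in simp)+
      moreover have "(LINT x|lborel. complex_of_real (?c m x) * (h x * u x)) = 0" for m
        using zero[OF schwartz_mult_slow[OF cS schwartz_slow[OF u(1)]], of m] by (simp add: mult_ac)
      ultimately show "(LINT x|lborel. indicator (box a b) x *\<^sub>R (h x * u x)) = 0"
        by (simp add: LIMSEQ_const_iff)
    qed
    then show ?thesis by eventually_elim (use u in auto)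
  qed
  have "AE x in lborel. \<forall>R. norm x \<le> real R \<longrightarrow> h x = 0"
    unfolding AE_all_countable using * by blast
  then show ?thesis by eventually_elim (meson real_arch_simple)
qed

section \<open>Tiling of \<open>\<real>\<^sup>d\<close> by unit cubes\<close>

text \<open>Half-open, so that every point has exactly one lattice translate in it, and centred, so
  that it is a neighbourhood of the origin.\<close>

definition unit_cube :: "(real ^ 'd) set" where
  "unit_cube = {x. \<forall>i. - 1 / 2 \<le> x $ i \<and> x $ i < 1 / 2}"

lemma unit_cube_ex1: "\<exists>!k. x + real_vec k \<in> unit_cube"
proof
  let ?k = "\<chi> i. - \<lfloor>x $ i + 1 / 2\<rfloor>"
  have "- 1 / 2 \<le> x $ i - \<lfloor>x $ i + 1 / 2\<rfloor> \<and> x $ i - \<lfloor>x $ i + 1 / 2\<rfloor> < 1 / 2" for i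
    by linarith
  then show "x + real_vec ?k \<in> unit_cube"
    by (simp add: unit_cube_def real_vec_def)
  fix k assume k: "x + real_vec k \<in> unit_cube"
  have "k $ i = - \<lfloor>x $ i + 1 / 2\<rfloor>" for i
  proof -
    have "- 1 / 2 \<le> x $ i + real_of_int (k $ i)" "x $ i + real_of_int (k $ i) < 1 / 2"
      using k by (auto simp: unit_cube_def real_vec_def)
    then have "\<lfloor>x $ i + 1 / 2\<rfloor> = - k $ i" by (simp add: floor_unique)
    then show ?thesis by simp
  qed
  then show "k = ?k" by (simp add: vec_eq_iff)
qed

lemma real_vec_minus: "real_vec (- k) = - real_vec k"
  by (simp add: real_vec_def vec_eq_iff)

lemma real_vec_add: "real_vec (k + l) = real_vec k + real_vec l"
  by (simp add: real_vec_def vec_eq_iff)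

lemma real_vec_0 [simp]: "real_vec 0 = 0"
  by (simp add: real_vec_def vec_eq_iff)

lemma unit_cube_borel [measurable]: "unit_cube \<in> sets borel"
proof -
  have "unit_cube = (\<Inter>i\<in>UNIV. {x :: real ^ 'd. - 1 / 2 \<le> x $ i} \<inter> {x. x $ i < 1 / 2})"
    by (auto simp: unit_cube_def)
  also have "... \<in> sets borel"
    by (intro sets.finite_INT sets.Int borel_closed borel_open closed_halfspace_component_ge_cart
       open_halfspace_component_lt_cart) auto
  finally show ?thesis .
qed

lemma emeasure_unit_cube [simp]: "emeasure lborel (unit_cube :: (real ^ 'd) set) = 1"
proof -
  let ?a = "\<chi> i. 1 / 2 :: real ^ 'd"
  have "box (- ?a) ?a \<subseteq> unit_cube" "unit_cube \<subseteq> cbox (- ?a) ?a"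
    by (auto simp: unit_cube_def mem_box_cart less_imp_le)
  then have le: "emeasure lborel (box (- ?a) ?a) \<le> emeasure lborel (unit_cube :: (real ^ 'd) set)"
    "emeasure lborel (unit_cube :: (real ^ 'd) set) \<le> emeasure lborel (cbox (- ?a) ?a)"
    by (auto intro!: emeasure_mono)
  have B: "(?a - - ?a) \<bullet> b = 1" "(- ?a) \<bullet> b \<le> ?a \<bullet> b" if "b \<in> Basis" for b :: "real ^ 'd"
    using that by (auto simp: Basis_vec_def inner_axis)
  have "emeasure lborel (box (- ?a) ?a) = 1" "emeasure lborel (cbox (- ?a) ?a) = 1"
    using B by (simp_all add: emeasure_lborel_box emeasure_lborel_cbox del: inner_minus_left)
  with le show ?thesis by (simp add: antisym)
qed

lemma nn_integral_count_unique:
  assumes "\<exists>!k. P k"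
  shows "(\<integral>\<^sup>+k. indicator {k. P k} k \<partial>count_space UNIV) = 1"
proof -
  obtain k where "{k. P k} = {k}" using assms by auto
  then show ?thesis by simp
qed

lemma nn_integral_indicator_cube:
  "(\<integral>\<^sup>+k. indicator unit_cube (x + real_vec k) \<partial>count_space UNIV) = (1 :: ennreal)"
  using nn_integral_count_unique[OF unit_cube_ex1[of x]] by (simp add: indicator_def)

lemma nn_integral_indicator_cube':
  "(\<integral>\<^sup>+k. indicator unit_cube (x - real_vec k) \<partial>count_space UNIV) = (1 :: ennreal)"
proof -
  have "\<exists>!k. x - real_vec k \<in> unit_cube"
    using unit_cube_ex1[of x] by (metis (no_types, lifting) add_uminus_conv_diff diff_minus_eq_add minus_minus real_vec_minus)
  from nn_integral_count_unique[OF this] show ?thesis by (simp add: indicator_def)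
qed

lemma borel_measurable_nn_integral_count:
  fixes f :: "'k :: countable \<Rightarrow> 'a \<Rightarrow> ennreal"
  assumes [measurable]: "\<And>k. f k \<in> borel_measurable M"
  shows "(\<lambda>x. \<integral>\<^sup>+k. f k x \<partial>count_space UNIV) \<in> borel_measurable M"
proof -
  interpret C: sigma_finite_measure "count_space (UNIV :: 'k set)"
    by (rule sigma_finite_measure_count_space_countable) simp
  have "(\<lambda>(k, x). f k x) \<in> borel_measurable (count_space UNIV \<Otimes>\<^sub>M M)"
    by (rule measurable_pair_measure_countable1) auto
  then have "(\<lambda>(x, k). f k x) \<in> borel_measurable (M \<Otimes>\<^sub>M count_space UNIV)"
    by (subst measurable_pair_swap_iff) (simp add: case_prod_unfold)
  then show ?thesis by (rule C.borel_measurable_nn_integral)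
qed

text \<open>The indicators of all lattice translates of the cube sum to 1; the rest is an
  interchange of sum and integral and a translation in each term.\<close>

lemma nn_integral_tile:
  fixes f :: "real ^ 'd \<Rightarrow> ennreal"
  assumes [measurable]: "f \<in> borel_measurable borel"
  shows "(\<integral>\<^sup>+x. f x \<partial>lborel) =
    (\<integral>\<^sup>+t. indicator unit_cube t * (\<integral>\<^sup>+k. f (t + real_vec k) \<partial>count_space UNIV) \<partial>lborel)"
proof -
  have "(\<integral>\<^sup>+t. indicator unit_cube t * (\<integral>\<^sup>+k. f (t + real_vec k) \<partial>count_space UNIV) \<partial>lborel)
    = (\<integral>\<^sup>+t. (\<integral>\<^sup>+k. indicator unit_cube t * f (t + real_vec k) \<partial>count_space UNIV) \<partial>lborel)"
    by (simp add: nn_integral_cmult)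
  also have "... = (\<integral>\<^sup>+k. (\<integral>\<^sup>+t. indicator unit_cube t * f (t + real_vec k) \<partial>lborel) \<partial>count_space UNIV)"
    by (rule nn_integral_count_space_nn_integral) auto
  also have "... = (\<integral>\<^sup>+k. (\<integral>\<^sup>+t. indicator unit_cube (t - real_vec k) * f t \<partial>lborel) \<partial>count_space UNIV)"
  proof (rule nn_integral_cong)
    fix k
    show "(\<integral>\<^sup>+t. indicator unit_cube t * f (t + real_vec k) \<partial>lborel) = (\<integral>\<^sup>+t. indicator unit_cube (t - real_vec k) * f t \<partial>lborel)"
      using nn_integral_shift[of "\<lambda>t. indicator unit_cube (t - real_vec k) * f t" "real_vec k"] by simp
  qed
  also have "... = (\<integral>\<^sup>+t. (\<integral>\<^sup>+k. indicator unit_cube (t - real_vec k) * f t \<partial>count_space UNIV) \<partial>lborel)"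
    by (rule nn_integral_count_space_nn_integral[symmetric]) auto
  also have "... = (\<integral>\<^sup>+t. f t \<partial>lborel)"
    by (simp add: nn_integral_multc nn_integral_indicator_cube')
  finally show ?thesis ..
qed

text \<open>Lattice sums are written as integrals against the counting measure, so that their
  interchange with integrals is an instance of Fubini.\<close>

lemma integral_count_swap:
  fixes K :: "'k :: countable \<Rightarrow> real ^ 'd \<Rightarrow> 'b :: {banach, second_countable_topology}"
  assumes [measurable]: "\<And>k. K k \<in> borel_measurable borel"
    and fin: "(\<integral>\<^sup>+x. \<integral>\<^sup>+k. ennreal (norm (K k x)) \<partial>count_space UNIV \<partial>lborel) < \<infinity>"
  shows "(LINT x|lborel. LINT k|count_space UNIV. K k x) = (LINT k|count_space UNIV. LINT x|lborel. K k x)"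
    and "integrable lborel (\<lambda>x. LINT k|count_space UNIV. K k x)"
proof -
  interpret C: sigma_finite_measure "count_space (UNIV :: 'k set)"
    by (rule sigma_finite_measure_count_space_countable) simp
  interpret P: pair_sigma_finite "count_space (UNIV :: 'k set)" "lborel :: (real ^ 'd) measure" ..
  have meas [measurable]: "(\<lambda>(k, x). K k x) \<in> borel_measurable (count_space UNIV \<Otimes>\<^sub>M lborel)"
    by (rule measurable_pair_measure_countable1) auto
  have int: "integrable (count_space UNIV \<Otimes>\<^sub>M lborel) (\<lambda>(k, x). K k x)"
  proof (rule integrableI_bounded)
    have "(\<integral>\<^sup>+z. ennreal (norm (case z of (k, x) \<Rightarrow> K k x)) \<partial>(count_space UNIV \<Otimes>\<^sub>M lborel))
      = (\<integral>\<^sup>+k. \<integral>\<^sup>+x. ennreal (norm (K k x)) \<partial>lborel \<partial>count_space UNIV)"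
      by (subst lborel.nn_integral_fst[symmetric]) (auto simp: case_prod_unfold)
    also have "... = (\<integral>\<^sup>+x. \<integral>\<^sup>+k. ennreal (norm (K k x)) \<partial>count_space UNIV \<partial>lborel)"
      by (rule nn_integral_count_space_nn_integral[symmetric]) auto
    finally show "(\<integral>\<^sup>+z. ennreal (norm (case z of (k, x) \<Rightarrow> K k x)) \<partial>(count_space UNIV \<Otimes>\<^sub>M lborel)) < \<infinity>"
      using fin by simp
  qed (rule meas)
  show "(LINT x|lborel. LINT k|count_space UNIV. K k x) = (LINT k|count_space UNIV. LINT x|lborel. K k x)"
    by (rule P.Fubini_integral[OF int])
  show "integrable lborel (\<lambda>x. LINT k|count_space UNIV. K k x)"
    by (rule P.integrable_snd[OF int])
qed

lemma integral_tile:
  fixes f :: "real ^ 'd \<Rightarrow> 'b :: {banach, second_countable_topology}"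
  assumes f: "integrable lborel f"
  shows "(LINT x|lborel. f x) = (LINT t|lborel. indicator unit_cube t *\<^sub>R (LINT k|count_space UNIV. f (t + real_vec k)))"
proof -
  have [measurable]: "f \<in> borel_measurable borel" using f by auto
  have "(\<integral>\<^sup>+t. \<integral>\<^sup>+k. ennreal (norm (indicator unit_cube t *\<^sub>R f (t + real_vec k))) \<partial>count_space UNIV \<partial>lborel)
    = (\<integral>\<^sup>+t. indicator unit_cube t * (\<integral>\<^sup>+k. ennreal (norm (f (t + real_vec k))) \<partial>count_space UNIV) \<partial>lborel)"
    by (intro nn_integral_cong) (auto simp: indicator_def)
  also have "... = (\<integral>\<^sup>+x. ennreal (norm (f x)) \<partial>lborel)"
    by (rule nn_integral_tile[symmetric]) auto
  also have "... < \<infinity>" using f by (simp add: integrable_iff_bounded)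
  finally have 1: "(\<integral>\<^sup>+t. \<integral>\<^sup>+k. ennreal (norm (indicator unit_cube t *\<^sub>R f (t + real_vec k))) \<partial>count_space UNIV \<partial>lborel) < \<infinity>" .
  have "(\<integral>\<^sup>+x. \<integral>\<^sup>+k. ennreal (norm (indicator unit_cube (x - real_vec k) *\<^sub>R f x)) \<partial>count_space UNIV \<partial>lborel)
    = (\<integral>\<^sup>+x. (\<integral>\<^sup>+k. indicator unit_cube (x - real_vec k) \<partial>count_space UNIV) * ennreal (norm (f x)) \<partial>lborel)"
    by (subst nn_integral_multc[symmetric]) (auto intro!: nn_integral_cong simp: indicator_def)
  also have "... = (\<integral>\<^sup>+x. ennreal (norm (f x)) \<partial>lborel)"
    by (simp add: nn_integral_indicator_cube')
  also have "... < \<infinity>" using f by (simp add: integrable_iff_bounded)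
  finally have 2: "(\<integral>\<^sup>+x. \<integral>\<^sup>+k. ennreal (norm (indicator unit_cube (x - real_vec k) *\<^sub>R f x)) \<partial>count_space UNIV \<partial>lborel) < \<infinity>" .
  have one: "(LINT k|count_space UNIV. indicator unit_cube (x - real_vec k) *\<^sub>R f x) = f x" for x
  proof -
    have "(LINT k|count_space UNIV. indicat_real unit_cube (x - real_vec k)) = 1"
      using nn_integral_indicator_cube'[of x]
      by (intro integral_eq_nn_integral[THEN trans]) (auto simp: ennreal_indicator)
    moreover have "integrable (count_space UNIV) (\<lambda>k. indicat_real unit_cube (x - real_vec k))"
      using nn_integral_indicator_cube'[of x]
      by (intro integrableI_bounded) (auto simp: ennreal_indicator)
    ultimately show ?thesis by (simp add: integral_scaleR_left)
  qed
  have "(LINT t|lborel. indicator unit_cube t *\<^sub>R (LINT k|count_space UNIV. f (t + real_vec k)))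
     = (LINT t|lborel. LINT k|count_space UNIV. indicator unit_cube t *\<^sub>R f (t + real_vec k))"
    by simp
  also have "... = (LINT k|count_space UNIV. LINT t|lborel. indicator unit_cube t *\<^sub>R f (t + real_vec k))"
    by (rule integral_count_swap(1)[OF _ 1]) auto
  also have "... = (LINT k|count_space UNIV. LINT t|lborel. indicator unit_cube (t - real_vec k) *\<^sub>R f t)"
  proof (rule Bochner_Integration.integral_cong[OF refl])
    fix k
    show "(LINT t|lborel. indicator unit_cube t *\<^sub>R f (t + real_vec k)) = (LINT t|lborel. indicator unit_cube (t - real_vec k) *\<^sub>R f t)"
      using integral_shift(1)[of "\<lambda>t. indicator unit_cube (t - real_vec k) *\<^sub>R f t" "real_vec k"] by simp
  qed
  also have "... = (LINT t|lborel. LINT k|count_space UNIV. indicator unit_cube (t - real_vec k) *\<^sub>R f t)"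
    by (rule integral_count_swap(1)[OF _ 2, symmetric]) auto
  also have "... = (LINT t|lborel. f t)" by (simp only: one)
  finally show ?thesis ..
qed

lemma norm_unit_cube: "t \<in> unit_cube ==> norm t \<le> real CARD('d)" for t :: "real ^ 'd"
proof -
  assume "t \<in> unit_cube"
  then have "\<bar>t $ i\<bar> \<le> 1" for i
    unfolding unit_cube_def mem_Collect_eq by (auto simp: abs_le_iff dest!: spec[of _ i])
  then have "(\<Sum>i\<in>UNIV. \<bar>t $ i\<bar>) \<le> (\<Sum>i\<in>(UNIV::'d set). 1)"
    by (intro sum_mono) auto
  with norm_le_l1_cart[of t] show ?thesis by simp
qed

text \<open>Moving the argument by a point of the unit cube changes the weight by at most a constant
  factor. Hence each term is at most a constant times an average over a translated cube, and the
  averages add up to the integral over the whole space, whatever \<open>t\<close> is.\<close>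

lemma lattice_weight_bound:
  obtains W where "W \<ge> 0" "\<And>t :: real ^ 'd.
    (\<integral>\<^sup>+k. ennreal (1 / (1 + norm (t + real_vec k)) ^ (CARD('d) + 2)) \<partial>count_space UNIV) \<le> ennreal W"
proof -
  let ?N = "CARD('d) + 2" and ?c = "(1 + real CARD('d)) ^ (CARD('d) + 2)"
  define w where "w x = 1 / (1 + norm x) ^ ?N" for x :: "real ^ 'd"
  have w0: "w x \<ge> 0" for x by (simp add: w_def)
  have [measurable]: "w \<in> borel_measurable borel" unfolding w_def by measurable
  have intw: "integrable lborel w" unfolding w_def by (rule integrable_weight)
  let ?I = "LINT x|lborel. w x"
  have "(\<integral>\<^sup>+k. ennreal (w (t + real_vec k)) \<partial>count_space UNIV) \<le> ennreal (?c * ?I)" for t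
  proof -
    have le: "w (t + real_vec k) \<le> ?c * w (t + y + real_vec k)" if "y \<in> unit_cube" for y k
    proof -
      have "1 / (1 + norm ((y + (t + real_vec k)) - y)) ^ ?N \<le> (1 + norm y) ^ ?N * (1 / (1 + norm (y + (t + real_vec k))) ^ ?N)"
        using weight_conv[where y=y and x="y + (t + real_vec k)" and K="?N"] by (simp only: norm_minus_commute)
      also have "... \<le> ?c * (1 / (1 + norm (y + (t + real_vec k))) ^ ?N)"
        using norm_unit_cube[OF that] by (intro mult_right_mono power_mono) auto
      finally show ?thesis by (simp add: w_def add_ac del: power_add power_Suc)
    qed
    have "(\<integral>\<^sup>+k. ennreal (w (t + real_vec k)) \<partial>count_space UNIV) =
      (\<integral>\<^sup>+y. (\<integral>\<^sup>+k. ennreal (w (t + real_vec k)) \<partial>count_space UNIV) * indicator unit_cube (y :: real ^ 'd) \<partial>lborel)"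
      by (simp add: nn_integral_cmult_indicator)
    also have "... \<le> (\<integral>\<^sup>+y. ennreal ?c * (indicator unit_cube y * (\<integral>\<^sup>+k. ennreal (w (t + (y + real_vec k))) \<partial>count_space UNIV)) \<partial>lborel)"
    proof (rule nn_integral_mono)
      fix y :: "real ^ 'd"
      show "(\<integral>\<^sup>+k. ennreal (w (t + real_vec k)) \<partial>count_space UNIV) * indicator unit_cube y
        \<le> ennreal ?c * (indicator unit_cube y * (\<integral>\<^sup>+k. ennreal (w (t + (y + real_vec k))) \<partial>count_space UNIV))"
      proof (cases "y \<in> unit_cube")
        case True
        have "(\<integral>\<^sup>+k. ennreal (w (t + real_vec k)) \<partial>count_space UNIV) \<le> (\<integral>\<^sup>+k. ennreal ?c * ennreal (w (t + (y + real_vec k))) \<partial>count_space UNIV)"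
        proof (rule nn_integral_mono)
          fix k
          show "ennreal (w (t + real_vec k)) \<le> ennreal ?c * ennreal (w (t + (y + real_vec k)))"
            using ennreal_leI[OF le[OF True, of k]] w0 by (simp add: ennreal_mult' add.assoc del: power_add power_Suc)
        qed
        then show ?thesis using True by (simp add: nn_integral_cmult del: power_add power_Suc)
      qed simp
    qed
    also have "... = ennreal ?c * (\<integral>\<^sup>+y. (indicator unit_cube y * (\<integral>\<^sup>+k. ennreal (w (t + (y + real_vec k))) \<partial>count_space UNIV)) \<partial>lborel)"
    proof (rule nn_integral_cmult)
      have "(\<lambda>y. \<integral>\<^sup>+k. ennreal (w (t + (y + real_vec k))) \<partial>count_space UNIV) \<in> borel_measurable borel"
        by (rule borel_measurable_nn_integral_count) auto
      then show "(\<lambda>y. indicator unit_cube y * (\<integral>\<^sup>+k. ennreal (w (t + (y + real_vec k))) \<partial>count_space UNIV)) \<in> borel_measurable lborel"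
        by simp
    qed
    also have "(\<integral>\<^sup>+y. (indicator unit_cube y * (\<integral>\<^sup>+k. ennreal (w (t + (y + real_vec k))) \<partial>count_space UNIV)) \<partial>lborel)
       = (\<integral>\<^sup>+y. ennreal (w (t + y)) \<partial>lborel)"
      by (rule nn_integral_tile[symmetric]) auto
    also have "... = (\<integral>\<^sup>+y. ennreal (w y) \<partial>lborel)"
      using nn_integral_shift[of "\<lambda>y. ennreal (w y)" t] by (simp add: add.commute)
    also have "... = ennreal ?I"
      using intw w0 by (intro nn_integral_eq_integral) auto
    also have "ennreal ?c * ennreal ?I = ennreal (?c * ?I)"
      using w0 by (intro ennreal_mult[symmetric] integral_nonneg) auto
    finally show ?thesis .
  qed
  then show ?thesis
    by (intro that[of "?c * ?I"]) (auto simp: w_def intro!: mult_nonneg_nonneg integral_nonneg)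
qed

section \<open>Poisson summation and Fourier inversion\<close>

lemma echar_lattice [simp]: "echar (real_vec k) (real_vec l) = 1"
proof -
  have "real_vec l \<bullet> real_vec k = real_of_int (\<Sum>i\<in>UNIV. l $ i * k $ i)"
    by (simp add: inner_vec_def real_vec_def)
  then show ?thesis
    unfolding echar_cis by (metis Ints_of_int cis_multiple_2pi)
qed

lemma echar_shift_lattice: "echar (real_vec k) (x + real_vec l) = echar (real_vec k) x"
  by (simp add: echar_add)

lemma integrable_count_weight:
  fixes f :: "int ^ 'd \<Rightarrow> 'b :: {banach, second_countable_topology}"
  assumes "\<And>k. norm (f k) \<le> C / (1 + norm (t + real_vec k)) ^ (CARD('d) + 2)"
  shows "integrable (count_space UNIV) f"
proof -
  obtain W where W: "\<And>t :: real ^ 'd.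
    (\<integral>\<^sup>+k. ennreal (1 / (1 + norm (t + real_vec k)) ^ (CARD('d) + 2)) \<partial>count_space UNIV) \<le> ennreal W"
    using lattice_weight_bound by blast
  have w: "integrable (count_space UNIV) (\<lambda>k. 1 / (1 + norm (t + real_vec k)) ^ (CARD('d) + 2))"
  proof (rule integrableI_bounded)
    have "(\<integral>\<^sup>+k. ennreal (norm (1 / (1 + norm (t + real_vec k)) ^ (CARD('d) + 2))) \<partial>count_space UNIV) \<le> ennreal W"
      using W[of t] by (simp add: abs_mult)
    also have "... < \<infinity>" by simp
    finally show "(\<integral>\<^sup>+k. ennreal (norm (1 / (1 + norm (t + real_vec k)) ^ (CARD('d) + 2))) \<partial>count_space UNIV) < \<infinity>" .
  qed simp
  show ?thesis
  proof (rule Bochner_Integration.integrable_bound)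
    show "integrable (count_space UNIV) (\<lambda>k. C * (1 / (1 + norm (t + real_vec k)) ^ (CARD('d) + 2)))"
      by (intro integrable_mult_right w)
    have "norm (f k) \<le> norm (C * (1 / (1 + norm (t + real_vec k)) ^ (CARD('d) + 2)))" for k
      using assms[of k] abs_ge_self[of "C / (1 + norm (t + real_vec k)) ^ (CARD('d) + 2)"] by simp
    then show "AE k in count_space UNIV. norm (f k) \<le> norm (C * (1 / (1 + norm (t + real_vec k)) ^ (CARD('d) + 2)))"
      by simp
  qed simp
qed

lemma integral_count_single:
  fixes f :: "'k \<Rightarrow> 'b :: {banach, second_countable_topology}"
  shows "(LINT l|count_space UNIV. indicator {a} l *\<^sub>R f l) = f a"
proof -
  have "(LINT l|count_space UNIV. indicator {a} l *\<^sub>R f l) = (LINT l|count_space UNIV. indicat_real {a} l *\<^sub>R f a)"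
    by (intro Bochner_Integration.integral_cong) (auto simp: indicator_def)
  also have "... = (LINT l|count_space UNIV. indicat_real {a} l) *\<^sub>R f a"
    by (intro integral_scaleR_left integrable_real_indicator) auto
  also have "... = f a" by (simp add: measure_def)
  finally show ?thesis .
qed

definition periodize :: "(real ^ 'd \<Rightarrow> complex) \<Rightarrow> real ^ 'd \<Rightarrow> complex" where
  "periodize u t = (LINT k|count_space UNIV. u (t + real_vec k))"

lemma integrable_periodize:
  assumes "u \<in> schwartz"
  shows "integrable (count_space UNIV) (\<lambda>k. u (t + real_vec k))"
proof -
  obtain C where "\<And>x. cmod (u x) \<le> C / (1 + norm x) ^ (CARD('a) + 2)"
    using schwartz_bound0[OF assms, of "CARD('a) + 2"] by blast
  then show ?thesis by (intro integrable_count_weight[of _ C t])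
qed

lemma integral_count_shift:
  fixes f :: "int ^ 'd \<Rightarrow> 'b :: {banach, second_countable_topology}"
  shows "(LINT k|count_space UNIV. f (k + l)) = (LINT k|count_space UNIV. f k)"
proof (rule integral_bij_count_space)
  show "bij_betw (\<lambda>k. k + l) UNIV UNIV"
    by (rule bij_betw_byWitness[where f'="\<lambda>k. k - l"]) auto
qed

lemma periodize_periodic: "periodize u (t + real_vec l) = periodize u t"
  using integral_count_shift[of "\<lambda>k. u (t + real_vec k)" l]
  by (simp add: periodize_def real_vec_add add_ac)

text \<open>Continuity comes from differentiability:
  \<open>has_derivative_parameter_integral\<close> applies to the counting measure, with a majorant
  from the second order estimate.\<close>

lemma continuous_periodize:
  fixes u :: "real ^ 'd \<Rightarrow> complex"
  assumes u: "u \<in> schwartz"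
  shows "isCont (periodize u) t"
proof -
  obtain C where C: "C \<ge> 0" "\<And>x h. norm h \<le> 1 ==>
    cmod (u (x + h) - u x - (\<Sum>i\<in>UNIV. h $ i *\<^sub>R partial_deriv i u x)) \<le> (norm h)^2 * (C / (1 + norm x) ^ (CARD('d) + 2))"
    using schwartz_second_order[OF u, of "CARD('d) + 2"] by blast
  have "(periodize u has_derivative (\<lambda>h. \<Sum>i\<in>UNIV. h $ i *\<^sub>R (LINT k|count_space UNIV. partial_deriv i u (t + real_vec k)))) (at t)"
    unfolding periodize_def[abs_def]
  proof (rule has_derivative_parameter_integral)
    show "integrable (count_space UNIV) (\<lambda>k. u (\<xi> + real_vec k))" for \<xi>
      by (rule integrable_periodize[OF u])
    show "integrable (count_space UNIV) (\<lambda>k. partial_deriv i u (t + real_vec k))" for i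
      by (intro integrable_periodize schwartz_partial_deriv u)
    show "integrable (count_space UNIV) (\<lambda>k. C / (1 + norm (t + real_vec k)) ^ (CARD('d) + 2))"
      by (rule integrable_count_weight[where C=C and t=t]) (use C(1) in simp)
    fix h :: "real ^ 'd" and k :: "int ^ 'd" assume "norm h \<le> 1"
    from C(2)[OF this, of "t + real_vec k"]
    show "cmod (u (t + h + real_vec k) - u (t + real_vec k) - (\<Sum>i\<in>UNIV. h $ i *\<^sub>R partial_deriv i u (t + real_vec k)))
      \<le> (norm h)^2 * (C / (1 + norm (t + real_vec k)) ^ (CARD('d) + 2))"
      by (simp add: add_ac)
  qed
  then show ?thesis by (rule has_derivative_continuous)
qed

text \<open>Integrating F over the shifted cube and tiling that integral gives back F on the
  standard cube, since by periodicity the lattice sum only counts one translate.\<close>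

lemma cube_integral_shift:
  fixes F :: "real ^ 'd \<Rightarrow> complex"
  assumes [measurable]: "F \<in> borel_measurable borel" and B: "\<And>t. cmod (F t) \<le> B"
    and per: "\<And>t k. F (t + real_vec k) = F t"
  shows "(LINT t|lborel. indicator unit_cube t *\<^sub>R F (t + a)) = (LINT t|lborel. indicator unit_cube t *\<^sub>R F t)"
proof -
  let ?f = "\<lambda>x. indicator unit_cube (x - a) *\<^sub>R F x"
  have int0: "integrable lborel (\<lambda>x. indicator unit_cube x *\<^sub>R F (x + a))"
  proof (rule Bochner_Integration.integrable_bound)
    show "integrable lborel (\<lambda>x :: real ^ 'd. B * indicator unit_cube x)"
      by (intro integrable_mult_right integrable_real_indicator) auto
    show "AE x in lborel. norm (indicator unit_cube x *\<^sub>R F (x + a)) \<le> norm (B * indicator unit_cube x)"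
      using B abs_ge_self[of B] by (auto simp: indicator_def intro: order_trans)
  qed measurable
  have sh: "(LINT x|lborel. ?f (x + a)) = (LINT x|lborel. ?f x)" "integrable lborel ?f"
    using integral_shift[of ?f a] int0 by auto
  have one: "(LINT k|count_space UNIV. indicator unit_cube (t + real_vec k - a) *\<^sub>R F (t + real_vec k)) = F t" for t
  proof -
    have "(\<integral>\<^sup>+k. indicator unit_cube (t - a + real_vec k) \<partial>count_space UNIV) = (1 :: ennreal)"
      by (rule nn_integral_indicator_cube)
    then have *: "(\<integral>\<^sup>+k. ennreal (indicator unit_cube (t + real_vec k - a)) \<partial>count_space UNIV) = 1"
      by (simp add: ennreal_indicator algebra_simps)
    then have "(LINT k|count_space UNIV. indicat_real unit_cube (t + real_vec k - a)) = 1"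
      by (intro integral_eq_nn_integral[THEN trans]) auto
    moreover have "integrable (count_space UNIV) (\<lambda>k. indicat_real unit_cube (t + real_vec k - a))"
      using * by (intro integrableI_bounded) auto
    ultimately show ?thesis by (simp add: per)
  qed
  have "(LINT t|lborel. indicator unit_cube t *\<^sub>R F (t + a)) = (LINT x|lborel. ?f x)"
    using sh(1) by simp
  also have "... = (LINT t|lborel. indicator unit_cube t *\<^sub>R F t)"
    by (subst integral_tile[OF sh(2)]) (simp only: one)
  finally show ?thesis .
qed

lemma integrable_cube:
  fixes F :: "real ^ 'd \<Rightarrow> 'b :: {banach, second_countable_topology}"
  assumes [measurable]: "F \<in> borel_measurable borel" and B: "\<And>t. t \<in> unit_cube ==> norm (F t) \<le> B"
  shows "integrable lborel (\<lambda>t. indicator unit_cube t *\<^sub>R F t)"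
proof (rule Bochner_Integration.integrable_bound)
  show "integrable lborel (\<lambda>x :: real ^ 'd. B * indicator unit_cube x)"
    by (intro integrable_mult_right integrable_real_indicator) auto
  show "AE x in lborel. norm (indicator unit_cube x *\<^sub>R F x) \<le> norm (B * indicator unit_cube x)"
    using B abs_ge_self[of B] by (auto simp: indicator_def intro: order_trans)
qed measurable

lemma measure_unit_cube [simp]: "measure lborel (unit_cube :: (real ^ 'd) set) = 1"
  by (simp add: measure_def)

lemma cube_integral_echar:
  "(LINT t|lborel. indicator unit_cube t *\<^sub>R echar (real_vec k) t) = (if k = 0 then 1 else 0)"
proof (cases "k = 0")
  case True
  then show ?thesis by simp
next
  case False
  then obtain i where i: "k $ i \<noteq> 0" by (auto simp: vec_eq_iff)
  \<comment> \<open>Half a period in a direction with k_i \<noteq> 0: the inner product with k is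
    1/2, so the shift multiplies the character by -1 and the integral equals its own
    negative.\<close>
  let ?a = "axis i (1 / (2 * real_of_int (k $ i)))"
  let ?I = "LINT t|lborel. indicator unit_cube t *\<^sub>R echar (real_vec k) t"
  have h: "?a \<bullet> real_vec k = 1 / 2"
    using i by (simp add: inner_axis' real_vec_def)
  then have e: "echar (real_vec k) ?a = - 1"
    unfolding echar_cis h by simp
  have "(LINT t|lborel. indicator unit_cube t *\<^sub>R echar (real_vec k) (t + ?a)) = ?I"
    by (rule cube_integral_shift[of _ 1]) (auto simp: echar_shift_lattice)
  then have "- ?I = ?I" by (simp add: echar_add e)
  then show ?thesis using False by simp
qed

text \<open>A nonnegative trigonometric polynomial with maximum 2d, attained exactly at the lattice
  points; multiplication by it mixes a frequency only with its nearest neighbours.\<close>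

definition dirichlet_peak :: "real ^ 'd \<Rightarrow> real" where
  "dirichlet_peak t = (\<Sum>i\<in>UNIV. 1 + cos (2 * pi * t $ i))"

lemma dirichlet_peak_echar:
  "complex_of_real (dirichlet_peak t) * echar (real_vec k) t =
    (\<Sum>i\<in>UNIV. echar (real_vec k) t + (echar (real_vec (k + axis i 1)) t + echar (real_vec (k - axis i 1)) t) / 2)"
proof -
  have c: "complex_of_real (cos (2 * pi * t $ i)) * echar (real_vec k) t =
    (echar (real_vec (k + axis i 1)) t + echar (real_vec (k - axis i 1)) t) / 2" for i
  proof -
    have "t \<bullet> real_vec (axis i 1) = t $ i"
      by (simp add: inner_vec_def real_vec_def axis_def if_distrib cong: if_cong)
    then have "echar (real_vec (axis i 1)) t = cis (2 * pi * t $ i)" "echar (- real_vec (axis i 1)) t = cis (- (2 * pi * t $ i))"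
      by (simp_all add: echar_cis)
    then have "echar (real_vec (axis i 1)) t + echar (- real_vec (axis i 1)) t = 2 * complex_of_real (cos (2 * pi * t $ i))"
      by (simp add: complex_eq_iff)
    then show ?thesis
      unfolding real_vec_add echar_add_left diff_conv_add_uminus
      by (simp add: distrib_left[symmetric] mult.commute real_vec_minus)
  qed
  then show ?thesis
    by (simp only: dirichlet_peak_def of_real_sum of_real_add of_real_1 sum_distrib_right distrib_right mult_1 c)
qed

lemma dirichlet_peak_bounds: "0 \<le> dirichlet_peak t" "dirichlet_peak (t :: real ^ 'd) \<le> 2 * real CARD('d)"
proof -
  have c: "0 \<le> 1 + cos (2 * pi * t $ i)" "1 + cos (2 * pi * t $ i) \<le> 2" for i
    using cos_ge_minus_one[of "2 * pi * t $ i"] cos_le_one[of "2 * pi * t $ i"] by linarith+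
  show "0 \<le> dirichlet_peak t" unfolding dirichlet_peak_def by (intro sum_nonneg c)
  have "dirichlet_peak t \<le> (\<Sum>i\<in>(UNIV :: 'd set). 2)" unfolding dirichlet_peak_def by (intro sum_mono c)
  then show "dirichlet_peak t \<le> 2 * real CARD('d)" by simp
qed

lemma dirichlet_peak_less:
  fixes t :: "real ^ 'd"
  assumes "\<And>i. \<bar>t $ i\<bar> \<le> 1 / 2" "t \<noteq> 0"
  shows "dirichlet_peak t < 2 * real CARD('d)"
proof -
  obtain i where i: "t $ i \<noteq> 0" using assms(2) by (auto simp: vec_eq_iff)
  have "cos (2 * pi * t $ i) \<noteq> 1"
  proof
    assume "cos (2 * pi * t $ i) = 1"
    then obtain n :: int where "2 * pi * t $ i = real_of_int n * 2 * pi"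
      by (auto simp: cos_one_2pi_int)
    then have n: "t $ i = real_of_int n" by simp
    with assms(1)[of i] have "\<bar>real_of_int n\<bar> < 1" by simp
    then have "n = 0" by linarith
    with n i show False by simp
  qed
  then have "1 + cos (2 * pi * t $ i) < 2"
    using cos_le_one[of "2 * pi * t $ i"] by (simp add: less_le)
  then have "dirichlet_peak t < (\<Sum>i\<in>(UNIV :: 'd set). 2)"
    unfolding dirichlet_peak_def using cos_le_one
    by (intro sum_strict_mono_ex1) (auto intro!: bexI[of _ i])
  then show ?thesis by simp
qed

lemma dirichlet_peak_continuous: "continuous_on A dirichlet_peak"
  unfolding dirichlet_peak_def[abs_def] by (intro continuous_intros)

lemma dirichlet_peak_measurable [measurable]: "dirichlet_peak \<in> borel_measurable borel"
  by (intro borel_measurable_continuous_onI dirichlet_peak_continuous)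

text \<open>If all Fourier coefficients of \<open>H\<close> vanish, then \<open>H\<close> is orthogonal to all powers of the peak
  function, whose mass concentrates at the lattice points.\<close>

lemma zero_coefficients_nonpos:
  fixes H :: "real ^ 'd \<Rightarrow> complex"
  assumes cont: "continuous_on UNIV H" and B: "\<And>t. cmod (H t) \<le> B"
    and zero: "\<And>k. (LINT t|lborel. indicator unit_cube t *\<^sub>R (H t * echar (real_vec k) t)) = 0"
  shows "Re (H 0) \<le> 0"
proof (rule ccontr)
  assume "\<not> Re (H 0) \<le> 0"
  define \<epsilon> where "\<epsilon> = Re (H 0) / 2"
  have \<epsilon>: "\<epsilon> > 0" using \<open>\<not> Re (H 0) \<le> 0\<close> by (simp add: \<epsilon>_def)
  let ?q = "dirichlet_peak :: real ^ 'd \<Rightarrow> real" and ?d = "real CARD('d)"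
  have [measurable]: "H \<in> borel_measurable borel" using cont by (rule borel_measurable_continuous_onI)
  have B0: "B \<ge> 0" using order_trans[OF norm_ge_zero B[of 0]] .
  have pow: "\<forall>k. (LINT t|lborel. indicator unit_cube t *\<^sub>R (H t * of_real (?q t) ^ N * echar (real_vec k) t)) = 0" for N
  proof (induction N)
    case 0 then show ?case using zero by simp
  next
    case (Suc N)
    have int: "integrable lborel (\<lambda>t. indicator unit_cube t *\<^sub>R (H t * of_real (?q t) ^ N * echar (real_vec k) t))" for k
    proof (rule integrable_cube)
      show "norm (H t * of_real (?q t) ^ N * echar (real_vec k) t) \<le> B * (2 * ?d) ^ N" for t
        unfolding norm_mult norm_power norm_of_real norm_echar mult_1_right
        using dirichlet_peak_bounds[of t] B0 by (intro mult_mono power_mono B) auto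
    qed measurable
    show ?case
    proof
      fix k
      let ?I = "\<lambda>k t. indicator unit_cube t *\<^sub>R (H t * of_real (?q t) ^ N * echar (real_vec k) t)"
      have "indicator unit_cube t *\<^sub>R (H t * of_real (?q t) ^ Suc N * echar (real_vec k) t)
        = (\<Sum>i\<in>UNIV. ?I k t + (?I (k + axis i 1) t + ?I (k - axis i 1) t) / 2)" for t
      proof -
        have "indicator unit_cube t *\<^sub>R (H t * of_real (?q t) ^ Suc N * echar (real_vec k) t)
          = indicator unit_cube t *\<^sub>R (H t * of_real (?q t) ^ N * (of_real (?q t) * echar (real_vec k) t))"
          by (simp add: mult_ac)
        then show ?thesis
          unfolding dirichlet_peak_echar sum_distrib_left scaleR_sum_right
          by (simp add: scaleR_conv_of_real add_divide_distrib algebra_simps)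
      qed
      then show "(LINT t|lborel. indicator unit_cube t *\<^sub>R (H t * of_real (?q t) ^ Suc N * echar (real_vec k) t)) = 0"
        using Suc int by simp
    qed
  qed
  have re0: "(LINT t|lborel. indicator unit_cube t * (Re (H t) * ?q t ^ N)) = 0" for N
  proof -
    have int: "integrable lborel (\<lambda>t. indicator unit_cube t *\<^sub>R (H t * of_real (?q t) ^ N))"
    proof (rule integrable_cube)
      show "norm (H t * of_real (?q t) ^ N) \<le> B * (2 * ?d) ^ N" for t
        unfolding norm_mult norm_power norm_of_real
        using dirichlet_peak_bounds[of t] B0 by (intro mult_mono power_mono B) auto
    qed measurable
    have "(LINT t|lborel. indicator unit_cube t *\<^sub>R (H t * of_real (?q t) ^ N)) = 0"
      using pow[of N, THEN spec, of 0] by simp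
    then have "Re (LINT t|lborel. indicator unit_cube t *\<^sub>R (H t * of_real (?q t) ^ N)) = 0"
      by simp
    also have "Re (LINT t|lborel. indicator unit_cube t *\<^sub>R (H t * of_real (?q t) ^ N)) =
      (LINT t|lborel. Re (indicator unit_cube t *\<^sub>R (H t * of_real (?q t) ^ N)))"
      by (rule integral_Re[OF int, symmetric])
    also have "(\<lambda>t. Re (indicator unit_cube t *\<^sub>R (H t * of_real (?q t) ^ N))) = (\<lambda>t. indicator unit_cube t * (Re (H t) * ?q t ^ N))"
      by (simp add: fun_eq_iff flip: of_real_power)
    finally show ?thesis .
  qed
  have "isCont (\<lambda>t. Re (H t)) 0"
    using cont by (auto intro!: continuous_intros simp: continuous_on_eq_continuous_at)
  then have "\<forall>\<^sub>F t in at 0. Re (H t) > \<epsilon>"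
    using \<epsilon> by (intro order_tendstoD(1)[of _ "Re (H 0)"]) (auto simp: isCont_def \<epsilon>_def)
  then obtain \<delta>0 where \<delta>0: "\<delta>0 > 0" "\<And>t. t \<noteq> 0 ==> dist t 0 < \<delta>0 ==> Re (H t) > \<epsilon>"
    unfolding eventually_at by blast
  define \<delta> where "\<delta> = min \<delta>0 (1 / 2)"
  have \<delta>: "\<delta> > 0" "\<delta> \<le> 1 / 2" "\<And>t. norm t < \<delta> ==> Re (H t) \<ge> \<epsilon>"
  proof -
    show "Re (H t) \<ge> \<epsilon>" if "norm t < \<delta>" for t
      using that \<delta>0(2)[of t] \<epsilon> by (cases "t = 0") (auto simp: \<delta>_def \<epsilon>_def)
  qed (use \<delta>0 in \<open>auto simp: \<delta>_def\<close>)
  let ?a = "\<chi> i. 1 / 2 :: real ^ 'd"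
  have "\<exists>m<2 * ?d. \<forall>t\<in>unit_cube - ball 0 \<delta>. ?q t \<le> m"
  proof -
    let ?K = "cbox (- ?a) ?a - ball 0 \<delta>"
    have cK: "compact ?K" by (intro compact_diff compact_cbox open_ball)
    have sub: "unit_cube - ball 0 \<delta> \<subseteq> ?K"
      by (auto simp: unit_cube_def mem_box_cart less_imp_le)
    show ?thesis
    proof (cases "?K = {}")
      case True
      then show ?thesis using sub by (intro exI[of _ 0]) auto
    next
      case False
      obtain t where t: "t \<in> ?K" "\<And>s. s \<in> ?K ==> ?q s \<le> ?q t"
        using continuous_attains_sup[OF cK False dirichlet_peak_continuous] by blast
      have "?q t < 2 * ?d"
      proof (rule dirichlet_peak_less)
        have "- (1 / 2) \<le> t $ i \<and> t $ i \<le> 1 / 2" for i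
          using t(1) by (simp add: mem_box_cart)
        then show "\<bar>t $ i\<bar> \<le> 1 / 2" for i
          by (simp only: abs_le_iff) (simp add: minus_le_iff)
        show "t \<noteq> 0" using t(1) \<delta>(1) by auto
      qed
      with t sub show ?thesis by (intro exI[of _ "?q t"]) auto
    qed
  qed
  then obtain m0 where m0: "m0 < 2 * ?d" "\<And>t. t \<in> unit_cube - ball 0 \<delta> ==> ?q t \<le> m0" by blast
  define m where "m = max m0 0"
  have m: "0 \<le> m" "m < 2 * ?d" "\<And>t. t \<in> unit_cube - ball 0 \<delta> ==> ?q t \<le> m"
    using m0 by (force simp: m_def)+
  \<comment> \<open>Lies strictly between \<open>m\<close>, the bound for the peak function away
    from the origin, and 2d, its value at the origin; the ratio m/\<mu> < 1 produces the
    contradiction.\<close>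
  define \<mu> where "\<mu> = (m + 2 * ?d) / 2"
  have \<mu>: "m < \<mu>" "\<mu> < 2 * ?d" "\<mu> > 0" using m by (auto simp: \<mu>_def)
  have "?q 0 = 2 * ?d" by (simp add: dirichlet_peak_def)
  moreover have "isCont ?q 0"
    using dirichlet_peak_continuous[where A="UNIV :: (real ^ 'd) set"] by (simp add: continuous_on_eq_continuous_at)
  ultimately have "\<forall>\<^sub>F t in at 0. ?q t > \<mu>"
    using \<mu> by (intro order_tendstoD(1)[of _ "?q 0"]) (auto simp: isCont_def)
  then obtain \<eta>0 where \<eta>0: "\<eta>0 > 0" "\<And>t. t \<noteq> 0 ==> dist t 0 < \<eta>0 ==> ?q t > \<mu>"
    unfolding eventually_at by blast
  define \<eta> where "\<eta> = min \<eta>0 \<delta>"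
  have \<eta>: "\<eta> > 0" "\<eta> \<le> \<delta>" "\<And>t. norm t < \<eta> ==> ?q t \<ge> \<mu>"
  proof -
    show "?q t \<ge> \<mu>" if "norm t < \<eta>" for t
      using that \<eta>0(2)[of t] \<mu> \<open>?q 0 = 2 * ?d\<close> by (cases "t = 0") (auto simp: \<eta>_def)
  qed (use \<eta>0 \<delta> in \<open>auto simp: \<eta>_def\<close>)
  let ?V = "measure lborel (ball (0 :: real ^ 'd) \<eta>)"
  have V: "?V > 0" using \<eta>(1) by (simp add: content_ball)
  \<comment> \<open>The integral of Re H times the N-th power of the peak function vanishes, but its
    integrand is at least \<epsilon> \<mu>^N on the \<eta>-ball, nonnegative on the rest of the
    \<delta>-ball and at least - B m^N on the rest of the cube.\<close>
  have le: "\<epsilon> * ?V \<le> B * (m / \<mu>) ^ N" for N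
  proof -
    let ?F = "\<lambda>t. indicator unit_cube t * (Re (H t) * ?q t ^ N)"
    let ?G = "\<lambda>t :: real ^ 'd. \<epsilon> * \<mu> ^ N * indicator (ball 0 \<eta>) t - B * m ^ N * indicator unit_cube t"
    have "(LINT t|lborel. ?G t) \<le> (LINT t|lborel. ?F t)"
    proof (rule integral_mono)
      show "integrable lborel ?G"
        by (intro Bochner_Integration.integrable_diff integrable_mult_right integrable_real_indicator)
           (auto simp: emeasure_ball less_imp_le \<eta>(1))
      have "integrable lborel (\<lambda>t. indicator unit_cube t *\<^sub>R (Re (H t) * ?q t ^ N))"
      proof (rule integrable_cube)
        show "norm (Re (H t) * ?q t ^ N) \<le> B * (2 * ?d) ^ N" for t
          unfolding real_norm_def abs_mult power_abs
          using dirichlet_peak_bounds[of t] B0 order_trans[OF abs_Re_le_cmod B] by (intro mult_mono power_mono) auto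
      qed measurable
      then show "integrable lborel ?F" by simp
      fix t
      show "?G t \<le> ?F t"
      proof (cases "norm t < \<delta>")
        case True
        then have tc: "t \<in> unit_cube"
        proof -
          have "\<bar>t $ i\<bar> < 1 / 2" for i
            using component_le_norm_cart[of t i] True \<delta>(2) by linarith
          then show ?thesis unfolding unit_cube_def mem_Collect_eq abs_less_iff
            by (metis less_eq_real_def minus_divide_left minus_less_iff)
        qed
        have H: "\<epsilon> \<le> Re (H t)" by (rule \<delta>(3)[OF True])
        have "0 \<le> Re (H t) * ?q t ^ N" using H \<epsilon> dirichlet_peak_bounds[of t] by auto
        moreover have "\<epsilon> * \<mu> ^ N \<le> Re (H t) * ?q t ^ N" if "norm t < \<eta>"
          using H \<epsilon> \<eta>(3)[OF that] \<mu> by (intro mult_mono power_mono) auto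
        moreover have "0 \<le> B * m ^ N" using B0 m by simp
        ultimately show ?thesis using tc by (auto simp: indicator_def)
      next
        case False
        show ?thesis
        proof (cases "t \<in> unit_cube")
          case True
          then have "?q t \<le> m" using False by (intro m) auto
          have "\<bar>Re (H t) * ?q t ^ N\<bar> \<le> B * m ^ N"
            unfolding abs_mult power_abs
            using dirichlet_peak_bounds[of t] \<open>?q t \<le> m\<close> B0 order_trans[OF abs_Re_le_cmod B]
            by (intro mult_mono power_mono) auto
          then have "- (B * m ^ N) \<le> Re (H t) * ?q t ^ N" by linarith
          then show ?thesis using True False \<eta>(2) by (auto simp: indicator_def)
        qed (use False \<eta>(2) in \<open>auto simp: indicator_def\<close>)
      qed
    qed
    also have "... = 0" by (rule re0)
    also have "(LINT t|lborel. ?G t) = \<epsilon> * \<mu> ^ N * ?V - B * m ^ N"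
      by (subst Bochner_Integration.integral_diff) (auto simp: emeasure_ball less_imp_le \<eta>(1))
    finally have "\<epsilon> * ?V * \<mu> ^ N \<le> B * m ^ N" by (simp add: mult_ac)
    then show ?thesis using \<mu> by (simp add: power_divide pos_le_divide_eq)
  qed
  have "(\<lambda>N. B * (m / \<mu>) ^ N) \<longlonglongrightarrow> B * 0"
    using m \<mu> by (intro tendsto_mult tendsto_const LIMSEQ_power_zero) auto
  then have "\<epsilon> * ?V \<le> B * 0"
    by (rule LIMSEQ_le_const) (use le in auto)
  then have "\<epsilon> * ?V \<le> 0" by simp
  with \<epsilon> V show False using mult_pos_pos[of \<epsilon> ?V] by linarith
qed

text \<open>The preceding lemma sees only the real part at the origin, so it is applied to t
  \<mapsto> cnj (H x) H(t + x), whose value at 0 is |H x|^2 and whose coefficients vanish as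
  well.\<close>

lemma zero_coefficients:
  fixes H :: "real ^ 'd \<Rightarrow> complex"
  assumes cont: "continuous_on UNIV H" and B: "\<And>t. cmod (H t) \<le> B"
    and per: "\<And>t k. H (t + real_vec k) = H t"
    and zero: "\<And>k. (LINT t|lborel. indicator unit_cube t *\<^sub>R (H t * echar (real_vec k) t)) = 0"
  shows "H x = 0"
proof -
  let ?H = "\<lambda>t. cnj (H x) * H (t + x)"
  have [measurable]: "H \<in> borel_measurable borel" using cont by (rule borel_measurable_continuous_onI)
  have "Re (?H 0) \<le> 0"
  proof (rule zero_coefficients_nonpos)
    show "continuous_on UNIV ?H"
      by (intro continuous_intros continuous_on_compose2[OF cont]) auto
    show "cmod (?H t) \<le> B * B" for t
      unfolding norm_mult complex_mod_cnj using order_trans[OF norm_ge_zero B] by (intro mult_mono B) auto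
    fix k
    have e: "echar (real_vec k) t = echar (real_vec k) (- x) * echar (real_vec k) (t + x)" for t
      by (simp flip: echar_add)
    have "(LINT t|lborel. indicator unit_cube t *\<^sub>R (H (t + x) * echar (real_vec k) (t + x))) = 0"
      unfolding zero[of k, symmetric]
      by (rule cube_integral_shift[of _ B]) (auto simp: norm_mult B per echar_shift_lattice)
    then have "(LINT t|lborel. (cnj (H x) * echar (real_vec k) (- x)) * (indicator unit_cube t *\<^sub>R (H (t + x) * echar (real_vec k) (t + x)))) = 0"
      by (simp only: integral_mult_right_zero mult_zero_right)
    then show "(LINT t|lborel. indicator unit_cube t *\<^sub>R (?H t * echar (real_vec k) t)) = 0"
      by (subst e) (simp add: mult_ac)
  qed
  then have "(cmod (H x))^2 \<le> 0"
    unfolding cmod_power2 by (simp add: power2_eq_square)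
  then show ?thesis by simp
qed

lemma integrable_fourier_lattice:
  assumes "u \<in> schwartz"
  shows "integrable (count_space UNIV) (\<lambda>k. fourier u (real_vec k) * echar (real_vec k) t)"
proof -
  obtain C where "\<And>x. cmod (fourier u x) \<le> C / (1 + norm x) ^ (CARD('a) + 2)"
    using schwartz_bound0[OF fourier_schwartz[OF assms], of "CARD('a) + 2"] by blast
  then show ?thesis by (intro integrable_count_weight[of _ C 0]) (simp add: norm_mult)
qed

lemma bounded_count_integral:
  assumes "\<And>k t. cmod (f t k) \<le> g k" "integrable (count_space UNIV) g"
  shows "cmod (LINT k|count_space UNIV. f t k) \<le> (LINT k|count_space UNIV. g k)"
proof -
  have "integrable (count_space UNIV) (f t)"
  proof (rule Bochner_Integration.integrable_bound[OF assms(2)])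
    show "AE k in count_space UNIV. norm (f t k) \<le> norm (g k)"
      using order_trans[OF assms(1) abs_ge_self] by simp
  qed simp
  then show ?thesis
    by (intro order_trans[OF integral_norm_bound] integral_mono assms integrable_norm) auto
qed

text \<open>Both sides are bounded, continuous and periodic with the same Fourier coefficients, so
  \<open>zero_coefficients\<close> applies to their difference.\<close>

theorem poisson_summation:
  fixes u :: "real ^ 'd \<Rightarrow> complex"
  assumes u: "u \<in> schwartz"
  shows "periodize u t = (LINT k|count_space UNIV. fourier u (real_vec k) * echar (real_vec k) t)"
proof -
  define P where "P t = (LINT k|count_space UNIV. fourier u (real_vec k) * echar (real_vec k) t)" for t
  let ?c = "\<lambda>k. cmod (fourier u (real_vec k))"
  have intc: "integrable (count_space UNIV) ?c"
    using integrable_norm[OF integrable_fourier_lattice[OF u, of 0]] by simp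
  have Pcont: "continuous_on UNIV P"
  proof (rule continuous_at_imp_continuous_on, rule ballI)
    fix t :: "real ^ 'd"
    show "isCont P t" unfolding continuous_at_sequentially
    proof (intro allI impI)
      fix s assume s: "s \<longlonglongrightarrow> t"
      have "(\<lambda>n. LINT k|count_space UNIV. fourier u (real_vec k) * echar (real_vec k) (s n))
        \<longlonglongrightarrow> (LINT k|count_space UNIV. fourier u (real_vec k) * echar (real_vec k) t)"
      proof (rule integral_dominated_convergence[OF _ _ intc])
        have "(\<lambda>n. echar k (s n)) \<longlonglongrightarrow> echar k t" for k
          unfolding echar_def using s by (intro tendsto_intros)
        then show "AE k in count_space UNIV. (\<lambda>n. fourier u (real_vec k) * echar (real_vec k) (s n))
          \<longlonglongrightarrow> fourier u (real_vec k) * echar (real_vec k) t"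
          by (intro AE_I2 tendsto_mult tendsto_const)
      qed (auto simp: norm_mult)
      then show "(P \<circ> s) \<longlonglongrightarrow> P t" by (simp add: P_def o_def)
    qed
  qed
  have Gcont: "continuous_on UNIV (periodize u)"
    using continuous_periodize[OF u] by (simp add: continuous_at_imp_continuous_on)
  have [measurable]: "P \<in> borel_measurable borel" "periodize u \<in> borel_measurable borel"
    using Pcont Gcont by (auto intro: borel_measurable_continuous_onI)
  note [measurable] = schwartz_measurable[OF u]
  obtain C where C: "C \<ge> 0" "\<And>x. cmod (u x) \<le> C / (1 + norm x) ^ (CARD('d) + 2)"
    using schwartz_bound0[OF u, of "CARD('d) + 2"] by blast
  obtain W where W: "W \<ge> 0" "\<And>t :: real ^ 'd.
    (\<integral>\<^sup>+k. ennreal (1 / (1 + norm (t + real_vec k)) ^ (CARD('d) + 2)) \<partial>count_space UNIV) \<le> ennreal W"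
    using lattice_weight_bound by blast
  have GB: "cmod (periodize u t) \<le> C * W" for t
  proof -
    let ?w = "\<lambda>k. 1 / (1 + norm (t + real_vec k)) ^ (CARD('d) + 2)"
    have iw: "integrable (count_space UNIV) ?w"
      by (rule integrable_count_weight[where C=1 and t=t]) simp
    have "cmod (periodize u t) \<le> (LINT k|count_space UNIV. C * ?w k)"
      unfolding periodize_def
      using C by (intro order_trans[OF integral_norm_bound] integral_mono integrable_norm integrable_periodize[OF u] integrable_mult_right iw) auto
    also have "... = C * (LINT k|count_space UNIV. ?w k)" by (rule integral_mult_right_zero)
    also have "(LINT k|count_space UNIV. ?w k) \<le> W"
    proof -
      have "ennreal (LINT k|count_space UNIV. ?w k) = (\<integral>\<^sup>+k. ennreal (?w k) \<partial>count_space UNIV)"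
        by (rule nn_integral_eq_integral[symmetric, OF iw]) simp
      with W show ?thesis by (metis ennreal_le_iff)
    qed
    finally show ?thesis using C(1) by (simp add: mult_left_mono)
  qed
  have PB: "cmod (P t) \<le> (LINT k|count_space UNIV. ?c k)" for t
    unfolding P_def by (rule bounded_count_integral[OF _ intc]) (simp add: norm_mult)
  \<comment> \<open>Lattice characters are periodic, so tiling turns the Fourier integral of u at a
    lattice frequency into a coefficient of the periodization.\<close>
  have coefG: "(LINT t|lborel. indicator unit_cube t *\<^sub>R (periodize u t * echar (real_vec k) t)) = fourier u (real_vec (- k))" for k
  proof -
    have "fourier u (real_vec (- k)) = (LINT x|lborel. u x * echar (real_vec k) x)"
      by (simp add: fourier_eq real_vec_minus)
    also have "... = (LINT t|lborel. indicator unit_cube t *\<^sub>R (LINT l|count_space UNIV. u (t + real_vec l) * echar (real_vec k) (t + real_vec l)))"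
      by (rule integral_tile) (intro schwartz_integrable schwartz_echar u)
    finally show ?thesis by (simp add: echar_shift_lattice periodize_def)
  qed
  have coefP: "(LINT t|lborel. indicator unit_cube t *\<^sub>R (P t * echar (real_vec k) t)) = fourier u (real_vec (- k))" for k
  proof -
    have "(LINT t|lborel. indicator unit_cube t *\<^sub>R (P t * echar (real_vec k) t)) =
      (LINT t|lborel. LINT l|count_space UNIV. fourier u (real_vec l) * (indicator unit_cube t *\<^sub>R echar (real_vec (l + k)) t))"
      by (intro Bochner_Integration.integral_cong refl, unfold P_def,
          subst integral_mult_left_zero[symmetric], subst integral_scaleR_right[symmetric])
         (simp add: real_vec_add echar_add_left mult_ac)
    also have "... = (LINT l|count_space UNIV. LINT t|lborel. fourier u (real_vec l) * (indicator unit_cube t *\<^sub>R echar (real_vec (l + k)) t))"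
    proof (rule integral_count_swap(1))
      have "(\<integral>\<^sup>+x. \<integral>\<^sup>+l. ennreal (norm (fourier u (real_vec l) * (indicator unit_cube x *\<^sub>R echar (real_vec (l + k)) x))) \<partial>count_space UNIV \<partial>(lborel :: (real ^ 'd) measure))
        = (\<integral>\<^sup>+x. indicator unit_cube x * (\<integral>\<^sup>+l. ennreal (?c l) \<partial>count_space UNIV) \<partial>(lborel :: (real ^ 'd) measure))"
        by (intro nn_integral_cong) (auto simp: norm_mult indicator_def)
      also have "... = (\<integral>\<^sup>+l. ennreal (?c l) \<partial>count_space UNIV)"
        by (subst mult.commute, subst nn_integral_cmult_indicator) auto
      also have "... < \<infinity>" using intc by (simp add: integrable_iff_bounded)
      finally show "(\<integral>\<^sup>+x. \<integral>\<^sup>+l. ennreal (norm (fourier u (real_vec l) * (indicator unit_cube x *\<^sub>R echar (real_vec (l + k)) x))) \<partial>count_space UNIV \<partial>(lborel :: (real ^ 'd) measure)) < \<infinity>" .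
    qed measurable
    also have "... = (LINT l|count_space UNIV. indicator {- k} l *\<^sub>R fourier u (real_vec l))"
    proof (rule Bochner_Integration.integral_cong[OF refl])
      fix l
      have "l + k = 0 \<longleftrightarrow> l = - k" by (rule add_eq_0_iff2)
      then show "(LINT t|lborel. fourier u (real_vec l) * (indicator unit_cube t *\<^sub>R echar (real_vec (l + k)) t)) =
        indicator {- k} l *\<^sub>R fourier u (real_vec l)"
        by (subst integral_mult_right_zero) (simp only: cube_integral_echar, simp)
    qed
    also have "... = fourier u (real_vec (- k))"
      by (rule integral_count_single)
    finally show ?thesis .
  qed
  have "periodize u t - P t = 0" for t
  proof (rule zero_coefficients[where H="\<lambda>t. periodize u t - P t"])
    show "continuous_on UNIV (\<lambda>t. periodize u t - P t)" by (intro continuous_on_diff Gcont Pcont)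
    show "cmod (periodize u t - P t) \<le> C * W + (LINT k|count_space UNIV. ?c k)" for t
      by (rule order_trans[OF norm_triangle_ineq4 add_mono[OF GB PB]])
    show "periodize u (t + real_vec k) - P (t + real_vec k) = periodize u t - P t" for t k
      by (simp add: periodize_periodic P_def echar_shift_lattice)
    fix k
    have "integrable lborel (\<lambda>t. indicator unit_cube t *\<^sub>R (periodize u t * echar (real_vec k) t))"
      by (rule integrable_cube[where B="C * W"]) (auto simp: norm_mult GB)
    moreover have "integrable lborel (\<lambda>t. indicator unit_cube t *\<^sub>R (P t * echar (real_vec k) t))"
      by (rule integrable_cube[where B="LINT k|count_space UNIV. ?c k"]) (auto simp: norm_mult PB)
    ultimately show "(LINT t|lborel. indicator unit_cube t *\<^sub>R ((periodize u t - P t) * echar (real_vec k) t)) = 0"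
      by (simp add: left_diff_distrib scaleR_diff_right coefG coefP)
  qed
  then show ?thesis by (simp add: P_def)
qed

text \<open>Integrating the Poisson formula for the modulations \<open>u(x) e\<^sup>-\<^sup>2\<^sup>\<pi>\<^sup>i\<^sup>x\<^sup>\<omega>\<close> over \<open>\<omega>\<close> in the unit cube
  isolates \<open>u t\<close> on one side and tiles the inversion integral on the other.\<close>

theorem fourier_inversion:
  fixes u :: "real ^ 'd \<Rightarrow> complex"
  assumes u: "u \<in> schwartz"
  shows "(LINT \<omega>|lborel. fourier u \<omega> * echar \<omega> t) = u t"
proof -
  note [measurable] = schwartz_measurable[OF u] schwartz_measurable[OF fourier_schwartz[OF u]]
  have mod: "(\<lambda>x. u x * echar (- \<omega>) x) \<in> schwartz" for \<omega>
    by (rule schwartz_echar[OF u])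
  have fmod: "fourier (\<lambda>x. u x * echar (- \<omega>) x) k = fourier u (\<omega> + k)" for \<omega> k
    by (simp add: fourier_eq mult.assoc flip: echar_add_left)
  have eq: "(LINT k|count_space UNIV. fourier u (\<omega> + real_vec k) * echar (\<omega> + real_vec k) t)
    = (LINT l|count_space UNIV. u (t + real_vec l) * echar (- real_vec l) \<omega>)" for \<omega>
  proof -
    have "echar \<omega> t * periodize (\<lambda>x. u x * echar (- \<omega>) x) t =
      echar \<omega> t * (LINT k|count_space UNIV. fourier u (\<omega> + real_vec k) * echar (real_vec k) t)"
      unfolding poisson_summation[OF mod] fmod ..
    also have "... = (LINT k|count_space UNIV. fourier u (\<omega> + real_vec k) * echar (\<omega> + real_vec k) t)"
      by (simp add: echar_add_left mult_ac flip: integral_mult_right_zero)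
    finally have 1: "(LINT k|count_space UNIV. fourier u (\<omega> + real_vec k) * echar (\<omega> + real_vec k) t)
      = echar \<omega> t * periodize (\<lambda>x. u x * echar (- \<omega>) x) t" ..
    have e: "echar \<omega> t * (u (t + real_vec l) * echar (- \<omega>) (t + real_vec l)) = u (t + real_vec l) * echar (- real_vec l) \<omega>" for l
    proof -
      have "echar \<omega> t * echar (- \<omega>) t = 1" by (simp flip: echar_add_left)
      moreover have "echar (- \<omega>) (real_vec l) = echar (- real_vec l) \<omega>"
        by (simp add: echar_def inner_commute)
      ultimately show ?thesis by (simp add: echar_add mult_ac)
    qed
    show ?thesis unfolding 1 periodize_def
      by (subst integral_mult_right_zero[symmetric]) (simp only: e)
  qed
  have intu: "integrable (count_space UNIV) (\<lambda>l. cmod (u (t + real_vec l)))"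
    by (intro integrable_norm integrable_periodize u)
  have "(LINT \<omega>|lborel. fourier u \<omega> * echar \<omega> t) =
    (LINT \<omega>|lborel. indicator unit_cube \<omega> *\<^sub>R (LINT k|count_space UNIV. fourier u (\<omega> + real_vec k) * echar (\<omega> + real_vec k) t))"
  proof (rule integral_tile)
    show "integrable lborel (\<lambda>\<omega>. fourier u \<omega> * echar \<omega> t)"
      using schwartz_integrable[OF schwartz_echar[OF fourier_schwartz[OF u], of t]]
      by (simp only: echar_commute[of _ t])
  qed
  also have "... = (LINT \<omega>|lborel. LINT l|count_space UNIV. u (t + real_vec l) * (indicator unit_cube \<omega> *\<^sub>R echar (- real_vec l) \<omega>))"
    unfolding eq by (simp add: mult_ac flip: integral_scaleR_right)
  also have "... = (LINT l|count_space UNIV. LINT \<omega>|lborel. u (t + real_vec l) * (indicator unit_cube \<omega> *\<^sub>R echar (- real_vec l) \<omega>))"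
  proof (rule integral_count_swap(1))
    have "(\<integral>\<^sup>+x. \<integral>\<^sup>+l. ennreal (norm (u (t + real_vec l) * (indicator unit_cube x *\<^sub>R echar (- real_vec l) x))) \<partial>count_space UNIV \<partial>(lborel :: (real ^ 'd) measure))
      = (\<integral>\<^sup>+x. indicator unit_cube x * (\<integral>\<^sup>+l. ennreal (cmod (u (t + real_vec l))) \<partial>count_space UNIV) \<partial>(lborel :: (real ^ 'd) measure))"
      by (intro nn_integral_cong) (auto simp: norm_mult indicator_def)
    also have "... = (\<integral>\<^sup>+l. ennreal (cmod (u (t + real_vec l))) \<partial>count_space UNIV)"
      by (subst mult.commute, subst nn_integral_cmult_indicator) auto
    also have "... < \<infinity>" using intu by (simp add: integrable_iff_bounded)
    finally show "(\<integral>\<^sup>+x. \<integral>\<^sup>+l. ennreal (norm (u (t + real_vec l) * (indicator unit_cube x *\<^sub>R echar (- real_vec l) x))) \<partial>count_space UNIV \<partial>(lborel :: (real ^ 'd) measure)) < \<infinity>" .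
  qed measurable
  also have "... = (LINT l|count_space UNIV. indicator {0} l *\<^sub>R u (t + real_vec l))"
  proof (rule Bochner_Integration.integral_cong[OF refl])
    fix l :: "int ^ 'd"
    have "(LINT \<omega>|lborel. indicator unit_cube \<omega> *\<^sub>R echar (- real_vec l) \<omega>) = (if l = 0 then 1 else 0)"
      using cube_integral_echar[of "- l"] by (simp add: real_vec_minus)
    then show "(LINT \<omega>|lborel. u (t + real_vec l) * (indicator unit_cube \<omega> *\<^sub>R echar (- real_vec l) \<omega>)) = indicator {0} l *\<^sub>R u (t + real_vec l)"
      by (subst integral_mult_right_zero) (simp add: indicator_def)
  qed
  also have "... = u t"
    by (subst integral_count_single) simp
  finally show ?thesis .
qed

lemma integral_reflect:
  fixes f :: "real ^ 'd \<Rightarrow> 'b :: {banach, second_countable_topology}"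
  assumes [measurable]: "f \<in> borel_measurable borel"
  shows "(LINT x|lborel. f (- x)) = (LINT x|lborel. f x)"
proof -
  have "(LINT x|lborel. f x) = (LINT x|density (distr lborel borel (\<lambda>x :: real ^ 'd. 0 + (-1) *\<^sub>R x)) (\<lambda>_. ennreal (\<bar>- 1 :: real\<bar> ^ DIM(real ^ 'd))). f x)"
    by (subst lborel_affine[of "-1" "0 :: real ^ 'd"]) simp_all
  also have "... = (LINT x|lborel. f (- x))"
    by (simp add: density_1 integral_distr)
  finally show ?thesis ..
qed

definition inv_fourier :: "(real ^ 'd \<Rightarrow> complex) \<Rightarrow> real ^ 'd \<Rightarrow> complex" where
  "inv_fourier \<psi> x = fourier \<psi> (- x)"

lemma inv_fourier_schwartz: "\<psi> \<in> schwartz ==> inv_fourier \<psi> \<in> schwartz"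
  unfolding inv_fourier_def[abs_def] by (intro schwartz_uminus_arg fourier_schwartz)

lemma inv_fourier_fourier:
  assumes "\<psi> \<in> schwartz" shows "inv_fourier (fourier \<psi>) = \<psi>"
proof
  fix x
  have "inv_fourier (fourier \<psi>) x = (LINT \<omega>|lborel. fourier \<psi> \<omega> * echar x \<omega>)"
    by (simp add: inv_fourier_def fourier_eq[of "fourier \<psi>"])
  also have "... = (LINT \<omega>|lborel. fourier \<psi> \<omega> * echar \<omega> x)"
    by (intro Bochner_Integration.integral_cong refl) (simp only: echar_commute[of x])
  finally show "inv_fourier (fourier \<psi>) x = \<psi> x"
    using fourier_inversion[OF assms] by simp
qed

lemma fourier_inv_fourier:
  assumes "\<psi> \<in> schwartz" shows "fourier (inv_fourier \<psi>) = \<psi>"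
proof
  fix t
  note [measurable] = schwartz_measurable[OF fourier_schwartz[OF assms]]
  have "fourier (inv_fourier \<psi>) t = (LINT \<omega>|lborel. fourier \<psi> (- \<omega>) * echar (- \<omega>) t)"
    unfolding fourier_eq[of "inv_fourier \<psi>"] inv_fourier_def
    by (intro Bochner_Integration.integral_cong refl) (simp add: echar_def inner_commute)
  also have "... = (LINT \<omega>|lborel. fourier \<psi> \<omega> * echar \<omega> t)"
    by (rule integral_reflect[of "\<lambda>\<omega>. fourier \<psi> \<omega> * echar \<omega> t"]) measurable
  finally show "fourier (inv_fourier \<psi>) t = \<psi> t"
    using fourier_inversion[OF assms] by simp
qed

section \<open>Distributions with a function as Fourier transform\<close>

lemma represents_measurable: "represents g T ==> g \<in> borel_measurable borel"
  by (simp add: represents_def)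

lemma represents_unique:
  assumes "represents g T" "represents h T"
  shows "AE x in lborel. g x = h x"
proof -
  have "AE x in lborel. g x - h x = 0"
  proof (rule schwartz_separates)
    show "(\<lambda>x. g x - h x) \<in> borel_measurable borel"
      using assms[THEN represents_measurable] by measurable
    fix \<psi> :: "real ^ 'a \<Rightarrow> complex" assume "\<psi> \<in> schwartz"
    with assms have "integrable lborel (\<lambda>x. g x * \<psi> x)" "integrable lborel (\<lambda>x. h x * \<psi> x)"
      "(LINT x|lborel. g x * \<psi> x) = (LINT x|lborel. h x * \<psi> x)"
      by (auto simp: represents_def)
    then show "integrable lborel (\<lambda>x. (g x - h x) * \<psi> x)" "(LINT x|lborel. (g x - h x) * \<psi> x) = 0"
      by (auto simp: left_diff_distrib)
  qed
  then show ?thesis by simp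
qed

lemma continuous_AE_eq:
  fixes f g :: "real ^ 'd \<Rightarrow> complex"
  assumes "continuous_on UNIV f" "continuous_on UNIV g" "AE x in lborel. f x = g x"
  shows "f = g"
proof (rule ccontr)
  assume "f \<noteq> g"
  then obtain x where x: "f x \<noteq> g x" by auto
  have "open {x. f x \<noteq> g x}"
    using assms(1,2) by (rule open_Collect_neq)
  then obtain e where e: "e > 0" "ball x e \<subseteq> {x. f x \<noteq> g x}"
    using x by (auto simp: open_contains_ball)
  have "AE y in lborel. y \<notin> ball x e"
    using assms(3) by eventually_elim (use e in auto)
  then have "ball x e \<in> null_sets lborel"
    by (subst (asm) AE_iff_null_sets[symmetric]) auto
  then have "measure lborel (ball x e) = 0" by (auto simp: measure_def)
  moreover have "measure lborel (ball x e) > 0" using e by (simp add: content_ball)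
  ultimately show False by simp
qed

lemma ft_represents:
  assumes "represents g (distr_fourier T)"
  shows "represents (ft T) (distr_fourier T)"
proof (cases "\<exists>g. represents g (distr_fourier T) \<and> continuous_on UNIV g")
  case True
  then show ?thesis unfolding ft_def using someI_ex[OF True] by simp
next
  case False
  then show ?thesis unfolding ft_def if_not_P[OF False] using someI[of "\<lambda>g. represents g (distr_fourier T)", OF assms] by simp
qed

lemma ft_AE:
  assumes "represents g (distr_fourier T)"
  shows "AE x in lborel. ft T x = g x"
  using represents_unique[OF ft_represents[OF assms] assms] .

text \<open>Continuous functions that agree almost everywhere agree everywhere, so the choice made
  in \<open>ft\<close> is forced and point values become available.\<close>

lemma ft_continuous:
  assumes "represents g (distr_fourier T)" "continuous_on UNIV g"
  shows "ft T = g"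
proof -
  have ex: "\<exists>g. represents g (distr_fourier T) \<and> continuous_on UNIV g" using assms by blast
  then have "continuous_on UNIV (ft T)" unfolding ft_def using someI_ex[OF ex] by simp
  then show ?thesis using assms(2) ft_AE[OF assms(1)] by (rule continuous_AE_eq)
qed

lemma represents_diff:
  assumes "represents g (distr_fourier S)" "represents h (distr_fourier T)"
  shows "represents (\<lambda>x. g x - h x) (distr_fourier (distr_diff S T))"
  using assms fourier_schwartz
  by (auto simp: represents_def distr_fourier_def distr_diff_def left_diff_distrib)

lemma represents_cmult:
  assumes "represents g (distr_fourier T)"
  shows "represents (\<lambda>x. c * g x) (distr_fourier (\<lambda>\<psi>. c * T \<psi>))"
  using assms fourier_schwartz
  by (auto simp: represents_def distr_fourier_def mult.assoc)

lemma represents_sum: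
  assumes "\<And>k. k \<in> F ==> represents (g k) (distr_fourier (T k))"
  shows "represents (\<lambda>x. \<Sum>k\<in>F. g k x) (distr_fourier (\<lambda>\<psi>. \<Sum>k\<in>F. T k \<psi>))"
proof -
  have "(\<lambda>x. \<Sum>k\<in>F. g k x) \<in> borel_measurable lborel"
    using assms by (intro borel_measurable_sum) (simp add: represents_def)
  then show ?thesis
    using assms fourier_schwartz
    by (auto simp: represents_def distr_fourier_def sum_distrib_right intro!: sum.cong)
qed

lemma fourier_distr_of:
  assumes f: "f \<in> schwartz"
  shows "represents (fourier f) (distr_fourier (distr_of f))" "ft (distr_of f) = fourier f"
proof -
  note fs = fourier_schwartz[OF f]
  show rep: "represents (fourier f) (distr_fourier (distr_of f))"
    using fs fourier_multiplication[OF f] fourier_schwartz schwartz_integrable[OF schwartz_mult_slow[OF fs schwartz_slow]]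
    by (auto simp: represents_def distr_fourier_def distr_of_def schwartz_measurable)
  show "ft (distr_of f) = fourier f"
    by (rule ft_continuous[OF rep schwartz_continuous[OF fs]])
qed

lemma slow_integrable_mult:
  assumes g: "slow_integrable g" and \<psi>: "\<psi> \<in> schwartz"
  shows "integrable lborel (\<lambda>x. g x * \<psi> x)"
  using slow_integrable_conv(1)[OF g schwartz_uminus_arg[OF \<psi>], of 0] by simp

text \<open>Every Schwartz function is the Fourier transform of its inverse transform, so
  \<open>h\<close> determines \<open>T\<close> on the Schwartz class; the first assumption fixes the
  values of the total functional elsewhere.\<close>

lemma tempered_value:
  assumes "\<And>\<psi>. \<psi> \<notin> schwartz ==> T \<psi> = 0" and rep: "represents h (distr_fourier T)"
  shows "T = (\<lambda>\<psi>. if \<psi> \<in> schwartz then (LINT x|lborel. h x * inv_fourier \<psi> x) else 0)"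
proof
  fix \<psi>
  show "T \<psi> = (if \<psi> \<in> schwartz then (LINT x|lborel. h x * inv_fourier \<psi> x) else 0)"
  proof (cases "\<psi> \<in> schwartz")
    case True
    have "T \<psi> = distr_fourier T (inv_fourier \<psi>)"
      using True by (simp add: distr_fourier_def inv_fourier_schwartz fourier_inv_fourier)
    also have "... = (LINT x|lborel. h x * inv_fourier \<psi> x)"
      using rep inv_fourier_schwartz[OF True] by (simp add: represents_def)
    finally show ?thesis using True by simp
  qed (simp add: assms)
qed

lemma fourier_add:
  assumes "f \<in> schwartz" "g \<in> schwartz"
  shows "fourier (\<lambda>x. f x + g x) \<xi> = fourier f \<xi> + fourier g \<xi>"
  using schwartz_integrable[OF schwartz_echar[OF assms(1)], of "- \<xi>"]
    schwartz_integrable[OF schwartz_echar[OF assms(2)], of "- \<xi>"]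
  by (simp add: fourier_eq distrib_right)

lemma fourier_cmult: "fourier (\<lambda>x. c * f x) \<xi> = c * fourier f \<xi>"
  by (simp add: fourier_eq mult.assoc)

text \<open>This constructs the quasi-projection from a formula for its Fourier transform.
  Continuity holds because the Fourier transforms of a null sequence are eventually at most \<delta>
  (1 + |x|)^(-K), uniformly in x.\<close>

lemma inverse_transform_tempered:
  fixes h :: "real ^ 'd \<Rightarrow> complex"
  assumes h: "slow_integrable h"
  defines "T \<equiv> (\<lambda>\<psi>. if \<psi> \<in> schwartz then (LINT x|lborel. h x * inv_fourier \<psi> x) else 0)"
  shows "T \<in> tempered" "represents h (distr_fourier T)"
proof -
  obtain K where K: "integrable lborel (\<lambda>x. cmod (h x) / (1 + norm x) ^ K)"
    and [measurable]: "h \<in> borel_measurable borel" using h by (auto simp: slow_integrable_def)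
  show "represents h (distr_fourier T)"
    unfolding represents_def
    using slow_integrable_mult[OF h] by (auto simp: distr_fourier_def T_def fourier_schwartz inv_fourier_fourier)
  have add: "T (\<lambda>x. \<psi> x + \<eta> x) = T \<psi> + T \<eta>" if "\<psi> \<in> schwartz" "\<eta> \<in> schwartz" for \<psi> \<eta>
    using that slow_integrable_mult[OF h inv_fourier_schwartz[OF that(1)]] slow_integrable_mult[OF h inv_fourier_schwartz[OF that(2)]]
    by (simp add: T_def schwartz_add inv_fourier_def fourier_add distrib_left)
  have cm: "T (\<lambda>x. c * \<psi> x) = c * T \<psi>" if "\<psi> \<in> schwartz" for \<psi> c
    using that by (simp add: T_def schwartz_cmult inv_fourier_def fourier_cmult mult.left_commute)
  have lim: "(\<lambda>l. T (\<psi> l)) \<longlonglongrightarrow> 0" if \<psi>: "\<And>l. \<psi> l \<in> schwartz" and null: "schwartz_null \<psi>" for \<psi> :: "nat \<Rightarrow> real ^ 'd \<Rightarrow> complex"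
  proof (rule LIMSEQ_I)
    fix e :: real assume "e > 0"
    define I where "I = (LINT x|lborel. cmod (h x) / (1 + norm x) ^ K)"
    have I: "I \<ge> 0" unfolding I_def by (rule Bochner_Integration.integral_nonneg) simp
    define \<delta> where "\<delta> = e / (I + 1)"
    have \<delta>: "\<delta> > 0" "I * \<delta> < e" using I \<open>e > 0\<close> by (auto simp: \<delta>_def field_simps)
    obtain l0 where l0: "\<And>l \<xi>. l \<ge> l0 ==> (1 + norm \<xi>) ^ K * cmod (fourier (\<psi> l) \<xi>) \<le> \<delta>"
      using fourier_null[OF null \<psi> \<delta>(1), of K] unfolding eventually_sequentially by blast
    have "cmod (T (\<psi> l)) < e" if "l \<ge> l0" for l
    proof -
      have "cmod (T (\<psi> l)) = cmod (LINT x|lborel. h x * inv_fourier (\<psi> l) x)"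
        by (simp add: T_def \<psi>)
      also have "... \<le> (LINT x|lborel. cmod (h x) / (1 + norm x) ^ K * \<delta>)"
      proof (rule Bochner_Integration.integral_norm_bound_integral)
        show "integrable lborel (\<lambda>x. h x * inv_fourier (\<psi> l) x)"
          by (rule slow_integrable_mult[OF h inv_fourier_schwartz[OF \<psi>]])
        show "integrable lborel (\<lambda>x. cmod (h x) / (1 + norm x) ^ K * \<delta>)"
          by (rule integrable_mult_left[OF K])
        fix x
        have "cmod (fourier (\<psi> l) (- x)) \<le> \<delta> / (1 + norm x) ^ K"
          using l0[OF that, of "- x"] by (simp add: pos_le_divide_eq mult.commute)
        then have "cmod (h x) * cmod (fourier (\<psi> l) (- x)) \<le> cmod (h x) * (\<delta> / (1 + norm x) ^ K)"
          by (rule mult_left_mono) simp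
        then show "norm (h x * inv_fourier (\<psi> l) x) \<le> cmod (h x) / (1 + norm x) ^ K * \<delta>"
          by (simp add: norm_mult inv_fourier_def)
      qed
      also have "... = I * \<delta>" unfolding I_def by (rule integral_mult_left_zero)
      finally show ?thesis using \<delta>(2) by simp
    qed
    then show "\<exists>l0. \<forall>l\<ge>l0. norm (T (\<psi> l) - 0) < e" by auto
  qed
  show "T \<in> tempered"
    unfolding tempered_def using add cm lim by (auto simp: T_def)
qed

lemma tempered_if_represents:
  assumes "\<And>\<psi>. \<psi> \<notin> schwartz ==> T \<psi> = 0" "represents h (distr_fourier T)" "slow_integrable h"
  shows "T \<in> tempered"
  using inverse_transform_tempered(1)[OF assms(3)] tempered_value[OF assms(1,2)] by simp

lemma temperedD:
  assumes "T \<in> tempered"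
  shows tempered_add: "\<psi> \<in> schwartz ==> \<eta> \<in> schwartz ==> T (\<lambda>x. \<psi> x + \<eta> x) = T \<psi> + T \<eta>"
    and tempered_cmult: "\<psi> \<in> schwartz ==> T (\<lambda>x. c * \<psi> x) = c * T \<psi>"
    and tempered_null: "(\<And>l. \<Psi> l \<in> schwartz) ==> schwartz_null \<Psi> ==> (\<lambda>l. T (\<Psi> l)) \<longlonglongrightarrow> 0"
    and tempered_outside: "\<psi> \<notin> schwartz ==> T \<psi> = 0"
  using assms by (auto simp: tempered_def)

lemma tempered_zero:
  assumes "T \<in> tempered" shows "T (\<lambda>_. 0) = 0"
  using tempered_cmult[OF assms schwartz_zero, of 0] by simp

lemma tempered_split:
  assumes "T \<in> tempered" "\<psi> \<in> schwartz" "g \<in> slow_fun" and "T (\<lambda>x. \<psi> x * g x) = 0"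
  shows "T \<psi> = T (\<lambda>x. \<psi> x * (1 - g x))"
proof -
  have "T \<psi> = T (\<lambda>x. \<psi> x * g x + \<psi> x * (1 - g x))" by (simp add: algebra_simps)
  also have "... = T (\<lambda>x. \<psi> x * g x) + T (\<lambda>x. \<psi> x * (1 - g x))"
    by (intro tempered_add schwartz_mult_slow slow_diff slow_const assms)
  finally show ?thesis using assms by simp
qed

section \<open>Localisation of compactly supported distributions\<close>

lemma local_cutoff:
  fixes x :: "real ^ 'd"
  assumes "open U" "x \<in> U"
  obtains c V where "c \<in> schwartz" "open V" "x \<in> V" "\<And>y. y \<in> V ==> c y = 1"
    "compact (closure {y. c y \<noteq> 0})" "closure {y. c y \<noteq> 0} \<subseteq> U"
proof -
  obtain a b where ab: "cbox a b \<subseteq> U" "x \<in> box a b"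
    using open_contains_cbox[OF assms] by metis
  have pos: "x $ i - a $ i > 0" "b $ i - x $ i > 0" for i
    using ab(2) by (auto simp: mem_box_cart)
  \<comment> \<open>The sum dominates 2/distance for all faces at once. With 2 in place of 1 the
    cutoff equals 1 on a whole neighbourhood of \<open>x\<close>, namely where the products still
    exceed 1.\<close>
  define m where "m = (\<Sum>i\<in>UNIV. 2 / (x $ i - a $ i) + 2 / (b $ i - x $ i))"
  have m: "m * (x $ i - a $ i) \<ge> 2" "m * (b $ i - x $ i) \<ge> 2" for i
  proof -
    have "2 / (x $ i - a $ i) + 2 / (b $ i - x $ i) \<le> m"
      unfolding m_def by (rule member_le_sum) (use pos in \<open>auto intro!: add_nonneg_nonneg divide_nonneg_pos\<close>)
    moreover have "2 / (x $ i - a $ i) > 0" "2 / (b $ i - x $ i) > 0" using pos by auto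
    ultimately have "2 / (x $ i - a $ i) \<le> m" "2 / (b $ i - x $ i) \<le> m" by linarith+
    then show "m * (x $ i - a $ i) \<ge> 2" "m * (b $ i - x $ i) \<ge> 2" using pos by (auto simp: pos_divide_le_eq)
  qed
  \<comment> \<open>Index types are nonempty, so one coordinate suffices to exclude m \<le> 0;
    \<open>undefined\<close> just names one.\<close>
  have m0: "m > 0"
  proof (rule ccontr)
    assume "\<not> m > 0"
    then have "m * (x $ undefined - a $ undefined) \<le> 0"
      using pos(1)[of undefined] by (intro mult_nonpos_nonneg) auto
    with m(1)[of undefined] show False by simp
  qed
  let ?c = "\<lambda>y. complex_of_real (box_cutoff m a b y)"
  let ?V = "\<Inter>i\<in>UNIV. {y :: real ^ 'd. m * (y $ i - a $ i) > 1} \<inter> {y. m * (b $ i - y $ i) > 1}"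
  have sub: "{y. ?c y \<noteq> 0} \<subseteq> cbox a b"
    using box_cutoff_0[OF m0] box_subset_cbox by fastforce
  then have cl: "closure {y. ?c y \<noteq> 0} \<subseteq> cbox a b"
    by (rule closure_minimal) (rule closed_cbox)
  show ?thesis
  proof (rule that[of ?c ?V])
    show "?c \<in> schwartz" by (rule box_cutoff_schwartz[OF m0])
    show "open ?V"
      by (intro open_INT ballI open_Int open_Collect_less continuous_intros) auto
    show "x \<in> ?V" using m by (auto intro: less_le_trans[of 1 2])
    show "?c y = 1" if "y \<in> ?V" for y
      using that by (subst box_cutoff_1) (auto simp: less_imp_le)
    show "compact (closure {y. ?c y \<noteq> 0})"
      using cl by (meson bounded_cbox bounded_subset closed_closure compact_eq_bounded_closed)
    show "closure {y. ?c y \<noteq> 0} \<subseteq> U" using cl ab(1) by blast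
  qed
qed

text \<open>The support is defined through local vanishing, so the test function has to be cut up:
  near each point of its own support there is a cutoff c with T (\<psi> c) = 0 for all \<psi>.
  Multiplying by 1 - c then does not change the value of T, and the product over a finite subcover
  turns the test function into 0.\<close>

lemma vanishes_off_support:
  fixes T :: "'d::finite distr"
  assumes T: "T \<in> tempered" and \<psi>: "\<psi> \<in> schwartz" and K: "compact (closure {x. \<psi> x \<noteq> 0})"
    and disj: "closure {x. \<psi> x \<noteq> 0} \<inter> distr_support T = {}"
  shows "T \<psi> = 0"
proof -
  let ?K = "closure {x. \<psi> x \<noteq> 0}"
  define P where "P x c V \<longleftrightarrow> c \<in> schwartz \<and> open V \<and> x \<in> V \<and> (\<forall>y\<in>V. c y = 1) \<and> (\<forall>\<psi>\<in>schwartz. T (\<lambda>y. \<psi> y * c y) = 0)"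
    for x :: "real ^ 'd" and c V
  have "\<exists>c V. P x c V" if "x \<in> ?K" for x
  proof -
    have "x \<in> \<Union> {U. open U \<and> vanishes_on T U}"
      using that disj by (auto simp: distr_support_def)
    then obtain U where U: "open U" "x \<in> U" "vanishes_on T U" by blast
    obtain c V where c: "c \<in> schwartz" "open V" "x \<in> V" "\<And>y. y \<in> V ==> c y = 1"
      "compact (closure {y. c y \<noteq> 0})" "closure {y. c y \<noteq> 0} \<subseteq> U"
      using U(1,2) by (rule local_cutoff) blast
    have "T (\<lambda>y. \<psi> y * c y) = 0" if "\<psi> \<in> schwartz" for \<psi>
    proof -
      have sub: "closure {y. \<psi> y * c y \<noteq> 0} \<subseteq> closure {y. c y \<noteq> 0}"
        by (intro closure_mono) auto
      have "compact (closure {y. \<psi> y * c y \<noteq> 0})"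
        using c(5) sub by (meson bounded_subset closed_closure compact_eq_bounded_closed)
      moreover have "(\<lambda>y. \<psi> y * c y) \<in> schwartz"
        by (intro schwartz_mult_slow schwartz_slow that c)
      ultimately show ?thesis
        using U(3)[unfolded vanishes_on_def, THEN bspec, of "\<lambda>y. \<psi> y * c y"] sub c(6) by blast
    qed
    with c show ?thesis unfolding P_def by blast
  qed
  then obtain c V where "\<And>x. x \<in> ?K ==> P x (c x) (V x)" by metis
  then have c: "\<And>x. x \<in> ?K ==> c x \<in> schwartz" and V: "\<And>x. x \<in> ?K ==> open (V x) \<and> x \<in> V x"
    and c1: "\<And>x y. x \<in> ?K ==> y \<in> V x ==> c x y = 1"
    and T0: "\<And>x \<psi>. x \<in> ?K ==> \<psi> \<in> schwartz ==> T (\<lambda>y. \<psi> y * c x y) = 0"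
    unfolding P_def by blast+
  obtain D where D: "D \<subseteq> ?K" "finite D" "?K \<subseteq> (\<Union>x\<in>D. V x)"
    using compactE_image[OF K, of ?K V] V by blast
  have "T \<psi> = T (\<lambda>y. \<psi> y * (\<Prod>x\<in>D'. 1 - c x y)) \<and> (\<lambda>y. \<psi> y * (\<Prod>x\<in>D'. 1 - c x y)) \<in> schwartz"
    if "D' \<subseteq> D" for D'
    using finite_subset[OF that D(2)] that
  proof (induction D' rule: finite_induct)
    case empty then show ?case using \<psi> by simp
  next
    case (insert x D')
    let ?f = "\<lambda>y. \<psi> y * (\<Prod>x\<in>D'. 1 - c x y)"
    have f: "T \<psi> = T ?f" "?f \<in> schwartz" using insert by auto
    have x: "x \<in> ?K" using insert D by auto
    have "T ?f = T (\<lambda>y. ?f y * (1 - c x y))"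
      by (rule tempered_split[OF T f(2) schwartz_slow[OF c[OF x]] T0[OF x f(2)]])
    moreover have "(\<lambda>y. ?f y * (1 - c x y)) \<in> schwartz"
      by (intro schwartz_mult_slow f(2) slow_diff slow_const schwartz_slow c x)
    moreover have "(\<lambda>y. ?f y * (1 - c x y)) = (\<lambda>y. \<psi> y * (\<Prod>x\<in>insert x D'. 1 - c x y))"
      using insert by (simp add: mult_ac)
    ultimately show ?case using f by simp
  qed
  from this[OF subset_refl] have "T \<psi> = T (\<lambda>y. \<psi> y * (\<Prod>x\<in>D. 1 - c x y))" by simp
  also have "(\<lambda>y. \<psi> y * (\<Prod>x\<in>D. 1 - c x y)) = (\<lambda>_. 0)"
  proof
    fix y
    show "\<psi> y * (\<Prod>x\<in>D. 1 - c x y) = 0"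
    proof (cases "\<psi> y = 0")
      case False
      then have "y \<in> ?K" using closure_subset[of "{x. \<psi> x \<noteq> 0}"] by blast
      then obtain x where "x \<in> D" "y \<in> V x" using D by blast
      then have "1 - c x y = 0" using c1 D by auto
      then show ?thesis using \<open>x \<in> D\<close> D(2) by (auto intro: prod_zero)
    qed simp
  qed
  finally show ?thesis using tempered_zero[OF T] by simp
qed

lemma schwartz_scale:
  fixes f :: "real ^ 'd \<Rightarrow> complex"
  assumes "f \<in> schwartz" "c \<noteq> 0"
  shows "(\<lambda>x. f (c *\<^sub>R x)) \<in> schwartz"
proof -
  have lin: "linear (\<lambda>x :: real ^ 'd. a *\<^sub>R x)" for a
    by (rule linearI) (simp_all add: scaleR_add_right)
  have "invertible (matrix (\<lambda>x :: real ^ 'd. c *\<^sub>R x))"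
    unfolding invertible_def
    by (intro exI[of _ "matrix (\<lambda>x. inverse c *\<^sub>R x)"] conjI; subst matrix_compose[symmetric, OF lin lin])
       (use assms(2) in \<open>auto simp: o_def matrix_def mat_def axis_def vec_eq_iff\<close>)
  from schwartz_affine[OF this assms(1), of 0] show ?thesis
    by (simp add: matrix_works lin)
qed

lemma cutoff_null:
  fixes u :: "real ^ 'd \<Rightarrow> complex"
  assumes \<psi>: "\<psi> \<in> schwartz" and u: "u \<in> schwartz" and u1: "\<And>x. norm x \<le> 1 ==> u x = 1" and ub: "\<And>x. cmod (u x) \<le> 1"
  shows "schwartz_null (\<lambda>l x. \<psi> x * (1 - u ((1 / real (Suc l)) *\<^sub>R x)))"
proof -
  define c where "c l = 1 / real (Suc l)" for l
  have c: "0 < c l" "c l \<le> 1" for l by (auto simp: c_def)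
  \<comment> \<open>With l short for \<open>Suc l\<close>, the product is regrouped as (\<psi> / l)
    times l (1 - u(x / l)). The first factor is null. The second is 0 for |x| \<le> l, hence at most
    2 (1 + |x|), and its derivatives are bounded uniformly in l since each differentiation gains
    1/l.\<close>
  let ?\<psi> = "\<lambda>l x. complex_of_real (c l) * \<psi> x" and ?g = "\<lambda>l x. complex_of_real (real (Suc l)) * (1 - u (c l *\<^sub>R x))"
  have usm: "u \<in> smooth_fun" by (rule schwartz_smooth[OF u])
  have uc: "(\<lambda>x. u (c l *\<^sub>R x)) \<in> smooth_fun" for l
    unfolding smooth_fun_def mem_Collect_eq
  proof (intro allI)
    fix "is" :: "'d list" and x
    have "(\<lambda>x. iter_partial is u (c l *\<^sub>R x)) differentiable (at x)"
      by (rule differentiable_chain_at[of "\<lambda>x. c l *\<^sub>R x", unfolded o_def])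
         (intro smooth_differentiable smooth_iter_partial usm differentiable_scaleR differentiable_const differentiable_ident)+
    then show "iter_partial is (\<lambda>x. u (c l *\<^sub>R x)) differentiable (at x)"
      unfolding iter_partial_scale[OF usm] by (intro differentiable_mult) auto
  qed
  have dc: "(\<lambda>x. 1 - u (c l *\<^sub>R x)) = (\<lambda>x. 1 + (-1) * u (c l *\<^sub>R x))" for l by simp
  have s1: "(\<lambda>x. 1 - u (c l *\<^sub>R x)) \<in> smooth_fun" and s2: "(\<lambda>x. (-1) * u (c l *\<^sub>R x)) \<in> smooth_fun" for l
    unfolding dc by (intro smooth_mult smooth_add smooth_const uc)+
  have gsm: "?g l \<in> smooth_fun" for l
    by (intro smooth_mult smooth_const s1)
  have "schwartz_null ?\<psi>"
    unfolding schwartz_null_def uniform_limit_zero_iff iter_partial_cmult[OF schwartz_smooth[OF \<psi>]]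
  proof (intro allI impI)
    fix "is" :: "'d list" and N and e :: real assume e: "e > 0"
    obtain C where C: "C \<ge> 0" "\<And>x. (1 + norm x) ^ N * cmod (iter_partial is \<psi> x) \<le> C"
      using schwartz_bound[OF \<psi>, of N "is"] by blast
    have "(\<lambda>l. c l * C) \<longlonglongrightarrow> 0" unfolding c_def by real_asymp
    then have "\<forall>\<^sub>F l in sequentially. c l * C < e"
      using e by (rule order_tendstoD)
    then show "\<forall>\<^sub>F l in sequentially. \<forall>x. norm ((1 + norm x) ^ N *\<^sub>R (complex_of_real (c l) * iter_partial is \<psi> x)) < e"
    proof (eventually_elim, intro allI)
      fix l x assume "c l * C < e"
      have "norm ((1 + norm x) ^ N *\<^sub>R (complex_of_real (c l) * iter_partial is \<psi> x)) = c l * ((1 + norm x) ^ N * cmod (iter_partial is \<psi> x))"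
        using c[of l] by (simp add: norm_mult)
      also have "... \<le> c l * C" using c[of l] by (intro mult_left_mono C) simp
      also note \<open>c l * C < e\<close>
      finally show "norm ((1 + norm x) ^ N *\<^sub>R (complex_of_real (c l) * iter_partial is \<psi> x)) < e" .
    qed
  qed
  then have "schwartz_null (\<lambda>l x. ?\<psi> l x * ?g l x)"
  proof (rule schwartz_null_mult[OF _ schwartz_cmult[OF \<psi>] gsm])
    fix "is" :: "'d list"
    show "\<exists>N C. \<forall>l x. cmod (iter_partial is (?g l) x) \<le> C * (1 + norm x) ^ N"
    proof (cases "is = []")
      case True
      have "cmod (?g l x) \<le> 2 * (1 + norm x) ^ 1" for l x
      proof (cases "norm x \<le> real (Suc l)")
        case True
        then have "norm (c l *\<^sub>R x) \<le> 1" by (simp add: c_def)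
        then show ?thesis by (simp add: u1)
      next
        case False
        have "cmod (1 - u (c l *\<^sub>R x)) \<le> 2"
          using norm_triangle_ineq4[of 1 "u (c l *\<^sub>R x)"] ub[of "c l *\<^sub>R x"] by simp
        then have "cmod (?g l x) \<le> real (Suc l) * 2"
          unfolding norm_mult norm_of_real by (intro mult_mono) auto
        with False show ?thesis by simp
      qed
      then show ?thesis unfolding True iter_partial_Nil by blast
    next
      case False
      obtain C where C: "C \<ge> 0" "\<And>x. (1 + norm x) ^ 0 * cmod (iter_partial is u x) \<le> C"
        using schwartz_bound[OF u, of 0 "is"] by blast
      have "iter_partial is (?g l) x = complex_of_real (real (Suc l)) * ((-1) * (complex_of_real (c l) ^ length is * iter_partial is u (c l *\<^sub>R x)))" for l x
        unfolding iter_partial_cmult[OF s1] dc iter_partial_add[OF smooth_const s2] iter_partial_const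
          iter_partial_cmult[OF uc] iter_partial_scale[OF usm] using False by simp
      then have e1: "cmod (iter_partial is (?g l) x) = real (Suc l) * c l ^ length is * cmod (iter_partial is u (c l *\<^sub>R x))" for l x
        using c[of l] by (simp add: norm_mult norm_power del: of_nat_Suc of_real_of_nat_eq)
      have e2: "real (Suc l) * c l ^ length is \<le> 1" for l
      proof -
        have "c l ^ length is \<le> c l ^ 1" using c[of l] False by (intro power_decreasing) (auto simp: Suc_le_eq)
        then have "real (Suc l) * c l ^ length is \<le> real (Suc l) * c l" by (intro mult_left_mono) auto
        also have "... = 1" by (simp add: c_def)
        finally show ?thesis .
      qed
      have "cmod (iter_partial is (?g l) x) \<le> 1 * C" for l x
        unfolding e1 using C(2)[of "c l *\<^sub>R x"] by (intro mult_mono e2) auto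
      then show ?thesis by (intro exI[of _ 0] exI[of _ C]) simp
    qed
  qed
  moreover have "(\<lambda>l x. ?\<psi> l x * ?g l x) = (\<lambda>l x. \<psi> x * (1 - u ((1 / real (Suc l)) *\<^sub>R x)))"
    by (simp add: fun_eq_iff c_def flip: of_nat_Suc)
  ultimately show ?thesis by simp
qed

text \<open>Vanishing off the support is known only for compactly supported test functions.
  Therefore \<psi> (1 - u) is truncated at scale l: the truncated functions are annihilated by
  \<open>T\<close>, and the remainders form a null sequence.\<close>

lemma localise:
  fixes T :: "'d::finite distr"
  assumes T: "T \<in> tempered" and K: "compact (distr_support T)"
  obtains u where "u \<in> schwartz" "\<And>\<psi>. \<psi> \<in> schwartz ==> T \<psi> = T (\<lambda>x. \<psi> x * u x)"
proof -
  \<comment> \<open>The inequality is strict because the closure of the set where u differs from 1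
    can reach the sphere of radius R.\<close>
  obtain R where R: "R > 0" "\<And>x. x \<in> distr_support T ==> norm x < R"
  proof -
    obtain B where "\<And>x. x \<in> distr_support T ==> norm x \<le> B"
      using K compact_imp_bounded bounded_iff by metis
    then show ?thesis using that[of "\<bar>B\<bar> + 1"] by force
  qed
  obtain u :: "real ^ 'd \<Rightarrow> complex" and R' where u: "u \<in> schwartz" "\<And>x. norm x \<le> R ==> u x = 1"
    "\<And>x. norm x \<ge> R' ==> u x = 0" "\<And>x. cmod (u x) \<le> 1"
    using R(1) by (rule cutoff_exists) blast
  have "0 < (1::real)" by simp
  then obtain v :: "real ^ 'd \<Rightarrow> complex" and Rv where v: "v \<in> schwartz" "\<And>x. norm x \<le> 1 ==> v x = 1"
    "\<And>x. norm x \<ge> Rv ==> v x = 0" "\<And>x. cmod (v x) \<le> 1"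
    by (rule cutoff_exists) blast
  have "T \<psi> = T (\<lambda>x. \<psi> x * u x)" if \<psi>: "\<psi> \<in> schwartz" for \<psi>
  proof -
    let ?f = "\<lambda>x. \<psi> x * (1 - u x)"
    have f: "?f \<in> schwartz" by (intro schwartz_mult_slow \<psi> slow_diff slow_const schwartz_slow u)
    let ?v = "\<lambda>l x. v ((1 / real (Suc l)) *\<^sub>R x)"
    have vs: "?v l \<in> slow_fun" for l
      by (intro schwartz_slow schwartz_scale v) simp
    have Tv: "T (\<lambda>x. ?f x * ?v l x) = 0" for l
    proof (rule vanishes_off_support[OF T])
      show "(\<lambda>x. ?f x * ?v l x) \<in> schwartz" by (intro schwartz_mult_slow f vs)
      have 1: "closure {x. ?f x * ?v l x \<noteq> 0} \<subseteq> {x. R \<le> norm x}"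
      proof (rule closure_minimal)
        show "{x. ?f x * ?v l x \<noteq> 0} \<subseteq> {x. R \<le> norm x}" using u(2) by (auto simp: not_le) (meson less_imp_le not_le)
        show "closed {x :: real ^ 'd. R \<le> norm x}" by (intro closed_Collect_le continuous_intros)
      qed
      then show "closure {x. ?f x * ?v l x \<noteq> 0} \<inter> distr_support T = {}"
        using R(2) by fastforce
      have "{x. ?f x * ?v l x \<noteq> 0} \<subseteq> cball 0 (Rv * real (Suc l))"
      proof
        fix x assume "x \<in> {x. ?f x * ?v l x \<noteq> 0}"
        then have "?v l x \<noteq> 0" by auto
        then have "norm ((1 / real (Suc l)) *\<^sub>R x) < Rv" using v(3) not_le by blast
        then show "x \<in> cball 0 (Rv * real (Suc l))" by (simp add: divide_simps mult.commute)
      qed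
      then have "bounded {x. ?f x * ?v l x \<noteq> 0}" by (rule bounded_subset[OF bounded_cball])
      then show "compact (closure {x. ?f x * ?v l x \<noteq> 0})"
        by (simp only: compact_closure)
    qed
    have "(\<lambda>l. T (\<lambda>x. ?f x * (1 - ?v l x))) \<longlonglongrightarrow> 0"
      by (intro tempered_null[OF T] cutoff_null f v schwartz_mult_slow slow_diff slow_const vs)
    moreover have "T (\<lambda>x. ?f x * (1 - ?v l x)) = T ?f" for l
      by (rule tempered_split[OF T f vs Tv, symmetric])
    ultimately have "T ?f = 0" by (simp add: LIMSEQ_const_iff)
    moreover have "T \<psi> = T (\<lambda>x. \<psi> x * u x + ?f x)" by (simp add: algebra_simps)
    moreover have "... = T (\<lambda>x. \<psi> x * u x) + T ?f"
      by (intro tempered_add[OF T] f schwartz_mult_slow \<psi> schwartz_slow u)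
    ultimately show ?thesis by simp
  qed
  then show ?thesis using that u(1) by blast
qed

lemma fourier_product:
  assumes u: "u \<in> schwartz" and \<psi>: "\<psi> \<in> schwartz"
  shows "inv_fourier (\<lambda>x. fourier \<psi> x * u x) y = (LINT z|lborel. \<psi> z * fourier u (z - y))"
proof -
  note [measurable] = schwartz_measurable[OF u] schwartz_measurable[OF \<psi>]
  have "inv_fourier (\<lambda>x. fourier \<psi> x * u x) y = (LINT x|lborel. LINT z|lborel. \<psi> z * (u x * echar (y - z) x))"
  proof -
    have "fourier \<psi> x * u x * echar y x = (LINT z|lborel. \<psi> z * (u x * echar (y - z) x))" for x
    proof -
      have "fourier \<psi> x * u x * echar y x = (LINT z|lborel. (\<psi> z * echar (- x) z) * (u x * echar y x))"
        by (subst integral_mult_left_zero) (simp add: fourier_eq mult.assoc)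
      also have "... = (LINT z|lborel. \<psi> z * (u x * echar (y - z) x))"
      proof (intro Bochner_Integration.integral_cong refl)
        fix z
        have "echar (y - z) x = echar (- x) z * echar y x"
          by (simp add: echar_def inner_diff_right inner_commute mult_exp_exp algebra_simps)
        then show "\<psi> z * echar (- x) z * (u x * echar y x) = \<psi> z * (u x * echar (y - z) x)" by simp
      qed
      finally show ?thesis .
    qed
    then show ?thesis by (simp add: inv_fourier_def fourier_eq[of "\<lambda>x. fourier \<psi> x * u x"])
  qed
  also have "... = (LINT z|lborel. LINT x|lborel. \<psi> z * (u x * echar (y - z) x))"
    by (rule fubini_bound[of _ "\<lambda>x. cmod (u x)" "\<lambda>x. cmod (\<psi> x)"])
       (auto intro!: integrable_norm schwartz_integrable u \<psi> simp: norm_mult)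
  also have "... = (LINT z|lborel. \<psi> z * fourier u (z - y))"
    by (simp add: fourier_eq)
  finally show ?thesis .
qed

text \<open>Localisation gives T = uT, and a product becomes a convolution on the Fourier side:
  \<open>conv g (fourier u)\<close> is a continuous representative and hence equal to
  \<open>ft T\<close>.\<close>

lemma ft_compact_support:
  fixes T :: "'d::finite distr"
  assumes T: "T \<in> tempered" and K: "compact (distr_support T)"
    and rep: "represents g (distr_fourier T)" and g: "slow_integrable g"
  obtains \<theta> where "\<theta> \<in> schwartz" "ft T = conv g \<theta>"
proof -
  obtain u where u: "u \<in> schwartz" "\<And>\<psi>. \<psi> \<in> schwartz ==> T \<psi> = T (\<lambda>x. \<psi> x * u x)"
    using localise[OF T K] by blast
  note fu = fourier_schwartz[OF u(1)]
  have slow: "conv g (fourier u) \<in> slow_fun" by (rule conv_slow[OF g fu])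
  have "represents (conv g (fourier u)) (distr_fourier T)"
    unfolding represents_def
  proof (intro conjI ballI)
    show "conv g (fourier u) \<in> borel_measurable lborel" using slow_measurable[OF slow] by simp
    fix \<psi> :: "real ^ 'd \<Rightarrow> complex" assume \<psi>: "\<psi> \<in> schwartz"
    show "integrable lborel (\<lambda>x. conv g (fourier u) x * \<psi> x)"
      using schwartz_integrable[OF schwartz_mult_slow[OF \<psi> slow]] by (simp add: mult.commute)
    have f\<psi>: "fourier \<psi> \<in> schwartz" by (rule fourier_schwartz[OF \<psi>])
    have s: "(\<lambda>x. fourier \<psi> x * u x) \<in> schwartz" by (intro schwartz_mult_slow f\<psi> schwartz_slow u)
    have "distr_fourier T \<psi> = T (\<lambda>x. fourier \<psi> x * u x)"
      using \<psi> u(2)[OF f\<psi>] by (simp add: distr_fourier_def)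
    also have "... = distr_fourier T (inv_fourier (\<lambda>x. fourier \<psi> x * u x))"
      using s by (simp add: distr_fourier_def inv_fourier_schwartz fourier_inv_fourier)
    also have "... = (LINT y|lborel. g y * inv_fourier (\<lambda>x. fourier \<psi> x * u x) y)"
      using rep inv_fourier_schwartz[OF s] by (simp add: represents_def)
    also have "... = (LINT z|lborel. conv g (fourier u) z * \<psi> z)"
      unfolding fourier_product[OF u(1) \<psi>] by (rule conv_duality[OF g fu \<psi>])
    finally show "distr_fourier T \<psi> = (LINT x|lborel. conv g (fourier u) x * \<psi> x)" .
  qed
  then have "ft T = conv g (fourier u)"
    by (rule ft_continuous) (intro smooth_continuous slow_smooth slow)
  then show ?thesis using that fu by blast
qed

section \<open>The Fourier transform of the quasi-projection\<close>

lemma matrix_inv_mult: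
  fixes A :: "real ^ 'd ^ 'd"
  assumes "det A \<noteq> 0"
  shows "A ** matrix_inv A = mat 1" "matrix_inv A ** A = mat 1"
proof -
  have "\<exists>B. A ** B = mat 1 \<and> B ** A = mat 1"
    using assms invertible_det_nz[of A] by (simp add: invertible_def)
  from someI_ex[OF this] show "A ** matrix_inv A = mat 1" "matrix_inv A ** A = mat 1"
    by (simp_all add: matrix_inv_def)
qed

lemma inner_transpose_left:
  fixes A :: "real ^ 'd ^ 'd"
  shows "(transpose A *v x) \<bullet> y = x \<bullet> (A *v y)"
  by (simp add: transpose_matrix_vector dot_lmul_matrix)

lemma echar_transpose:
  fixes A :: "real ^ 'd ^ 'd"
  shows "echar y (transpose A *v x) = echar (A *v y) x"
  unfolding echar_def inner_transpose_left ..

lemma fourier_affine: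
  fixes A :: "real ^ 'd ^ 'd" and b y :: "real ^ 'd"
  assumes \<psi>: "\<psi> \<in> schwartz" and A: "det A \<noteq> 0"
  defines "\<Psi> \<equiv> (\<lambda>z. \<psi> (transpose A *v z) * echar b z)"
  shows "\<Psi> \<in> schwartz" "fourier \<psi> (matrix_inv A *v (y - b)) = complex_of_real \<bar>det A\<bar> * fourier \<Psi> y"
proof -
  note [measurable] = schwartz_measurable[OF \<psi>]
  have "invertible (transpose A)" using A by (simp add: invertible_det_nz)
  from schwartz_echar[OF schwartz_affine[OF this \<psi>, of 0], of b] show "\<Psi> \<in> schwartz"
    by (simp add: \<Psi>_def)
  let ?I = "matrix_inv A"
  let ?K = "\<lambda>x. \<psi> x * echar (?I *v (b - y)) x"
  have AI: "A *v (?I *v (b - y)) = b - y"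
    by (simp only: matrix_vector_mul_assoc matrix_inv_mult[OF A] matrix_vector_mul_lid)
  have "?K (transpose A *v z) = \<Psi> z * echar (- y) z" for z
    unfolding \<Psi>_def echar_transpose AI by (simp add: mult.assoc flip: echar_add_left)
  moreover have "fourier \<psi> (?I *v (y - b)) = (LINT x|lborel. ?K x)"
    by (simp add: fourier_eq matrix_vector_mult_diff_distrib)
  moreover have "(LINT x|lborel. ?K x) = \<bar>det (transpose A)\<bar> *\<^sub>R (LINT z|lborel. ?K (transpose A *v z + 0))"
    by (rule integral_affine_matrix(1)) (use A in auto)
  ultimately show "fourier \<psi> (?I *v (y - b)) = complex_of_real \<bar>det A\<bar> * fourier \<Psi> y"
    by (simp add: fourier_eq scaleR_conv_of_real)
qed

text \<open>Composition with \<open>A\<close> acts on the Fourier side through the inverse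
  transpose, here \<open>C\<close>, and the translation becomes a character. Homogeneity of
  \<open>T\<close> is used to cancel the Jacobian against the normalisation in
  \<open>distr_affine\<close>.\<close>

lemma represents_affine:
  fixes A C :: "real ^ 'd ^ 'd"
  assumes T: "T \<in> tempered" and rep: "represents g (distr_fourier T)"
    and C: "transpose A ** C = mat 1" "C ** transpose A = mat 1"
  shows "represents (\<lambda>\<xi>. complex_of_real (1 / \<bar>det A\<bar>) * (g (C *v \<xi>) * echar b (C *v \<xi>))) (distr_fourier (distr_affine A b T))"
proof -
  have A: "det A \<noteq> 0" and detC: "det C = 1 / det A"
    using det_matrix_inv[OF C(1)] by simp_all
  then have detC0: "det C \<noteq> 0" by simp
  have [measurable]: "g \<in> borel_measurable borel" using rep by (rule represents_measurable)
  have meas: "(\<lambda>\<xi>. complex_of_real (1 / \<bar>det A\<bar>) * (g (C *v \<xi>) * echar b (C *v \<xi>))) \<in> borel_measurable borel"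
    by measurable
  show ?thesis unfolding represents_def
  proof (intro conjI ballI)
    fix \<psi> :: "real ^ 'd \<Rightarrow> complex" assume \<psi>: "\<psi> \<in> schwartz"
    note [measurable] = schwartz_measurable[OF \<psi>]
    define \<Psi> where "\<Psi> = (\<lambda>z. \<psi> (transpose A *v z) * echar b z)"
    have \<Psi>: "\<Psi> \<in> schwartz" and F: "fourier \<psi> (matrix_inv A *v (y - b)) = complex_of_real \<bar>det A\<bar> * fourier \<Psi> y" for y
      unfolding \<Psi>_def using fourier_affine[OF \<psi> A] by blast+
    note [measurable] = schwartz_measurable[OF \<Psi>]
    have int: "integrable lborel (\<lambda>z. g z * \<Psi> z)" and val: "distr_fourier T \<Psi> = (LINT z|lborel. g z * \<Psi> z)"
      using rep \<Psi> by (auto simp: represents_def)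
    have e: "g (C *v \<xi> + 0) * \<Psi> (C *v \<xi> + 0) = (g (C *v \<xi>) * echar b (C *v \<xi>)) * \<psi> \<xi>" for \<xi>
      by (simp only: \<Psi>_def add_0_right matrix_vector_mul_assoc C matrix_vector_mul_lid mult_ac)
    have e': "complex_of_real (1 / \<bar>det A\<bar>) * (g (C *v \<xi>) * echar b (C *v \<xi>)) * \<psi> \<xi>
      = complex_of_real (1 / \<bar>det A\<bar>) * (g (C *v \<xi> + 0) * \<Psi> (C *v \<xi> + 0))" for \<xi>
      unfolding e by (simp only: mult.assoc)
    have int': "integrable lborel (\<lambda>\<xi>. g (C *v \<xi> + 0) * \<Psi> (C *v \<xi> + 0))"
      using integral_affine_matrix(2)[of "\<lambda>z. g z * \<Psi> z" C 0] int detC0 by simp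
    show "integrable lborel (\<lambda>\<xi>. complex_of_real (1 / \<bar>det A\<bar>) * (g (C *v \<xi>) * echar b (C *v \<xi>)) * \<psi> \<xi>)"
      unfolding e' by (rule integrable_mult_right[OF int'])
    have "distr_fourier (distr_affine A b T) \<psi> = T (\<lambda>y. complex_of_real \<bar>det A\<bar> * fourier \<Psi> y) / complex_of_real \<bar>det A\<bar>"
      using \<psi> by (simp add: distr_fourier_def distr_affine_def F)
    also have "... = T (fourier \<Psi>)"
      using A by (simp add: tempered_cmult[OF T fourier_schwartz[OF \<Psi>]])
    also have "... = (LINT z|lborel. g z * \<Psi> z)"
      using val \<Psi> by (simp add: distr_fourier_def)
    also have "... = \<bar>det C\<bar> *\<^sub>R (LINT \<xi>|lborel. g (C *v \<xi> + 0) * \<Psi> (C *v \<xi> + 0))"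
      by (rule integral_affine_matrix(1)) (use detC0 in auto)
    also have "... = (LINT \<xi>|lborel. complex_of_real (1 / \<bar>det A\<bar>) * (g (C *v \<xi>) * echar b (C *v \<xi>)) * \<psi> \<xi>)"
      unfolding e' by (subst integral_mult_right_zero) (simp add: detC scaleR_conv_of_real)
    finally show "distr_fourier (distr_affine A b T) \<psi> = (LINT \<xi>|lborel. complex_of_real (1 / \<bar>det A\<bar>) * (g (C *v \<xi>) * echar b (C *v \<xi>)) * \<psi> \<xi>)" .
  qed (use meas in simp)
qed

text \<open>If the transformed function were Schwartz, transforming it back would make \<psi>
  Schwartz; so the convention of value 0 outside the Schwartz class survives affine
  substitutions.\<close>

lemma distr_affine_outside:
  fixes A :: "real ^ 'd ^ 'd"
  assumes T: "T \<in> tempered" and A: "det A \<noteq> 0" and \<psi>: "\<psi> \<notin> schwartz"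
  shows "distr_affine A b T \<psi> = 0"
proof -
  have "(\<lambda>y. \<psi> (matrix_inv A *v (y - b))) \<notin> schwartz"
  proof
    assume "(\<lambda>y. \<psi> (matrix_inv A *v (y - b))) \<in> schwartz"
    moreover have "invertible A" using A by (simp add: invertible_det_nz)
    ultimately have "(\<lambda>x. \<psi> (matrix_inv A *v (A *v x + b - b))) \<in> schwartz"
      using schwartz_affine[of A "\<lambda>y. \<psi> (matrix_inv A *v (y - b))" b] by simp
    with \<psi> show False by (simp add: matrix_vector_mul_assoc matrix_inv_mult[OF A])
  qed
  then show ?thesis by (simp add: distr_affine_def tempered_outside[OF T])
qed

lemma norm_matrix_le: "norm ((A :: real ^ 'd ^ 'd) *v x) \<le> mat_norm A * norm x"
  unfolding mat_norm_def by (rule onorm[OF matrix_vector_mul_bounded_linear])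

lemma mat_norm_nonneg: "0 \<le> mat_norm (A :: real ^ 'd ^ 'd)"
  unfolding mat_norm_def by (rule onorm_pos_le[OF matrix_vector_mul_bounded_linear])

section \<open>Sobolev weights, Sobolev norms and unconditional sums\<close>

abbreviation wt :: "'a :: real_normed_vector \<Rightarrow> real" where "wt x \<equiv> 1 + (norm x)^2"

lemma weight_powr_nat: "wt x powr real s = wt x ^ s"
  by (rule powr_realpow) (simp add: add_pos_nonneg)

lemma weight_le: "1 + (norm x)^2 \<le> (1 + norm x)^2"
  by (simp add: power2_eq_square algebra_simps)

text \<open>The integrand is split as a b with a = |g| w^(\<sigma>/2) and estimated by a^2 + b^2:
  the first square is integrable by assumption, and the extra s powers in the denominator make the
  second at most the standard integrable weight.\<close>

lemma sobolev_slow_integrable: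
  fixes g :: "real ^ 'd \<Rightarrow> complex"
  assumes [measurable]: "g \<in> borel_measurable borel" and \<sigma>: "- \<sigma> \<le> real s"
    and int: "integrable lborel (\<lambda>\<xi>. (cmod (g \<xi>))^2 * wt \<xi> powr \<sigma>)"
  shows "slow_integrable g"
  unfolding slow_integrable_def
proof (intro conjI exI)
  let ?N = "CARD('d) + 2" and ?w = "\<lambda>x :: real ^ 'd. 1 + (norm x)^2"
  show "integrable lborel (\<lambda>x. cmod (g x) / (1 + norm x) ^ (s + ?N))"
  proof (rule Bochner_Integration.integrable_bound)
    show "integrable lborel (\<lambda>x. (cmod (g x))^2 * ?w x powr \<sigma> + 1 / (1 + norm x) ^ ?N)"
      by (intro Bochner_Integration.integrable_add int integrable_weight)
    have "cmod (g x) / (1 + norm x) ^ (s + ?N) \<le> (cmod (g x))^2 * ?w x powr \<sigma> + 1 / (1 + norm x) ^ ?N" for x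
    proof -
      define a where "a = cmod (g x) * ?w x powr (\<sigma> / 2)"
      define b where "b = ?w x powr (- \<sigma> / 2) / (1 + norm x) ^ (s + ?N)"
      have w1: "?w x \<ge> 1" "?w x > 0" by (auto simp: add_pos_nonneg)
      have "?w x powr (\<sigma> / 2) * ?w x powr (- \<sigma> / 2) = 1"
        using w1 by (simp add: powr_add[symmetric])
      then have ab: "cmod (g x) / (1 + norm x) ^ (s + ?N) = a * b"
        by (simp add: a_def b_def field_simps)
      have a2: "a^2 = (cmod (g x))^2 * ?w x powr \<sigma>"
        using w1 by (simp add: a_def power_mult_distrib power2_eq_square powr_add[symmetric])
      have "(?w x powr (- \<sigma> / 2))^2 = ?w x powr (- \<sigma>)"
        using w1 by (simp add: power2_eq_square powr_add[symmetric])
      also have "... \<le> ?w x powr real s" using w1 \<sigma> by (intro powr_mono) auto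
      also have "... = ?w x ^ s" by (rule weight_powr_nat)
      also have "... \<le> ((1 + norm x)^2) ^ s" using w1 by (intro power_mono weight_le) auto
      finally have "(?w x powr (- \<sigma> / 2))^2 \<le> ((1 + norm x) ^ s)^2" by (simp add: power_mult[symmetric] mult.commute)
      then have "b^2 \<le> ((1 + norm x) ^ s)^2 / ((1 + norm x) ^ (s + ?N))^2"
        unfolding b_def power_divide by (intro divide_right_mono) auto
      also have "... = (1 / (1 + norm x) ^ ?N)^2"
        unfolding power_add[of _ s] by (simp add: power_divide power_mult_distrib del: power_add power_Suc)
      also have "... \<le> 1 / (1 + norm x) ^ ?N"
      proof -
        have "1 / (1 + norm x) ^ ?N \<le> 1" by (simp add: one_le_power del: power_add power_Suc)
        then show ?thesis unfolding power2_eq_square by (intro mult_left_le) auto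
      qed
      finally have "b^2 \<le> 1 / (1 + norm x) ^ ?N" .
      moreover have "a * b \<le> a^2 + b^2"
      proof -
        have "2 * (a * b) \<le> a^2 + b^2" using sum_squares_bound[of a b] by (simp add: mult.assoc)
        moreover have "0 \<le> a^2 + b^2" by simp
        ultimately show ?thesis by linarith
      qed
      ultimately show ?thesis using ab a2 by linarith
    qed
    then show "AE x in lborel. norm (cmod (g x) / (1 + norm x) ^ (s + ?N)) \<le> norm ((cmod (g x))^2 * ?w x powr \<sigma> + 1 / (1 + norm x) ^ ?N)"
      by (auto simp: abs_mult intro!: AE_I2 order_trans[OF _ abs_ge_self] simp del: power_add power_Suc)
  qed measurable
qed measurable

lemma sobolevD:
  assumes "T \<in> sobolev \<sigma>" and \<sigma>: "- \<sigma> \<le> real s"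
  shows "T \<in> tempered" "represents (ft T) (distr_fourier T)" "slow_integrable (ft T)"
    "integrable lborel (\<lambda>\<xi>. (cmod (ft T \<xi>))^2 * wt \<xi> powr \<sigma>)"
proof -
  show T: "T \<in> tempered" and int: "integrable lborel (\<lambda>\<xi>. (cmod (ft T \<xi>))^2 * wt \<xi> powr \<sigma>)"
    using assms by (auto simp: sobolev_def)
  show rep: "represents (ft T) (distr_fourier T)"
    using assms ft_represents by (auto simp: sobolev_def)
  show "slow_integrable (ft T)"
    by (rule sobolev_slow_integrable[OF represents_measurable[OF rep] \<sigma> int])
qed

text \<open>Besides smoothness this records that \<open>ft T\<close> reproduces itself by
  convolution with a Schwartz function; the lattice estimates for \<phi> rest on this
  identity.\<close>

lemma sobolev_compact_support:
  assumes T: "T \<in> sobolev \<sigma>" and \<sigma>: "- \<sigma> \<le> real s" and K: "compact (distr_support T)"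
  obtains \<theta> where "\<theta> \<in> schwartz" "ft T = conv (ft T) \<theta>" "ft T \<in> slow_fun"
proof -
  obtain \<theta> where \<theta>: "\<theta> \<in> schwartz" "ft T = conv (ft T) \<theta>"
    by (rule ft_compact_support[OF sobolevD(1)[OF T \<sigma>] K sobolevD(2)[OF T \<sigma>] sobolevD(3)[OF T \<sigma>]]) blast
  moreover from \<theta> have "ft T \<in> slow_fun" using conv_slow[OF sobolevD(3)[OF T \<sigma>] \<theta>(1)] by simp
  ultimately show ?thesis using that by blast
qed

lemma sobolevI:
  assumes T: "T \<in> tempered" and rep: "represents h (distr_fourier T)"
    and int: "integrable lborel (\<lambda>\<xi>. (cmod (h \<xi>))^2 * wt \<xi> powr \<sigma>)"
  shows "T \<in> sobolev \<sigma>"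
proof -
  have [measurable]: "ft T \<in> borel_measurable borel" "h \<in> borel_measurable borel"
    using ft_represents[OF rep] rep by (auto intro: represents_measurable)
  have "integrable lborel (\<lambda>\<xi>. (cmod (ft T \<xi>))^2 * wt \<xi> powr \<sigma>)"
  proof (subst integrable_cong_AE)
    show "AE \<xi> in lborel. (cmod (ft T \<xi>))^2 * wt \<xi> powr \<sigma> = (cmod (h \<xi>))^2 * wt \<xi> powr \<sigma>"
      using ft_AE[OF rep] by eventually_elim simp
  qed (use int in measurable)
  then show ?thesis using T rep by (auto simp: sobolev_def)
qed

lemma sobolev_norm_eq:
  assumes rep: "represents h (distr_fourier T)"
  shows "sobolev_norm \<sigma> T = sqrt (LINT \<xi>|lborel. (cmod (h \<xi>))^2 * wt \<xi> powr \<sigma>)"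
proof -
  have [measurable]: "ft T \<in> borel_measurable borel" "h \<in> borel_measurable borel"
    using ft_represents[OF rep] rep by (auto intro: represents_measurable)
  have "(LINT \<xi>|lborel. (cmod (ft T \<xi>))^2 * wt \<xi> powr \<sigma>) = (LINT \<xi>|lborel. (cmod (h \<xi>))^2 * wt \<xi> powr \<sigma>)"
  proof (rule integral_cong_AE)
    show "AE \<xi> in lborel. (cmod (ft T \<xi>))^2 * wt \<xi> powr \<sigma> = (cmod (h \<xi>))^2 * wt \<xi> powr \<sigma>"
      using ft_AE[OF rep] by eventually_elim simp
  qed measurable
  then show ?thesis by (simp add: sobolev_norm_def)
qed

lemma sobolev_seminorm_eq:
  assumes rep: "represents h (distr_fourier T)"
  shows "sobolev_seminorm r T = sqrt (LINT \<xi>|lborel. norm \<xi> ^ (2 * r) * (cmod (h \<xi>))^2)"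
proof -
  have [measurable]: "ft T \<in> borel_measurable borel" "h \<in> borel_measurable borel"
    using ft_represents[OF rep] rep by (auto intro: represents_measurable)
  have "(LINT \<xi>|lborel. norm \<xi> ^ (2 * r) * (cmod (ft T \<xi>))^2) = (LINT \<xi>|lborel. norm \<xi> ^ (2 * r) * (cmod (h \<xi>))^2)"
  proof (rule integral_cong_AE)
    show "AE \<xi> in lborel. norm \<xi> ^ (2 * r) * (cmod (ft T \<xi>))^2 = norm \<xi> ^ (2 * r) * (cmod (h \<xi>))^2"
      using ft_AE[OF rep] by eventually_elim simp
  qed measurable
  then show ?thesis by (simp add: sobolev_seminorm_def)
qed

lemma integrable_square_diff:
  fixes g h :: "real ^ 'd \<Rightarrow> complex"
  assumes [measurable]: "g \<in> borel_measurable borel" "h \<in> borel_measurable borel" "w \<in> borel_measurable borel"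
    and w: "\<And>x. w x \<ge> 0"
    and int: "integrable lborel (\<lambda>x. (cmod (g x))^2 * w x)" "integrable lborel (\<lambda>x. (cmod (h x))^2 * w x)"
  shows "integrable lborel (\<lambda>x. (cmod (g x - h x))^2 * w x)"
    and "(cmod (g x - h x))^2 * w x \<le> 2 * ((cmod (g x))^2 * w x) + 2 * ((cmod (h x))^2 * w x)"
proof -
  show le: "(cmod (g x - h x))^2 * w x \<le> 2 * ((cmod (g x))^2 * w x) + 2 * ((cmod (h x))^2 * w x)" for x
  proof -
    have "(cmod (g x - h x))^2 \<le> (cmod (g x) + cmod (h x))^2"
      by (intro power_mono norm_triangle_ineq4) simp
    also have "... \<le> 2 * (cmod (g x))^2 + 2 * (cmod (h x))^2"
      using sum_squares_bound[of "cmod (g x)" "cmod (h x)"] by (simp add: power2_sum)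
    finally have "(cmod (g x - h x))^2 * w x \<le> (2 * (cmod (g x))^2 + 2 * (cmod (h x))^2) * w x"
      by (intro mult_right_mono w)
    then show ?thesis by (simp add: algebra_simps)
  qed
  show "integrable lborel (\<lambda>x. (cmod (g x - h x))^2 * w x)"
  proof (rule Bochner_Integration.integrable_bound)
    show "integrable lborel (\<lambda>x. 2 * ((cmod (g x))^2 * w x) + 2 * ((cmod (h x))^2 * w x))"
      by (intro Bochner_Integration.integrable_add integrable_mult_right int)
    show "AE x in lborel. norm ((cmod (g x - h x))^2 * w x) \<le> norm (2 * ((cmod (g x))^2 * w x) + 2 * ((cmod (h x))^2 * w x))"
      using le w by (intro AE_I2) (simp add: abs_mult)
  qed measurable
qed

text \<open>\<open>quasi_proj\<close> is a definite description, so limits have to be unique. The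
  squared weighted distance of the two Fourier transforms is at most twice the sum of the squared
  errors of any finite partial sum, hence 0, and a tempered distribution is determined by its
  Fourier transform.\<close>

lemma sobolev_has_sum_unique:
  fixes G :: "'k \<Rightarrow> 'd::finite distr"
  assumes S: "sobolev_has_sum (real s) G S" and T: "sobolev_has_sum (real s) G T"
  shows "S = T"
proof -
  let ?w = "\<lambda>\<xi> :: real ^ 'd. wt \<xi> powr real s"
  have s: "- real s \<le> real s" by simp
  note SS = sobolevD[OF conjunct1[OF S[unfolded sobolev_has_sum_def]] s]
  note TT = sobolevD[OF conjunct1[OF T[unfolded sobolev_has_sum_def]] s]
  have GG: "G k \<in> sobolev (real s)" for k using S by (simp add: sobolev_has_sum_def)
  note GD = sobolevD[OF GG s]
  let ?g = "\<lambda>F x. \<Sum>k\<in>F. ft (G k) x"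
  have gm [measurable]: "ft (G k) \<in> borel_measurable borel" "ft S \<in> borel_measurable borel" "ft T \<in> borel_measurable borel" for k
    using represents_measurable SS(2) TT(2) GD(2) by blast+
  have gint: "integrable lborel (\<lambda>x. (cmod (?g F x))^2 * ?w x)" if "finite F" for F
    using that
  proof (induction F)
    case (insert k F)
    have "integrable lborel (\<lambda>x. (cmod (ft (G k) x - (- ?g F x)))^2 * ?w x)"
      by (rule integrable_square_diff) (use GD insert in auto)
    then show ?case using insert by simp
  qed simp
  let ?N = "\<lambda>S F. sobolev_norm (real s) (distr_diff S (\<lambda>\<psi>. \<Sum>k\<in>F. G k \<psi>))"
  have norm: "(?N U F)^2 = (LINT x|lborel. (cmod (ft U x - ?g F x))^2 * ?w x)"
    if "represents (ft U) (distr_fourier U)" for U F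
  proof -
    have "0 \<le> (LINT x|lborel. (cmod (ft U x - ?g F x))^2 * ?w x)" by (intro Bochner_Integration.integral_nonneg) simp
    then show ?thesis
      by (subst sobolev_norm_eq[OF represents_diff[OF that represents_sum[of F "\<lambda>k. ft (G k)" G, OF GD(2)]]]) simp
  qed
  let ?D = "LINT x|lborel. (cmod (ft S x - ft T x))^2 * ?w x"
  have intD: "integrable lborel (\<lambda>x. (cmod (ft S x - ft T x))^2 * ?w x)"
    by (rule integrable_square_diff) (use SS TT in auto)
  have "?D \<le> 2 * (?N S F)^2 + 2 * (?N T F)^2" if F: "finite F" for F
  proof -
    have iS: "integrable lborel (\<lambda>x. (cmod (ft S x - ?g F x))^2 * ?w x)"
      and iT: "integrable lborel (\<lambda>x. (cmod (ft T x - ?g F x))^2 * ?w x)"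
      by (rule integrable_square_diff; use SS TT gint[OF F] in auto)+
    have "?D \<le> (LINT x|lborel. 2 * ((cmod (ft S x - ?g F x))^2 * ?w x) + 2 * ((cmod (ft T x - ?g F x))^2 * ?w x))"
    proof (rule integral_mono[OF intD])
      show "integrable lborel (\<lambda>x. 2 * ((cmod (ft S x - ?g F x))^2 * ?w x) + 2 * ((cmod (ft T x - ?g F x))^2 * ?w x))"
        by (intro Bochner_Integration.integrable_add integrable_mult_right iS iT)
      fix x
      show "(cmod (ft S x - ft T x))^2 * ?w x \<le> 2 * ((cmod (ft S x - ?g F x))^2 * ?w x) + 2 * ((cmod (ft T x - ?g F x))^2 * ?w x)"
        using integrable_square_diff(2)[of "\<lambda>x. ft S x - ?g F x" "\<lambda>x. ft T x - ?g F x" ?w x] iS iT by simp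
    qed
    also have "... = 2 * (?N S F)^2 + 2 * (?N T F)^2"
      unfolding norm[OF SS(2)] norm[OF TT(2)] using iS iT by simp
    finally show ?thesis .
  qed
  then have ev: "\<forall>\<^sub>F F in finite_subsets_at_top UNIV. ?D \<le> 2 * (?N S F)^2 + 2 * (?N T F)^2"
    by (auto simp: eventually_finite_subsets_at_top)
  have "((\<lambda>F. 2 * (?N S F)^2 + 2 * (?N T F)^2) \<longlongrightarrow> 2 * 0^2 + 2 * 0^2) (finite_subsets_at_top UNIV)"
    using S T unfolding sobolev_has_sum_def by (intro tendsto_intros) auto
  then have "?D \<le> 2 * 0^2 + 2 * 0^2"
    by (rule tendsto_lowerbound[OF _ ev]) simp
  moreover have "?D \<ge> 0" by (intro Bochner_Integration.integral_nonneg) simp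
  ultimately have "?D = 0" by simp
  then have "AE x in lborel. (cmod (ft S x - ft T x))^2 * ?w x = 0"
    by (subst (asm) integral_nonneg_eq_0_iff_AE[OF intD]) auto
  then have eq: "AE x in lborel. ft S x = ft T x"
    by eventually_elim (auto simp: add_nonneg_eq_0_iff)
  have "(LINT x|lborel. ft S x * inv_fourier \<psi> x) = (LINT x|lborel. ft T x * inv_fourier \<psi> x)" if "\<psi> \<in> schwartz" for \<psi>
  proof (rule integral_cong_AE)
    have [measurable]: "inv_fourier \<psi> \<in> borel_measurable borel"
      by (intro schwartz_measurable inv_fourier_schwartz that)
    show "(\<lambda>x. ft S x * inv_fourier \<psi> x) \<in> borel_measurable lborel" "(\<lambda>x. ft T x * inv_fourier \<psi> x) \<in> borel_measurable lborel"
      by measurable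
    show "AE x in lborel. ft S x * inv_fourier \<psi> x = ft T x * inv_fourier \<psi> x"
      using eq by eventually_elim simp
  qed
  then show ?thesis
    using tempered_value[OF tempered_outside[OF SS(1)] SS(2)] tempered_value[OF tempered_outside[OF TT(1)] TT(2)]
    by (simp add: fun_eq_iff)
qed

lemma integral_count_finite:
  fixes g :: "'k \<Rightarrow> 'b :: {banach, second_countable_topology}"
  assumes "finite F"
  shows "(LINT k|count_space UNIV. indicator F k *\<^sub>R g k) = sum g F"
    and "integrable (count_space UNIV) (\<lambda>k. indicator F k *\<^sub>R g k)"
proof -
  have e: "indicator F k *\<^sub>R g k = (\<Sum>a\<in>F. indicator {a} k *\<^sub>R g a)" for k
  proof -
    have "(\<Sum>a\<in>F. indicator {a} k *\<^sub>R g a) = (\<Sum>a\<in>F. if k = a then g a else 0)"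
      by (intro sum.cong) (auto simp: indicator_def)
    then show ?thesis using assms by (simp add: indicator_def)
  qed
  have i: "integrable (count_space UNIV) (\<lambda>k. indicator {a} k *\<^sub>R g a)" for a
    by (intro integrable_scaleR_left integrable_real_indicator) auto
  show "integrable (count_space UNIV) (\<lambda>k. indicator F k *\<^sub>R g k)"
    unfolding e by (intro Bochner_Integration.integrable_sum i)
  show "(LINT k|count_space UNIV. indicator F k *\<^sub>R g k) = sum g F"
    unfolding e using integral_count_single[of _ "\<lambda>_. g _"]
    by (subst Bochner_Integration.integral_sum) (auto intro: i simp: integral_count_single)
qed

text \<open>The bound does not involve the unimodular factors \<open>e\<close>. For a Fourier series
  they are the characters at a point, so the convergence is uniform in that point.\<close>

lemma count_tail:
  fixes a e :: "int ^ 'd \<Rightarrow> complex"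
  assumes a: "integrable (count_space UNIV) a" and e: "\<And>k. cmod (e k) = 1" and F: "finite F"
  shows "cmod ((LINT k|count_space UNIV. a k * e k) - (\<Sum>k\<in>F. a k * e k))
    \<le> (LINT k|count_space UNIV. cmod (a k)) - (\<Sum>k\<in>F. cmod (a k))"
proof -
  have ae: "integrable (count_space UNIV) (\<lambda>k. a k * e k)"
    by (rule Bochner_Integration.integrable_bound[OF a]) (auto simp: norm_mult e)
  note I = integral_count_finite[OF F]
  have "(LINT k|count_space UNIV. a k * e k) - (\<Sum>k\<in>F. a k * e k)
     = (LINT k|count_space UNIV. a k * e k - indicator F k *\<^sub>R (a k * e k))"
    unfolding I(1)[of "\<lambda>k. a k * e k", symmetric] by (rule Bochner_Integration.integral_diff[symmetric, OF ae I(2)])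
  also have "cmod ... \<le> (LINT k|count_space UNIV. cmod (a k) - indicator F k *\<^sub>R cmod (a k))"
  proof (rule order_trans[OF integral_norm_bound])
    show "(LINT k|count_space UNIV. cmod (a k * e k - indicator F k *\<^sub>R (a k * e k))) \<le> (LINT k|count_space UNIV. cmod (a k) - indicator F k *\<^sub>R cmod (a k))"
    proof (rule integral_mono)
      show "integrable (count_space UNIV) (\<lambda>k. cmod (a k * e k - indicator F k *\<^sub>R (a k * e k)))"
        by (intro integrable_norm Bochner_Integration.integrable_diff ae I(2))
      show "integrable (count_space UNIV) (\<lambda>k. cmod (a k) - indicator F k *\<^sub>R cmod (a k))"
        by (intro Bochner_Integration.integrable_diff I(2) integrable_norm a)
    qed (simp add: indicator_def norm_mult e)
  qed
  also have "... = (LINT k|count_space UNIV. cmod (a k)) - (\<Sum>k\<in>F. cmod (a k))"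
    unfolding I(1)[of "\<lambda>k. cmod (a k)", symmetric]
    by (rule Bochner_Integration.integral_diff[OF integrable_norm[OF a] I(2)])
  finally show ?thesis .
qed

lemma count_tail_limit:
  fixes a :: "'k \<Rightarrow> complex"
  assumes a: "integrable (count_space UNIV) a"
  shows "((\<lambda>F. (LINT k|count_space UNIV. cmod (a k)) - (\<Sum>k\<in>F. cmod (a k))) \<longlongrightarrow> 0) (finite_subsets_at_top UNIV)"
proof -
  let ?b = "\<lambda>k. cmod (a k)"
  have b: "Infinite_Set_Sum.abs_summable_on ?b UNIV"
    unfolding Infinite_Set_Sum.abs_summable_on_def by (rule integrable_norm[OF a])
  then have "(\<lambda>k. norm (?b k)) summable_on UNIV"
    by (simp only: abs_summable_equivalent)
  then have "?b summable_on UNIV" by simp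
  then have "(?b has_sum infsum ?b UNIV) UNIV" by (rule has_sum_infsum)
  moreover have "infsum ?b UNIV = (LINT k|count_space UNIV. ?b k)"
    using infsetsum_infsum[OF b] by (simp add: infsetsum_def)
  ultimately have "(sum ?b \<longlongrightarrow> (LINT k|count_space UNIV. ?b k)) (finite_subsets_at_top UNIV)"
    by (simp add: has_sum_def)
  from tendsto_diff[OF tendsto_const[of "LINT k|count_space UNIV. ?b k"] this] show ?thesis by simp
qed

lemma slow_cnj:
  fixes g :: "real ^ 'd \<Rightarrow> complex"
  assumes "g \<in> slow_fun" shows "(\<lambda>x. cnj (g x)) \<in> slow_fun"
proof (rule slow_coinduct[where X="(\<lambda>g x. cnj (g x)) ` slow_fun"])
  fix F :: "real ^ 'd \<Rightarrow> complex" assume "F \<in> (\<lambda>g x. cnj (g x)) ` slow_fun"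
  then obtain g where F: "F = (\<lambda>x. cnj (g x))" and g: "g \<in> slow_fun" by auto
  have d: "((\<lambda>x. cnj (g x)) has_derivative (\<lambda>h. cnj (frechet_derivative g (at x) h))) (at x)" for x
    by (intro bounded_linear.has_derivative[OF bounded_linear_cnj] differentiable_derivative
        smooth_differentiable slow_smooth g)
  show "F differentiable (at x)" for x unfolding F differentiable_def using d by blast
  show "partial_deriv i F \<in> (\<lambda>g x. cnj (g x)) ` slow_fun" for i
  proof (rule image_eqI)
    show "partial_deriv i F = (\<lambda>x. cnj (partial_deriv i g x))"
      unfolding F by (rule ext, subst partial_deriv_eq[OF d]) (simp add: partial_deriv_def)
  qed (rule slow_partial_deriv[OF g])
  obtain N C where "C \<ge> 0" "\<And>x. cmod (iter_partial [] g x) \<le> C * (1 + norm x) ^ N"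
    using slow_bound[OF g, of "[]"] by blast
  then show "\<exists>N C. \<forall>x. cmod (F x) \<le> C * (1 + norm x) ^ N" unfolding F by auto
qed (use assms in auto)

lemma slow_growth: "g \<in> slow_fun ==> \<exists>N C. \<forall>x. cmod (g x) \<le> C * (1 + norm x) ^ N"
  using slow_bound[of g "[]"] by (metis iter_partial_Nil)

lemma measurable_cnj [measurable]: "cnj \<in> borel_measurable borel"
  by (intro borel_measurable_continuous_onI continuous_intros)

section \<open>A single quasi-projection on the Fourier side\<close>

locale quasi_projection =
  fixes M :: "int ^ 'd ^ 'd" and s :: nat and \<phi> \<phi>' :: "'d distr" and f :: "real ^ 'd \<Rightarrow> complex"
    and j :: int and A C :: "real ^ 'd ^ 'd"
  assumes \<phi>: "\<phi> \<in> sobolev (real s)" and \<phi>': "\<phi>' \<in> sobolev (- real s)"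
    and slow: "ft \<phi> \<in> slow_fun" "ft \<phi>' \<in> slow_fun"
    and f: "f \<in> schwartz"
    and A: "A = mat_powi (real_mat M) j"
    and detA: "\<bar>det A\<bar> = absdet M powr real_of_int j"
    and AC: "transpose A ** C = mat 1"
begin

text \<open>Chosen so that the coefficient of the quasi-projection at k is \<open>c\<close> times
  the Fourier transform of \<open>u\<close> at k.\<close>

definition u :: "real ^ 'd \<Rightarrow> complex" where
  "u \<tau> = fourier f (transpose A *v \<tau>) * cnj (ft \<phi>' \<tau>)"

definition c :: real where "c = absdet M powr (real_of_int j / 2)"

text \<open>The Fourier transform that the quasi-projection should have: formal summation of the
  series gives \<phi>^ times a Fourier series, which Poisson summation identifies with the
  periodization of \<open>u\<close>.\<close>

definition h :: "real ^ 'd \<Rightarrow> complex" where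
  "h \<xi> = ft \<phi> (C *v \<xi>) * periodize u (C *v \<xi>)"

lemma det_nz: "det A \<noteq> 0" and det_C: "det C = 1 / det A"
  using det_matrix_inv[OF AC] by simp_all

lemma CA: "C ** transpose A = mat 1"
  using AC by (simp add: matrix_left_right_inverse)

lemma c_square: "c * c = \<bar>det A\<bar>"
  by (simp add: c_def detA powr_add[symmetric])

lemma c_pos: "c > 0"
  using c_square det_nz by (cases "c = 0") (auto simp: c_def)

lemma AC_apply [simp]: "transpose A *v (C *v x) = x" "C *v (transpose A *v x) = x"
  by (simp_all only: matrix_vector_mul_assoc AC CA matrix_vector_mul_lid)

lemma AC_apply' [simp]: "(C *v x) v* A = x" "C *v (x v* A) = x"
  using AC_apply unfolding transpose_matrix_vector by simp_all

lemma u_schwartz: "u \<in> schwartz"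
proof -
  have "invertible (transpose A)" using det_nz by (simp add: invertible_det_nz)
  from schwartz_affine[OF this fourier_schwartz[OF f], of 0]
  have "(\<lambda>\<tau>. fourier f (transpose A *v \<tau>)) \<in> schwartz" by simp
  then show ?thesis unfolding u_def[abs_def] by (intro schwartz_mult_slow slow_cnj slow)
qed

lemma s_ge: "- real s \<le> real s" "- (- real s) \<le> real s" by simp_all

lemmas \<phi>D = sobolevD[OF \<phi> s_ge(1)]
lemmas \<phi>'D = sobolevD[OF \<phi>' s_ge(2)]

lemma measurable_ft [measurable]: "ft \<phi> \<in> borel_measurable borel" "ft \<phi>' \<in> borel_measurable borel"
  using slow by (auto intro: slow_measurable)

lemma measurable_fourier [measurable]: "fourier f \<in> borel_measurable borel" "u \<in> borel_measurable borel"
  by (intro schwartz_measurable fourier_schwartz f u_schwartz)+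

lemma represents_dilate:
  assumes "T \<in> tempered" "represents g (distr_fourier T)"
  shows "represents (\<lambda>\<xi>. complex_of_real (1 / c) * (g (C *v \<xi>) * echar (real_vec k) (C *v \<xi>)))
    (distr_fourier (dilate_shift M j k T))"
proof -
  have "represents (\<lambda>\<xi>. complex_of_real c * (complex_of_real (1 / \<bar>det A\<bar>) * (g (C *v \<xi>) * echar (real_vec k) (C *v \<xi>))))
    (distr_fourier (dilate_shift M j k T))"
    unfolding dilate_shift_def c_def[symmetric] A[symmetric] scaleR_conv_of_real
    by (intro represents_cmult represents_affine assms AC CA)
  moreover have "complex_of_real c * (complex_of_real (1 / \<bar>det A\<bar>) * z) = complex_of_real (1 / c) * z" for z
    unfolding c_square[symmetric] using c_pos by simp
  ultimately show ?thesis by simp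
qed

text \<open>The substitution \<tau> = C \<xi> turns the pairing into a Fourier integral of
  \<open>u\<close>; the Jacobian |det A| = c^2 against the normalisation 1/c leaves one factor
  c.\<close>

lemma coefficient: "pairing (distr_of f) (dilate_shift M j k \<phi>') = complex_of_real c * fourier u (real_vec k)"
proof -
  note rep = represents_dilate[OF \<phi>'D(1,2), of k]
  note [measurable] =
    represents_measurable[OF rep] represents_measurable[OF ft_represents[OF rep]]
  have "pairing (distr_of f) (dilate_shift M j k \<phi>') = (LINT \<xi>|lborel. fourier f \<xi> * cnj (complex_of_real (1 / c) * (ft \<phi>' (C *v \<xi>) * echar (real_vec k) (C *v \<xi>))))"
    unfolding pairing_def fourier_distr_of(2)[OF f]
  proof (rule integral_cong_AE)
    show "AE \<xi> in lborel. fourier f \<xi> * cnj (ft (dilate_shift M j k \<phi>') \<xi>) = fourier f \<xi> * cnj (complex_of_real (1 / c) * (ft \<phi>' (C *v \<xi>) * echar (real_vec k) (C *v \<xi>)))"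
      using ft_AE[OF rep] by eventually_elim simp
    show "(\<lambda>\<xi>. fourier f \<xi> * cnj (ft (dilate_shift M j k \<phi>') \<xi>)) \<in> borel_measurable lborel"
      "(\<lambda>\<xi>. fourier f \<xi> * cnj (complex_of_real (1 / c) * (ft \<phi>' (C *v \<xi>) * echar (real_vec k) (C *v \<xi>)))) \<in> borel_measurable lborel"
      unfolding measurable_lborel1 by measurable
  qed
  also have "... = (LINT \<xi>|lborel. complex_of_real (1 / c) * (u (C *v \<xi>) * echar (- real_vec k) (C *v \<xi>)))"
    by (intro Bochner_Integration.integral_cong refl) (simp add: u_def cnj_echar mult_ac)
  also have "... = complex_of_real (1 / c) * (LINT \<xi>|lborel. u (C *v \<xi>) * echar (- real_vec k) (C *v \<xi>))"
    by (rule integral_mult_right_zero)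
  also have "(LINT \<xi>|lborel. u (C *v \<xi>) * echar (- real_vec k) (C *v \<xi>)) = complex_of_real (c * c) * fourier u (real_vec k)"
  proof -
    have "fourier u (real_vec k) = \<bar>det C\<bar> *\<^sub>R (LINT \<xi>|lborel. u (C *v \<xi> + 0) * echar (- real_vec k) (C *v \<xi> + 0))"
      unfolding fourier_eq by (rule integral_affine_matrix(1)) (use det_C det_nz in auto)
    also have "\<bar>det C\<bar> = 1 / (c * c)" by (simp add: det_C c_square)
    finally show ?thesis using c_pos by (simp add: scaleR_conv_of_real)
  qed
  finally show ?thesis using c_pos by simp
qed

definition G :: "int ^ 'd \<Rightarrow> 'd distr" where
  "G k = (\<lambda>\<psi>. pairing (distr_of f) (dilate_shift M j k \<phi>') * dilate_shift M j k \<phi> \<psi>)"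

text \<open>The factor c of the coefficient cancels the factor 1/c from the Fourier transform of the
  dilated \<phi>.\<close>

lemma represents_G:
  "represents (\<lambda>\<xi>. fourier u (real_vec k) * (ft \<phi> (C *v \<xi>) * echar (real_vec k) (C *v \<xi>))) (distr_fourier (G k))"
proof -
  have "represents (\<lambda>\<xi>. (complex_of_real c * fourier u (real_vec k)) * (complex_of_real (1 / c) * (ft \<phi> (C *v \<xi>) * echar (real_vec k) (C *v \<xi>))))
     (distr_fourier (G k))"
    unfolding G_def coefficient by (intro represents_cmult represents_dilate \<phi>D)
  moreover have "(complex_of_real c * a) * (complex_of_real (1 / c) * z) = a * z" for a z
    using c_pos by simp
  ultimately show ?thesis by simp
qed

lemma weight_transpose:
  "wt \<xi> powr real s \<le> (1 + (mat_norm (transpose A))^2) ^ s * wt (C *v \<xi>) powr real s"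
proof -
  let ?a = "mat_norm (transpose A)" and ?n = "norm (C *v \<xi>)"
  have "norm \<xi> \<le> ?a * ?n"
    using norm_matrix_le[of "transpose A" "C *v \<xi>"] unfolding AC_apply .
  then have "(norm \<xi>)^2 \<le> (?a * ?n)^2" by (rule power_mono) simp
  moreover have "(1 + ?a^2) * (1 + ?n^2) = 1 + ?a^2 + ?n^2 + (?a * ?n)^2"
    by (simp add: algebra_simps power_mult_distrib)
  moreover have "?a^2 \<ge> 0" "?n^2 \<ge> 0" by simp_all
  ultimately have "1 + (norm \<xi>)^2 \<le> (1 + ?a^2) * (1 + ?n^2)" by linarith
  then have "wt \<xi> ^ s \<le> ((1 + ?a^2) * (1 + ?n^2)) ^ s"
    by (rule power_mono) (simp add: add_nonneg_nonneg)
  then show ?thesis unfolding weight_powr_nat power_mult_distrib .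
qed

lemma integrable_dilated:
  "integrable lborel (\<lambda>\<xi>. (cmod (ft \<phi> (C *v \<xi>)))^2 * wt \<xi> powr real s)"
proof (rule Bochner_Integration.integrable_bound)
  let ?K = "(1 + (mat_norm (transpose A))^2) ^ s"
  have "integrable lborel (\<lambda>\<xi>. (cmod (ft \<phi> (C *v \<xi> + 0)))^2 * wt (C *v \<xi> + 0) powr real s)"
    using integral_affine_matrix(2)[of "\<lambda>\<xi>. (cmod (ft \<phi> \<xi>))^2 * wt \<xi> powr real s" C 0] \<phi>D(4) det_C det_nz
    by simp
  then show "integrable lborel (\<lambda>\<xi>. ?K * ((cmod (ft \<phi> (C *v \<xi>)))^2 * wt (C *v \<xi>) powr real s))"
    by (intro integrable_mult_right) simp
  show "AE \<xi> in lborel. norm ((cmod (ft \<phi> (C *v \<xi>)))^2 * wt \<xi> powr real s)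
    \<le> norm (?K * ((cmod (ft \<phi> (C *v \<xi>)))^2 * wt (C *v \<xi>) powr real s))"
  proof (rule AE_I2)
    fix \<xi> :: "real ^ 'd"
    have "(cmod (ft \<phi> (C *v \<xi>)))^2 * wt \<xi> powr real s \<le> (cmod (ft \<phi> (C *v \<xi>)))^2 * (?K * wt (C *v \<xi>) powr real s)"
      by (intro mult_left_mono weight_transpose) simp
    then show "norm ((cmod (ft \<phi> (C *v \<xi>)))^2 * wt \<xi> powr real s)
      \<le> norm (?K * ((cmod (ft \<phi> (C *v \<xi>)))^2 * wt (C *v \<xi>) powr real s))"
      by (simp add: abs_mult mult.left_commute)
  qed
qed measurable

lemma periodize_measurable [measurable]: "periodize u \<in> borel_measurable borel"
  using continuous_periodize[OF u_schwartz]
  by (intro borel_measurable_continuous_onI) (simp add: continuous_at_imp_continuous_on)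

lemma h_measurable [measurable]: "h \<in> borel_measurable borel"
  unfolding h_def[abs_def] by measurable

lemma integrable_coefficients: "integrable (count_space UNIV) (\<lambda>k. fourier u (real_vec k))"
  using integrable_fourier_lattice[OF u_schwartz, of 0] by simp

lemma periodize_error:
  assumes "finite F"
  shows "cmod (periodize u t - (\<Sum>k\<in>F. fourier u (real_vec k) * echar (real_vec k) t))
    \<le> (LINT k|count_space UNIV. cmod (fourier u (real_vec k))) - (\<Sum>k\<in>F. cmod (fourier u (real_vec k)))"
  unfolding poisson_summation[OF u_schwartz]
  by (rule count_tail[OF integrable_coefficients _ assms]) simp

lemma integrable_factor:
  assumes [measurable]: "p \<in> borel_measurable borel" and B: "\<And>t. cmod (p t) \<le> B"
  shows "integrable lborel (\<lambda>\<xi>. (cmod (ft \<phi> (C *v \<xi>) * p (C *v \<xi>)))^2 * wt \<xi> powr real s)"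
    and "(LINT \<xi>|lborel. (cmod (ft \<phi> (C *v \<xi>) * p (C *v \<xi>)))^2 * wt \<xi> powr real s)
      \<le> B^2 * (LINT \<xi>|lborel. (cmod (ft \<phi> (C *v \<xi>)))^2 * wt \<xi> powr real s)"
proof -
  have le: "(cmod (ft \<phi> (C *v \<xi>) * p (C *v \<xi>)))^2 * wt \<xi> powr real s
    \<le> B^2 * ((cmod (ft \<phi> (C *v \<xi>)))^2 * wt \<xi> powr real s)" for \<xi>
  proof -
    have "(cmod (p (C *v \<xi>)))^2 \<le> B^2" by (intro power_mono B) simp
    then have "(cmod (p (C *v \<xi>)))^2 * ((cmod (ft \<phi> (C *v \<xi>)))^2 * wt \<xi> powr real s)
      \<le> B^2 * ((cmod (ft \<phi> (C *v \<xi>)))^2 * wt \<xi> powr real s)"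
      by (rule mult_right_mono) simp
    then show ?thesis by (simp add: norm_mult power_mult_distrib mult_ac)
  qed
  show int: "integrable lborel (\<lambda>\<xi>. (cmod (ft \<phi> (C *v \<xi>) * p (C *v \<xi>)))^2 * wt \<xi> powr real s)"
  proof (rule Bochner_Integration.integrable_bound)
    show "integrable lborel (\<lambda>\<xi>. B^2 * ((cmod (ft \<phi> (C *v \<xi>)))^2 * wt \<xi> powr real s))"
      by (intro integrable_mult_right integrable_dilated)
    show "AE \<xi> in lborel. norm ((cmod (ft \<phi> (C *v \<xi>) * p (C *v \<xi>)))^2 * wt \<xi> powr real s)
      \<le> norm (B^2 * ((cmod (ft \<phi> (C *v \<xi>)))^2 * wt \<xi> powr real s))"
      using le by (intro AE_I2) (simp add: abs_mult)
  qed measurable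
  have "(LINT \<xi>|lborel. (cmod (ft \<phi> (C *v \<xi>) * p (C *v \<xi>)))^2 * wt \<xi> powr real s)
    \<le> (LINT \<xi>|lborel. B^2 * ((cmod (ft \<phi> (C *v \<xi>)))^2 * wt \<xi> powr real s))"
    by (rule integral_mono[OF int integrable_mult_right[OF integrable_dilated] le])
  also have "... = B^2 * (LINT \<xi>|lborel. (cmod (ft \<phi> (C *v \<xi>)))^2 * wt \<xi> powr real s)"
    by (rule integral_mult_right_zero)
  finally show "(LINT \<xi>|lborel. (cmod (ft \<phi> (C *v \<xi>) * p (C *v \<xi>)))^2 * wt \<xi> powr real s)
      \<le> B^2 * (LINT \<xi>|lborel. (cmod (ft \<phi> (C *v \<xi>)))^2 * wt \<xi> powr real s)" .
qed

lemma periodize_bounded: "cmod (periodize u t) \<le> (LINT k|count_space UNIV. cmod (fourier u (real_vec k)))"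
  using periodize_error[of "{}" t] by simp

lemma integrable_h: "integrable lborel (\<lambda>\<xi>. (cmod (h \<xi>))^2 * wt \<xi> powr real s)"
  unfolding h_def by (rule integrable_factor(1)[OF _ periodize_bounded]) measurable

definition Q :: "'d distr" where
  "Q = (\<lambda>\<psi>. if \<psi> \<in> schwartz then (LINT x|lborel. h x * inv_fourier \<psi> x) else 0)"

lemma h_slow_integrable: "slow_integrable h"
  by (rule sobolev_slow_integrable[OF h_measurable _ integrable_h, of s]) simp

lemma Q_tempered: "Q \<in> tempered" and represents_Q: "represents h (distr_fourier Q)"
  unfolding Q_def using inverse_transform_tempered[OF h_slow_integrable] by blast+

lemma G_sobolev: "G k \<in> sobolev (real s)"
proof (rule sobolevI[OF _ represents_G])
  have eq: "fourier u (real_vec k) * (ft \<phi> (C *v \<xi>) * echar (real_vec k) (C *v \<xi>)) =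
    ft \<phi> (C *v \<xi>) * (fourier u (real_vec k) * echar (real_vec k) (C *v \<xi>))" for \<xi>
    by (simp add: mult_ac)
  show int: "integrable lborel (\<lambda>\<xi>. (cmod (fourier u (real_vec k) * (ft \<phi> (C *v \<xi>) * echar (real_vec k) (C *v \<xi>))))^2 * wt \<xi> powr real s)"
    unfolding eq
    by (rule integrable_factor(1)[where B="cmod (fourier u (real_vec k))"]) (auto simp: norm_mult)
  show "G k \<in> tempered"
  proof (rule tempered_if_represents[OF _ represents_G])
    show "G k \<psi> = 0" if "\<psi> \<notin> schwartz" for \<psi>
      using distr_affine_outside[OF \<phi>D(1) det_nz that] by (simp add: G_def dilate_shift_def A)
    show "slow_integrable (\<lambda>\<xi>. fourier u (real_vec k) * (ft \<phi> (C *v \<xi>) * echar (real_vec k) (C *v \<xi>)))"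
      by (rule sobolev_slow_integrable[OF _ _ int, of s]) auto
  qed
qed

lemma represents_Q_minus:
  "represents (\<lambda>\<xi>. ft \<phi> (C *v \<xi>) * (periodize u (C *v \<xi>) - (\<Sum>k\<in>F. fourier u (real_vec k) * echar (real_vec k) (C *v \<xi>))))
    (distr_fourier (distr_diff Q (\<lambda>\<psi>. \<Sum>k\<in>F. G k \<psi>)))"
proof -
  have "represents (\<lambda>\<xi>. h \<xi> - (\<Sum>k\<in>F. fourier u (real_vec k) * (ft \<phi> (C *v \<xi>) * echar (real_vec k) (C *v \<xi>))))
    (distr_fourier (distr_diff Q (\<lambda>\<psi>. \<Sum>k\<in>F. G k \<psi>)))"
    by (intro represents_diff represents_sum represents_Q represents_G)
  moreover have "h \<xi> - (\<Sum>k\<in>F. fourier u (real_vec k) * (ft \<phi> (C *v \<xi>) * echar (real_vec k) (C *v \<xi>)))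
    = ft \<phi> (C *v \<xi>) * (periodize u (C *v \<xi>) - (\<Sum>k\<in>F. fourier u (real_vec k) * echar (real_vec k) (C *v \<xi>)))" for \<xi>
    by (simp add: h_def right_diff_distrib sum_distrib_left mult_ac)
  ultimately show ?thesis by simp
qed

text \<open>The partial sums converge to the periodization uniformly, and the dilated \<phi>^ has
  finite weighted norm; so the Sobolev error is at most the tail of the coefficient sum times a
  constant.\<close>

lemma has_sum_Q: "sobolev_has_sum (real s) G Q"
proof -
  let ?W = "LINT \<xi>|lborel. (cmod (ft \<phi> (C *v \<xi>)))^2 * wt \<xi> powr real s"
  let ?t = "\<lambda>F. (LINT k|count_space UNIV. cmod (fourier u (real_vec k))) - (\<Sum>k\<in>F. cmod (fourier u (real_vec k)))"
  let ?N = "\<lambda>F. sobolev_norm (real s) (distr_diff Q (\<lambda>\<psi>. \<Sum>k\<in>F. G k \<psi>))"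
  have "?N F \<le> ?t F * sqrt ?W" if F: "finite F" for F
  proof -
    have t0: "?t F \<ge> 0" using order_trans[OF norm_ge_zero periodize_error[OF F]] .
    have "?N F \<le> sqrt ((?t F)^2 * ?W)"
      unfolding sobolev_norm_eq[OF represents_Q_minus]
      by (intro real_sqrt_le_mono integrable_factor(2)[OF _ periodize_error[OF F]]) measurable
    then show ?thesis using t0 by (simp add: real_sqrt_mult)
  qed
  then have le: "\<forall>\<^sub>F F in finite_subsets_at_top UNIV. ?N F \<le> ?t F * sqrt ?W"
    by (auto simp: eventually_finite_subsets_at_top)
  have "((\<lambda>F. ?t F * sqrt ?W) \<longlongrightarrow> 0 * sqrt ?W) (finite_subsets_at_top UNIV)"
    by (intro tendsto_mult tendsto_const count_tail_limit integrable_coefficients)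
  then have "((\<lambda>F. ?t F * sqrt ?W) \<longlongrightarrow> 0) (finite_subsets_at_top UNIV)" by simp
  then have "(?N \<longlongrightarrow> 0) (finite_subsets_at_top UNIV)"
    by (rule tendsto_sandwich[rotated 2, OF tendsto_const])
       (use le in \<open>auto simp: sobolev_norm_def intro!: always_eventually Bochner_Integration.integral_nonneg\<close>)
  moreover have "Q \<in> sobolev (real s)"
    by (rule sobolevI[OF Q_tempered represents_Q integrable_h])
  ultimately show ?thesis using G_sobolev by (simp add: sobolev_has_sum_def)
qed

lemma quasi_proj_eq: "quasi_proj M s \<phi> \<phi>' j (distr_of f) = Q"
  unfolding quasi_proj_def G_def[symmetric, abs_def]
  using has_sum_Q sobolev_has_sum_unique by (intro the_equality) auto

lemma integrable_fourier_weight: "integrable lborel (\<lambda>\<xi>. (cmod (fourier f \<xi>))^2 * wt \<xi> powr real s)"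
proof -
  note F = fourier_schwartz[OF f]
  obtain B where B: "B \<ge> 0" "\<And>x. cmod (fourier f x) \<le> B / (1 + norm x) ^ 0"
    using schwartz_bound0[OF F, of 0] by blast
  have "integrable lborel (\<lambda>\<xi>. cmod (fourier f \<xi> * (fourier f \<xi> * of_real (wt \<xi> ^ s))))"
  proof (rule integrable_norm, rule schwartz_integrable_bound(1)[OF F])
    show "cmod (fourier f \<xi> * of_real (wt \<xi> ^ s)) \<le> B * (1 + norm \<xi>) ^ (2 * s)" for \<xi>
    proof -
      have "wt \<xi> ^ s \<le> ((1 + norm \<xi>)^2) ^ s"
        by (intro power_mono weight_le) (simp add: add_nonneg_nonneg)
      then have "cmod (fourier f \<xi>) * wt \<xi> ^ s \<le> B * ((1 + norm \<xi>)^2) ^ s"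
        using B(1) B(2)[of \<xi>] by (intro mult_mono) auto
      then show ?thesis
        unfolding norm_mult norm_of_real power_mult by (simp add: abs_of_nonneg add_nonneg_nonneg)
    qed
  qed measurable
  moreover have "cmod (fourier f \<xi> * (fourier f \<xi> * of_real (wt \<xi> ^ s))) = (cmod (fourier f \<xi>))^2 * wt \<xi> powr real s" for \<xi>
    unfolding weight_powr_nat norm_mult norm_of_real
    by (simp add: abs_of_nonneg add_nonneg_nonneg power2_eq_square)
  ultimately show ?thesis by simp
qed

lemma integrable_error:
  assumes "r \<le> s"
  shows "integrable lborel (\<lambda>\<xi>. norm \<xi> ^ (2 * r) * (cmod (fourier f \<xi> - h \<xi>))^2)"
proof (rule Bochner_Integration.integrable_bound)
  show "integrable lborel (\<lambda>\<xi>. (cmod (fourier f \<xi> - h \<xi>))^2 * wt \<xi> powr real s)"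
    by (rule integrable_square_diff) (use integrable_fourier_weight integrable_h in auto)
  have "norm \<xi> ^ (2 * r) \<le> wt \<xi> powr real s" for \<xi> :: "real ^ 'd"
  proof -
    have "norm \<xi> ^ (2 * r) \<le> wt \<xi> ^ r"
      unfolding power_mult by (intro power_mono) auto
    also have "... \<le> wt \<xi> ^ s" by (rule power_increasing[OF assms]) simp
    finally show ?thesis unfolding weight_powr_nat .
  qed
  then have "norm \<xi> ^ (2 * r) * (cmod (fourier f \<xi> - h \<xi>))^2 \<le> (cmod (fourier f \<xi> - h \<xi>))^2 * wt \<xi> powr real s" for \<xi>
    by (subst mult.commute, intro mult_left_mono) auto
  then show "AE \<xi> in lborel. norm (norm \<xi> ^ (2 * r) * (cmod (fourier f \<xi> - h \<xi>))^2)
    \<le> norm ((cmod (fourier f \<xi> - h \<xi>))^2 * wt \<xi> powr real s)"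
    by (intro AE_I2) (simp add: abs_mult)
qed measurable

text \<open>The substitution of the transpose of \<open>A\<close> applied to t for \<xi> undoes the
  dilation, so that the periodization is evaluated at t itself and the integral can be tiled by unit
  cubes.\<close>

lemma error_formula:
  "sobolev_seminorm r (distr_diff (distr_of f) (quasi_proj M s \<phi> \<phi>' j (distr_of f))) =
     sqrt (\<bar>det A\<bar> * (LINT t|lborel. norm (transpose A *v t) ^ (2 * r) *
       (cmod (fourier f (transpose A *v t) - ft \<phi> t * periodize u t))^2))" (is ?eq)
  and error_integrable: "r \<le> s ==> integrable lborel (\<lambda>t. norm (transpose A *v t) ^ (2 * r) *
       (cmod (fourier f (transpose A *v t) - ft \<phi> t * periodize u t))^2)"
proof -
  let ?F = "\<lambda>\<xi>. norm \<xi> ^ (2 * r) * (cmod (fourier f \<xi> - h \<xi>))^2"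
  have e: "?F (transpose A *v t + 0) = norm (transpose A *v t) ^ (2 * r) *
       (cmod (fourier f (transpose A *v t) - ft \<phi> t * periodize u t))^2" for t
    by (simp only: add_0_right h_def AC_apply)
  have dt: "det (transpose A) \<noteq> 0" using det_nz by simp
  have "sobolev_seminorm r (distr_diff (distr_of f) Q) = sqrt (LINT \<xi>|lborel. ?F \<xi>)"
    by (rule sobolev_seminorm_eq[OF represents_diff[OF fourier_distr_of(1)[OF f] represents_Q]])
  also have "(LINT \<xi>|lborel. ?F \<xi>) = \<bar>det (transpose A)\<bar> *\<^sub>R (LINT t|lborel. ?F (transpose A *v t + 0))"
    by (rule integral_affine_matrix(1)[OF _ dt]) measurable
  finally show ?eq unfolding quasi_proj_eq e by simp
  assume "r \<le> s"
  from integrable_error[OF this] have "integrable lborel (\<lambda>t. ?F (transpose A *v t + 0))"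
    by (subst (asm) integral_affine_matrix(2)[OF _ dt, of _ 0]) measurable
  then show "integrable lborel (\<lambda>t. norm (transpose A *v t) ^ (2 * r) *
       (cmod (fourier f (transpose A *v t) - ft \<phi> t * periodize u t))^2)"
    unfolding e .
qed

end

section \<open>Powers of dilation matrices\<close>

text \<open>With L = e/2, once b is below (1 - q) L the recursion gives a(k + 1) - L \<le> q (a(k) -
  L), so the excess over L decays geometrically.\<close>

lemma contracting_recursion_tendsto_0:
  fixes a b :: "nat \<Rightarrow> real"
  assumes a: "\<And>k. 0 \<le> a k" and q: "0 \<le> q" "q < 1"
    and step: "\<And>k. a (Suc k) \<le> q * (a k + b k)" and b: "b \<longlonglongrightarrow> 0"
  shows "a \<longlonglongrightarrow> 0"
proof (rule LIMSEQ_I)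
  fix e :: real assume e: "e > 0"
  define L where "L = e / 2"
  have "(1 - q) * L > 0" using q e by (simp add: L_def)
  from LIMSEQ_D[OF b this] obtain K where K: "\<And>k. k \<ge> K ==> \<bar>b k\<bar> < (1 - q) * L" by auto
  have bound: "a (K + m) - L \<le> q ^ m * \<bar>a K - L\<bar>" for m
  proof (induction m)
    case (Suc m)
    have "q * b (K + m) \<le> 1 * ((1 - q) * L)"
    proof -
      have "q * b (K + m) \<le> q * ((1 - q) * L)" using K[of "K + m"] q by (intro mult_left_mono) auto
      also have "... \<le> 1 * ((1 - q) * L)" using q e by (intro mult_right_mono) (auto simp: L_def)
      finally show ?thesis .
    qed
    then have "a (K + Suc m) - L \<le> q * (a (K + m) - L)"
      using step[of "K + m"] by (simp add: algebra_simps)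
    also have "... \<le> q * (q ^ m * \<bar>a K - L\<bar>)" by (rule mult_left_mono[OF Suc q(1)])
    finally show ?case by (simp add: mult_ac)
  qed simp
  have "(\<lambda>m. q ^ m * \<bar>a K - L\<bar>) \<longlonglongrightarrow> 0 * \<bar>a K - L\<bar>"
    using q by (intro tendsto_mult tendsto_const LIMSEQ_realpow_zero)
  then have "(\<lambda>m. q ^ m * \<bar>a K - L\<bar>) \<longlonglongrightarrow> 0" by simp
  from LIMSEQ_D[OF this, of L] e obtain m0 where m0: "\<And>m. m \<ge> m0 ==> \<bar>q ^ m * \<bar>a K - L\<bar>\<bar> < L"
    by (auto simp: L_def)
  have "norm (a n - 0) < e" if "n \<ge> K + m0" for n
  proof -
    have "a n - L \<le> q ^ (n - K) * \<bar>a K - L\<bar>" using bound[of "n - K"] that by simp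
    also have "... < L" using m0[of "n - K"] that by (simp add: le_diff_conv2 abs_less_iff)
    finally show ?thesis using a[of n] by (simp add: L_def)
  qed
  then show "\<exists>no. \<forall>n\<ge>no. norm (a n - 0) < e" by blast
qed

lemma linear_recursion_tendsto_0:
  fixes x y :: "nat \<Rightarrow> complex"
  assumes c: "cmod c > 1" and step: "\<And>k. x k - c * x (Suc k) = y (Suc k)" and y: "y \<longlonglongrightarrow> 0"
  shows "x \<longlonglongrightarrow> 0"
proof -
  have "(\<lambda>k. cmod (x k)) \<longlonglongrightarrow> 0"
  proof (rule contracting_recursion_tendsto_0)
    show "cmod (x (Suc k)) \<le> (1 / cmod c) * (cmod (x k) + cmod (y (Suc k)))" for k
    proof -
      have "cmod c * cmod (x (Suc k)) = cmod (x k - y (Suc k))"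
        using step[of k] by (simp add: norm_mult[symmetric] algebra_simps)
      also have "... \<le> cmod (x k) + cmod (y (Suc k))" by (rule norm_triangle_ineq4)
      finally have le: "cmod c * cmod (x (Suc k)) \<le> cmod (x k) + cmod (y (Suc k))" .
      have "cmod (x (Suc k)) = (1 / cmod c) * (cmod c * cmod (x (Suc k)))" using c by auto
      also have "... \<le> (1 / cmod c) * (cmod (x k) + cmod (y (Suc k)))"
        by (rule mult_left_mono[OF le]) simp
      finally show ?thesis .
    qed
    show "(\<lambda>k. cmod (y (Suc k))) \<longlonglongrightarrow> 0" using LIMSEQ_Suc[OF y] by (simp add: tendsto_norm_zero)
  qed (use c in \<open>auto simp: divide_less_eq\<close>)
  then show ?thesis by (simp add: tendsto_norm_zero_iff)
qed

text \<open>This is p(A) v by Horner's scheme, which lets polynomials act on vectors without forming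
  matrix polynomials.\<close>

definition poly_apply :: "complex ^ 'd ^ 'd \<Rightarrow> complex poly \<Rightarrow> complex ^ 'd \<Rightarrow> complex ^ 'd" where
  "poly_apply A p v = fold_coeffs (\<lambda>a u. a *s v + A *v u) p 0"

lemma poly_apply_0 [simp]: "poly_apply A 0 v = 0"
  by (simp add: poly_apply_def)

lemma poly_apply_pCons [simp]: "poly_apply A (pCons a p) v = a *s v + A *v poly_apply A p v"
  by (cases "a = 0 \<and> p = 0") (auto simp: poly_apply_def)

lemma poly_apply_add: "poly_apply A (p + q) v = poly_apply A p v + poly_apply A q v"
  by (induction p q rule: poly_induct2)
     (simp_all add: vector_sadd_rdistrib matrix_vector_right_distrib algebra_simps)

lemma poly_apply_smult: "poly_apply A (smult c p) v = c *s poly_apply A p v"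
  by (induction p) (simp_all add: vector_add_ldistrib vector_scalar_commute vector_smult_assoc)

lemma poly_apply_vec:
  "poly_apply A p (u + v) = poly_apply A p u + poly_apply A p v"
  "poly_apply A p (c *s v) = c *s poly_apply A p v"
  "poly_apply A p (A *v v) = A *v poly_apply A p v"
  by (induction p) (simp_all add: vector_add_ldistrib matrix_vector_right_distrib vector_scalar_commute
      vector_smult_assoc mult.commute algebra_simps)

lemma poly_apply_linear_factor:
  "poly_apply A ([:- c, 1:] * q) v = poly_apply A q (A *v v + (- c) *s v)"
proof -
  have "[:- c, 1:] * q = smult (- c) q + pCons 0 q" by simp
  then show ?thesis by (simp only: poly_apply_add poly_apply_smult poly_apply_vec poly_apply_pCons) simp
qed

lemma poly_apply_monom: "poly_apply A (monom a i) v = a *s (((*v) A ^^ i) v)"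
  by (induction i) (simp_all add: monom_0 monom_Suc vector_scalar_commute)

lemma poly_apply_sum: "poly_apply A (\<Sum>i\<in>I. g i) v = (\<Sum>i\<in>I. poly_apply A (g i) v)"
  by (induction I rule: infinite_finite_induct) (simp_all add: poly_apply_add)

text \<open>The d + 1 vectors w, A w, ..., A^d w are linearly dependent, and a dependency is a
  polynomial.\<close>

lemma exists_annihilator:
  fixes A :: "complex ^ 'd ^ 'd"
  obtains p where "p \<noteq> 0" "poly_apply A p w = 0"
proof -
  let ?e = "\<lambda>i. ((*v) A ^^ i) w" and ?I = "{..CARD('d)}"
  have "\<exists>b i0. i0 \<in> ?I \<and> b i0 \<noteq> 0 \<and> (\<Sum>i\<in>?I. b i *s ?e i) = 0"
  \<comment> \<open>Linear dependence is a property of sets, so coinciding vectors are treated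
    separately: they give the relation with coefficients 1 and -1.\<close>
  proof (cases "inj_on ?e ?I")
    case True
    have "vec.dependent (?e ` ?I)"
    proof (rule ccontr)
      assume "vec.independent (?e ` ?I)"
      then have "card (?e ` ?I) \<le> CARD('d)"
        using vec.independent_card_le_dim[of "?e ` ?I" UNIV] by (simp add: vec.dim_UNIV card_cart_basis)
      then show False by (simp add: card_image[OF True])
    qed
    then obtain u v where "v \<in> ?e ` ?I" "u v \<noteq> 0" "(\<Sum>v\<in>?e ` ?I. u v *s v) = 0"
      using vec.dependent_finite[of "?e ` ?I"] by auto
    then show ?thesis
      unfolding sum.reindex[OF True] by (intro exI[of _ "\<lambda>i. u (?e i)"]) auto
  next
    case False
    then obtain i k where ik: "i \<in> ?I" "k \<in> ?I" "i \<noteq> k" "?e i = ?e k" by (auto simp: inj_on_def)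
    let ?b = "\<lambda>l. if l = i then 1 else if l = k then - 1 else 0 :: complex"
    have "(\<Sum>l\<in>?I. ?b l *s ?e l) = (\<Sum>l\<in>{i, k}. ?b l *s ?e l)"
      using ik by (intro sum.mono_neutral_right) auto
    also have "... = 0" using ik by simp
    finally show ?thesis using ik by (intro exI[of _ ?b] exI[of _ i]) auto
  qed
  then obtain b i0 where b: "i0 \<in> ?I" "b i0 \<noteq> 0" "(\<Sum>i\<in>?I. b i *s ?e i) = 0" by blast
  show thesis
  proof
    let ?p = "\<Sum>i\<in>?I. monom (b i) i"
    have "coeff ?p i0 = b i0" using b(1) by (simp add: coeff_sum coeff_monom if_distrib[of coeff] cong: if_cong)
    then show "?p \<noteq> 0" using b(2) by auto
    show "poly_apply A ?p w = 0" by (simp add: poly_apply_sum poly_apply_monom b(3))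
  qed
qed

lemma matrix_tendsto_0:
  fixes A :: "complex ^ 'd ^ 'd"
  assumes "Y \<longlonglongrightarrow> 0" shows "(\<lambda>k. A *v Y k) \<longlonglongrightarrow> 0"
proof (rule vec_tendstoI)
  fix i
  have "(\<lambda>k. \<Sum>l\<in>UNIV. A $ i $ l * Y k $ l) \<longlonglongrightarrow> (\<Sum>l\<in>UNIV. A $ i $ l * (0 :: complex ^ 'd) $ l)"
    by (intro tendsto_intros assms)
  then show "(\<lambda>k. (A *v Y k) $ i) \<longlonglongrightarrow> 0 $ i" by (simp add: matrix_vector_mult_def)
qed

text \<open>Induction on the degree takes the place of a Jordan form. For a root c of p, the vectors
  Y = A X - c X again form a backward orbit, annihilated by the quotient of p by its linear factor,
  so Y tends to 0. Then X does so too: by a contracting recursion in each coordinate if c is an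
  eigenvalue, and by inverting A - c otherwise.\<close>

lemma backward_orbit_annihilated:
  fixes A :: "complex ^ 'd ^ 'd"
  assumes "\<And>c. eigenvalue_of A c ==> cmod c > 1" and "p \<noteq> 0"
    and "\<And>k. A *v X (Suc k) = X k" and "\<And>k. poly_apply A p (X k) = 0"
  shows "X \<longlonglongrightarrow> 0"
  using assms(2-)
proof (induction "degree p" arbitrary: p X rule: less_induct)
  case less
  show ?case
  proof (cases "degree p = 0")
    case True
    then obtain a where "p = [:a:]" by (meson degree_eq_zeroE)
    then have "X = (\<lambda>_. 0)" using less.prems(1) less.prems(3) by (auto simp: vector_mul_eq_0)
    then show ?thesis by simp
  next
    case False
    then have "\<not> constant (poly p)" by (simp add: constant_degree)
    then obtain c where "poly p c = 0" using fundamental_theorem_of_algebra by blast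
    then obtain q where q: "p = [:- c, 1:] * q" by (metis dvdE poly_eq_0_iff_dvd)
    with less.prems(1) have q0: "q \<noteq> 0" by auto
    have deg: "degree q < degree p"
      unfolding q by (subst degree_mult_eq) (use q0 in auto)
    define Y where "Y k = A *v X k + (- c) *s X k" for k
    have "Y \<longlonglongrightarrow> 0"
    proof (rule less.hyps[OF deg q0])
      show "A *v Y (Suc k) = Y k" for k
        by (simp only: Y_def matrix_vector_right_distrib vector_scalar_commute less.prems(2))
      show "poly_apply A q (Y k) = 0" for k
        using less.prems(3)[of k] unfolding q poly_apply_linear_factor Y_def .
    qed
    show ?thesis
    proof (cases "eigenvalue_of A c")
      case True
      show ?thesis
      proof (rule vec_tendstoI)
        fix i
        have "(\<lambda>k. X k $ i) \<longlonglongrightarrow> 0"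
        proof (rule linear_recursion_tendsto_0[OF assms(1)[OF True]])
          show "X k $ i - c * X (Suc k) $ i = Y (Suc k) $ i" for k
            by (simp add: Y_def less.prems(2))
          show "(\<lambda>k. Y k $ i) \<longlonglongrightarrow> 0" using tendsto_vec_nth[OF \<open>Y \<longlonglongrightarrow> 0\<close>] by simp
        qed
        then show "(\<lambda>k. X k $ i) \<longlonglongrightarrow> 0 $ i" by simp
      qed
    next
      case False
      have "x = 0" if "(A + mat (- c)) *v x = 0" for x
      proof (rule ccontr)
        assume "x \<noteq> 0"
        have "mat (- c) *v x = (- c) *s x"
          by (simp add: vec_eq_iff matrix_vector_mult_def mat_def if_distrib if_distribR cong: if_cong)
        with that have "A *v x = c *s x"
          by (simp add: matrix_vector_mult_add_rdistrib)
        with False \<open>x \<noteq> 0\<close> show False by (auto simp: eigenvalue_of_def)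
      qed
      then obtain E where E: "E ** (A + mat (- c)) = mat 1"
        using matrix_left_invertible_ker[of "A + mat (- c)"] by blast
      have "Y k = (A + mat (- c)) *v X k" for k
        by (simp add: Y_def matrix_vector_mult_add_rdistrib)
           (simp add: vec_eq_iff matrix_vector_mult_def mat_def if_distrib if_distribR cong: if_cong)
      then have "E *v Y k = X k" for k by (simp add: matrix_vector_mul_assoc E)
      then show ?thesis using matrix_tendsto_0[OF \<open>Y \<longlonglongrightarrow> 0\<close>, of E] by simp
    qed
  qed
qed

lemma expanding_injective:
  fixes A :: "complex ^ 'd ^ 'd"
  assumes "\<And>c. eigenvalue_of A c ==> cmod c > 1" "A *v x = 0" shows "x = 0"
proof (rule ccontr)
  assume "x \<noteq> 0"
  then have "eigenvalue_of A 0" using assms(2) by (auto simp: eigenvalue_of_def)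
  then show False using assms(1)[of 0] by simp
qed

text \<open>A polynomial annihilating the starting vector annihilates the whole orbit: A maps p(A)
  X(k + 1) to p(A) X(k), and A is injective because 0 is not an eigenvalue.\<close>

lemma backward_orbit_tendsto_0:
  fixes A :: "complex ^ 'd ^ 'd"
  assumes ev: "\<And>c. eigenvalue_of A c ==> cmod c > 1" and X: "\<And>k. A *v X (Suc k) = X k"
  shows "X \<longlonglongrightarrow> 0"
proof -
  obtain p where p: "p \<noteq> 0" "poly_apply A p (X 0) = 0" by (rule exists_annihilator)
  have "poly_apply A p (X k) = 0" for k
  proof (induction k)
    case (Suc k)
    then have "A *v poly_apply A p (X (Suc k)) = 0" by (simp add: X flip: poly_apply_vec(3))
    from expanding_injective[OF ev this] show ?case by simp
  qed (rule p)
  then show ?thesis by (intro backward_orbit_annihilated[where A=A and p=p] ev p(1) X)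
qed

text \<open>Eigenvalues are complex while norms and integrals live over the reals; this identity
  passes between the two.\<close>

lemma complexify:
  "map_matrix of_int M *v (\<chi> i. complex_of_real (v $ i)) = (\<chi> i. complex_of_real ((real_mat M *v v) $ i))"
  by (simp add: vec_eq_iff matrix_vector_mult_def real_mat_def map_matrix_def)

lemma dilation_det:
  assumes "dilation_matrix M" shows "det (real_mat M) \<noteq> 0"
proof -
  have "v = 0" if "real_mat M *v v = 0" for v
  proof -
    have "map_matrix of_int M *v (\<chi> i. complex_of_real (v $ i)) = 0"
      unfolding complexify that by (simp add: vec_eq_iff)
    then have "(\<chi> i. complex_of_real (v $ i)) = 0"
      by (rule expanding_injective[rotated]) (use assms in \<open>auto simp: dilation_matrix_def\<close>)
    then show ?thesis by (simp add: vec_eq_iff)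
  qed
  then show ?thesis
    using matrix_left_invertible_ker[of "real_mat M"] invertible_left_inverse[of "real_mat M"]
    by (auto simp: invertible_det_nz)
qed

lemma dilation_inverse_powers:
  assumes "dilation_matrix M"
  shows "(\<lambda>k. mat_pow (matrix_inv (real_mat M)) k *v v) \<longlonglongrightarrow> 0"
proof (rule vec_tendstoI)
  fix i
  let ?x = "\<lambda>k. mat_pow (matrix_inv (real_mat M)) k *v v"
  let ?X = "\<lambda>k. \<chi> i. complex_of_real (?x k $ i)"
  have inv: "real_mat M ** matrix_inv (real_mat M) = mat 1"
    using matrix_inv_mult[OF dilation_det[OF assms]] by blast
  have "real_mat M *v ?x (Suc k) = ?x k" for k
    by (simp add: matrix_vector_mul_assoc matrix_mul_assoc inv)
  then have "map_matrix of_int M *v ?X (Suc k) = ?X k" for k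
    by (simp only: complexify)
  then have "?X \<longlonglongrightarrow> 0"
    by (rule backward_orbit_tendsto_0[rotated]) (use assms in \<open>auto simp: dilation_matrix_def\<close>)
  from tendsto_vec_nth[OF this, of i] have "(\<lambda>k. complex_of_real (?x k $ i)) \<longlonglongrightarrow> complex_of_real 0" by simp
  then show "(\<lambda>k. ?x k $ i) \<longlonglongrightarrow> 0 $ i" unfolding tendsto_of_real_iff by simp
qed

lemma mat_pow_commute: "mat_pow A k ** A = A ** mat_pow A k"
  by (induction k) (simp_all add: matrix_mul_assoc[symmetric])

lemma mat_pow_transpose: "mat_pow (transpose A) k = transpose (mat_pow A k)"
  by (induction k) (simp_all add: transpose_mat matrix_transpose_mul mat_pow_commute flip: mat_pow_commute)

lemma mat_pow_inverse:
  assumes "A ** B = mat 1" shows "mat_pow A k ** mat_pow B k = mat 1"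
proof (induction k)
  case (Suc k)
  have "mat_pow A (Suc k) ** mat_pow B (Suc k) = mat_pow A k ** (A ** B) ** mat_pow B k"
    by (simp only: mat_pow.simps matrix_mul_assoc mat_pow_commute)
  then show ?case by (simp add: assms Suc)
qed simp

lemma matrix_inv_transpose:
  fixes A :: "real ^ 'd ^ 'd"
  assumes "det A \<noteq> 0" shows "matrix_inv (transpose A) = transpose (matrix_inv A)"
proof -
  have 1: "transpose A ** transpose (matrix_inv A) = mat 1"
    using matrix_inv_mult[OF assms] by (simp add: matrix_transpose_mul[symmetric] transpose_mat)
  have "matrix_inv (transpose A) = matrix_inv (transpose A) ** (transpose A ** transpose (matrix_inv A))"
    unfolding 1 by simp
  also have "... = transpose (matrix_inv A)"
    using matrix_inv_mult[of "transpose A"] assms by (simp add: matrix_mul_assoc)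
  finally show ?thesis .
qed

lemma det_mat_pow: "det (mat_pow A k) = det A ^ k"
  by (induction k) (simp_all add: det_mul)

lemma mat_norm_transpose: "mat_norm (transpose A) = mat_norm A"
proof -
  have le: "mat_norm (transpose A) \<le> mat_norm A" for A :: "real ^ 'd ^ 'd"
    unfolding mat_norm_def
  proof (rule onorm_le)
    fix y :: "real ^ 'd"
    let ?z = "transpose A *v y"
    have "norm ?z * norm ?z = ?z \<bullet> ?z" by (simp add: norm_eq_sqrt_inner)
    also have "... = y \<bullet> (A *v ?z)" by (rule inner_transpose_left)
    also have "... \<le> norm y * norm (A *v ?z)" by (rule norm_cauchy_schwarz)
    also have "... \<le> norm y * (mat_norm A * norm ?z)" by (intro mult_left_mono norm_matrix_le) simp
    finally have "norm ?z * norm ?z \<le> (mat_norm A * norm y) * norm ?z" by (simp add: mult_ac)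
    then show "norm ?z \<le> onorm ((*v) A) * norm y"
      by (cases "norm ?z = 0") (auto simp: mat_norm_def[symmetric] mat_norm_nonneg)
  qed
  show ?thesis using le[of A] le[of "transpose A"] by (simp add: transpose_transpose)
qed

text \<open>Powers of the transpose with natural exponents: the density order concerns exponents
  tending to plus infinity, so negative powers enter only through the inverses
  \<open>undil\<close>.\<close>

definition dil :: "int ^ 'd ^ 'd \<Rightarrow> nat \<Rightarrow> real ^ 'd ^ 'd" where
  "dil M k = mat_powi (transpose (real_mat M)) (int k)"

definition undil :: "int ^ 'd ^ 'd \<Rightarrow> nat \<Rightarrow> real ^ 'd ^ 'd" where
  "undil M k = mat_powi (transpose (real_mat M)) (- int k)"

lemma dil_eq: "dil M k = transpose (mat_powi (real_mat M) (int k))"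
  by (simp add: dil_def mat_powi_def mat_pow_transpose)

lemma undil_eq:
  assumes "dilation_matrix M"
  shows "undil M k = transpose (mat_pow (matrix_inv (real_mat M)) k)"
    and "undil M k = transpose (mat_powi (real_mat M) (- int k))"
  using dilation_det[OF assms]
  by (cases "k = 0"; simp add: undil_def mat_powi_def mat_pow_transpose matrix_inv_transpose transpose_mat)+

lemma dil_undil:
  assumes "dilation_matrix M" shows "dil M k ** undil M k = mat 1"
proof -
  have "mat_pow (matrix_inv (real_mat M)) k ** mat_pow (real_mat M) k = mat 1"
    using matrix_inv_mult[OF dilation_det[OF assms]] by (intro mat_pow_inverse) blast
  then show ?thesis
    by (simp add: dil_eq undil_eq(1)[OF assms] mat_powi_def matrix_transpose_mul[symmetric] transpose_mat)
qed

lemma det_dil: "dilation_matrix M ==> \<bar>det (mat_powi (real_mat M) (int k))\<bar> = absdet M powr real_of_int (int k)"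
  using dilation_det[of M] by (simp add: mat_powi_def det_mat_pow absdet_def power_abs powr_realpow)

text \<open>Applied to the unit vectors, \<open>dilation_inverse_powers\<close> gives convergence of
  every entry, and finitely many entries control the norm.\<close>

lemma norm_undil_tendsto_0:
  assumes "dilation_matrix M" shows "(\<lambda>k. mat_norm (undil M k)) \<longlonglongrightarrow> 0"
proof (rule tendsto_sandwich[OF _ _ tendsto_const])
  have entry: "(\<lambda>k. undil M k $ i $ l) \<longlonglongrightarrow> 0" for i l
    using tendsto_vec_nth[OF dilation_inverse_powers[OF assms, of "axis i 1"], of l]
    by (simp add: undil_eq(1)[OF assms] transpose_def matrix_vector_mult_basis column_def)
  have "(\<lambda>k. \<Sum>i\<in>UNIV. \<Sum>l\<in>UNIV. \<bar>undil M k $ i $ l\<bar>) \<longlonglongrightarrow> (\<Sum>i\<in>(UNIV :: 'a set). \<Sum>l\<in>(UNIV :: 'a set). \<bar>0\<bar>)"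
    by (intro tendsto_sum tendsto_rabs entry)
  then show "(\<lambda>k. \<Sum>i\<in>UNIV. \<Sum>l\<in>UNIV. \<bar>undil M k $ i $ l\<bar>) \<longlonglongrightarrow> 0" by simp
  show "\<forall>\<^sub>F k in sequentially. mat_norm (undil M k) \<le> (\<Sum>i\<in>UNIV. \<Sum>l\<in>UNIV. \<bar>undil M k $ i $ l\<bar>)"
    unfolding mat_norm_def by (intro always_eventually allI onorm_le_matrix_component_sum)
qed (auto simp: mat_norm_nonneg)

lemma norm_dil_bounds:
  assumes "dilation_matrix M"
  shows "mat_norm (undil M k) > 0" "mat_norm (dil M k) > 0"
    and "norm t \<le> mat_norm (undil M k) * norm (dil M k *v t)"
proof -
  have CB: "undil M k ** dil M k = mat 1"
    using dil_undil[OF assms, of k] by (simp add: matrix_left_right_inverse)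
  show le: "norm t \<le> mat_norm (undil M k) * norm (dil M k *v t)" for t
    using norm_matrix_le[of "undil M k" "dil M k *v t"] by (simp only: matrix_vector_mul_assoc CB matrix_vector_mul_lid)
  obtain t :: "real ^ 'a" where t: "norm t = 1" using vector_choose_size[of 1] by auto
  have "1 \<le> mat_norm (undil M k) * norm (dil M k *v t)" using le[of t] t by simp
  also have "... \<le> mat_norm (undil M k) * (mat_norm (dil M k) * norm t)"
    by (intro mult_left_mono norm_matrix_le mat_norm_nonneg)
  finally have "1 \<le> mat_norm (undil M k) * mat_norm (dil M k)" using t by simp
  then have "mat_norm (undil M k) \<noteq> 0 \<and> mat_norm (dil M k) \<noteq> 0" by auto
  then show "mat_norm (undil M k) > 0" "mat_norm (dil M k) > 0"
    using mat_norm_nonneg[of "undil M k"] mat_norm_nonneg[of "dil M k"] by linarith+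
qed

lemma isotropic_bounds:
  fixes M :: "int ^ 'd ^ 'd"
  assumes M: "dilation_matrix M" and iso: "isotropic M"
  obtains \<rho> C1 C2 where "\<rho> > 1" "C1 > 0" "C2 > 0" "\<And>k. absdet M powr real_of_int (int k) = (\<rho> ^ k) ^ CARD('d)"
    "\<And>k. mat_norm (dil M k) \<le> C2 * \<rho> ^ k" "\<And>k. C1 * \<rho> ^ k \<le> mat_norm (dil M k)"
    "\<And>k. mat_norm (undil M k) \<le> C2 / \<rho> ^ k" "\<And>k. C1 / \<rho> ^ k \<le> mat_norm (undil M k)"
proof -
  define \<rho> where "\<rho> = absdet M powr (1 / real CARD('d))"
  have D: "absdet M > 0" using dilation_det[OF M] by (simp add: absdet_def)
  then have \<rho>: "\<rho> > 0" by (simp add: \<rho>_def)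
  obtain C1 C2 where C: "C1 > 0" "C2 > 0"
    "\<And>j. C1 * \<rho> powi j \<le> mat_norm (mat_powi (real_mat M) j)"
    "\<And>j. mat_norm (mat_powi (real_mat M) j) \<le> C2 * \<rho> powi j"
    using iso unfolding isotropic_def \<rho>_def[symmetric] Let_def by blast
  have dn: "mat_norm (dil M k) = mat_norm (mat_powi (real_mat M) (int k))"
    "mat_norm (undil M k) = mat_norm (mat_powi (real_mat M) (- int k))" for k
    by (simp_all add: dil_eq undil_eq(2)[OF M] mat_norm_transpose)
  have pw: "\<rho> powi (int k) = \<rho> ^ k" "C * \<rho> powi (- int k) = C / \<rho> ^ k" for k C
    by (simp_all add: power_int_minus divide_inverse)
  have B: "mat_norm (dil M k) \<le> C2 * \<rho> ^ k" "C1 * \<rho> ^ k \<le> mat_norm (dil M k)"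
    "mat_norm (undil M k) \<le> C2 / \<rho> ^ k" "C1 / \<rho> ^ k \<le> mat_norm (undil M k)" for k
    using C(3,4)[of "int k"] C(3,4)[of "- int k"] unfolding pw dn by auto
  \<comment> \<open>Otherwise C1/\<rho>^k \<ge> C1 would keep the norms of the inverse powers away
    from 0.\<close>
  have "\<rho> > 1"
  proof (rule ccontr)
    assume "\<not> \<rho> > 1"
    then have "\<rho> ^ k \<le> 1" for k using \<rho> by (intro power_le_one) auto
    then have "C1 \<le> C1 / \<rho> ^ k" for k using \<rho> C(1) by (simp add: field_simps mult_left_le)
    then have "C1 \<le> mat_norm (undil M k)" for k using B(4)[of k] order_trans by blast
    then have "C1 \<le> 0" by (intro LIMSEQ_le_const[OF norm_undil_tendsto_0[OF M]]) auto
    with C(1) show False by simp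
  qed
  moreover have "absdet M powr real_of_int (int k) = (\<rho> ^ k) ^ CARD('d)" for k
  proof -
    have "\<rho> ^ CARD('d) = absdet M"
      using D by (simp add: \<rho>_def powr_powr flip: powr_realpow)
    then have "(\<rho> ^ k) ^ CARD('d) = absdet M ^ k" by (metis power_mult mult.commute)
    then show ?thesis using D by (simp add: powr_realpow)
  qed
  ultimately show thesis using that C(1,2) B by blast
qed

section \<open>Weighted lattice sums and finite differences\<close>

text \<open>For a countable type the supremum over finite sets is reached along the sets {k. to_nat
  k < n}, to which monotone convergence applies. This moves the lattice sums of
  \<open>origin_conditions\<close> to the counting measure.\<close>

lemma infsum_count:
  fixes f :: "'k :: countable \<Rightarrow> ennreal"
  shows "(\<Sum>\<^sub>\<infinity>k\<in>S. f k) = (\<integral>\<^sup>+k. indicator S k * f k \<partial>count_space UNIV)"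
proof -
  let ?F = "\<lambda>n. {k :: 'k. to_nat k < n}" and ?f = "\<lambda>k. indicator S k * f k"
  have fin: "finite (?F n)" for n
    by (rule finite_imageD[of to_nat]) (auto intro: finite_subset[of _ "{..<n}"] inj_onI)
  have sub: "\<exists>n. F \<subseteq> ?F n" if "finite F" for F
  proof (intro exI subsetI CollectI)
    fix k assume "k \<in> F"
    then have "to_nat k \<le> (\<Sum>k\<in>F. to_nat k)" using that by (intro member_le_sum) auto
    then show "to_nat k < Suc (\<Sum>k\<in>F. to_nat k)" by simp
  qed
  have "(\<Sum>\<^sub>\<infinity>k\<in>S. f k) = (\<Sum>\<^sub>\<infinity>k. ?f k)"
    by (rule infsum_cong_neutral) auto
  also have "... = (SUP F\<in>{F. finite F \<and> F \<subseteq> UNIV}. sum ?f F)"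
    by (rule nonneg_infsum_complete) simp
  also have "... = (SUP n. sum ?f (?F n))"
  proof (rule antisym)
    show "(SUP F\<in>{F. finite F \<and> F \<subseteq> UNIV}. sum ?f F) \<le> (SUP n. sum ?f (?F n))"
    proof (rule SUP_mono)
      fix F :: "'k set" assume "F \<in> {F. finite F \<and> F \<subseteq> UNIV}"
      then obtain n where "F \<subseteq> ?F n" using sub by blast
      then show "\<exists>n\<in>UNIV. sum ?f F \<le> sum ?f (?F n)" using fin[of n] by (auto intro!: sum_mono2)
    qed
    show "(SUP n. sum ?f (?F n)) \<le> (SUP F\<in>{F. finite F \<and> F \<subseteq> UNIV}. sum ?f F)"
      by (rule SUP_mono) (use fin in blast)
  qed
  also have "... = (SUP n. \<integral>\<^sup>+k. ?f k * indicator (?F n) k \<partial>count_space UNIV)"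
    by (intro SUP_cong refl, subst nn_integral_count_space_indicator[symmetric])
       (auto simp: nn_integral_count_space_finite[OF fin])
  also have "... = (\<integral>\<^sup>+k. (SUP n. ?f k * indicator (?F n) k) \<partial>count_space UNIV)"
    by (rule nn_integral_monotone_convergence_SUP[symmetric])
       (auto simp: incseq_def le_fun_def intro!: mult_left_mono split: split_indicator)
  also have "... = (\<integral>\<^sup>+k. ?f k \<partial>count_space UNIV)"
  proof (rule nn_integral_cong)
    fix k
    show "(SUP n. ?f k * indicator (?F n) k) = ?f k"
    proof (rule antisym)
      show "(SUP n. ?f k * indicator (?F n) k) \<le> ?f k" by (rule SUP_least) (simp split: split_indicator)
      show "?f k \<le> (SUP n. ?f k * indicator (?F n) k)"
        by (rule SUP_upper2[of "Suc (to_nat k)"]) auto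
    qed
  qed
  finally show ?thesis .
qed

text \<open>The weighted bracket product of g with itself over a part \<open>S\<close> of the
  lattice. The origin condition concerns \<open>- {0}\<close>, the error estimate also needs
  \<open>UNIV\<close>, and the difference estimates hold for every \<open>S\<close>.\<close>

definition bracket :: "(int ^ 'd) set \<Rightarrow> nat \<Rightarrow> (real ^ 'd \<Rightarrow> complex) \<Rightarrow> real ^ 'd \<Rightarrow> ennreal" where
  "bracket S s g t = (\<integral>\<^sup>+k. indicator S k *
     ennreal (wt (t + real_vec k) ^ s * (cmod (g (t + real_vec k)))^2) \<partial>count_space UNIV)"

lemma bracket_measurable [measurable]:
  assumes [measurable]: "g \<in> borel_measurable borel"
  shows "bracket S s g \<in> borel_measurable borel"
  unfolding bracket_def[abs_def] by (rule borel_measurable_nn_integral_count) measurable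

lemma bracket_mono: "r \<le> s ==> bracket S r g t \<le> bracket S s g t"
  unfolding bracket_def
  by (intro nn_integral_mono mult_left_mono ennreal_leI mult_right_mono power_increasing) auto

text \<open>Peetre's inequality: it lets the weight follow a shift and pass through a
  convolution.\<close>

lemma weight_peetre:
  fixes x y :: "'a :: real_normed_vector"
  shows "wt x ^ s \<le> 2 ^ s * wt y ^ s * wt (x - y) ^ s"
proof -
  let ?a = "norm y" and ?b = "norm (x - y)"
  have "norm x \<le> ?a + ?b" using norm_triangle_ineq[of y "x - y"] by simp
  then have "(norm x)^2 \<le> (?a + ?b)^2" by (rule power_mono) simp
  also have "(?a + ?b)^2 \<le> 2 * ?a^2 + 2 * ?b^2"
    using sum_squares_ge_zero[of "?a - ?b" 0] by (simp add: power2_eq_square algebra_simps)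
  finally have "1 + (norm x)^2 \<le> 1 + (2 * ?a^2 + 2 * ?b^2)" by simp
  also have "... \<le> 2 * (1 + ?a^2) * (1 + ?b^2)" by (simp add: algebra_simps)
  finally have "wt x ^ s \<le> (2 * (1 + ?a^2) * (1 + ?b^2)) ^ s"
    by (rule power_mono) (simp add: add_nonneg_nonneg)
  then show ?thesis by (simp only: power_mult_distrib)
qed

text \<open>Cauchy-Schwarz bounds the squared convolution by a convolution of |a|^2, Peetre's
  inequality moves the weight onto \<open>a\<close>, and the lattice sum of the remaining decay is
  bounded. \<open>D\<close> does not depend on \<theta>, and the bound is quadratic in its size
  \<open>c\<close>; both matter when \<theta> is replaced by its small finite differences.\<close>

lemma bracket_conv_bound:
  fixes a :: "real ^ 'd \<Rightarrow> complex"
  assumes a: "slow_integrable a"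
    and int: "integrable lborel (\<lambda>\<xi>. (cmod (a \<xi>))^2 * wt \<xi> ^ s)"
  obtains D where "D \<ge> 0" "\<And>\<theta> c S t. \<theta> \<in> schwartz ==> c \<ge> 0 ==>
      (\<And>x. cmod (\<theta> x) \<le> c / (1 + norm x) ^ (CARD('d) + 2 + s)) ==>
      bracket S s (conv a \<theta>) t \<le> ennreal (D * c^2)"
proof -
  have [measurable]: "a \<in> borel_measurable borel" using a by (simp add: slow_integrable_def)
  define w where "w x = 1 / (1 + norm x) ^ (CARD('d) + 2)" for x :: "real ^ 'd"
  have w0: "w x \<ge> 0" for x by (simp add: w_def)
  have w_meas [measurable]: "w \<in> borel_measurable borel" unfolding w_def[abs_def] by measurable
  define I where "I = (LINT x|lborel. w x)"
  have I: "(\<integral>\<^sup>+\<eta>. ennreal (w (\<xi> - \<eta>)) \<partial>lborel) = ennreal I" for \<xi>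
  proof -
    have "(\<integral>\<^sup>+\<eta>. ennreal (w (\<xi> - \<eta>)) \<partial>lborel) = (\<integral>\<^sup>+\<eta>. ennreal (w (\<eta> + (- \<xi>))) \<partial>lborel)"
      by (simp add: w_def norm_minus_commute)
    also have "... = (\<integral>\<^sup>+\<eta>. ennreal (w \<eta>) \<partial>lborel)"
      by (rule nn_integral_shift[of "\<lambda>\<eta>. ennreal (w \<eta>)"]) measurable
    also have "... = ennreal I"
      unfolding I_def using integrable_weight w0 by (intro nn_integral_eq_integral) (auto simp: w_def)
    finally show ?thesis .
  qed
  have I0: "I \<ge> 0" unfolding I_def by (rule Bochner_Integration.integral_nonneg) (rule w0)
  define P where "P \<eta> = (cmod (a \<eta>))^2 * wt \<eta> ^ s" for \<eta>
  have P0: "P \<eta> \<ge> 0" for \<eta> by (simp add: P_def add_nonneg_nonneg)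
  have [measurable]: "P \<in> borel_measurable borel" unfolding P_def[abs_def] by measurable
  define E where "E = (LINT \<eta>|lborel. P \<eta>)"
  have E: "(\<integral>\<^sup>+\<eta>. ennreal (P \<eta>) \<partial>lborel) = ennreal E"
    unfolding E_def using int P0 by (intro nn_integral_eq_integral) (auto simp: P_def[abs_def])
  have E0: "E \<ge> 0" unfolding E_def by (rule Bochner_Integration.integral_nonneg) (rule P0)
  obtain L where L: "L \<ge> 0" "\<And>t. (\<integral>\<^sup>+k. ennreal (w (t + real_vec k)) \<partial>count_space UNIV) \<le> ennreal L"
    unfolding w_def by (rule lattice_weight_bound) blast
  show thesis
  proof
    show "I * 2 ^ s * (E * L) \<ge> 0" using I0 E0 L(1) by simp
    fix \<theta> :: "real ^ 'd \<Rightarrow> complex" and c :: real and S t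
    assume \<theta>: "\<theta> \<in> schwartz" and c: "c \<ge> 0"
      and le: "\<And>x. cmod (\<theta> x) \<le> c / (1 + norm x) ^ (CARD('d) + 2 + s)"
    have [measurable]: "\<theta> \<in> borel_measurable borel" by (rule schwartz_measurable[OF \<theta>])
    let ?K = "ennreal (I * (c^2 * 2 ^ s))"
    have pt: "ennreal (wt \<xi> ^ s * (cmod (conv a \<theta> \<xi>))^2) \<le> ?K * (\<integral>\<^sup>+\<eta>. ennreal (P \<eta> * w (\<xi> - \<eta>)) \<partial>lborel)" for \<xi>
    proof -
      \<comment> \<open>The decay of \<theta> is shared out: d + 2 powers form the weight
        \<open>w\<close>, split evenly between the two Cauchy-Schwarz factors, and the remaining s
        powers, once squared, absorb the factor from Peetre's inequality.\<close>
      let ?g = "\<lambda>\<eta>. c * cmod (a \<eta>) * sqrt (w (\<xi> - \<eta>)) / (1 + norm (\<xi> - \<eta>)) ^ s"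
      have "ennreal (cmod (conv a \<theta> \<xi>)) \<le> (\<integral>\<^sup>+\<eta>. ennreal (cmod (a \<eta> * \<theta> (\<xi> - \<eta>))) \<partial>lborel)"
        unfolding conv_def by (rule integral_norm_bound_ennreal[OF slow_integrable_conv(1)[OF a \<theta>]])
      also have "... \<le> (\<integral>\<^sup>+\<eta>. ennreal (sqrt (w (\<xi> - \<eta>))) * ennreal (?g \<eta>) \<partial>lborel)"
      proof (rule nn_integral_mono)
        fix \<eta> :: "real ^ 'd"
        have "cmod (a \<eta>) * cmod (\<theta> (\<xi> - \<eta>)) \<le> cmod (a \<eta>) * (c / (1 + norm (\<xi> - \<eta>)) ^ (CARD('d) + 2 + s))"
          by (rule mult_left_mono[OF le]) simp
        also have "... = c * cmod (a \<eta>) * (sqrt (w (\<xi> - \<eta>)) * sqrt (w (\<xi> - \<eta>))) / (1 + norm (\<xi> - \<eta>)) ^ s"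
          unfolding real_sqrt_mult_self using w0[of "\<xi> - \<eta>"]
          by (simp add: w_def power_add[of _ "CARD('d)"] mult_ac)
        also have "... = sqrt (w (\<xi> - \<eta>)) * ?g \<eta>" by simp
        finally show "ennreal (cmod (a \<eta> * \<theta> (\<xi> - \<eta>))) \<le> ennreal (sqrt (w (\<xi> - \<eta>))) * ennreal (?g \<eta>)"
          by (subst ennreal_mult[symmetric]) (use w0 c in \<open>auto simp: norm_mult intro!: ennreal_leI\<close>)
      qed
      finally have "(ennreal (cmod (conv a \<theta> \<xi>)))^2 \<le> (\<integral>\<^sup>+\<eta>. ennreal (sqrt (w (\<xi> - \<eta>))) * ennreal (?g \<eta>) \<partial>lborel)^2"
        by (intro power_mono) auto
      also have "... \<le> (\<integral>\<^sup>+\<eta>. (ennreal (sqrt (w (\<xi> - \<eta>))))^2 \<partial>lborel) * (\<integral>\<^sup>+\<eta>. (ennreal (?g \<eta>))^2 \<partial>lborel)"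
        by (rule Cauchy_Schwarz_nn_integral) measurable
      also have "(\<integral>\<^sup>+\<eta>. (ennreal (sqrt (w (\<xi> - \<eta>))))^2 \<partial>lborel) = ennreal I"
        using w0 by (subst I[of \<xi>, symmetric]) (intro nn_integral_cong, simp add: ennreal_power)
      finally have "ennreal (wt \<xi> ^ s) * (ennreal (cmod (conv a \<theta> \<xi>)))^2
        \<le> ennreal (wt \<xi> ^ s) * (ennreal I * (\<integral>\<^sup>+\<eta>. (ennreal (?g \<eta>))^2 \<partial>lborel))"
        by (rule mult_left_mono) simp
      also have "... = ennreal I * (\<integral>\<^sup>+\<eta>. ennreal (wt \<xi> ^ s) * (ennreal (?g \<eta>))^2 \<partial>lborel)"
        by (subst nn_integral_cmult) (auto simp: mult_ac)
      also have "... \<le> ennreal I * (\<integral>\<^sup>+\<eta>. ennreal (c^2 * 2 ^ s) * ennreal (P \<eta> * w (\<xi> - \<eta>)) \<partial>lborel)"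
      proof (intro mult_left_mono nn_integral_mono)
        fix \<eta> :: "real ^ 'd"
        let ?z = "\<xi> - \<eta>"
        have "wt \<xi> ^ s \<le> 2 ^ s * wt \<eta> ^ s * wt ?z ^ s" by (rule weight_peetre)
        also have "... \<le> 2 ^ s * wt \<eta> ^ s * ((1 + norm ?z)^2) ^ s"
          by (intro mult_left_mono power_mono weight_le) (simp_all add: add_nonneg_nonneg)
        finally have W: "wt \<xi> ^ s \<le> 2 ^ s * wt \<eta> ^ s * ((1 + norm ?z) ^ s)^2"
          by (simp only: power_mult[symmetric] mult.commute[of s 2])
        have "wt \<xi> ^ s * (?g \<eta>)^2 \<le> 2 ^ s * wt \<eta> ^ s * ((1 + norm ?z) ^ s)^2 * (?g \<eta>)^2"
          by (rule mult_right_mono[OF W]) simp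
        also have "... = c^2 * 2 ^ s * (P \<eta> * w ?z)"
          using w0[of ?z] by (simp add: P_def power_mult_distrib power_divide mult_ac)
        finally have "wt \<xi> ^ s * (?g \<eta>)^2 \<le> c^2 * 2 ^ s * (P \<eta> * w ?z)" .
        then show "ennreal (wt \<xi> ^ s) * (ennreal (?g \<eta>))^2 \<le> ennreal (c^2 * 2 ^ s) * ennreal (P \<eta> * w ?z)"
          using c w0 P0 by (simp add: ennreal_power ennreal_mult[symmetric] add_nonneg_nonneg ennreal_leI)
      qed simp
      also have "... = ?K * (\<integral>\<^sup>+\<eta>. ennreal (P \<eta> * w (\<xi> - \<eta>)) \<partial>lborel)"
        using I0 c by (subst nn_integral_cmult) (auto simp: ennreal_mult mult_ac)
      finally show ?thesis by (simp add: ennreal_power ennreal_mult add_nonneg_nonneg)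
    qed
    have "bracket S s (conv a \<theta>) t \<le> (\<integral>\<^sup>+k. ?K * (\<integral>\<^sup>+\<eta>. ennreal (P \<eta> * w (t + real_vec k - \<eta>)) \<partial>lborel) \<partial>count_space UNIV)"
      unfolding bracket_def
    proof (rule nn_integral_mono)
      fix k
      have "indicator S k * ennreal (wt (t + real_vec k) ^ s * (cmod (conv a \<theta> (t + real_vec k)))^2)
        \<le> ennreal (wt (t + real_vec k) ^ s * (cmod (conv a \<theta> (t + real_vec k)))^2)"
        by (simp split: split_indicator)
      also note pt
      finally show "indicator S k * ennreal (wt (t + real_vec k) ^ s * (cmod (conv a \<theta> (t + real_vec k)))^2)
        \<le> ?K * (\<integral>\<^sup>+\<eta>. ennreal (P \<eta> * w (t + real_vec k - \<eta>)) \<partial>lborel)" .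
    qed
    also have "... = ?K * (\<integral>\<^sup>+k. (\<integral>\<^sup>+\<eta>. ennreal (P \<eta> * w (t + real_vec k - \<eta>)) \<partial>lborel) \<partial>count_space UNIV)"
      by (rule nn_integral_cmult) simp
    also have "(\<integral>\<^sup>+k. (\<integral>\<^sup>+\<eta>. ennreal (P \<eta> * w (t + real_vec k - \<eta>)) \<partial>lborel) \<partial>count_space UNIV)
      = (\<integral>\<^sup>+\<eta>. (\<integral>\<^sup>+k. ennreal (P \<eta> * w (t + real_vec k - \<eta>)) \<partial>count_space UNIV) \<partial>lborel)"
      by (rule nn_integral_count_space_nn_integral[symmetric]) auto
    also have "... \<le> (\<integral>\<^sup>+\<eta>. ennreal (P \<eta>) * ennreal L \<partial>lborel)"
    proof (rule nn_integral_mono)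
      fix \<eta> :: "real ^ 'd"
      have "(\<integral>\<^sup>+k. ennreal (P \<eta> * w (t + real_vec k - \<eta>)) \<partial>count_space UNIV) = ennreal (P \<eta>) * (\<integral>\<^sup>+k. ennreal (w ((t - \<eta>) + real_vec k)) \<partial>count_space UNIV)"
        using P0 w0 by (subst nn_integral_cmult[symmetric]) (auto simp: ennreal_mult algebra_simps)
      also have "... \<le> ennreal (P \<eta>) * ennreal L" by (rule mult_left_mono[OF L(2)]) simp
      finally show "(\<integral>\<^sup>+k. ennreal (P \<eta> * w (t + real_vec k - \<eta>)) \<partial>count_space UNIV) \<le> ennreal (P \<eta>) * ennreal L" .
    qed
    also have "... = ennreal E * ennreal L" by (subst nn_integral_multc) (auto simp: E)
    finally have "bracket S s (conv a \<theta>) t \<le> ?K * (ennreal E * ennreal L)" by (simp add: mult_left_mono)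
    also have "... = ennreal (I * 2 ^ s * (E * L) * c^2)"
      using I0 c E0 L(1) by (simp add: ennreal_mult[symmetric] mult_ac)
    finally show "bracket S s (conv a \<theta>) t \<le> ennreal (I * 2 ^ s * (E * L) * c^2)" .
  qed
qed

section \<open>Finite differences\<close>

primrec fd :: "nat \<Rightarrow> real ^ 'd \<Rightarrow> (real ^ 'd \<Rightarrow> complex) \<Rightarrow> real ^ 'd \<Rightarrow> complex" where
  "fd 0 h g = g"
| "fd (Suc N) h g = fd N h (\<lambda>x. g (x + h) - g x)"

lemma fd_Suc': "fd (Suc N) h g x = fd N h g (x + h) - fd N h g x"
proof (induction N arbitrary: g x)
  case (Suc N)
  have "fd (Suc (Suc N)) h g x = fd (Suc N) h (\<lambda>x. g (x + h) - g x) x" by (simp only: fd.simps)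
  also have "... = fd N h (\<lambda>x. g (x + h) - g x) (x + h) - fd N h (\<lambda>x. g (x + h) - g x) x" by (rule Suc)
  finally show ?case by (simp only: fd.simps)
qed simp

lemma schwartz_shift:
  fixes \<theta> :: "real ^ 'd \<Rightarrow> complex"
  assumes "\<theta> \<in> schwartz" shows "(\<lambda>x. \<theta> (x + h)) \<in> schwartz"
proof -
  have "invertible (mat 1 :: real ^ 'd ^ 'd)" by (simp add: invertible_det_nz)
  from schwartz_affine[OF this assms, of h] show ?thesis by simp
qed

lemma fd_schwartz: "\<theta> \<in> schwartz ==> fd N h \<theta> \<in> schwartz"
  by (induction N arbitrary: \<theta>) (simp_all add: schwartz_diff schwartz_shift)

lemma partial_deriv_fd: "\<theta> \<in> schwartz ==> partial_deriv i (fd N h \<theta>) = fd N h (partial_deriv i \<theta>)"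
proof (induction N arbitrary: \<theta>)
  case (Suc N)
  have d: "(\<theta> has_derivative frechet_derivative \<theta> (at x)) (at x)" for x
    by (intro differentiable_derivative smooth_differentiable schwartz_smooth Suc.prems)
  have "((\<lambda>x. \<theta> (x + h) - \<theta> x) has_derivative
    (\<lambda>v. frechet_derivative \<theta> (at (x + h)) v - frechet_derivative \<theta> (at x) v)) (at x)" for x
  proof (rule has_derivative_diff[OF _ d])
    have "((\<lambda>x. x + h) has_derivative (\<lambda>v. v)) (at x)" by (auto intro!: derivative_eq_intros)
    from has_derivative_compose[OF this d]
    show "((\<lambda>x. \<theta> (x + h)) has_derivative frechet_derivative \<theta> (at (x + h))) (at x)" by simp
  qed
  from partial_deriv_eq[OF this]
  have "partial_deriv i (\<lambda>x. \<theta> (x + h) - \<theta> x) = (\<lambda>x. partial_deriv i \<theta> (x + h) - partial_deriv i \<theta> x)"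
    by (simp add: partial_deriv_def fun_eq_iff)
  moreover have "(\<lambda>x. \<theta> (x + h) - \<theta> x) \<in> schwartz" by (intro schwartz_diff schwartz_shift Suc.prems)
  ultimately show ?case using Suc.IH by simp
qed simp

text \<open>By the mean value theorem each difference costs one derivative and gains a factor |h|.
  Differences commute with partial derivatives, so the induction hypothesis is used for the partial
  derivatives of \<theta>.\<close>

lemma fd_bound:
  "\<theta> \<in> schwartz ==> \<exists>C \<ge> 0. \<forall>h x. norm h \<le> 1 \<longrightarrow> cmod (fd N h \<theta> x) \<le> C * norm h ^ N / (1 + norm (x :: real ^ 'd)) ^ K"
proof (induction N arbitrary: \<theta>)
  case 0
  then show ?case using schwartz_bound0[of \<theta> K] by (metis fd.simps(1) mult.right_neutral power_0)
next
  case (Suc N)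
  define Pr where "Pr i C \<longleftrightarrow> C \<ge> 0 \<and> (\<forall>h x. norm h \<le> 1 \<longrightarrow>
    cmod (fd N h (partial_deriv i \<theta>) x) \<le> C * norm h ^ N / (1 + norm x) ^ K)" for i C
  have "\<forall>i. \<exists>C. Pr i C" using Suc.IH[OF schwartz_partial_deriv[OF Suc.prems]] unfolding Pr_def by blast
  then obtain c where c: "\<And>i. Pr i (c i)" by metis
  define C where "C = (\<Sum>i\<in>UNIV. c i)"
  have c0: "c i \<ge> 0" for i using c[of i] by (simp add: Pr_def)
  then have C0: "C \<ge> 0" and cC: "c i \<le> C" for i by (auto simp: C_def intro: sum_nonneg member_le_sum)
  have "cmod (fd (Suc N) h \<theta> x) \<le> real CARD('d) * (C * 2 ^ K) * norm h ^ Suc N / (1 + norm x) ^ K"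
    if h: "norm h \<le> 1" for h x :: "real ^ 'd"
  proof -
    have "cmod (partial_deriv i (fd N h \<theta>) y) \<le> C * norm h ^ N * (2 ^ K / (1 + norm x) ^ K)"
      if y: "norm (y - x) \<le> norm h" for y i
    proof -
      have "cmod (partial_deriv i (fd N h \<theta>) y) \<le> c i * norm h ^ N * (1 / (1 + norm y) ^ K)"
        using c[of i] h unfolding Pr_def partial_deriv_fd[OF Suc.prems] by simp
      also have "... \<le> C * norm h ^ N * (2 ^ K / (1 + norm x) ^ K)"
        using C0 cC h y by (intro mult_mono weight_shift) auto
      finally show ?thesis .
    qed
    from partial_mean_value[OF smooth_differentiable[OF schwartz_smooth[OF fd_schwartz[OF Suc.prems]]] this]
    show ?thesis unfolding fd_Suc' by (simp add: mult_ac)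
  qed
  moreover have "real CARD('d) * (C * 2 ^ K) \<ge> 0" using C0 by simp
  ultimately show ?case by blast
qed

lemma fd_conv:
  assumes g: "slow_integrable g" shows "\<theta> \<in> schwartz ==> fd N h (conv g \<theta>) = conv g (fd N h \<theta>)"
proof (induction N arbitrary: \<theta>)
  case (Suc N)
  have "conv g \<theta> (x + h) - conv g \<theta> x = conv g (\<lambda>x. \<theta> (x + h) - \<theta> x) x" for x
  proof -
    have "conv g (\<lambda>x. \<theta> (x + h) - \<theta> x) x = (LINT \<eta>|lborel. g \<eta> * \<theta> (x + h - \<eta>) - g \<eta> * \<theta> (x - \<eta>))"
      unfolding conv_def by (intro Bochner_Integration.integral_cong refl) (simp add: algebra_simps)
    also have "... = conv g \<theta> (x + h) - conv g \<theta> x"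
      unfolding conv_def by (intro Bochner_Integration.integral_diff slow_integrable_conv(1) g Suc.prems)
    finally show ?thesis by simp
  qed
  then show ?case using Suc.IH[OF schwartz_diff[OF schwartz_shift[OF Suc.prems] Suc.prems]] by simp
qed simp

lemma cmod_sum_square: "(cmod (x + y))^2 \<le> 2 * (cmod x)^2 + 2 * (cmod y)^2"
proof -
  have "(cmod (x + y))^2 \<le> (cmod x + cmod y)^2" by (intro power_mono norm_triangle_ineq) simp
  also have "... \<le> 2 * (cmod x)^2 + 2 * (cmod y)^2"
    using sum_squares_ge_zero[of "cmod x - cmod y" 0] by (simp add: power2_eq_square algebra_simps)
  finally show ?thesis .
qed

lemma cmod_diff_square: "(cmod (x - y))^2 \<le> 2 * (cmod x)^2 + 2 * (cmod y)^2"
  using cmod_sum_square[of x "- y"] by simp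

text \<open>Solves the N-th difference for g(t), leaving only values at the points t + i h with i
  \<ge> 1. The base 10 comes from the induction step: 2 for the value at t + h and 8 for the first
  differences.\<close>

lemma fd_square_bound:
  "(cmod (g t))^2 \<le> 10 ^ N * ((cmod (fd N h g t))^2 + (\<Sum>i=1..N. (cmod (g (t + real i *\<^sub>R h)))^2))"
proof (induction N arbitrary: g)
  case (Suc N)
  let ?G = "\<lambda>i. (cmod (g (t + real i *\<^sub>R h)))^2" and ?d = "\<lambda>x. g (x + h) - g x"
  let ?S = "\<Sum>i=1..Suc N. ?G i" and ?F = "(cmod (fd (Suc N) h g t))^2"
  have d: "(cmod (?d (t + real i *\<^sub>R h)))^2 \<le> 2 * ?G (Suc i) + 2 * ?G i" for i
    using cmod_diff_square[of "g (t + real i *\<^sub>R h + h)" "g (t + real i *\<^sub>R h)"] by (simp add: algebra_simps)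
  have "(\<Sum>i=1..N. (cmod (?d (t + real i *\<^sub>R h)))^2) \<le> (\<Sum>i=1..N. 2 * ?G (Suc i) + 2 * ?G i)"
    by (rule sum_mono) (rule d)
  also have "... = 2 * (\<Sum>i=1..N. ?G (Suc i)) + 2 * (\<Sum>i=1..N. ?G i)"
    by (simp only: sum.distrib sum_distrib_left)
  also have "(\<Sum>i=1..N. ?G (Suc i)) = (\<Sum>i=Suc 1..Suc N. ?G i)"
    by (rule sum.shift_bounds_cl_Suc_ivl[symmetric])
  also have "... \<le> ?S" by (rule sum_mono2) auto
  also have "(\<Sum>i=1..N. ?G i) \<le> ?S" by (rule sum_mono2) auto
  finally have S: "(\<Sum>i=1..N. (cmod (?d (t + real i *\<^sub>R h)))^2) \<le> 4 * ?S" by simp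
  have F0: "?F \<ge> 0" and S0: "?S \<ge> 0" by (simp, intro sum_nonneg zero_le_power2)
  have G1: "?G 1 \<le> ?S" by (rule member_le_sum) auto
  have p: "(10 :: real) ^ N \<ge> 1" by simp
  have "(cmod (g t))^2 \<le> 2 * ?G 1 + 2 * (cmod (?d t))^2"
    using cmod_diff_square[of "g (t + h)" "?d t"] by simp
  also have "(cmod (?d t))^2 \<le> 10 ^ N * (?F + (\<Sum>i=1..N. (cmod (?d (t + real i *\<^sub>R h)))^2))"
    using Suc[of ?d] by simp
  also have "... \<le> 10 ^ N * (?F + 4 * ?S)" by (intro mult_left_mono add_left_mono S) simp
  also have "2 * ?G 1 \<le> 10 ^ N * (2 * ?S)"
    unfolding mult.left_commute[of "10 ^ N"] using mult_right_mono[OF p S0] G1 by linarith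
  finally have "(cmod (g t))^2 \<le> 10 ^ N * (2 * ?S) + 2 * (10 ^ N * (?F + 4 * ?S))" by simp
  also have "... = 10 ^ N * (2 * ?F + 10 * ?S)" by (simp add: algebra_simps)
  also have "... \<le> 10 ^ N * (10 * ?F + 10 * ?S)" using F0 by (intro mult_left_mono) auto
  finally show ?case by (simp add: algebra_simps)
qed simp

text \<open>\<open>fd_square_bound\<close> is applied at every lattice translate; since |i h| \<le>
  N, Peetre's inequality makes the weights at t + k and at t + i h + k comparable.\<close>

lemma bracket_fd_bound:
  fixes h :: "real ^ 'd"
  assumes h: "norm h \<le> 1"
  shows "bracket S s g t \<le> ennreal (10 ^ N * (2 * (1 + (real N)^2)) ^ s) *
    (bracket S s (fd N h g) t + (\<Sum>i=1..N. bracket S s g (t + real i *\<^sub>R h)))"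
proof -
  let ?P = "10 ^ N * (2 * (1 + (real N)^2)) ^ s" and ?x = "\<lambda>k. t + real_vec k"
  let ?W = "\<lambda>x :: real ^ 'd. wt x ^ s"
  have W0: "?W x \<ge> 0" for x by (simp add: add_nonneg_nonneg)
  have W: "?W x \<le> (2 * (1 + (real N)^2)) ^ s * ?W (x + real i *\<^sub>R h)" if "i \<le> N" for x i
  proof -
    have "norm (x - (x + real i *\<^sub>R h)) \<le> real N * 1" using mult_mono[of "real i" "real N" "norm h" 1] that h by simp
    then have "(norm (x - (x + real i *\<^sub>R h)))^2 \<le> (real N)^2" by (intro power_mono) auto
    then have le: "2 ^ s * ?W (x + real i *\<^sub>R h) * wt (x - (x + real i *\<^sub>R h)) ^ s
       \<le> 2 ^ s * ?W (x + real i *\<^sub>R h) * (1 + (real N)^2) ^ s"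
      using W0 by (intro mult_left_mono power_mono) (auto simp: add_nonneg_nonneg)
    show ?thesis
      using order_trans[OF weight_peetre[of x s "x + real i *\<^sub>R h"] le] by (simp only: power_mult_distrib mult_ac)
  qed
  have pt: "?W x * (cmod (g x))^2 \<le> ?P * (?W x * (cmod (fd N h g x))^2 +
    (\<Sum>i=1..N. ?W (x + real i *\<^sub>R h) * (cmod (g (x + real i *\<^sub>R h)))^2))" for x
  proof -
    let ?Q = "(2 * (1 + (real N)^2)) ^ s"
    have Q: "?Q \<ge> 1" by (rule one_le_power) simp
    have "?W x * (cmod (g x))^2 \<le> ?W x * (10 ^ N * ((cmod (fd N h g x))^2 + (\<Sum>i=1..N. (cmod (g (x + real i *\<^sub>R h)))^2)))"
      by (rule mult_left_mono[OF fd_square_bound W0])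
    also have "... = 10 ^ N * (?W x * (cmod (fd N h g x))^2 + (\<Sum>i=1..N. ?W x * (cmod (g (x + real i *\<^sub>R h)))^2))"
      by (simp add: sum_distrib_left algebra_simps)
    also have "... \<le> 10 ^ N * (?Q * (?W x * (cmod (fd N h g x))^2) + (\<Sum>i=1..N. ?Q * (?W (x + real i *\<^sub>R h) * (cmod (g (x + real i *\<^sub>R h)))^2)))"
    proof (intro mult_left_mono add_mono sum_mono)
      show "?W x * (cmod (fd N h g x))^2 \<le> ?Q * (?W x * (cmod (fd N h g x))^2)"
        using mult_right_mono[OF Q, of "?W x * (cmod (fd N h g x))^2"] W0 by simp
      show "?W x * (cmod (g (x + real i *\<^sub>R h)))^2 \<le> ?Q * (?W (x + real i *\<^sub>R h) * (cmod (g (x + real i *\<^sub>R h)))^2)"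
        if "i \<in> {1..N}" for i
        using mult_right_mono[OF W[of i x], of "(cmod (g (x + real i *\<^sub>R h)))^2"] that by (simp add: mult_ac)
    qed simp
    finally show ?thesis by (simp only: sum_distrib_left[symmetric] distrib_left[symmetric] mult.assoc)
  qed
  let ?e = "\<lambda>g x. ennreal (?W x * (cmod (g x))^2)"
  have "bracket S s g t \<le> (\<integral>\<^sup>+k. ennreal ?P * (indicator S k * ?e (fd N h g) (?x k) +
      (\<Sum>i=1..N. indicator S k * ?e g (t + real i *\<^sub>R h + real_vec k))) \<partial>count_space UNIV)"
    unfolding bracket_def
  proof (rule nn_integral_mono)
    fix k
    have "?e g (?x k) \<le> ennreal (?P * (?W (?x k) * (cmod (fd N h g (?x k)))^2 +
       (\<Sum>i=1..N. ?W (?x k + real i *\<^sub>R h) * (cmod (g (?x k + real i *\<^sub>R h)))^2)))"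
      by (rule ennreal_leI[OF pt])
    also have "... = ennreal ?P * (?e (fd N h g) (?x k) + (\<Sum>i=1..N. ?e g (?x k + real i *\<^sub>R h)))"
      using W0 by (subst ennreal_mult) (auto simp: sum_nonneg sum_ennreal add_nonneg_nonneg)
    finally show "indicator S k * ?e g (?x k) \<le> ennreal ?P * (indicator S k * ?e (fd N h g) (?x k) +
      (\<Sum>i=1..N. indicator S k * ?e g (t + real i *\<^sub>R h + real_vec k)))"
      by (cases "k \<in> S") (simp_all add: add_ac)
  qed
  also have "... = ennreal ?P * (bracket S s (fd N h g) t + (\<Sum>i=1..N. bracket S s g (t + real i *\<^sub>R h)))"
    unfolding bracket_def by (subst nn_integral_cmult, simp, subst nn_integral_add, simp, simp, subst nn_integral_sum) simp_all
  finally show ?thesis .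
qed

section \<open>Functions vanishing at the origin to a given order\<close>

text \<open>The relation p(x) = o(|x|^m) at 0, with values in [0, \<infinity>] so that divergent
  lattice sums are covered. The origin itself is left out, as in the limits of
  \<open>origin_conditions\<close>.\<close>

definition little_o :: "real \<Rightarrow> (real ^ 'd \<Rightarrow> ennreal) \<Rightarrow> bool" where
  "little_o m p \<longleftrightarrow> (\<forall>e > 0. \<exists>\<delta> > 0. \<forall>x. x \<noteq> 0 \<and> norm x < \<delta> \<longrightarrow> p x \<le> ennreal (e * norm x powr m))"

lemma ennreal_tendsto_0_iff_eventually_le:
  fixes f :: "'a \<Rightarrow> ennreal"
  shows "(f \<longlongrightarrow> 0) F \<longleftrightarrow> (\<forall>e > 0. \<forall>\<^sub>F x in F. f x \<le> ennreal e)"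
proof
  assume f: "(f \<longlongrightarrow> 0) F"
  show "\<forall>e > 0. \<forall>\<^sub>F x in F. f x \<le> ennreal e"
  proof (intro allI impI)
    fix e :: real assume "e > 0"
    then have "0 < ennreal e" by simp
    from order_tendstoD(2)[OF f this] show "\<forall>\<^sub>F x in F. f x \<le> ennreal e" by (rule eventually_mono) simp
  qed
next
  assume le: "\<forall>e > 0. \<forall>\<^sub>F x in F. f x \<le> ennreal e"
  show "(f \<longlongrightarrow> 0) F"
  proof (rule order_tendstoI)
    fix a :: ennreal assume "0 < a"
    then obtain b where b: "0 < b" "b < a" using dense by blast
    then have bt: "b < top" using less_top_ennreal order_less_le_trans top_greatest by blast
    then have "enn2real b > 0" "ennreal (enn2real b) = b" using b(1) by (simp_all add: enn2real_positive_iff)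
    with le have "\<forall>\<^sub>F x in F. f x \<le> b" by metis
    then show "\<forall>\<^sub>F x in F. f x < a" using b(2) by (auto elim: eventually_mono)
  qed simp
qed

lemma ennreal_divide_le_iff:
  assumes "c > 0" shows "ennreal (1 / c) * p \<le> ennreal e \<longleftrightarrow> p \<le> ennreal (e * c)"
proof (cases p)
  case (real r)
  then show ?thesis
    using assms by (auto simp: ennreal_mult[symmetric] ennreal_le_iff2 field_simps zero_le_mult_iff mult_le_0_iff)
next
  case top
  then show ?thesis using assms by (simp add: ennreal_mult_top top_unique)
qed

lemma little_o_iff:
  fixes p :: "real ^ 'd \<Rightarrow> ennreal"
  shows "((\<lambda>t. ennreal (1 / norm t powr m) * p t) \<longlongrightarrow> 0) (at 0) \<longleftrightarrow> little_o m p"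
proof -
  have "(\<forall>x. x \<noteq> 0 \<and> norm x < \<delta> \<longrightarrow> ennreal (1 / norm x powr m) * p x \<le> ennreal e) \<longleftrightarrow>
    (\<forall>x. x \<noteq> 0 \<and> norm x < \<delta> \<longrightarrow> p x \<le> ennreal (e * norm x powr m))" for \<delta> e
    by (simp add: ennreal_divide_le_iff cong: imp_cong)
  then show ?thesis
    unfolding ennreal_tendsto_0_iff_eventually_le eventually_at little_o_def by simp
qed

text \<open>The weight is at least 1, so the lattice condition for r = s implies those for all
  smaller r.\<close>

lemma origin_conditions_iff:
  "origin_conditions \<phi> \<phi>' s n \<longleftrightarrow>
     little_o n (\<lambda>t. ennreal (cmod (1 - ft \<phi> t * cnj (ft \<phi>' t)))) \<and>
     little_o (2 * n) (bracket (- {0}) s (ft \<phi>))"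
proof -
  have 1: "((\<lambda>t. 1 / norm t powr n * cmod (1 - ft \<phi> t * cnj (ft \<phi>' t))) \<longlongrightarrow> 0) (at 0) \<longleftrightarrow>
    little_o n (\<lambda>t. ennreal (cmod (1 - ft \<phi> t * cnj (ft \<phi>' t))))"
    unfolding little_o_iff[symmetric] ennreal_mult'[symmetric, OF norm_ge_zero] ennreal_mult''[symmetric, OF norm_ge_zero]
    by (subst tendsto_ennreal_iff[symmetric]) auto
  have 2: "((\<lambda>t. ennreal (1 / norm t powr (2 * n)) *
         (\<Sum>\<^sub>\<infinity>k\<in>- {0}. ennreal (wt (t + real_vec k) ^ r * (cmod (ft \<phi> (t + real_vec k)))^2)))
         \<longlongrightarrow> 0) (at 0) \<longleftrightarrow> little_o (2 * n) (bracket (- {0}) r (ft \<phi>))" for r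
    unfolding infsum_count bracket_def[symmetric] by (rule little_o_iff)
  have "little_o (2 * n) (bracket (- {0}) r (ft \<phi>))"
    if "little_o (2 * n) (bracket (- {0}) s (ft \<phi>))" "r \<le> s" for r
    using that(1) order_trans[OF bracket_mono[OF that(2)]] unfolding little_o_def by meson
  then show ?thesis unfolding origin_conditions_def 1 2 by auto
qed

text \<open>After the substitution \<xi> = B x, the argument of p is B^-1 \<xi>, of norm at most
  \<beta> |\<xi>| with \<beta> the norm of B^-1. Near the origin p contributes e1 \<beta>^m;
  elsewhere the growth bound is weakened by one more power of |x|, which yields an extra factor
  \<beta> tending to 0. The decay of g absorbs all powers of |\<xi>|.\<close>

lemma scaled_integral_limit:
  fixes p :: "real ^ 'd \<Rightarrow> ennreal" and g :: "real ^ 'd \<Rightarrow> real" and M :: "int ^ 'd ^ 'd"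
  assumes M: "dilation_matrix M" and m: "m \<ge> 0" and [measurable]: "p \<in> borel_measurable borel" "g \<in> borel_measurable borel"
    and C: "C \<ge> 0" "\<And>x. p x \<le> ennreal (C * (1 + norm x) ^ K)" and p: "little_o m p"
    and g: "\<And>x. g x \<ge> 0" "\<And>L. \<exists>c. \<forall>x. g x \<le> c / (1 + norm x) ^ L"
  shows "(\<lambda>k. ennreal (mat_norm (undil M k) powr (- m) * \<bar>det (dil M k)\<bar>) * (\<integral>\<^sup>+x. p x * ennreal (g (dil M k *v x)) \<partial>lborel))
    \<longlonglongrightarrow> 0"
  unfolding ennreal_tendsto_0_iff_eventually_le
proof (intro allI impI)
  fix e :: real assume e: "e > 0"
  let ?b = "\<lambda>k. mat_norm (undil M k)"
  \<comment> \<open>Enough powers of 1 + |\<xi>| to dominate |\<xi>|^(m+1) together with the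
    polynomial growth of p.\<close>
  define q where "q = nat \<lceil>m\<rceil> + 1 + K"
  obtain c where c: "\<And>x. g x \<le> c / (1 + norm x) ^ (q + (CARD('d) + 2))" using g(2) by blast
  define Gr where "Gr = (LINT x|lborel. (1 + norm x) ^ q * g x)"
  have int: "integrable lborel (\<lambda>x. (1 + norm x) ^ q * g x)"
  proof (rule integrable_weight_bound)
    show "norm ((1 + norm x) ^ q * g x) \<le> c / (1 + norm x) ^ (CARD('d) + 2)" for x :: "real ^ 'd"
    proof -
      have "(1 + norm x) ^ q * g x \<le> (1 + norm x) ^ q * (c / (1 + norm x) ^ (q + (CARD('d) + 2)))"
        by (rule mult_left_mono[OF c]) simp
      also have "... = c / (1 + norm x) ^ (CARD('d) + 2)" unfolding power_add[of _ q] by simp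
      finally show ?thesis using g(1) by (simp add: abs_mult)
    qed
  qed measurable
  have Gr0: "Gr \<ge> 0" unfolding Gr_def by (rule Bochner_Integration.integral_nonneg) (simp add: g(1))
  have Gr: "(\<integral>\<^sup>+x. ennreal ((1 + norm x) ^ q * g x) \<partial>lborel) = ennreal Gr"
    unfolding Gr_def by (rule nn_integral_eq_integral[OF int]) (simp add: g(1))
  define e1 where "e1 = e / (2 * (Gr + 1))"
  have e1: "e1 > 0" using e Gr0 by (simp add: e1_def)
  obtain \<delta> where \<delta>: "\<delta> > 0" "\<And>x. x \<noteq> 0 ==> norm x < \<delta> ==> p x \<le> ennreal (e1 * norm x powr m)"
    using p e1 unfolding little_o_def by blast
  \<comment> \<open>For |x| \<ge> \<delta> one has 1 \<le> (|x| / \<delta>)^(m+1), which turns the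
    growth bound into one that vanishes to order m + 1.\<close>
  define E where "E = C / \<delta> powr (m + 1)"
  have E0: "E \<ge> 0" using C(1) by (simp add: E_def)
  have px: "p x \<le> ennreal (e1 * norm x powr m + E * norm x powr (m + 1) * (1 + norm x) ^ K)" if "x \<noteq> 0" for x
  proof (cases "norm x < \<delta>")
    case True
    show ?thesis
      by (rule order_trans[OF \<delta>(2)[OF that True]]) (use E0 in \<open>auto intro!: ennreal_leI\<close>)
  next
    case False
    have "C = E * \<delta> powr (m + 1)" using \<delta>(1) by (simp add: E_def)
    also have "... \<le> E * norm x powr (m + 1)"
      using False \<delta>(1) m E0 by (intro mult_left_mono powr_mono2) auto
    finally have "C * (1 + norm x) ^ K \<le> E * norm x powr (m + 1) * (1 + norm x) ^ K"
      by (rule mult_right_mono) simp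
    also have "... \<le> e1 * norm x powr m + E * norm x powr (m + 1) * (1 + norm x) ^ K" using e1 by simp
    finally show ?thesis using order_trans[OF C(2)] ennreal_leI by blast
  qed
  have em: "ennreal (a * x) * ennreal y = ennreal a * ennreal (x * y)" if "a \<ge> 0" "x \<ge> 0" "y \<ge> 0" for a x y
    using that by (simp add: ennreal_mult mult.assoc)
  have main: "ennreal (?b k powr (- m) * \<bar>det (dil M k)\<bar>) * (\<integral>\<^sup>+x. p x * ennreal (g (dil M k *v x)) \<partial>lborel) \<le> ennreal e"
    if b1: "?b k \<le> 1" and b2: "E * Gr * ?b k \<le> e / 2" for k
  proof -
    let ?B = "dil M k" and ?C = "undil M k" and ?\<beta> = "?b k"
    have b0: "?\<beta> > 0" by (rule norm_dil_bounds(1)[OF M])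
    have BC: "?B ** ?C = mat 1" by (rule dil_undil[OF M])
    then have CB: "?C ** ?B = mat 1" by (simp add: matrix_left_right_inverse)
    have det: "det ?B \<noteq> 0" using det_matrix_inv[OF CB] det_matrix_inv[OF BC] by auto
    have "(\<integral>\<^sup>+\<xi>. p (?C *v \<xi>) * ennreal (g \<xi>) \<partial>lborel) = ennreal \<bar>det ?B\<bar> * (\<integral>\<^sup>+x. p (?C *v (?B *v x + 0)) * ennreal (g (?B *v x + 0)) \<partial>lborel)"
      by (rule nn_integral_affine_matrix[OF _ det]) measurable
    then have sub: "ennreal \<bar>det ?B\<bar> * (\<integral>\<^sup>+x. p x * ennreal (g (?B *v x)) \<partial>lborel) = (\<integral>\<^sup>+\<xi>. p (?C *v \<xi>) * ennreal (g \<xi>) \<partial>lborel)"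
      by (simp add: matrix_vector_mul_assoc CB)
    let ?A = "?\<beta> powr m * (e1 + E * ?\<beta>)"
    have A0: "?A \<ge> 0" using b0 e1 E0 by simp
    have "(\<integral>\<^sup>+\<xi>. p (?C *v \<xi>) * ennreal (g \<xi>) \<partial>lborel) \<le> (\<integral>\<^sup>+\<xi>. ennreal ?A * ennreal ((1 + norm \<xi>) ^ q * g \<xi>) \<partial>lborel)"
    proof (rule nn_integral_mono_AE)
      show "AE \<xi> in lborel. p (?C *v \<xi>) * ennreal (g \<xi>) \<le> ennreal ?A * ennreal ((1 + norm \<xi>) ^ q * g \<xi>)"
        using AE_lborel_singleton[of "0 :: real ^ 'd"]
      proof eventually_elim
        fix \<xi> :: "real ^ 'd" assume \<xi>: "\<xi> \<noteq> 0"
        have "?B *v (?C *v \<xi>) = \<xi>" by (simp only: matrix_vector_mul_assoc BC matrix_vector_mul_lid)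
        then have C0: "?C *v \<xi> \<noteq> 0" using \<xi> by auto
        have le: "norm (?C *v \<xi>) \<le> ?\<beta> * norm \<xi>" by (rule norm_matrix_le)
        then have le1: "norm (?C *v \<xi>) \<le> norm \<xi>"
          using mult_right_mono[OF b1, of "norm \<xi>"] by simp
        have pw: "norm (?C *v \<xi>) powr a \<le> ?\<beta> powr a * (1 + norm \<xi>) ^ N" if "0 \<le> a" "a \<le> real N" for a N
        proof -
          have "norm (?C *v \<xi>) powr a \<le> (?\<beta> * norm \<xi>) powr a" using le that by (intro powr_mono2) auto
          also have "... = ?\<beta> powr a * norm \<xi> powr a" using b0 by (simp add: powr_mult)
          also have "norm \<xi> powr a \<le> (1 + norm \<xi>) powr a" using that by (intro powr_mono2) auto
          also have "... \<le> (1 + norm \<xi>) powr real N" using that by (intro powr_mono) auto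
          also have "... = (1 + norm \<xi>) ^ N" by (simp add: powr_realpow)
          finally show ?thesis by (simp add: mult_left_mono)
        qed
        let ?N = "nat \<lceil>m\<rceil> + 1"
        have "norm (?C *v \<xi>) powr m \<le> ?\<beta> powr m * (1 + norm \<xi>) ^ q"
          by (rule pw[OF m]) (unfold q_def, linarith)
        moreover have "norm (?C *v \<xi>) powr (m + 1) * (1 + norm (?C *v \<xi>)) ^ K \<le> (?\<beta> powr (m + 1) * (1 + norm \<xi>) ^ ?N) * (1 + norm \<xi>) ^ K"
          using m le1 real_nat_ceiling_ge[of m] by (intro mult_mono pw power_mono) auto
        ultimately have "e1 * norm (?C *v \<xi>) powr m + E * (norm (?C *v \<xi>) powr (m + 1) * (1 + norm (?C *v \<xi>)) ^ K)
          \<le> e1 * (?\<beta> powr m * (1 + norm \<xi>) ^ q) + E * ((?\<beta> powr (m + 1) * (1 + norm \<xi>) ^ ?N) * (1 + norm \<xi>) ^ K)"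
          using e1 E0 by (intro add_mono mult_left_mono) auto
        also have "... = ?A * (1 + norm \<xi>) ^ q"
          using b0 by (simp add: q_def powr_add power_add algebra_simps)
        finally have "p (?C *v \<xi>) \<le> ennreal (?A * (1 + norm \<xi>) ^ q)"
          using order_trans[OF px[OF C0]] ennreal_leI by (simp add: mult.assoc)
        then have "p (?C *v \<xi>) * ennreal (g \<xi>) \<le> ennreal (?A * (1 + norm \<xi>) ^ q) * ennreal (g \<xi>)"
          by (rule mult_right_mono) simp
        then show "p (?C *v \<xi>) * ennreal (g \<xi>) \<le> ennreal ?A * ennreal ((1 + norm \<xi>) ^ q * g \<xi>)"
          by (subst (asm) em) (use A0 g(1) in auto)
      qed
    qed
    also have "... = ennreal (?A * Gr)" using A0 Gr0 by (subst nn_integral_cmult) (auto simp: Gr ennreal_mult)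
    finally have "ennreal (?\<beta> powr (- m)) * (ennreal \<bar>det ?B\<bar> * (\<integral>\<^sup>+x. p x * ennreal (g (?B *v x)) \<partial>lborel)) \<le> ennreal (?\<beta> powr (- m)) * ennreal (?A * Gr)"
      unfolding sub by (rule mult_left_mono) simp
    also have "... = ennreal ((e1 + E * ?\<beta>) * Gr)"
    proof -
      have "ennreal (?\<beta> powr (- m)) * ennreal (?A * Gr) = ennreal (?\<beta> powr (- m) * (?A * Gr))"
        by (rule ennreal_mult[symmetric]) (rule powr_ge_zero, rule mult_nonneg_nonneg[OF A0 Gr0])
      also have "?\<beta> powr (- m) * (?A * Gr) = (?\<beta> powr (- m) * ?\<beta> powr m) * ((e1 + E * ?\<beta>) * Gr)" by (simp only: mult_ac)
      also have "?\<beta> powr (- m) * ?\<beta> powr m = 1" using b0 by (simp add: powr_minus)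
      finally show ?thesis by simp
    qed
    also have "... \<le> ennreal e"
    proof (rule ennreal_leI)
      have "e1 * Gr \<le> e1 * (Gr + 1)" using e1 by simp
      also have "... = e / 2" using Gr0 by (simp add: e1_def field_simps)
      finally show "(e1 + E * ?\<beta>) * Gr \<le> e" using b2 by (simp add: algebra_simps)
    qed
    finally show ?thesis by (simp add: ennreal_mult mult.assoc)
  qed
  have "\<forall>\<^sub>F k in sequentially. ?b k < 1"
    using order_tendstoD(2)[OF norm_undil_tendsto_0[OF M]] by simp
  moreover have "(\<lambda>k. E * Gr * ?b k) \<longlonglongrightarrow> E * Gr * 0"
    by (intro tendsto_mult tendsto_const norm_undil_tendsto_0 M)
  then have "\<forall>\<^sub>F k in sequentially. E * Gr * ?b k < e / 2"
    by (rule order_tendstoD(2)) (use e in simp)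
  ultimately show "\<forall>\<^sub>F k in sequentially. ennreal (?b k powr (- m) * \<bar>det (dil M k)\<bar>) *
    (\<integral>\<^sup>+x. p x * ennreal (g (dil M k *v x)) \<partial>lborel) \<le> ennreal e"
    by eventually_elim (rule main, auto)
qed

section \<open>The rescaled projection error\<close>

definition sample :: "'d::finite distr \<Rightarrow> (real ^ 'd \<Rightarrow> complex) \<Rightarrow> real ^ 'd ^ 'd \<Rightarrow> real ^ 'd \<Rightarrow> complex" where
  "sample \<phi>' f B \<tau> = fourier f (B *v \<tau>) * cnj (ft \<phi>' \<tau>)"

definition proj_error :: "'d::finite distr \<Rightarrow> 'd distr \<Rightarrow> (real ^ 'd \<Rightarrow> complex) \<Rightarrow> real ^ 'd ^ 'd \<Rightarrow> real ^ 'd \<Rightarrow> real" where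
  "proj_error \<phi> \<phi>' f B t = cmod (fourier f (B *v t) - ft \<phi> t * periodize (sample \<phi>' f B) t)"

locale density =
  fixes M :: "int ^ 'd ^ 'd" and s :: nat and n :: real and \<phi> \<phi>' :: "'d distr"
  assumes M: "dilation_matrix M" and \<phi>: "\<phi> \<in> sobolev (real s)" and \<phi>': "\<phi>' \<in> sobolev (- real s)"
    and K: "compact (distr_support \<phi>)" "compact (distr_support \<phi>')" and n: "n \<ge> real s"
begin

abbreviation \<beta> where "\<beta> k \<equiv> mat_norm (undil M k)"
abbreviation \<Phi> where "\<Phi> \<equiv> bracket (- {0}) s (ft \<phi>)"
abbreviation err where "err f k \<equiv> proj_error \<phi> \<phi>' f (dil M k)"

definition v :: "real ^ 'd \<Rightarrow> complex" where "v t = 1 - ft \<phi> t * cnj (ft \<phi>' t)"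

lemma slow: "ft \<phi> \<in> slow_fun" "ft \<phi>' \<in> slow_fun" "v \<in> slow_fun"
proof -
  show 1: "ft \<phi> \<in> slow_fun" by (rule sobolev_compact_support[OF \<phi> _ K(1), of s]) auto
  show 2: "ft \<phi>' \<in> slow_fun" by (rule sobolev_compact_support[OF \<phi>' _ K(2), of s]) auto
  show "v \<in> slow_fun" unfolding v_def[abs_def] by (intro slow_diff slow_const slow_mult slow_cnj 1 2)
qed

lemma measurable_ft [measurable]:
  "ft \<phi> \<in> borel_measurable borel" "ft \<phi>' \<in> borel_measurable borel" "v \<in> borel_measurable borel"
  using slow by (auto intro: slow_measurable)

text \<open>The reproducing identity for \<phi>^ moves the difference onto \<theta>, where it is
  O(|h|^N) with rapid decay, and \<open>bracket_conv_bound\<close> is quadratic in that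
  size.\<close>

lemma bracket_fd_decay:
  obtains D where "D \<ge> 0"
    "\<And>S t h. norm h \<le> 1 ==> bracket S s (fd N h (ft \<phi>)) t \<le> ennreal (D * (norm h ^ N)^2)"
proof -
  obtain \<theta> where \<theta>: "\<theta> \<in> schwartz" "ft \<phi> = conv (ft \<phi>) \<theta>"
    by (rule sobolev_compact_support[OF \<phi> _ K(1), of s]) auto
  have "- real s \<le> real s" by simp
  note S = sobolevD(3,4)[OF \<phi> this, unfolded weight_powr_nat]
  obtain D where D: "D \<ge> 0" "\<And>\<theta> c S t. \<theta> \<in> schwartz ==> c \<ge> 0 ==>
      (\<And>x. cmod (\<theta> x) \<le> c / (1 + norm x) ^ (CARD('d) + 2 + s)) ==>
      bracket S s (conv (ft \<phi>) \<theta>) t \<le> ennreal (D * c^2)"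
    by (rule bracket_conv_bound[OF S]) blast
  obtain C where C: "C \<ge> 0" "\<And>h x. norm h \<le> 1 ==> cmod (fd N h \<theta> x) \<le> C * norm h ^ N / (1 + norm x) ^ (CARD('d) + 2 + s)"
    using fd_bound[OF \<theta>(1), of N "CARD('d) + 2 + s"] by blast
  show thesis
  proof
    show "D * C^2 \<ge> 0" using D(1) by simp
    fix S t and h :: "real ^ 'd" assume h: "norm h \<le> 1"
    have "fd N h (ft \<phi>) = conv (ft \<phi>) (fd N h \<theta>)"
      using fd_conv[OF S(1) \<theta>(1), of N h] \<theta>(2) by metis
    moreover have "bracket S s (conv (ft \<phi>) (fd N h \<theta>)) t \<le> ennreal (D * (C * norm h ^ N)^2)"
      by (rule D(2)[OF fd_schwartz[OF \<theta>(1)] _ C(2)[OF h]]) (use C(1) in simp)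
    ultimately show "bracket S s (fd N h (ft \<phi>)) t \<le> ennreal (D * C^2 * (norm h ^ N)^2)"
      by (simp add: power_mult_distrib mult_ac)
  qed
qed

lemma quasi_projection: "f \<in> schwartz ==> quasi_projection M s \<phi> \<phi>' f (int k) (mat_powi (real_mat M) (int k)) (undil M k)"
  using M \<phi> \<phi>' slow dil_undil[OF M, of k] det_dil[OF M, of k] by unfold_locales (auto simp: dil_eq)

lemma sample_eq:
  assumes "f \<in> schwartz"
  shows "quasi_projection.u \<phi>' f (mat_powi (real_mat M) (int k)) = sample \<phi>' f (dil M k)"
  by (rule ext) (simp only: quasi_projection.u_def[OF quasi_projection[OF assms]] sample_def dil_eq)

lemma sample_schwartz:
  assumes f: "f \<in> schwartz" shows "sample \<phi>' f (dil M k) \<in> schwartz"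
  using quasi_projection.u_schwartz[OF quasi_projection[OF f, of k]] by (simp only: sample_eq[OF f])

lemma proj_error_measurable: 
  assumes f: "f \<in> schwartz" shows "err f k \<in> borel_measurable borel"
proof -
  have [measurable]: "periodize (sample \<phi>' f (dil M k)) \<in> borel_measurable borel"
    using continuous_periodize[OF sample_schwartz[OF f]]
    by (intro borel_measurable_continuous_onI) (simp add: continuous_at_imp_continuous_on)
  have [measurable]: "fourier f \<in> borel_measurable borel" by (intro schwartz_measurable fourier_schwartz f)
  show ?thesis unfolding proj_error_def[abs_def] by measurable
qed

lemma seminorm_error:
  assumes f: "f \<in> schwartz" and r: "r \<le> s"
  shows "ennreal ((sobolev_seminorm r (distr_diff (distr_of f) (quasi_proj M s \<phi> \<phi>' (int k) (distr_of f))))^2)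
    = ennreal \<bar>det (dil M k)\<bar> * (\<integral>\<^sup>+t. ennreal (norm (dil M k *v t) ^ (2 * r) * (err f k t)^2) \<partial>lborel)"
proof -
  note Q = quasi_projection[OF f, of k]
  note F = quasi_projection.error_formula[OF Q, of r, folded dil_eq, unfolded sample_eq[OF f], folded proj_error_def]
  note I = quasi_projection.error_integrable[OF Q r, folded dil_eq, unfolded sample_eq[OF f], folded proj_error_def]
  have d: "\<bar>det (mat_powi (real_mat M) (int k))\<bar> = \<bar>det (dil M k)\<bar>" by (simp add: dil_eq)
  have "ennreal ((sobolev_seminorm r (distr_diff (distr_of f) (quasi_proj M s \<phi> \<phi>' (int k) (distr_of f))))^2)
    = ennreal (\<bar>det (dil M k)\<bar> * (LINT t|lborel. norm (dil M k *v t) ^ (2 * r) * (err f k t)^2))"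
    unfolding F d by (subst real_sqrt_pow2) (auto intro!: mult_nonneg_nonneg Bochner_Integration.integral_nonneg)
  also have "... = ennreal \<bar>det (dil M k)\<bar> * ennreal (LINT t|lborel. norm (dil M k *v t) ^ (2 * r) * (err f k t)^2)"
    by (intro ennreal_mult Bochner_Integration.integral_nonneg) auto
  also have "ennreal (LINT t|lborel. norm (dil M k *v t) ^ (2 * r) * (err f k t)^2)
    = (\<integral>\<^sup>+t. ennreal (norm (dil M k *v t) ^ (2 * r) * (err f k t)^2) \<partial>lborel)"
    by (rule nn_integral_eq_integral[OF I, symmetric]) simp
  finally show ?thesis .
qed

end

section \<open>Sufficiency of the origin conditions\<close>

lemma unit_cube_shift: "t \<in> unit_cube ==> t + real_vec k \<in> unit_cube \<longleftrightarrow> k = 0"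
  using unit_cube_ex1[of t] by (metis add.right_neutral real_vec_0)

lemma small_in_unit_cube: "norm t < 1 / 2 ==> t \<in> unit_cube"
  unfolding unit_cube_def
proof (intro CollectI allI)
  fix i assume "norm t < 1 / 2"
  with component_le_norm_cart[of t i] show "- 1 / 2 \<le> t $ i \<and> t $ i < 1 / 2" by linarith
qed

context density
begin

text \<open>The weight of |f^(Bt)|^2: in the cube the error is governed by \<open>v\<close>, outside
  it f^ is not reproduced at all and counts in full.\<close>

definition p1 :: "real ^ 'd \<Rightarrow> ennreal" where
  "p1 x = ennreal (wt x ^ s * (if x \<in> unit_cube then (cmod (v x))^2 else 1))"

text \<open>The leakage of the sample at a point of the cube into its nonzero lattice translates,
  through the values of \<phi>^ there.\<close>

definition p2 :: "real ^ 'd \<Rightarrow> ennreal" where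
  "p2 x = indicator unit_cube x * (\<Phi> x * ennreal ((cmod (ft \<phi>' x))^2))"

text \<open>Samples from outside the cube that periodization folds into it. The first power suffices
  because one of the two factors of a square is bounded by a constant.\<close>

definition p3 :: "real ^ 'd \<Rightarrow> ennreal" where
  "p3 x = indicator (- unit_cube) x * ennreal (cmod (ft \<phi>' x))"

lemma p_measurable [measurable]:
  "p1 \<in> borel_measurable borel" "p2 \<in> borel_measurable borel" "p3 \<in> borel_measurable borel"
  unfolding p1_def[abs_def] p2_def[abs_def] p3_def[abs_def] by measurable

text \<open>The case N = 0 of the difference estimate.\<close>

lemma bracket_bound: obtains Ba where "Ba \<ge> 0" "\<And>S t. bracket S s (ft \<phi>) t \<le> ennreal Ba"
proof -
  obtain D where D: "D \<ge> 0"
    "\<And>S t h. norm h \<le> 1 ==> bracket S s (fd 0 h (ft \<phi>)) t \<le> ennreal (D * (norm h ^ 0)^2)"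
    by (rule bracket_fd_decay) blast
  show thesis using that[OF D(1)] D(2)[of 0] by simp
qed

lemma norm_le_dil:
  assumes "\<beta> k \<le> 1" shows "norm x \<le> norm (dil M k *v x)"
  using norm_dil_bounds(3)[OF M, of x k] mult_right_mono[OF assms, of "norm (dil M k *v x)"] by simp

text \<open>If the norm of B^-1 is at most 1 then |x| \<le> |Bx|, so f^(Bx) decays in x uniformly in
  k and outweighs the polynomial growth of \<phi>'^.\<close>

lemma sample_lattice_bound:
  assumes f: "f \<in> schwartz"
  obtains c where "c \<ge> 0" "\<And>k t. \<beta> k \<le> 1 ==>
    (\<integral>\<^sup>+l. ennreal (cmod (sample \<phi>' f (dil M k) (t + real_vec l))) \<partial>count_space UNIV) \<le> ennreal c"
proof -
  obtain N C where C: "\<And>x. cmod (ft \<phi>' x) \<le> C * (1 + norm x) ^ N"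
    using slow_growth[OF slow(2)] by blast
  obtain c where c: "c \<ge> 0" "\<And>x. cmod (fourier f x) \<le> c / (1 + norm x) ^ (N + (CARD('d) + 2))"
    using schwartz_bound0[OF fourier_schwartz[OF f]] by blast
  have C0: "C \<ge> 0" using order_trans[OF norm_ge_zero C[of 0]] by simp
  obtain W where W: "W \<ge> 0" "\<And>t :: real ^ 'd.
    (\<integral>\<^sup>+k. ennreal (1 / (1 + norm (t + real_vec k)) ^ (CARD('d) + 2)) \<partial>count_space UNIV) \<le> ennreal W"
    by (rule lattice_weight_bound) blast
  show thesis
  proof
    show "c * C * W \<ge> 0" using c C0 W by simp
    fix k t assume k: "\<beta> k \<le> 1"
    have le: "cmod (sample \<phi>' f (dil M k) x) \<le> c * C * (1 / (1 + norm x) ^ (CARD('d) + 2))" for x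
    proof -
      have "cmod (fourier f (dil M k *v x)) \<le> c / (1 + norm (dil M k *v x)) ^ (N + (CARD('d) + 2))" by (rule c(2))
      also have "... \<le> c / (1 + norm x) ^ (N + (CARD('d) + 2))"
        using c(1) norm_le_dil[OF k, of x] by (intro divide_left_mono power_mono mult_pos_pos zero_less_power) auto
      finally have "cmod (fourier f (dil M k *v x)) * cmod (ft \<phi>' x) \<le> (c / (1 + norm x) ^ (N + (CARD('d) + 2))) * (C * (1 + norm x) ^ N)"
        using c(1) by (intro mult_mono C) auto
      also have "... = c * C * (1 / (1 + norm x) ^ (CARD('d) + 2))"
        unfolding power_add[of _ N] by simp
      finally show ?thesis by (simp add: sample_def norm_mult)
    qed
    have "(\<integral>\<^sup>+l. ennreal (cmod (sample \<phi>' f (dil M k) (t + real_vec l))) \<partial>count_space UNIV) \<le>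
      (\<integral>\<^sup>+l. ennreal (c * C) * ennreal (1 / (1 + norm (t + real_vec l)) ^ (CARD('d) + 2)) \<partial>count_space UNIV)"
    proof (rule nn_integral_mono)
      fix l
      show "ennreal (cmod (sample \<phi>' f (dil M k) (t + real_vec l))) \<le> ennreal (c * C) * ennreal (1 / (1 + norm (t + real_vec l)) ^ (CARD('d) + 2))"
        by (subst ennreal_mult[symmetric]) (use c(1) C0 in simp, simp, rule ennreal_leI[OF le])
    qed
    also have "... = ennreal (c * C) * (\<integral>\<^sup>+l. ennreal (1 / (1 + norm (t + real_vec l)) ^ (CARD('d) + 2)) \<partial>count_space UNIV)"
      by (rule nn_integral_cmult) simp
    also have "... \<le> ennreal (c * C) * ennreal W" by (rule mult_left_mono[OF W(2)]) simp
    also have "... = ennreal (c * C * W)" using c(1) C0 W(1) by (simp add: ennreal_mult)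
    finally show "(\<integral>\<^sup>+l. ennreal (cmod (sample \<phi>' f (dil M k) (t + real_vec l))) \<partial>count_space UNIV) \<le> ennreal (c * C * W)" .
  qed
qed

text \<open>The periodized sample P is the same at all lattice translates of t, and
  \<open>bb\<close> bounds |P - u(t)|. At t the error is f^ v - \<phi>^ (P - u(t)), at the other
  translates it is f^ - \<phi>^ P. Squaring with |x + y|^2 \<le> 2 |x|^2 + 2 |y|^2 and summing with
  weights gives the three terms.\<close>

lemma error_pointwise:
  fixes f k
  defines "B \<equiv> dil M k" and "u \<equiv> sample \<phi>' f (dil M k)"
  assumes f: "f \<in> schwartz" and t: "t \<in> unit_cube"
    and Ba: "Ba \<ge> 0" "bracket UNIV s (ft \<phi>) t \<le> ennreal Ba"
    and c: "(\<integral>\<^sup>+l. ennreal (cmod (u (t + real_vec l))) \<partial>count_space UNIV) \<le> ennreal c" "c \<ge> 0"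
  shows "(\<integral>\<^sup>+l. ennreal (wt (t + real_vec l) ^ s * (proj_error \<phi> \<phi>' f B (t + real_vec l))^2) \<partial>count_space UNIV)
    \<le> 2 * (\<integral>\<^sup>+l. p1 (t + real_vec l) * ennreal ((cmod (fourier f (B *v (t + real_vec l))))^2) \<partial>count_space UNIV)
     + 4 * (p2 t * ennreal ((cmod (fourier f (B *v t)))^2))
     + ennreal (4 * Ba * c) * (\<integral>\<^sup>+l. p3 (t + real_vec l) * ennreal (cmod (fourier f (B *v (t + real_vec l)))) \<partial>count_space UNIV)"
proof -
  let ?F = "\<lambda>x. fourier f (B *v x)" and ?x = "\<lambda>l. t + real_vec l"
  have u: "u \<in> schwartz" unfolding u_def by (rule sample_schwartz[OF f])
  have u_eq: "u x = ?F x * cnj (ft \<phi>' x)" for x by (simp add: u_def sample_def B_def)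
  define bb where "bb = (LINT l|count_space UNIV. indicator (- {0}) l * cmod (u (?x l)))"
  have i1: "integrable (count_space UNIV) (\<lambda>l. u (?x l))" by (rule integrable_periodize[OF u])
  have i2: "integrable (count_space UNIV) (\<lambda>l. indicator A l *\<^sub>R u (?x l))" for A
    by (rule integrable_mult_indicator[OF _ i1]) simp
  have i3: "integrable (count_space UNIV) (\<lambda>l. indicator (- {0}) l * cmod (u (?x l)))"
    using integrable_norm[OF i2[of "- {0}"]] by simp
  have bb0: "bb \<ge> 0" unfolding bb_def by (rule Bochner_Integration.integral_nonneg) simp
  have ebb: "ennreal bb = (\<integral>\<^sup>+l. ennreal (indicator (- {0}) l * cmod (u (?x l))) \<partial>count_space UNIV)"
    unfolding bb_def by (rule nn_integral_eq_integral[OF i3, symmetric]) simp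
  have "ennreal bb \<le> (\<integral>\<^sup>+l. ennreal (cmod (u (?x l))) \<partial>count_space UNIV)"
    unfolding ebb by (intro nn_integral_mono ennreal_leI) (simp split: split_indicator)
  from order_trans[OF this c(1)] have bbc: "bb \<le> c" using c(2) by (simp add: ennreal_le_iff)
  have p3: "(\<integral>\<^sup>+l. p3 (?x l) * ennreal (cmod (?F (?x l))) \<partial>count_space UNIV) = ennreal bb"
    unfolding ebb
    by (intro nn_integral_cong)
       (simp add: p3_def u_eq unit_cube_shift[OF t] t norm_mult ennreal_mult mult.commute split: split_indicator)
  let ?P = "periodize u t"
  have "?P = (LINT l|count_space UNIV. indicator {0} l *\<^sub>R u (?x l) + indicator (- {0}) l *\<^sub>R u (?x l))"
    unfolding periodize_def by (intro Bochner_Integration.integral_cong refl) (simp split: split_indicator)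
  also have "... = (LINT l|count_space UNIV. indicator {0} l *\<^sub>R u (?x l)) + (LINT l|count_space UNIV. indicator (- {0}) l *\<^sub>R u (?x l))"
    by (rule Bochner_Integration.integral_add[OF i2 i2])
  also have "(LINT l|count_space UNIV. indicator {0} l *\<^sub>R u (?x l)) = u t" by (subst integral_count_single) simp
  finally have "?P - u t = (LINT l|count_space UNIV. indicator (- {0}) l *\<^sub>R u (?x l))" by simp
  then have "cmod (?P - u t) \<le> (LINT l|count_space UNIV. norm (indicator (- {0}) l *\<^sub>R u (?x l)))"
    by (simp only: integral_norm_bound)
  then have "cmod (?P - u t) \<le> bb" by (simp add: bb_def)
  then have Pb: "(cmod (?P - u t))^2 \<le> bb^2" by (rule power_mono) simp
  let ?W = "\<lambda>x. wt x ^ s" and ?a = "ft \<phi>"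
  let ?p = "\<lambda>l. if ?x l \<in> unit_cube then (cmod (v (?x l)))^2 else 1"
  have W0: "?W x \<ge> 0" for x :: "real ^ 'd" by (simp add: add_nonneg_nonneg)
  have e: "(proj_error \<phi> \<phi>' f B (?x l))^2 \<le> 2 * (?p l * (cmod (?F (?x l)))^2)
    + 4 * (cmod (u t))^2 * (indicator (- {0}) l * (cmod (?a (?x l)))^2) + 4 * bb^2 * (cmod (?a (?x l)))^2" for l
  proof -
    have pe: "proj_error \<phi> \<phi>' f B (?x l) = cmod (?F (?x l) - ?a (?x l) * ?P)"
      by (simp add: proj_error_def periodize_periodic u_def B_def)
    show ?thesis
    proof (cases "l = 0")
      case True
      have "?F t - ?a t * ?P = ?F t * v t - ?a t * (?P - u t)" by (simp add: v_def u_eq algebra_simps)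
      then have "(cmod (?F t - ?a t * ?P))^2 \<le> 2 * ((cmod (v t))^2 * (cmod (?F t))^2) + 2 * ((cmod (?a t))^2 * (cmod (?P - u t))^2)"
        using cmod_diff_square[of "?F t * v t" "?a t * (?P - u t)"] by (simp add: norm_mult power_mult_distrib mult_ac)
      also have "(cmod (?a t))^2 * (cmod (?P - u t))^2 \<le> (cmod (?a t))^2 * bb^2" by (rule mult_left_mono[OF Pb]) simp
      also have "2 * ((cmod (?a t))^2 * bb^2) \<le> 4 * bb^2 * (cmod (?a t))^2" by simp
      finally show ?thesis unfolding pe using True t by simp
    next
      case False
      have "(cmod ?P)^2 \<le> 2 * (cmod (u t))^2 + 2 * bb^2"
        using cmod_sum_square[of "u t" "?P - u t"] Pb by simp
      then have "(cmod (?a (?x l)))^2 * (cmod ?P)^2 \<le> (cmod (?a (?x l)))^2 * (2 * (cmod (u t))^2 + 2 * bb^2)"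
        by (rule mult_left_mono) simp
      then show ?thesis
        using cmod_diff_square[of "?F (?x l)" "?a (?x l) * ?P"] False
        by (simp add: pe unit_cube_shift[OF t] norm_mult power_mult_distrib algebra_simps)
    qed
  qed
  let ?e = "\<lambda>l. ennreal (?W (?x l) * (cmod (?a (?x l)))^2)"
  have "(\<integral>\<^sup>+l. ennreal (?W (?x l) * (proj_error \<phi> \<phi>' f B (?x l))^2) \<partial>count_space UNIV)
    \<le> (\<integral>\<^sup>+l. 2 * (p1 (?x l) * ennreal ((cmod (?F (?x l)))^2)) + (ennreal (4 * (cmod (u t))^2) * (indicator (- {0}) l * ?e l)
        + ennreal (4 * bb^2) * (indicator UNIV l * ?e l)) \<partial>count_space UNIV)"
  proof (rule nn_integral_mono)
    fix l
    have "?W (?x l) * (proj_error \<phi> \<phi>' f B (?x l))^2 \<le> ?W (?x l) * (2 * (?p l * (cmod (?F (?x l)))^2)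
      + 4 * (cmod (u t))^2 * (indicator (- {0}) l * (cmod (?a (?x l)))^2) + 4 * bb^2 * (cmod (?a (?x l)))^2)"
      by (rule mult_left_mono[OF e W0])
    also have "... = 2 * ((?W (?x l) * ?p l) * (cmod (?F (?x l)))^2)
      + (4 * (cmod (u t))^2 * (indicator (- {0}) l * (?W (?x l) * (cmod (?a (?x l)))^2)) + 4 * bb^2 * (?W (?x l) * (cmod (?a (?x l)))^2))"
      by (simp only: distrib_left mult_ac add_ac)
    finally have "ennreal (?W (?x l) * (proj_error \<phi> \<phi>' f B (?x l))^2) \<le> ennreal (2 * ((?W (?x l) * ?p l) * (cmod (?F (?x l)))^2)
      + (4 * (cmod (u t))^2 * (indicator (- {0}) l * (?W (?x l) * (cmod (?a (?x l)))^2)) + 4 * bb^2 * (?W (?x l) * (cmod (?a (?x l)))^2)))"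
      by (rule ennreal_leI)
    also have "... = 2 * (p1 (?x l) * ennreal ((cmod (?F (?x l)))^2)) + (ennreal (4 * (cmod (u t))^2) * (indicator (- {0}) l * ?e l)
        + ennreal (4 * bb^2) * (indicator UNIV l * ?e l))"
    proof -
      define A where "A = ?W (?x l) * ?p l"
      define E where "E = ?W (?x l) * (cmod (?a (?x l)))^2"
      have AE: "A \<ge> 0" "E \<ge> 0" using W0 by (auto simp: A_def E_def)
      have p: "p1 (?x l) = ennreal A" by (simp add: p1_def A_def)
      show ?thesis unfolding p A_def[symmetric] E_def[symmetric] using AE
        by (cases "l = 0") (simp_all add: ennreal_mult ennreal_plus[symmetric] del: ennreal_plus, simp_all add: ennreal_mult)
    qed
    finally show "ennreal (?W (?x l) * (proj_error \<phi> \<phi>' f B (?x l))^2) \<le> 2 * (p1 (?x l) * ennreal ((cmod (?F (?x l)))^2)) +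
      (ennreal (4 * (cmod (u t))^2) * (indicator (- {0}) l * ?e l) + ennreal (4 * bb^2) * (indicator UNIV l * ?e l))" .
  qed
  also have "... = 2 * (\<integral>\<^sup>+l. p1 (?x l) * ennreal ((cmod (?F (?x l)))^2) \<partial>count_space UNIV)
    + (ennreal (4 * (cmod (u t))^2) * \<Phi> t + ennreal (4 * bb^2) * bracket UNIV s (ft \<phi>) t)"
    unfolding bracket_def by (simp only: nn_integral_add nn_integral_cmult measurable_count_space_eq1 Pi_UNIV UNIV_I space_borel)
  also have "... \<le> 2 * (\<integral>\<^sup>+l. p1 (?x l) * ennreal ((cmod (?F (?x l)))^2) \<partial>count_space UNIV)
    + (4 * (p2 t * ennreal ((cmod (?F t))^2)) + ennreal (4 * Ba * c) * ennreal bb)"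
  proof (intro add_mono order_refl)
    show "ennreal (4 * (cmod (u t))^2) * \<Phi> t \<le> 4 * (p2 t * ennreal ((cmod (?F t))^2))"
      using t by (simp add: p2_def u_eq norm_mult power_mult_distrib ennreal_mult mult_ac)
    have "ennreal (4 * bb^2) * bracket UNIV s (ft \<phi>) t \<le> ennreal (4 * bb^2) * ennreal Ba"
      by (rule mult_left_mono[OF Ba(2)]) simp
    also have "... = ennreal (4 * Ba * bb * bb)"
      using Ba(1) by (simp add: ennreal_mult[symmetric] power2_eq_square mult_ac)
    \<comment> \<open>One factor \<open>bb\<close> is replaced by its uniform bound
      \<open>c\<close>; the other one stays, as the lattice sum belonging to
      \<open>p3\<close>.\<close>
    also have "... \<le> ennreal (4 * Ba * c * bb)"
      using Ba(1) bbc bb0 by (intro ennreal_leI mult_right_mono mult_left_mono) auto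
    finally show "ennreal (4 * bb^2) * bracket UNIV s (ft \<phi>) t \<le> ennreal (4 * Ba * c) * ennreal bb"
      using Ba(1) c(2) bb0 by (simp add: ennreal_mult)
  qed
  finally show ?thesis unfolding p3 by (simp only: add.assoc)
qed

lemma schwartz_decay_square:
  assumes "g \<in> schwartz" shows "\<exists>c. \<forall>x. (cmod (g x))^2 \<le> c / (1 + norm x) ^ L"
proof -
  obtain c where c: "c \<ge> 0" "\<And>x. cmod (g x) \<le> c / (1 + norm x) ^ L"
    using schwartz_bound0[OF assms] by blast
  have "(cmod (g x))^2 \<le> c^2 / (1 + norm x) ^ L" for x
  proof -
    have "(cmod (g x))^2 \<le> (c / (1 + norm x) ^ L)^2" by (rule power_mono[OF c(2)]) simp
    also have "... = c^2 / (1 + norm x) ^ L * (1 / (1 + norm x) ^ L)" by (simp add: power_divide power2_eq_square)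
    also have "... \<le> c^2 / (1 + norm x) ^ L * 1"
      by (intro mult_left_mono) (auto simp: divide_le_eq_1 one_le_power)
    finally show ?thesis by simp
  qed
  then show ?thesis by blast
qed

text \<open>Squaring doubles the order of \<open>v\<close>, and the other factors in
  \<open>p1\<close> and \<open>p2\<close> are bounded near the origin, where \<open>p3\<close>
  vanishes identically; so the order of the latter is arbitrary.\<close>

lemma little_o_p:
  assumes v: "little_o n (\<lambda>t. ennreal (cmod (v t)))" and b: "little_o (2 * n) (\<Phi>)"
  shows "little_o (2 * n) p1" "little_o (2 * n) p2" "little_o m p3"
proof -
  show "little_o m p3" unfolding little_o_def
    by (intro allI impI exI[of _ "1 / 2"]) (auto simp: p3_def small_in_unit_cube)
  show "little_o (2 * n) p1" unfolding little_o_def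
  proof (intro allI impI)
    fix e :: real assume e: "e > 0"
    define e' where "e' = sqrt (e / 2 ^ s)"
    have e': "e' > 0" "e'^2 = e / 2 ^ s" using e by (simp_all add: e'_def)
    obtain \<delta> where \<delta>: "\<delta> > 0" "\<And>x. x \<noteq> 0 ==> norm x < \<delta> ==> ennreal (cmod (v x)) \<le> ennreal (e' * norm x powr n)"
      using v e'(1) unfolding little_o_def by blast
    have "p1 x \<le> ennreal (e * norm x powr (2 * n))" if x: "x \<noteq> 0" "norm x < min \<delta> (1 / 2)" for x
    proof -
      have "cmod (v x) \<le> e' * norm x powr n"
        using \<delta>(2)[of x] x e' by (simp add: ennreal_le_iff)
      then have "(cmod (v x))^2 \<le> (e' * norm x powr n)^2" by (rule power_mono) simp
      also have "... = e / 2 ^ s * norm x powr (2 * n)"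
        unfolding power_mult_distrib e'(2) by (simp add: power2_eq_square powr_add[symmetric])
      finally have V: "(cmod (v x))^2 \<le> e / 2 ^ s * norm x powr (2 * n)" .
      have "(norm x)^2 \<le> 1" using x by (simp add: power_le_one)
      then have "wt x ^ s \<le> 2 ^ s" by (intro power_mono) auto
      then have "wt x ^ s * (cmod (v x))^2 \<le> 2 ^ s * (e / 2 ^ s * norm x powr (2 * n))"
        using V by (intro mult_mono) auto
      then show ?thesis using small_in_unit_cube[of x] x by (simp add: p1_def ennreal_leI)
    qed
    then show "\<exists>\<delta>>0. \<forall>x. x \<noteq> 0 \<and> norm x < \<delta> \<longrightarrow> p1 x \<le> ennreal (e * norm x powr (2 * n))"
      using \<delta>(1) by (intro exI[of _ "min \<delta> (1 / 2)"]) auto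
  qed
  obtain N C where C: "\<And>x. cmod (ft \<phi>' x) \<le> C * (1 + norm x) ^ N"
    using slow_growth[OF slow(2)] by blast
  have C0: "C \<ge> 0" using order_trans[OF norm_ge_zero C[of 0]] by simp
  show "little_o (2 * n) p2" unfolding little_o_def
  proof (intro allI impI)
    fix e :: real assume e: "e > 0"
    define e' where "e' = e / ((C * 2 ^ N)^2 + 1)"
    have e': "e' > 0" using e by (simp add: e'_def add_nonneg_pos)
    obtain \<delta> where \<delta>: "\<delta> > 0" "\<And>x. x \<noteq> 0 ==> norm x < \<delta> ==> \<Phi> x \<le> ennreal (e' * norm x powr (2 * n))"
      using b e' unfolding little_o_def by blast
    have "p2 x \<le> ennreal (e * norm x powr (2 * n))" if x: "x \<noteq> 0" "norm x < min \<delta> 1" for x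
    proof -
      have "cmod (ft \<phi>' x) \<le> C * (1 + norm x) ^ N" by (rule C)
      also have "... \<le> C * 2 ^ N" using x C0 by (intro mult_left_mono power_mono) auto
      finally have "(cmod (ft \<phi>' x))^2 \<le> (C * 2 ^ N)^2" by (rule power_mono) simp
      then have "(cmod (ft \<phi>' x))^2 \<le> (C * 2 ^ N)^2 + 1" by simp
      then have "\<Phi> x * ennreal ((cmod (ft \<phi>' x))^2) \<le> ennreal (e' * norm x powr (2 * n)) * ennreal ((C * 2 ^ N)^2 + 1)"
        using x by (intro mult_mono \<delta>(2) ennreal_leI) auto
      also have "... = ennreal (e' * norm x powr (2 * n) * ((C * 2 ^ N)^2 + 1))"
        using e' by (intro ennreal_mult[symmetric]) (auto simp: add_nonneg_nonneg)
      also have "e' * norm x powr (2 * n) * ((C * 2 ^ N)^2 + 1) = e * norm x powr (2 * n)"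
      proof -
        have "(C * 2 ^ N)^2 + 1 \<noteq> 0" by (metis add_nonneg_pos less_irrefl zero_le_power2 zero_less_one)
        then show ?thesis by (simp add: e'_def)
      qed
      finally have "\<Phi> x * ennreal ((cmod (ft \<phi>' x))^2) \<le> ennreal (e * norm x powr (2 * n))" .
      then show ?thesis by (simp add: p2_def split: split_indicator)
    qed
    then show "\<exists>\<delta>>0. \<forall>x. x \<noteq> 0 \<and> norm x < \<delta> \<longrightarrow> p2 x \<le> ennreal (e * norm x powr (2 * n))"
      using \<delta>(1) by (intro exI[of _ "min \<delta> 1"]) auto
  qed
qed

lemma p_growth:
  "\<exists>C K. C \<ge> 0 \<and> (\<forall>x. p1 x \<le> ennreal (C * (1 + norm x) ^ K))"
  "\<exists>C K. C \<ge> 0 \<and> (\<forall>x. p2 x \<le> ennreal (C * (1 + norm x) ^ K))"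
  "\<exists>C K. C \<ge> 0 \<and> (\<forall>x. p3 x \<le> ennreal (C * (1 + norm x) ^ K))"
proof -
  have sq: "\<exists>C N. C \<ge> 0 \<and> (\<forall>x. (cmod (g x))^2 \<le> C * (1 + norm x) ^ N)" if g: "g \<in> slow_fun" for g :: "real ^ 'd \<Rightarrow> complex"
  proof -
    obtain N C where C: "\<And>x. cmod (g x) \<le> C * (1 + norm x) ^ N" using slow_growth[OF g] by blast
    have "(cmod (g x))^2 \<le> C^2 * (1 + norm x) ^ (N * 2)" for x
      using power_mono[OF C[of x], of 2] by (simp add: power_mult_distrib power_mult)
    then show ?thesis by (intro exI[of _ "C^2"] exI[of _ "N * 2"]) auto
  qed
  obtain C N where C: "C \<ge> 0" "\<And>x. (cmod (v x))^2 \<le> C * (1 + norm x) ^ N" using sq[OF slow(3)] by blast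
  have "p1 x \<le> ennreal ((C + 1) * (1 + norm x) ^ (2 * s + N))" for x
    unfolding p1_def
  proof (rule ennreal_leI)
    have "wt x ^ s \<le> ((1 + norm x)^2) ^ s" by (intro power_mono weight_le) (simp add: add_nonneg_nonneg)
    moreover have "(if x \<in> unit_cube then (cmod (v x))^2 else 1) \<le> (C + 1) * (1 + norm x) ^ N"
    proof -
      have "1 \<le> (1 + norm x) ^ N" by (rule one_le_power) simp
      moreover have "C * (1 + norm x) ^ N \<ge> 0" using C(1) by simp
      moreover have "(C + 1) * (1 + norm x) ^ N = C * (1 + norm x) ^ N + (1 + norm x) ^ N"
        by (simp only: distrib_right mult_1_left)
      ultimately have "(cmod (v x))^2 \<le> (C + 1) * (1 + norm x) ^ N" "1 \<le> (C + 1) * (1 + norm x) ^ N"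
        using C(2)[of x] by linarith+
      then show ?thesis by metis
    qed
    ultimately have "wt x ^ s * (if x \<in> unit_cube then (cmod (v x))^2 else 1) \<le> ((1 + norm x)^2) ^ s * ((C + 1) * (1 + norm x) ^ N)"
      by (intro mult_mono) auto
    then show "wt x ^ s * (if x \<in> unit_cube then (cmod (v x))^2 else 1) \<le> (C + 1) * (1 + norm x) ^ (2 * s + N)"
      unfolding power_add power_mult by (simp only: mult_ac)
  qed
  then show "\<exists>C K. C \<ge> 0 \<and> (\<forall>x. p1 x \<le> ennreal (C * (1 + norm x) ^ K))"
    using C(1) by (intro exI[of _ "C + 1"] exI[of _ "2 * s + N"]) auto
  obtain Ba where Ba: "Ba \<ge> 0" "\<And>S t. bracket S s (ft \<phi>) t \<le> ennreal Ba" by (rule bracket_bound) blast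
  obtain C N where C: "C \<ge> 0" "\<And>x. (cmod (ft \<phi>' x))^2 \<le> C * (1 + norm x) ^ N" using sq[OF slow(2)] by blast
  have "p2 x \<le> ennreal ((Ba * C) * (1 + norm x) ^ N)" for x
  proof -
    have "p2 x \<le> \<Phi> x * ennreal ((cmod (ft \<phi>' x))^2)"
      by (simp add: p2_def split: split_indicator)
    also have "... \<le> ennreal Ba * ennreal (C * (1 + norm x) ^ N)" by (intro mult_mono Ba ennreal_leI C) auto
    finally show ?thesis using Ba(1) C(1) by (simp add: ennreal_mult mult.assoc)
  qed
  then show "\<exists>C K. C \<ge> 0 \<and> (\<forall>x. p2 x \<le> ennreal (C * (1 + norm x) ^ K))"
    using Ba(1) C(1) by (intro exI[of _ "Ba * C"] exI[of _ N]) auto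
  obtain N C where C: "\<And>x. cmod (ft \<phi>' x) \<le> C * (1 + norm x) ^ N" using slow_growth[OF slow(2)] by blast
  have C0: "C \<ge> 0" using order_trans[OF norm_ge_zero C[of 0]] by simp
  have "p3 x \<le> ennreal (C * (1 + norm x) ^ N)" for x
    using ennreal_leI[OF C[of x]] by (simp add: p3_def split: split_indicator)
  then show "\<exists>C K. C \<ge> 0 \<and> (\<forall>x. p3 x \<le> ennreal (C * (1 + norm x) ^ K))" using C0 by blast
qed

text \<open>Integrating the pointwise bound over the cube and undoing the tiling leaves three
  integrals over the whole space, each covered by \<open>scaled_integral_limit\<close>.\<close>

lemma error_limit:
  assumes f: "f \<in> schwartz"
    and v: "little_o n (\<lambda>t. ennreal (cmod (v t)))" and b: "little_o (2 * n) (\<Phi>)"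
  shows "(\<lambda>k. ennreal (\<beta> k powr (- (2 * n)) * \<bar>det (dil M k)\<bar>) *
    (\<integral>\<^sup>+t. ennreal (wt t ^ s * (err f k t)^2) \<partial>lborel)) \<longlonglongrightarrow> 0"
proof -
  let ?b = "\<lambda>k. \<beta> k"
  let ?D = "\<lambda>k. ennreal (?b k powr (- (2 * n)) * \<bar>det (dil M k)\<bar>)"
  let ?F = "\<lambda>k x. fourier f (dil M k *v x)"
  have F: "fourier f \<in> schwartz" by (rule fourier_schwartz[OF f])
  have [measurable]: "fourier f \<in> borel_measurable borel" by (rule schwartz_measurable[OF F])
  obtain Ba where Ba: "Ba \<ge> 0" "\<And>S t. bracket S s (ft \<phi>) t \<le> ennreal Ba" by (rule bracket_bound) blast
  obtain c where c: "c \<ge> 0" "\<And>k t. ?b k \<le> 1 ==>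
    (\<integral>\<^sup>+l. ennreal (cmod (sample \<phi>' f (dil M k) (t + real_vec l))) \<partial>count_space UNIV) \<le> ennreal c"
    by (rule sample_lattice_bound[OF f]) blast
  have n0: "2 * n \<ge> 0" using n by simp
  let ?I1 = "\<lambda>k. \<integral>\<^sup>+x. p1 x * ennreal ((cmod (?F k x))^2) \<partial>lborel"
  let ?I2 = "\<lambda>k. \<integral>\<^sup>+x. p2 x * ennreal ((cmod (?F k x))^2) \<partial>lborel"
  let ?I3 = "\<lambda>k. \<integral>\<^sup>+x. p3 x * ennreal (cmod (?F k x)) \<partial>lborel"
  have dec: "\<exists>c. \<forall>x. cmod (fourier f x) \<le> c / (1 + norm x) ^ L" for L
    using schwartz_bound0[OF F, of L] by blast
  have l1: "(\<lambda>k. ?D k * ?I1 k) \<longlonglongrightarrow> 0" and l2: "(\<lambda>k. ?D k * ?I2 k) \<longlonglongrightarrow> 0" and l3: "(\<lambda>k. ?D k * ?I3 k) \<longlonglongrightarrow> 0"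
  proof -
    have m1: "(\<lambda>x. cmod (fourier f x)) \<in> borel_measurable borel"
      and m2: "(\<lambda>x. (cmod (fourier f x))^2) \<in> borel_measurable borel" by measurable
    obtain C K where C: "C \<ge> 0" "\<And>x. p1 x \<le> ennreal (C * (1 + norm x) ^ K)" using p_growth(1) by blast
    show "(\<lambda>k. ?D k * ?I1 k) \<longlonglongrightarrow> 0"
      by (rule scaled_integral_limit[OF M n0 p_measurable(1) m2 C little_o_p(1)[OF v b] zero_le_power2 schwartz_decay_square[OF F]])
    obtain C K where C: "C \<ge> 0" "\<And>x. p2 x \<le> ennreal (C * (1 + norm x) ^ K)" using p_growth(2) by blast
    show "(\<lambda>k. ?D k * ?I2 k) \<longlonglongrightarrow> 0"
      by (rule scaled_integral_limit[OF M n0 p_measurable(2) m2 C little_o_p(2)[OF v b] zero_le_power2 schwartz_decay_square[OF F]])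
    obtain C K where C: "C \<ge> 0" "\<And>x. p3 x \<le> ennreal (C * (1 + norm x) ^ K)" using p_growth(3) by blast
    show "(\<lambda>k. ?D k * ?I3 k) \<longlonglongrightarrow> 0"
      by (rule scaled_integral_limit[OF M n0 p_measurable(3) m1 C little_o_p(3)[OF v b] norm_ge_zero dec])
  qed
  have "?D k * (\<integral>\<^sup>+t. ennreal (wt t ^ s * (err f k t)^2) \<partial>lborel)
    \<le> 2 * (?D k * ?I1 k) + 4 * (?D k * ?I2 k) + ennreal (4 * Ba * c) * (?D k * ?I3 k)" if k: "?b k \<le> 1" for k
  proof -
    note [measurable] = proj_error_measurable[OF f, of k]
    let ?i = "indicator unit_cube :: real ^ 'd \<Rightarrow> ennreal"
    define A1 where "A1 = (\<lambda>t. \<integral>\<^sup>+l. p1 (t + real_vec l) * ennreal ((cmod (?F k (t + real_vec l)))^2) \<partial>count_space UNIV)"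
    define A3 where "A3 = (\<lambda>t. \<integral>\<^sup>+l. p3 (t + real_vec l) * ennreal (cmod (?F k (t + real_vec l))) \<partial>count_space UNIV)"
    have [measurable]: "A1 \<in> borel_measurable borel" "A3 \<in> borel_measurable borel"
      unfolding A1_def A3_def by (rule borel_measurable_nn_integral_count, measurable)+
    have "(\<integral>\<^sup>+t. ennreal (wt t ^ s * (err f k t)^2) \<partial>lborel)
      = (\<integral>\<^sup>+t. ?i t * (\<integral>\<^sup>+l. ennreal (wt (t + real_vec l) ^ s * (err f k (t + real_vec l))^2) \<partial>count_space UNIV) \<partial>lborel)"
      by (rule nn_integral_tile) measurable
    also have "... \<le> (\<integral>\<^sup>+t. 2 * (?i t * A1 t) + 4 * (p2 t * ennreal ((cmod (?F k t))^2)) + ennreal (4 * Ba * c) * (?i t * A3 t) \<partial>lborel)"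
    proof (rule nn_integral_mono)
      fix t
      show "?i t * (\<integral>\<^sup>+l. ennreal (wt (t + real_vec l) ^ s * (err f k (t + real_vec l))^2) \<partial>count_space UNIV)
        \<le> 2 * (?i t * A1 t) + 4 * (p2 t * ennreal ((cmod (?F k t))^2)) + ennreal (4 * Ba * c) * (?i t * A3 t)"
        using error_pointwise[OF f, of t Ba k c] Ba c(2)[OF k, of t] c(1)
          by (cases "t \<in> unit_cube") (auto simp: A1_def A3_def)
    qed
    also have "... = 2 * (\<integral>\<^sup>+t. ?i t * A1 t \<partial>lborel) + 4 * ?I2 k + ennreal (4 * Ba * c) * (\<integral>\<^sup>+t. ?i t * A3 t \<partial>lborel)"
    proof -
      let ?X = "\<lambda>t. ?i t * A1 t" and ?Y = "\<lambda>t. p2 t * ennreal ((cmod (?F k t))^2)" and ?Z = "\<lambda>t. ?i t * A3 t"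
      have m: "?X \<in> borel_measurable lborel" "?Y \<in> borel_measurable lborel" "?Z \<in> borel_measurable lborel"
        unfolding measurable_lborel1 by measurable
      show ?thesis
        by (simp only: nn_integral_add nn_integral_cmult m borel_measurable_add borel_measurable_times_ennreal borel_measurable_const)
    qed
    also have "(\<integral>\<^sup>+t. ?i t * A1 t \<partial>lborel) = ?I1 k" unfolding A1_def by (rule nn_integral_tile[symmetric]) measurable
    also have "(\<integral>\<^sup>+t. ?i t * A3 t \<partial>lborel) = ?I3 k" unfolding A3_def by (rule nn_integral_tile[symmetric]) measurable
    finally have "?D k * (\<integral>\<^sup>+t. ennreal (wt t ^ s * (err f k t)^2) \<partial>lborel)
      \<le> ?D k * (2 * ?I1 k + 4 * ?I2 k + ennreal (4 * Ba * c) * ?I3 k)" by (rule mult_left_mono) simp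
    also have "... = 2 * (?D k * ?I1 k) + 4 * (?D k * ?I2 k) + ennreal (4 * Ba * c) * (?D k * ?I3 k)"
      by (simp only: distrib_left mult_ac)
    finally show ?thesis .
  qed
  moreover have "\<forall>\<^sub>F k in sequentially. ?b k < 1"
    using order_tendstoD(2)[OF norm_undil_tendsto_0[OF M]] by simp
  ultimately have ev: "\<forall>\<^sub>F k in sequentially. ?D k * (\<integral>\<^sup>+t. ennreal (wt t ^ s * (err f k t)^2) \<partial>lborel)
    \<le> 2 * (?D k * ?I1 k) + 4 * (?D k * ?I2 k) + ennreal (4 * Ba * c) * (?D k * ?I3 k)"
    by (auto elim: eventually_mono)
  have "(\<lambda>k. 2 * (?D k * ?I1 k) + 4 * (?D k * ?I2 k) + ennreal (4 * Ba * c) * (?D k * ?I3 k)) \<longlonglongrightarrow> 2 * 0 + 4 * 0 + ennreal (4 * Ba * c) * 0"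
    by (intro tendsto_add ennreal_tendsto_cmult l1 l2 l3) auto
  then have "(\<lambda>k. 2 * (?D k * ?I1 k) + 4 * (?D k * ?I2 k) + ennreal (4 * Ba * c) * (?D k * ?I3 k)) \<longlonglongrightarrow> 0" by simp
  from tendsto_sandwich[OF _ ev tendsto_const this] show ?thesis by simp
qed

definition weighted_error :: "(real ^ 'd \<Rightarrow> complex) \<Rightarrow> nat \<Rightarrow> nat \<Rightarrow> real" where
  "weighted_error f r k = \<beta> k powr (- n) * (mat_norm (dil M k) powr (- real r) *
     sobolev_seminorm r (distr_diff (distr_of f) (quasi_proj M s \<phi> \<phi>' (int k) (distr_of f))))"

lemma weighted_error_nonneg: "weighted_error f r k \<ge> 0"
  by (auto simp: weighted_error_def sobolev_seminorm_def intro!: mult_nonneg_nonneg Bochner_Integration.integral_nonneg)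

lemma weighted_error_square:
  assumes "f \<in> schwartz" "r \<le> s"
  shows "ennreal ((weighted_error f r k)^2) =
    ennreal (\<beta> k powr (- (2 * n)) * \<bar>det (dil M k)\<bar>) * (ennreal (mat_norm (dil M k) powr (- (2 * real r))) *
      (\<integral>\<^sup>+t. ennreal (norm (dil M k *v t) ^ (2 * r) * (err f k t)^2) \<partial>lborel))"
proof -
  have sq: "(x powr a)^2 = x powr (2 * a)" for x a :: real by (simp add: power2_eq_square powr_add[symmetric])
  show ?thesis
    unfolding weighted_error_def power_mult_distrib sq
    by (simp add: ennreal_mult seminorm_error[OF assms] mult_ac)
qed

text \<open>Since the limit is at plus infinity, integer exponents may be replaced by natural
  ones.\<close>

lemma density_order_iff:
  "simultaneous_density_order M \<phi> \<phi>' s n \<longleftrightarrow> (\<forall>f\<in>schwartz. (\<lambda>k. \<Sum>r=0..s. weighted_error f r k) \<longlonglongrightarrow> 0)"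
proof -
  define G where "G f j = mat_norm (mat_powi (transpose (real_mat M)) (- j)) powr (- n) *
    (\<Sum>r = 0..s. mat_norm (mat_powi (transpose (real_mat M)) j) powr (- real r) *
      sobolev_seminorm r (distr_diff (distr_of f) (quasi_proj M s \<phi> \<phi>' j (distr_of f))))" for f :: "real ^ 'd \<Rightarrow> complex" and j :: int
  have eq: "(\<lambda>k. \<Sum>r=0..s. weighted_error f r k) = (\<lambda>k. G f (int k))" for f
    by (rule ext) (simp add: weighted_error_def G_def dil_def undil_def sum_distrib_left)
  have "(G f \<longlongrightarrow> 0) at_top \<longleftrightarrow> (\<lambda>k. G f (int k)) \<longlonglongrightarrow> 0" for f
    using filterlim_int_of_nat_at_topD[of "G f" "nhds 0"] filterlim_compose[OF _ filterlim_int_sequentially, of "G f" "nhds 0"] by blast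
  then show ?thesis unfolding simultaneous_density_order_def G_def[symmetric] eq by simp
qed

text \<open>The estimate |B|^(-2r) |Bt|^(2r) \<le> |t|^(2r) \<le> (1 + |t|^2)^s reduces all
  seminorms with r \<le> s to the single limit \<open>error_limit\<close>.\<close>

lemma sufficiency:
  assumes "origin_conditions \<phi> \<phi>' s n" shows "simultaneous_density_order M \<phi> \<phi>' s n"
  unfolding density_order_iff
proof
  fix f :: "real ^ 'd \<Rightarrow> complex" assume f: "f \<in> schwartz"
  have v: "little_o n (\<lambda>t. ennreal (cmod (v t)))" and b: "little_o (2 * n) (\<Phi>)"
    using assms by (simp_all add: origin_conditions_iff v_def)
  have "(\<lambda>k. weighted_error f r k) \<longlonglongrightarrow> 0" if r: "r \<le> s" for r
  proof -
    let ?I = "\<lambda>k. \<integral>\<^sup>+t. ennreal (wt t ^ s * (err f k t)^2) \<partial>lborel"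
    let ?D = "\<lambda>k. ennreal (\<beta> k powr (- (2 * n)) * \<bar>det (dil M k)\<bar>)"
    have "ennreal ((weighted_error f r k)^2) \<le> ?D k * ?I k" for k
      unfolding weighted_error_square[OF f r]
    proof (rule mult_left_mono)
      note [measurable] = proj_error_measurable[OF f, of k]
      let ?b = "mat_norm (dil M k)"
      have b: "?b > 0" by (rule norm_dil_bounds(2)[OF M])
      have "ennreal (?b powr (- (2 * real r))) * (\<integral>\<^sup>+t. ennreal (norm (dil M k *v t) ^ (2 * r) * (err f k t)^2) \<partial>lborel)
        = (\<integral>\<^sup>+t. ennreal (?b powr (- (2 * real r))) * ennreal (norm (dil M k *v t) ^ (2 * r) * (err f k t)^2) \<partial>lborel)"
        by (rule nn_integral_cmult[symmetric]) measurable
      also have "... \<le> ?I k"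
      proof (rule nn_integral_mono)
        fix t :: "real ^ 'd"
        have "norm (dil M k *v t) ^ (2 * r) \<le> (?b * norm t) ^ (2 * r)" by (intro power_mono norm_matrix_le) simp
        also have "... = ?b powr (2 * real r) * ((norm t)^2) ^ r"
          using powr_realpow[OF b, of "2 * r"] by (simp add: power_mult_distrib power_mult)
        finally have "?b powr (- (2 * real r)) * norm (dil M k *v t) ^ (2 * r) \<le> ?b powr (- (2 * real r)) * (?b powr (2 * real r) * ((norm t)^2) ^ r)"
          by (rule mult_left_mono) simp
        also have "... = ((norm t)^2) ^ r" using b by (simp add: powr_minus)
        also have "... \<le> wt t ^ r" by (rule power_mono) auto
        also have "... \<le> wt t ^ s" by (rule power_increasing[OF r]) simp
        finally have "?b powr (- (2 * real r)) * norm (dil M k *v t) ^ (2 * r) * (err f k t)^2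
          \<le> wt t ^ s * (err f k t)^2" by (rule mult_right_mono) simp
        then show "ennreal (?b powr (- (2 * real r))) * ennreal (norm (dil M k *v t) ^ (2 * r) * (err f k t)^2)
          \<le> ennreal (wt t ^ s * (err f k t)^2)"
          by (subst ennreal_mult[symmetric]) (auto intro!: ennreal_leI simp: mult.assoc)
      qed
      finally show "ennreal (?b powr (- (2 * real r))) * (\<integral>\<^sup>+t. ennreal (norm (dil M k *v t) ^ (2 * r) * (err f k t)^2) \<partial>lborel) \<le> ?I k" .
    qed simp
    then have "(\<lambda>k. ennreal ((weighted_error f r k)^2)) \<longlonglongrightarrow> 0"
      by (intro tendsto_sandwich[OF _ _ tendsto_const error_limit[OF f v b]]) auto
    then have "(\<lambda>k. (weighted_error f r k)^2) \<longlonglongrightarrow> 0" by (subst (asm) ennreal_tendsto_0_iff) auto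
    then show ?thesis using tendsto_real_sqrt[of "\<lambda>k. (weighted_error f r k)^2" 0] weighted_error_nonneg by simp
  qed
  then have "(\<lambda>k. \<Sum>r=0..s. weighted_error f r k) \<longlonglongrightarrow> (\<Sum>r=0..s. 0)" by (intro tendsto_sum) auto
  then show "(\<lambda>k. \<Sum>r=0..s. weighted_error f r k) \<longlonglongrightarrow> 0" by simp
qed

end

section \<open>Necessity of the origin conditions\<close>

text \<open>The mean of p over the ball of radius R is o(R^m); R^d stands for the volume, up to a
  constant factor.\<close>

definition avg_small :: "real \<Rightarrow> (real ^ 'd \<Rightarrow> ennreal) \<Rightarrow> bool" where
  "avg_small m p \<longleftrightarrow> (\<forall>e > 0. \<exists>\<delta> > 0. \<forall>R. 0 < R \<and> R < \<delta> \<longrightarrow>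
     (\<integral>\<^sup>+x. indicator (cball 0 R) x * p x \<partial>lborel) \<le> ennreal (e * (R powr m * R ^ CARD('d))))"

lemma ennreal_mult_le_iff:
  assumes "c > 0" shows "ennreal c * p \<le> ennreal e \<longleftrightarrow> p \<le> ennreal (e / c)"
  using ennreal_divide_le_iff[of "1 / c" p e] assms by simp

text \<open>The inequality assumed below for \<open>p\<close> expresses that \<open>p = |g|\<^sup>2\<close> for some \<open>g\<close> whose \<open>N\<close>-th differences are
  \<open>O(|h|\<^sup>N)\<close>. Averaging it over the steps \<open>h\<close> in the ball of radius \<open>|t|\<close> bounds \<open>p(t)\<close> by averages of \<open>p\<close>.\<close>

lemma little_o_of_average:
  fixes p :: "real ^ 'd \<Rightarrow> ennreal"
  assumes [measurable]: "p \<in> borel_measurable borel" and m: "m \<ge> 0" "m < 2 * real N" and K: "K \<ge> 0"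
    and ineq: "\<And>t h. norm t \<le> 1 ==> norm h \<le> 1 ==>
      p t \<le> ennreal K * ((\<Sum>i=1..N. p (t + real i *\<^sub>R h)) + ennreal (norm h ^ (2 * N)))"
    and avg: "avg_small m p"
  shows "little_o m p"
  unfolding little_o_def
proof (intro allI impI)
  fix e :: real assume e: "e > 0"
  have [measurable]: "cball (0 :: real ^ 'd) r \<in> sets borel" for r by simp
  define \<omega> where "\<omega> = unit_ball_vol (real CARD('d))"
  have \<omega>: "\<omega> > 0" by (simp add: \<omega>_def)
  \<comment> \<open>Collects the constants of N integrals over a ball of radius (N + 1) R, divided
    by the volume of the ball of radius R.\<close>
  define Q where "Q = K * real N * (real (N + 1) powr m * real (N + 1) ^ CARD('d)) / \<omega>"
  have Q0: "Q \<ge> 0" using K \<omega> by (simp add: Q_def)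
  define e1 where "e1 = e / (2 * (Q + 1))"
  have e1: "e1 > 0" using e Q0 by (simp add: e1_def)
  obtain \<delta> where \<delta>: "\<delta> > 0" "\<And>R. 0 < R ==> R < \<delta> ==>
     (\<integral>\<^sup>+x. indicator (cball 0 R) x * p x \<partial>lborel) \<le> ennreal (e1 * (R powr m * R ^ CARD('d)))"
    using avg e1 unfolding avg_small_def by blast
  \<comment> \<open>Makes K R^(2N) at most half of e R^m for R \<le> \<delta>2; the exponent 1/(2N -
    m) is where m < 2N enters.\<close>
  define \<delta>2 where "\<delta>2 = (e / (2 * (K + 1))) powr (1 / (2 * real N - m))"
  have \<delta>2: "\<delta>2 > 0" using e K by (simp add: \<delta>2_def)
  have "p t \<le> ennreal (e * norm t powr m)" if t0: "t \<noteq> 0" and t: "norm t < min (min 1 \<delta>2) (\<delta> / real (N + 1))" for t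
  proof -
    define R where "R = norm t"
    let ?B = "indicator (cball 0 R) :: real ^ 'd \<Rightarrow> ennreal"
    let ?R = "real (N + 1) * R"
    have R: "0 < R" "R \<le> 1" "R \<le> \<delta>2" "?R < \<delta>" using t0 t by (auto simp: R_def field_simps)
    have vol: "emeasure lborel (cball 0 R :: (real ^ 'd) set) = ennreal (\<omega> * R ^ CARD('d))"
      using R(1) by (simp add: emeasure_cball \<omega>_def)
    let ?I = "\<integral>\<^sup>+x. indicator (cball 0 ?R) x * p x \<partial>lborel"
    have "ennreal (\<omega> * R ^ CARD('d)) * p t = (\<integral>\<^sup>+h. ?B h * p t \<partial>lborel)"
      by (subst nn_integral_multc) (simp_all add: vol borel_measurable_indicator)
    also have "... \<le> (\<integral>\<^sup>+h. ennreal K * ((\<Sum>i=1..N. ?B h * p (t + real i *\<^sub>R h)) + ennreal (R ^ (2 * N)) * ?B h) \<partial>lborel)"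
    proof (rule nn_integral_mono)
      fix h :: "real ^ 'd"
      show "?B h * p t \<le> ennreal K * ((\<Sum>i=1..N. ?B h * p (t + real i *\<^sub>R h)) + ennreal (R ^ (2 * N)) * ?B h)"
      proof (cases "h \<in> cball 0 R")
        case True
        then have h: "norm h \<le> R" by simp
        have "p t \<le> ennreal K * ((\<Sum>i=1..N. p (t + real i *\<^sub>R h)) + ennreal (norm h ^ (2 * N)))"
          using R(2) h by (intro ineq) (auto simp: R_def)
        also have "... \<le> ennreal K * ((\<Sum>i=1..N. p (t + real i *\<^sub>R h)) + ennreal (R ^ (2 * N)))"
          using h by (intro mult_left_mono add_left_mono ennreal_leI power_mono) auto
        finally show ?thesis using True by simp
      qed simp
    qed
    also have "... = ennreal K * ((\<Sum>i=1..N. (\<integral>\<^sup>+h. ?B h * p (t + real i *\<^sub>R h) \<partial>lborel)) + ennreal (R ^ (2 * N)) * ennreal (\<omega> * R ^ CARD('d)))"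
      by (subst nn_integral_cmult, measurable, subst nn_integral_add, measurable, subst nn_integral_sum, measurable, subst nn_integral_cmult, measurable)
         (simp add: vol)
    also have "... \<le> ennreal K * ((\<Sum>i=1..N. ?I) + ennreal (R ^ (2 * N)) * ennreal (\<omega> * R ^ CARD('d)))"
    proof (intro mult_left_mono add_right_mono sum_mono)
      fix i assume i: "i \<in> {1..N}"
      \<comment> \<open>Scaling by i \<ge> 1 has determinant at least 1, so the Jacobian of h
        \<mapsto> i h + t can be inserted for an upper bound; all the points t + i h lie in the ball
        of radius (N + 1) R.\<close>
      let ?S = "matrix ((*\<^sub>R) (real i)) :: real ^ 'd ^ 'd"
      have S: "?S *v h = real i *\<^sub>R h" for h
        by (simp add: matrix_def axis_def vec_eq_iff matrix_vector_mult_def if_distrib if_distribR cong: if_cong)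
      have det: "\<bar>det ?S\<bar> \<ge> 1" using i by (simp add: one_le_power)
      have "(\<integral>\<^sup>+h. ?B h * p (t + real i *\<^sub>R h) \<partial>lborel) \<le> (\<integral>\<^sup>+h. indicator (cball 0 ?R) (?S *v h + t) * p (?S *v h + t) \<partial>lborel)"
      proof (rule nn_integral_mono)
        fix h :: "real ^ 'd"
        have "norm (real i *\<^sub>R h + t) \<le> ?R" if "norm h \<le> R"
        proof -
          have "norm (real i *\<^sub>R h + t) \<le> real i * norm h + norm t" using norm_triangle_ineq[of "real i *\<^sub>R h" t] by simp
          also have "... \<le> real N * R + R" using i that R(1) by (intro add_mono mult_mono) (auto simp: R_def)
          finally show ?thesis by (simp add: algebra_simps)
        qed
        then show "?B h * p (t + real i *\<^sub>R h) \<le> indicator (cball 0 ?R) (?S *v h + t) * p (?S *v h + t)"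
          unfolding S by (auto simp: add.commute split: split_indicator)
      qed
      also have "... \<le> ennreal \<bar>det ?S\<bar> * (\<integral>\<^sup>+h. indicator (cball 0 ?R) (?S *v h + t) * p (?S *v h + t) \<partial>lborel)"
        using mult_right_mono[OF ennreal_leI[OF det]] by simp
      also have "... = ?I"
        by (rule nn_integral_affine_matrix[symmetric]) (use det i in auto)
      finally show "(\<integral>\<^sup>+h. ?B h * p (t + real i *\<^sub>R h) \<partial>lborel) \<le> ?I" .
    qed simp_all
    also have "... \<le> ennreal K * (ennreal (real N * (e1 * (?R powr m * ?R ^ CARD('d)))) + ennreal (R ^ (2 * N) * (\<omega> * R ^ CARD('d))))"
    proof (intro mult_left_mono add_mono)
      have "(\<Sum>i=1..N. ?I) = ennreal (real N) * ?I" by (simp add: ennreal_of_nat_eq_real_of_nat)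
      also have "... \<le> ennreal (real N) * ennreal (e1 * (?R powr m * ?R ^ CARD('d)))"
        using R by (intro mult_left_mono \<delta>(2)) auto
      also have "... = ennreal (real N * (e1 * (?R powr m * ?R ^ CARD('d))))"
        using e1 R(1) by (intro ennreal_mult[symmetric]) auto
      finally show "(\<Sum>i=1..N. ?I) \<le> ennreal (real N * (e1 * (?R powr m * ?R ^ CARD('d))))" .
      show "ennreal (R ^ (2 * N)) * ennreal (\<omega> * R ^ CARD('d)) \<le> ennreal (R ^ (2 * N) * (\<omega> * R ^ CARD('d)))"
        using R(1) \<omega> by (subst ennreal_mult) auto
    qed simp
    also have "... = ennreal (K * (real N * (e1 * (?R powr m * ?R ^ CARD('d))) + R ^ (2 * N) * (\<omega> * R ^ CARD('d))))"
      using K e1 R(1) \<omega> by (simp add: ennreal_mult[symmetric] flip: ennreal_plus)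
    finally have "p t \<le> ennreal (K * (real N * (e1 * (?R powr m * ?R ^ CARD('d))) + R ^ (2 * N) * (\<omega> * R ^ CARD('d))) / (\<omega> * R ^ CARD('d)))"
      using R(1) \<omega> by (subst (asm) ennreal_mult_le_iff) auto
    also have "K * (real N * (e1 * (?R powr m * ?R ^ CARD('d))) + R ^ (2 * N) * (\<omega> * R ^ CARD('d))) / (\<omega> * R ^ CARD('d))
      = Q * e1 * R powr m + K * R ^ (2 * N)"
    proof -
      have "?R powr m = real (N + 1) powr m * R powr m" "?R ^ CARD('d) = real (N + 1) ^ CARD('d) * R ^ CARD('d)"
        using R(1) by (auto simp: powr_mult power_mult_distrib)
      moreover have "\<omega> * R ^ CARD('d) \<noteq> 0" using R(1) \<omega> by simp
      ultimately show ?thesis using \<omega> by (simp only: Q_def) (simp add: field_simps del: of_nat_Suc)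
    qed
    also have "Q * e1 * R powr m + K * R ^ (2 * N) \<le> e / 2 * R powr m + e / 2 * R powr m"
    proof (rule add_mono)
      have "Q * e1 \<le> (Q + 1) * e1" using e1 by simp
      also have "... = e / 2" using Q0 by (simp add: e1_def field_simps)
      finally show "Q * e1 * R powr m \<le> e / 2 * R powr m" by (rule mult_right_mono) simp
      have r1: "R ^ (2 * N) = R powr m * R powr (2 * real N - m)"
        using R(1) powr_realpow[OF R(1), of "2 * N"] by (simp flip: powr_add)
      have r2: "R powr (2 * real N - m) \<le> \<delta>2 powr (2 * real N - m)" using R m by (intro powr_mono2) auto
      have r3: "\<delta>2 powr (2 * real N - m) = e / (2 * (K + 1))" using m e K by (simp add: \<delta>2_def powr_powr)
      have "K * R ^ (2 * N) \<le> K * (R powr m * (e / (2 * (K + 1))))"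
        unfolding r1 by (intro mult_left_mono K powr_ge_zero r2[unfolded r3])
      also have "... = (K / (K + 1)) * (e / 2 * R powr m)" by (simp add: mult_ac)
      also have "... \<le> 1 * (e / 2 * R powr m)" using K e by (intro mult_right_mono) (auto simp: divide_le_eq)
      finally show "K * R ^ (2 * N) \<le> e / 2 * R powr m" by simp
    qed
    finally show ?thesis by (simp add: R_def ennreal_leI)
  qed
  moreover have "min (min 1 \<delta>2) (\<delta> / real (N + 1)) > 0" using \<delta>(1) \<delta>2 by simp
  ultimately show "\<exists>\<delta>>0. \<forall>t. t \<noteq> 0 \<and> norm t < \<delta> \<longrightarrow> p t \<le> ennreal (e * norm t powr m)" by blast
qed

text \<open>A small radius R is matched with an exponent k for which 1/\<rho>^k is comparable to R.
  Then the ball of radius R lies in the set |Bx| \<le> 1, the determinant \<rho>^(kd) is comparable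
  to R^(-d), and the norm of B^-1 is O(R).\<close>

lemma isotropic_average:
  fixes p :: "real ^ 'd \<Rightarrow> ennreal" and M :: "int ^ 'd ^ 'd"
  assumes M: "dilation_matrix M" and iso: "isotropic M" and m: "m \<ge> 0"
    and H: "\<And>e. e > 0 ==> \<exists>k0. \<forall>k\<ge>k0. ennreal \<bar>det (dil M k)\<bar> *
      (\<integral>\<^sup>+x. indicator {x. norm (dil M k *v x) \<le> 1} x * p x \<partial>lborel) \<le> ennreal (e * mat_norm (undil M k) powr m)"
  shows "avg_small m p"
  unfolding avg_small_def
proof (intro allI impI)
  fix e :: real assume e: "e > 0"
  obtain \<rho> C1 C2 where \<rho>: "\<rho> > 1" "C2 > 0" "\<And>k. absdet M powr real_of_int (int k) = (\<rho> ^ k) ^ CARD('d)"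
    "\<And>k. mat_norm (dil M k) \<le> C2 * \<rho> ^ k" "\<And>k. mat_norm (undil M k) \<le> C2 / \<rho> ^ k"
    by (rule isotropic_bounds[OF M iso]) blast
  define a where "a = C2 * \<rho>"
  have a: "a > 0" using \<rho> by (simp add: a_def)
  define e1 where "e1 = e / ((C2 * a) powr m * a ^ CARD('d))"
  have e1: "e1 > 0" using e a \<rho>(2) by (simp add: e1_def)
  obtain k0 where k0: "\<And>k. k \<ge> k0 ==> ennreal \<bar>det (dil M k)\<bar> *
      (\<integral>\<^sup>+x. indicator {x. norm (dil M k *v x) \<le> 1} x * p x \<partial>lborel) \<le> ennreal (e1 * mat_norm (undil M k) powr m)"
    using H[OF e1] by blast
  have "(\<integral>\<^sup>+x. indicator (cball 0 R) x * p x \<partial>lborel) \<le> ennreal (e * (R powr m * R ^ CARD('d)))"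
    if R: "0 < R" "R < 1 / (C2 * \<rho> ^ k0)" for R
  proof -
    \<comment> \<open>The least l with this property exceeds \<open>k0\<close> because R is small.
      Its predecessor k satisfies C2 \<rho>^k R \<le> 1 by minimality, while the property at k + 1
      reads 1/\<rho>^k < C2 \<rho> R.\<close>
    let ?P = "\<lambda>l. 1 < C2 * \<rho> ^ l * R"
    obtain l0 where "1 / (C2 * R) < \<rho> ^ l0" using real_arch_pow[OF \<rho>(1)] by blast
    then have P: "?P l0" using R(1) \<rho>(2) by (simp add: field_simps)
    define l where "l = (LEAST l. ?P l)"
    have l: "?P l" unfolding l_def by (rule LeastI[of ?P, OF P])
    have "l > k0"
    proof (rule ccontr)
      assume "\<not> l > k0"
      then have "\<rho> ^ l \<le> \<rho> ^ k0" using \<rho>(1) by (intro power_increasing) auto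
      then have "C2 * \<rho> ^ l * R \<le> C2 * \<rho> ^ k0 * R" using \<rho>(2) R(1) by (intro mult_right_mono mult_left_mono) auto
      also have "... < 1" using R \<rho> by (simp add: field_simps)
      finally show False using l by simp
    qed
    then obtain k where lk: "l = Suc k" and k: "k \<ge> k0" by (metis less_imp_Suc_add le_add1)
    have "\<not> ?P k" using not_less_Least[of k ?P] lk unfolding l_def by simp
    then have kR: "C2 * \<rho> ^ k * R \<le> 1" by simp
    have Rk: "1 / \<rho> ^ k < a * R" using l \<rho>(1) by (simp add: lk a_def field_simps)
    have \<rho>k: "\<rho> ^ k > 0" using \<rho>(1) by simp
    have "mat_norm (undil M k) \<le> C2 * (1 / \<rho> ^ k)" using \<rho>(5)[of k] by simp
    also have "... \<le> C2 * (a * R)" using Rk \<rho>(2) by (intro mult_left_mono) auto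
    finally have b: "mat_norm (undil M k) powr m \<le> (C2 * a) powr m * R powr m"
      using m R(1) a \<rho>(2) mat_norm_nonneg[of "undil M k"]
      by (subst powr_mult[symmetric]) (auto intro!: powr_mono2 simp: mult.assoc)
    have det: "\<bar>det (dil M k)\<bar> = (\<rho> ^ k) ^ CARD('d)" using det_dil[OF M, of k] \<rho>(3)[of k] by (simp add: dil_eq)
    have "ennreal ((\<rho> ^ k) ^ CARD('d)) * (\<integral>\<^sup>+x. indicator (cball 0 R) x * p x \<partial>lborel)
      \<le> ennreal ((\<rho> ^ k) ^ CARD('d)) * (\<integral>\<^sup>+x. indicator {x. norm (dil M k *v x) \<le> 1} x * p x \<partial>lborel)"
    proof (intro mult_left_mono nn_integral_mono mult_right_mono)
      fix x :: "real ^ 'd"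
      have "norm (dil M k *v x) \<le> 1" if "norm x \<le> R"
      proof -
        have "norm (dil M k *v x) \<le> mat_norm (dil M k) * norm x" by (rule norm_matrix_le)
        also have "... \<le> (C2 * \<rho> ^ k) * R" using \<rho>(2) \<rho>k that by (intro mult_mono \<rho>) auto
        finally show ?thesis using kR by simp
      qed
      then show "indicator (cball 0 R) x \<le> (indicator {x. norm (dil M k *v x) \<le> 1} x :: ennreal)"
        by (simp split: split_indicator)
    qed simp_all
    also have "... \<le> ennreal (e1 * mat_norm (undil M k) powr m)" using k0[OF k] unfolding det .
    finally have "(\<integral>\<^sup>+x. indicator (cball 0 R) x * p x \<partial>lborel) \<le> ennreal (e1 * mat_norm (undil M k) powr m / (\<rho> ^ k) ^ CARD('d))"
      using \<rho>k by (subst (asm) ennreal_mult_le_iff) auto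
    also have "... \<le> ennreal (e * (R powr m * R ^ CARD('d)))"
    proof (rule ennreal_leI)
      have "(1 / \<rho> ^ k) ^ CARD('d) \<le> (a * R) ^ CARD('d)" using Rk \<rho>k by (intro power_mono) auto
      then have "e1 * mat_norm (undil M k) powr m * (1 / \<rho> ^ k) ^ CARD('d) \<le> e1 * ((C2 * a) powr m * R powr m) * (a * R) ^ CARD('d)"
        using e1 b \<rho>k by (intro mult_mono) auto
      also have "... = e * (R powr m * R ^ CARD('d))"
        using a \<rho>(2) by (simp add: e1_def power_mult_distrib)
      finally show "e1 * mat_norm (undil M k) powr m / (\<rho> ^ k) ^ CARD('d) \<le> e * (R powr m * R ^ CARD('d))"
        by (simp add: power_divide)
    qed
    finally show ?thesis .
  qed
  moreover have "1 / (C2 * \<rho> ^ k0) > 0" using \<rho> by simp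
  ultimately show "\<exists>\<delta>>0. \<forall>R. 0 < R \<and> R < \<delta> \<longrightarrow>
     (\<integral>\<^sup>+x. indicator (cball 0 R) x * p x \<partial>lborel) \<le> ennreal (e * (R powr m * R ^ CARD('d)))" by blast
qed

context density
begin

text \<open>At Bt the function f^ is 1, while every other translate of t lies outside the cube and
  is therefore mapped by B beyond radius R, where f^ vanishes. Hence the periodized sample has the
  single term cnj \<phi>'^(t).\<close>

lemma truncated_error:
  assumes w: "\<forall>x. norm x \<le> 1 \<longrightarrow> w x = 1" "\<forall>x. norm x \<ge> R \<longrightarrow> w x = 0" and f: "fourier f = w"
    and k: "\<beta> k < 1 / 2" "\<beta> k * R < 1 / 2" and t: "norm (dil M k *v t) \<le> 1"
  shows "t \<in> unit_cube" "err f k t = cmod (v t)"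
    "l \<noteq> 0 ==> err f k (t + real_vec l) = cmod (ft \<phi> (t + real_vec l)) * cmod (ft \<phi>' t)"
proof -
  let ?b = "\<beta> k" and ?u = "sample \<phi>' f (dil M k)"
  have b: "?b > 0" by (rule norm_dil_bounds(1)[OF M])
  have "norm t \<le> ?b * 1"
    using order_trans[OF norm_dil_bounds(3)[OF M, of t k] mult_left_mono[OF t]] b by simp
  then show cube: "t \<in> unit_cube" using k(1) by (intro small_in_unit_cube) simp
  have zero: "w (dil M k *v (t + real_vec l)) = 0" if "l \<noteq> 0" for l
  proof (rule ccontr)
    assume "w (dil M k *v (t + real_vec l)) \<noteq> 0"
    then have "norm (dil M k *v (t + real_vec l)) \<le> R" using w(2) by (meson linorder_le_cases)
    then have "norm (t + real_vec l) \<le> ?b * R"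
      using order_trans[OF norm_dil_bounds(3)[OF M, of "t + real_vec l" k] mult_left_mono] b by simp
    then have "t + real_vec l \<in> unit_cube" using k(2) by (intro small_in_unit_cube) simp
    with unit_cube_shift[OF cube] that show False by simp
  qed
  have "periodize ?u t = (LINT l|count_space UNIV. indicator {0} l *\<^sub>R ?u (t + real_vec l))"
    unfolding periodize_def
    by (intro Bochner_Integration.integral_cong refl) (simp add: sample_def f zero split: split_indicator)
  also have "... = ?u t" by (subst integral_count_single) simp
  finally have P: "periodize ?u t = cnj (ft \<phi>' t)" using w(1)[rule_format, OF t] by (simp add: sample_def f)
  show "err f k t = cmod (v t)"
    by (simp only: proj_error_def P f w(1)[rule_format, OF t] v_def)
  show "err f k (t + real_vec l) = cmod (ft \<phi> (t + real_vec l)) * cmod (ft \<phi>' t)" if "l \<noteq> 0"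
    by (simp only: proj_error_def periodize_periodic P f zero[OF that]) (simp add: norm_mult)
qed

text \<open>By \<open>truncated_error\<close> the integrand on the left is a lattice sum of squared
  errors at t + l with l \<noteq> 0, and untiling it gives the seminorm of order s alone: away from
  the origin the homogeneous weight dominates the inhomogeneous one.\<close>

lemma truncated_bracket:
  assumes w: "\<forall>x. norm x \<le> 1 \<longrightarrow> w x = 1" "\<forall>x. norm x \<ge> R \<longrightarrow> w x = 0" and f: "fourier f = w" "f \<in> schwartz"
    and k: "\<beta> k < 1 / 2" "\<beta> k * R < 1 / 2"
  shows "(\<integral>\<^sup>+t. indicator {t. norm (dil M k *v t) \<le> 1} t * (\<Phi> t * ennreal ((cmod (ft \<phi>' t))^2)) \<partial>lborel)
    \<le> ennreal ((5 * (\<beta> k)^2) ^ s) *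
      (\<integral>\<^sup>+t. ennreal (norm (dil M k *v t) ^ (2 * s) * (err f k t)^2) \<partial>lborel)"
proof -
  note [measurable] = proj_error_measurable[OF f(2), of k]
  let ?b = "\<beta> k" and ?B = "dil M k" and ?E = "err f k"
  let ?K = "ennreal ((5 * ?b^2) ^ s)"
  let ?h = "\<lambda>x. ?K * ennreal (norm (?B *v x) ^ (2 * s) * (?E x)^2)"
  have b0: "?b > 0" by (rule norm_dil_bounds(1)[OF M])
  have "(\<integral>\<^sup>+t. indicator {t. norm (?B *v t) \<le> 1} t * (\<Phi> t * ennreal ((cmod (ft \<phi>' t))^2)) \<partial>lborel)
    \<le> (\<integral>\<^sup>+t. indicator unit_cube t * (\<integral>\<^sup>+l. ?h (t + real_vec l) \<partial>count_space UNIV) \<partial>lborel)"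
  proof (rule nn_integral_mono)
    fix t :: "real ^ 'd"
    show "indicator {t. norm (?B *v t) \<le> 1} t * (\<Phi> t * ennreal ((cmod (ft \<phi>' t))^2))
      \<le> indicator unit_cube t * (\<integral>\<^sup>+l. ?h (t + real_vec l) \<partial>count_space UNIV)"
    proof (cases "norm (?B *v t) \<le> 1")
      case True
      note E = truncated_error[OF w f(1) k True]
      have "\<Phi> t * ennreal ((cmod (ft \<phi>' t))^2) =
        (\<integral>\<^sup>+l. indicator (- {0}) l * ennreal (wt (t + real_vec l) ^ s * (cmod (ft \<phi> (t + real_vec l)))^2) * ennreal ((cmod (ft \<phi>' t))^2) \<partial>count_space UNIV)"
        unfolding bracket_def by (rule nn_integral_multc[symmetric]) simp
      also have "... \<le> (\<integral>\<^sup>+l. ?h (t + real_vec l) \<partial>count_space UNIV)"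
      proof (rule nn_integral_mono)
        fix l
        let ?x = "t + real_vec l"
        show "indicator (- {0}) l * ennreal (wt ?x ^ s * (cmod (ft \<phi> ?x))^2) * ennreal ((cmod (ft \<phi>' t))^2) \<le> ?h ?x"
        proof (cases "l = 0")
          case False
          \<comment> \<open>Points outside the cube have norm at least 1/2, so 1 \<le> 4 |x|^2 and
            the weight is at most 5 |x|^2; then |x| is at most the norm of B^-1 times |Bx|.\<close>
          have "?x \<notin> unit_cube" using False unit_cube_shift[OF E(1)] by simp
          then have "norm ?x \<ge> 1 / 2" using small_in_unit_cube by (meson not_le)
          then have "(1 / 2)^2 \<le> (norm ?x)^2" by (intro power_mono) auto
          then have "1 + (norm ?x)^2 \<le> 5 * (norm ?x)^2" by (simp add: power2_eq_square)
          also have "(norm ?x)^2 \<le> (?b * norm (?B *v ?x))^2" by (intro power_mono norm_dil_bounds(3)[OF M]) simp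
          finally have "1 + (norm ?x)^2 \<le> 5 * ?b^2 * (norm (?B *v ?x))^2" by (simp add: power_mult_distrib)
          then have "wt ?x ^ s \<le> (5 * ?b^2 * (norm (?B *v ?x))^2) ^ s"
            by (rule power_mono) (simp add: add_nonneg_nonneg)
          also have "... = (5 * ?b^2) ^ s * norm (?B *v ?x) ^ (2 * s)"
            by (simp only: power_mult_distrib[of "5 * ?b^2"] power_mult)
          finally have W: "wt ?x ^ s \<le> (5 * ?b^2) ^ s * norm (?B *v ?x) ^ (2 * s)" .
          have "wt ?x ^ s * (cmod (ft \<phi> ?x))^2 * (cmod (ft \<phi>' t))^2 = wt ?x ^ s * (?E ?x)^2"
            unfolding E(3)[OF False] by (simp add: power_mult_distrib)
          also have "... \<le> (5 * ?b^2) ^ s * norm (?B *v ?x) ^ (2 * s) * (?E ?x)^2" by (rule mult_right_mono[OF W]) simp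
          finally have "ennreal (wt ?x ^ s * (cmod (ft \<phi> ?x))^2 * (cmod (ft \<phi>' t))^2)
            \<le> ennreal ((5 * ?b^2) ^ s * (norm (?B *v ?x) ^ (2 * s) * (?E ?x)^2))"
            by (intro ennreal_leI) (simp only: mult.assoc)
          also have "... = ?h ?x" by (rule ennreal_mult) auto
          also have "ennreal (wt ?x ^ s * (cmod (ft \<phi> ?x))^2 * (cmod (ft \<phi>' t))^2) =
            ennreal (wt ?x ^ s * (cmod (ft \<phi> ?x))^2) * ennreal ((cmod (ft \<phi>' t))^2)"
            by (rule ennreal_mult) (auto simp: add_nonneg_nonneg)
          finally show ?thesis using False by simp
        qed simp
      qed
      finally show ?thesis using True E(1) by simp
    qed simp
  qed
  also have "... = (\<integral>\<^sup>+t. ?h t \<partial>lborel)" by (rule nn_integral_tile[symmetric]) measurable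
  also have "... = ?K * (\<integral>\<^sup>+t. ennreal (norm (?B *v t) ^ (2 * s) * (?E t)^2) \<partial>lborel)"
    by (rule nn_integral_cmult) measurable
  finally show ?thesis .
qed

text \<open>The seminorm with r = 0 gives the first average and the one with r = s the second. In
  the latter the factor |B^-1|^(2s) from \<open>truncated_bracket\<close> is exchanged for the
  normalisation |B|^(-2s), by means of |B^-1| |B| \<le> C2^2.\<close>

lemma necessity_averages:
  assumes iso: "isotropic M" and order: "simultaneous_density_order M \<phi> \<phi>' s n"
  shows "avg_small (2 * n) (\<lambda>t. ennreal ((cmod (v t))^2))"
    and "avg_small (2 * n) (\<lambda>t. \<Phi> t * ennreal ((cmod (ft \<phi>' t))^2))"
proof -
  obtain w :: "real ^ 'd \<Rightarrow> complex" and R where w: "w \<in> schwartz" "\<forall>x. norm x \<le> 1 \<longrightarrow> w x = 1" "\<forall>x. norm x \<ge> R \<longrightarrow> w x = 0"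
    by (rule cutoff_exists[of 1]) (simp, blast)
  \<comment> \<open>A single test function suffices: the one whose Fourier transform is a cutoff
    equal to 1 on the unit ball.\<close>
  define f where "f = inv_fourier w"
  have f: "f \<in> schwartz" "fourier f = w" unfolding f_def by (intro inv_fourier_schwartz fourier_inv_fourier w(1))+
  let ?b = "\<lambda>k. \<beta> k"
  let ?I = "\<lambda>r k. \<integral>\<^sup>+t. ennreal (norm (dil M k *v t) ^ (2 * r) * (err f k t)^2) \<partial>lborel"
  let ?J = "\<lambda>r k. ennreal \<bar>det (dil M k)\<bar> * (ennreal (mat_norm (dil M k) powr (- (2 * real r))) * ?I r k)"
  have b0: "?b k > 0" for k by (rule norm_dil_bounds(1)[OF M])
  have ev: "\<forall>\<^sub>F k in sequentially. ?J r k \<le> ennreal (e * ?b k powr (2 * n))" if r: "r \<le> s" and e: "e > 0" for r e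
  proof -
    have lim: "(\<lambda>k. \<Sum>r=0..s. weighted_error f r k) \<longlonglongrightarrow> 0" using order f(1) unfolding density_order_iff by blast
    have le: "weighted_error f r k \<le> (\<Sum>r=0..s. weighted_error f r k)" for k
      using r weighted_error_nonneg by (intro member_le_sum) auto
    have "(\<lambda>k. weighted_error f r k) \<longlonglongrightarrow> 0"
      by (rule tendsto_sandwich[OF _ _ tendsto_const lim]; intro always_eventually allI weighted_error_nonneg le)
    then have "(\<lambda>k. (weighted_error f r k)^2) \<longlonglongrightarrow> 0^2" by (rule tendsto_power)
    then have "(\<lambda>k. ennreal ((weighted_error f r k)^2)) \<longlonglongrightarrow> 0" by (subst ennreal_tendsto_0_iff) auto
    with e have "\<forall>\<^sub>F k in sequentially. ennreal ((weighted_error f r k)^2) \<le> ennreal e"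
      unfolding ennreal_tendsto_0_iff_eventually_le by blast
    moreover have eq: "ennreal ((weighted_error f r k)^2) = ennreal (1 / ?b k powr (2 * n)) * ?J r k" for k
    proof -
      have eq: "?b k powr (- (2 * n)) = 1 / ?b k powr (2 * n)" by (simp only: powr_minus inverse_eq_divide)
      have "ennreal (1 / ?b k powr (2 * n) * \<bar>det (dil M k)\<bar>) = ennreal (1 / ?b k powr (2 * n)) * ennreal \<bar>det (dil M k)\<bar>"
        by (rule ennreal_mult) auto
      then show ?thesis unfolding weighted_error_square[OF f(1) r] eq by (simp only: mult.assoc)
    qed
    have "ennreal ((weighted_error f r k)^2) \<le> ennreal e \<longleftrightarrow> ?J r k \<le> ennreal (e * ?b k powr (2 * n))" for k
      unfolding eq by (rule ennreal_divide_le_iff) (use b0[of k] in simp)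
    ultimately show ?thesis by simp
  qed
  have small: "\<forall>\<^sub>F k in sequentially. ?b k < 1 / 2 \<and> ?b k * R < 1 / 2"
  proof -
    have "(\<lambda>k. ?b k * R) \<longlonglongrightarrow> 0 * R" by (intro tendsto_mult tendsto_const norm_undil_tendsto_0 M)
    then have "\<forall>\<^sub>F k in sequentially. ?b k * R < 1 / 2" by (rule order_tendstoD(2)) simp
    moreover have "\<forall>\<^sub>F k in sequentially. ?b k < 1 / 2" by (rule order_tendstoD(2)[OF norm_undil_tendsto_0[OF M]]) simp
    ultimately show ?thesis by eventually_elim simp
  qed
  have n0: "2 * n \<ge> 0" using n by simp
  show "avg_small (2 * n) (\<lambda>t. ennreal ((cmod (v t))^2))"
  proof (rule isotropic_average[OF M iso n0])
    fix e :: real assume "e > 0"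
    from ev[OF le0 this] small have "\<forall>\<^sub>F k in sequentially. ennreal \<bar>det (dil M k)\<bar> *
      (\<integral>\<^sup>+x. indicator {x. norm (dil M k *v x) \<le> 1} x * ennreal ((cmod (v x))^2) \<partial>lborel) \<le> ennreal (e * ?b k powr (2 * n))"
    proof (eventually_elim)
      fix k assume "?J 0 k \<le> ennreal (e * ?b k powr (2 * n))" and k: "?b k < 1 / 2 \<and> ?b k * R < 1 / 2"
      have "mat_norm (dil M k) powr 0 = 1" using norm_dil_bounds(2)[OF M, of k] by simp
      then have J: "?J 0 k = ennreal \<bar>det (dil M k)\<bar> * ?I 0 k" by simp
      have "(\<integral>\<^sup>+x. indicator {x. norm (dil M k *v x) \<le> 1} x * ennreal ((cmod (v x))^2) \<partial>lborel) \<le> ?I 0 k"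
      proof (rule nn_integral_mono)
        fix x :: "real ^ 'd"
        show "indicator {x. norm (dil M k *v x) \<le> 1} x * ennreal ((cmod (v x))^2) \<le> ennreal (norm (dil M k *v x) ^ (2 * 0) * (err f k x)^2)"
          using truncated_error(2)[OF w(2,3) f(2), of k x] k by (cases "norm (dil M k *v x) \<le> 1") auto
      qed
      then have "ennreal \<bar>det (dil M k)\<bar> * (\<integral>\<^sup>+x. indicator {x. norm (dil M k *v x) \<le> 1} x * ennreal ((cmod (v x))^2) \<partial>lborel) \<le> ?J 0 k"
        unfolding J by (rule mult_left_mono) simp
      also note \<open>?J 0 k \<le> ennreal (e * ?b k powr (2 * n))\<close>
      finally show "ennreal \<bar>det (dil M k)\<bar> * (\<integral>\<^sup>+x. indicator {x. norm (dil M k *v x) \<le> 1} x * ennreal ((cmod (v x))^2) \<partial>lborel) \<le> ennreal (e * ?b k powr (2 * n))" .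
    qed
    then show "\<exists>k0. \<forall>k\<ge>k0. ennreal \<bar>det (dil M k)\<bar> *
      (\<integral>\<^sup>+x. indicator {x. norm (dil M k *v x) \<le> 1} x * ennreal ((cmod (v x))^2) \<partial>lborel) \<le> ennreal (e * ?b k powr (2 * n))"
      unfolding eventually_sequentially .
  qed
  obtain \<rho> C2 where \<rho>: "\<rho> > 1" "C2 > 0" "\<And>k. mat_norm (dil M k) \<le> C2 * \<rho> ^ k" "\<And>k. ?b k \<le> C2 / \<rho> ^ k"
    by (rule isotropic_bounds[OF M iso]) blast
  define Z where "Z = (5 * (C2 * C2)^2) ^ s"
  have Z: "Z > 0" using \<rho>(2) by (simp add: Z_def)
  have cond: "(5 * (?b k)^2) ^ s \<le> Z * mat_norm (dil M k) powr (- (2 * real s))" for k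
  proof -
    let ?a = "mat_norm (dil M k)"
    have a: "?a > 0" by (rule norm_dil_bounds(2)[OF M])
    have "?b k * ?a \<le> (C2 / \<rho> ^ k) * (C2 * \<rho> ^ k)" using a b0[of k] \<rho> by (intro mult_mono) auto
    also have "... = C2 * C2" using \<rho>(1) by simp
    finally have "(?b k * ?a)^2 \<le> (C2 * C2)^2" using a b0[of k] by (intro power_mono) auto
    then have "5 * (?b k * ?a)^2 \<le> 5 * (C2 * C2)^2" by simp
    then have "(5 * (?b k * ?a)^2) ^ s \<le> Z" unfolding Z_def by (rule power_mono) simp
    moreover have "(5 * (?b k * ?a)^2) ^ s = (5 * (?b k)^2) ^ s * (?a^2) ^ s" by (simp add: power_mult_distrib)
    moreover have "(?a^2) ^ s = ?a powr (2 * real s)"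
      using powr_realpow[OF a, of "2 * s"] by (simp add: power_mult)
    ultimately have "(5 * (?b k)^2) ^ s * ?a powr (2 * real s) * ?a powr (- (2 * real s)) \<le> Z * ?a powr (- (2 * real s))"
      by (intro mult_right_mono) auto
    moreover have "?a powr (2 * real s) * ?a powr (- (2 * real s)) = 1" using a by (simp add: powr_minus)
    ultimately show ?thesis by (simp only: mult.assoc mult_1_right)
  qed
  show "avg_small (2 * n) (\<lambda>t. \<Phi> t * ennreal ((cmod (ft \<phi>' t))^2))"
  proof (rule isotropic_average[OF M iso n0])
    fix e :: real assume "e > 0"
    then have "e / Z > 0" using Z by simp
    let ?L = "\<lambda>k. \<integral>\<^sup>+x. indicator {x. norm (dil M k *v x) \<le> 1} x * (\<Phi> x * ennreal ((cmod (ft \<phi>' x))^2)) \<partial>lborel"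
    from ev[OF order_refl \<open>e / Z > 0\<close>] small
    have "\<forall>\<^sub>F k in sequentially. ennreal \<bar>det (dil M k)\<bar> * ?L k \<le> ennreal (e * ?b k powr (2 * n))"
    proof (eventually_elim)
      fix k assume J: "?J s k \<le> ennreal (e / Z * ?b k powr (2 * n))" and k: "?b k < 1 / 2 \<and> ?b k * R < 1 / 2"
      have "?L k \<le> ennreal ((5 * (?b k)^2) ^ s) * ?I s k"
        using truncated_bracket[OF w(2,3) f(2,1), of k] k by blast
      also have "... \<le> ennreal (Z * mat_norm (dil M k) powr (- (2 * real s))) * ?I s k"
        by (intro mult_right_mono ennreal_leI cond) simp
      finally have "ennreal \<bar>det (dil M k)\<bar> * ?L k \<le> ennreal \<bar>det (dil M k)\<bar> * (ennreal (Z * mat_norm (dil M k) powr (- (2 * real s))) * ?I s k)"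
        by (rule mult_left_mono) simp
      also have "... = ennreal Z * ?J s k" using Z by (simp add: ennreal_mult mult_ac)
      also have "... \<le> ennreal Z * ennreal (e / Z * ?b k powr (2 * n))" by (rule mult_left_mono[OF J]) simp
      also have "... = ennreal (e * ?b k powr (2 * n))" using Z \<open>e > 0\<close> by (simp add: ennreal_mult[symmetric])
      finally show "ennreal \<bar>det (dil M k)\<bar> * ?L k \<le> ennreal (e * ?b k powr (2 * n))" .
    qed
    then show "\<exists>k0. \<forall>k\<ge>k0. ennreal \<bar>det (dil M k)\<bar> * ?L k \<le> ennreal (e * ?b k powr (2 * n))"
      unfolding eventually_sequentially .
  qed
qed

text \<open>Since \<open>v\<close> only grows slowly, it is multiplied by a cutoff equal to 1 on the
  ball of radius N + 1, which contains all points t + i h; the product is Schwartz and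
  \<open>fd_bound\<close> applies.\<close>

lemma difference_inequality_v:
  obtains K where "K \<ge> 0" "\<And>t h. norm t \<le> 1 ==> norm h \<le> 1 ==>
    ennreal ((cmod (v t))^2) \<le> ennreal K * ((\<Sum>i=1..N. ennreal ((cmod (v (t + real i *\<^sub>R h)))^2)) + ennreal (norm h ^ (2 * N)))"
proof -
  obtain w :: "real ^ 'd \<Rightarrow> complex" where w: "w \<in> schwartz" "\<And>x. norm x \<le> real N + 1 ==> w x = 1"
    by (rule cutoff_exists[of "real N + 1"]) (simp, blast)
  define g where "g x = w x * v x" for x
  have "g \<in> schwartz" unfolding g_def[abs_def] by (intro schwartz_mult_slow w slow)
  then obtain C where C: "C \<ge> 0" "\<And>h x. norm h \<le> 1 ==> cmod (fd N h g x) \<le> C * norm h ^ N"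
    using fd_bound[of g N 0] by auto
  show thesis
  proof
    show "10 ^ N * (C^2 + 1) \<ge> 0" by simp
    fix t h :: "real ^ 'd" assume th: "norm t \<le> 1" "norm h \<le> 1"
    have g: "g (t + real i *\<^sub>R h) = v (t + real i *\<^sub>R h)" if "i \<le> N" for i
    proof -
      have "norm (t + real i *\<^sub>R h) \<le> norm t + real i * norm h" using norm_triangle_ineq[of t "real i *\<^sub>R h"] by simp
      also have "... \<le> 1 + real N * 1" using th that by (intro add_mono mult_mono) auto
      finally show ?thesis by (simp add: g_def w(2))
    qed
    have S: "(\<Sum>i=1..N. (cmod (g (t + real i *\<^sub>R h)))^2) = (\<Sum>i=1..N. (cmod (v (t + real i *\<^sub>R h)))^2)"
      by (intro sum.cong refl) (simp add: g)
    let ?S = "\<Sum>i=1..N. (cmod (v (t + real i *\<^sub>R h)))^2"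
    have S0: "?S \<ge> 0" by (intro sum_nonneg) simp
    have "(cmod (v t))^2 \<le> 10 ^ N * ((cmod (fd N h g t))^2 + ?S)"
      using fd_square_bound[of g t N h] g[of 0] unfolding S by simp
    also have "(cmod (fd N h g t))^2 \<le> C^2 * norm h ^ (2 * N)"
      using power_mono[OF C(2)[OF th(2), of t], of 2] by (simp add: power_mult_distrib power_mult[symmetric] mult.commute)
    also have "C^2 * norm h ^ (2 * N) + ?S \<le> (C^2 + 1) * (?S + norm h ^ (2 * N))"
      using S0 by (simp add: algebra_simps add_nonneg_nonneg)
    finally have "(cmod (v t))^2 \<le> 10 ^ N * (C^2 + 1) * (?S + norm h ^ (2 * N))" by (simp add: mult.assoc)
    then have "ennreal ((cmod (v t))^2) \<le> ennreal (10 ^ N * (C^2 + 1) * (?S + norm h ^ (2 * N)))" by (rule ennreal_leI)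
    also have "... = ennreal (10 ^ N * (C^2 + 1)) * (ennreal ?S + ennreal (norm h ^ (2 * N)))"
      using S0 by (subst ennreal_mult) auto
    also have "ennreal ?S = (\<Sum>i=1..N. ennreal ((cmod (v (t + real i *\<^sub>R h)))^2))" by (rule sum_ennreal[symmetric]) simp
    finally show "ennreal ((cmod (v t))^2) \<le> ennreal (10 ^ N * (C^2 + 1)) *
      ((\<Sum>i=1..N. ennreal ((cmod (v (t + real i *\<^sub>R h)))^2)) + ennreal (norm h ^ (2 * N)))" .
  qed
qed

text \<open>The difference estimate for \<phi>^ is uniform in t and S, so it combines directly with
  \<open>bracket_fd_bound\<close>.\<close>

lemma difference_inequality_bracket:
  obtains K where "K \<ge> 0" "\<And>S t h. norm h \<le> 1 ==>
    bracket S s (ft \<phi>) t \<le> ennreal K * ((\<Sum>i=1..N. bracket S s (ft \<phi>) (t + real i *\<^sub>R h)) + ennreal (norm h ^ (2 * N)))"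
proof -
  obtain D where D: "D \<ge> 0" "\<And>S t h. norm h \<le> 1 ==> bracket S s (fd N h (ft \<phi>)) t \<le> ennreal (D * (norm h ^ N)^2)"
    by (rule bracket_fd_decay) blast
  let ?P = "10 ^ N * (2 * (1 + (real N)^2)) ^ s"
  have P: "?P \<ge> 0" by (simp add: add_nonneg_nonneg)
  show thesis
  proof
    show "?P * (D + 1) \<ge> 0" using P D(1) by simp
    fix S t and h :: "real ^ 'd" assume h: "norm h \<le> 1"
    let ?S = "\<Sum>i=1..N. bracket S s (ft \<phi>) (t + real i *\<^sub>R h)"
    have "bracket S s (ft \<phi>) t \<le> ennreal ?P * (bracket S s (fd N h (ft \<phi>)) t + ?S)" by (rule bracket_fd_bound[OF h])
    also have "... \<le> ennreal ?P * (ennreal (D + 1) * ennreal (norm h ^ (2 * N)) + ennreal (D + 1) * ?S)"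
    proof (intro mult_left_mono add_mono)
      have "bracket S s (fd N h (ft \<phi>)) t \<le> ennreal (D * (norm h ^ N)^2)" by (rule D(2)[OF h])
      also have "... \<le> ennreal ((D + 1) * norm h ^ (2 * N))"
        by (intro ennreal_leI) (simp add: power_mult[symmetric] mult.commute algebra_simps)
      finally show "bracket S s (fd N h (ft \<phi>)) t \<le> ennreal (D + 1) * ennreal (norm h ^ (2 * N))"
        using D(1) by (simp add: ennreal_mult)
      have "1 * ?S \<le> ennreal (D + 1) * ?S" using D(1) by (intro mult_right_mono) auto
      then show "?S \<le> ennreal (D + 1) * ?S" by simp
    qed simp
    also have "... = ennreal (?P * (D + 1)) * (?S + ennreal (norm h ^ (2 * N)))"
      using P D(1) by (simp only: ennreal_mult[of ?P "D + 1"] add_nonneg_nonneg zero_le_one) (simp only: distrib_left distrib_right mult_ac add_ac)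
    finally show "bracket S s (ft \<phi>) t \<le> ennreal (?P * (D + 1)) * (?S + ennreal (norm h ^ (2 * N)))" .
  qed
qed

lemma necessity:
  assumes iso: "isotropic M" and order: "simultaneous_density_order M \<phi> \<phi>' s n"
  shows "origin_conditions \<phi> \<phi>' s n"
proof -
  \<comment> \<open>The added 1 makes N > n strict for integral n as well, so that |h|^(2N) is
    negligible against |t|^(2n).\<close>
  define N where "N = nat \<lceil>n\<rceil> + 1"
  have n0: "n \<ge> 0" "2 * n \<ge> 0" using n by simp_all
  have N: "2 * n < 2 * real N" unfolding N_def using real_nat_ceiling_ge[of n] by simp
  note A = necessity_averages[OF iso order]
  obtain K where "K \<ge> 0" "\<And>t h. norm t \<le> 1 ==> norm h \<le> 1 ==>
    ennreal ((cmod (v t))^2) \<le> ennreal K * ((\<Sum>i=1..N. ennreal ((cmod (v (t + real i *\<^sub>R h)))^2)) + ennreal (norm h ^ (2 * N)))"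
    by (rule difference_inequality_v) blast
  from little_o_of_average[OF _ n0(2) N this A(1)]
  have sq: "little_o (2 * n) (\<lambda>t. ennreal ((cmod (v t))^2))" by measurable
  have v: "little_o n (\<lambda>t. ennreal (cmod (v t)))"
    unfolding little_o_def
  proof (intro allI impI)
    fix e :: real assume e: "e > 0"
    then have "e^2 > 0" by simp
    then obtain \<delta> where \<delta>: "\<delta> > 0" "\<And>x. x \<noteq> 0 ==> norm x < \<delta> ==> ennreal ((cmod (v x))^2) \<le> ennreal (e^2 * norm x powr (2 * n))"
      using sq unfolding little_o_def by blast
    have "ennreal (cmod (v x)) \<le> ennreal (e * norm x powr n)" if "x \<noteq> 0" "norm x < \<delta>" for x
    proof (rule ennreal_leI)
      have "(cmod (v x))^2 \<le> e^2 * norm x powr (2 * n)" using \<delta>(2)[OF that] by (simp add: ennreal_le_iff)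
      also have "... = (e * norm x powr n)^2" by (simp add: power2_eq_square powr_add[symmetric])
      finally show "cmod (v x) \<le> e * norm x powr n" by (rule power2_le_imp_le) (use e in simp)
    qed
    then show "\<exists>\<delta>>0. \<forall>x. x \<noteq> 0 \<and> norm x < \<delta> \<longrightarrow> ennreal (cmod (v x)) \<le> ennreal (e * norm x powr n)" using \<delta>(1) by blast
  qed
  \<comment> \<open>\<open>little_o\<close> says nothing at the origin itself; continuity of
    \<open>v\<close> supplies the value there, also when n = 0.\<close>
  have "v 0 = 0"
  proof (rule ccontr)
    assume "v 0 \<noteq> 0"
    then have e: "cmod (v 0) / 2 > 0" by simp
    then obtain \<delta> where \<delta>: "\<delta> > 0" "\<And>x. x \<noteq> 0 ==> norm x < \<delta> ==> ennreal (cmod (v x)) \<le> ennreal (cmod (v 0) / 2 * norm x powr n)"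
      using v unfolding little_o_def by blast
    have "cmod (v x) \<le> cmod (v 0) / 2" if x: "x \<noteq> 0" "norm x < min \<delta> 1" for x
    proof -
      have "cmod (v x) \<le> cmod (v 0) / 2 * norm x powr n" using \<delta>(2)[of x] x by (simp add: ennreal_le_iff)
      also have "... \<le> cmod (v 0) / 2 * 1" using x n0 by (intro mult_left_mono powr_le1) auto
      finally show ?thesis by simp
    qed
    then have "\<forall>\<^sub>F x in at 0. cmod (v x) \<le> cmod (v 0) / 2"
      unfolding eventually_at using \<delta>(1) by (intro exI[of _ "min \<delta> 1"]) auto
    moreover have "((\<lambda>x. cmod (v x)) \<longlongrightarrow> cmod (v 0)) (at 0)"
      using smooth_continuous[OF slow_smooth[OF slow(3)], of UNIV]
      by (intro tendsto_norm) (simp add: continuous_on_eq_continuous_at isCont_def)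
    ultimately have "cmod (v 0) \<le> cmod (v 0) / 2" by (intro tendsto_upperbound) auto
    with e show False by simp
  qed
  \<comment> \<open>Now \<phi>^(0) cnj \<phi>'^(0) = 1, so |\<phi>'^| is bounded below by a positive
    \<open>c0\<close> near 0 and can be removed from the second average.\<close>
  then have b0: "ft \<phi>' 0 \<noteq> 0" by (auto simp: v_def)
  define c0 where "c0 = cmod (ft \<phi>' 0) / 2"
  have c0: "c0 > 0" using b0 by (simp add: c0_def)
  have "isCont (ft \<phi>') 0"
    using smooth_continuous[OF slow_smooth[OF slow(2)], of UNIV] by (simp add: continuous_on_eq_continuous_at)
  then obtain \<delta>0 where \<delta>0: "\<delta>0 > 0" "\<And>x. norm x < \<delta>0 ==> cmod (ft \<phi>' x - ft \<phi>' 0) < c0"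
    using c0 unfolding continuous_at_eps_delta dist_norm by (metis diff_zero)
  have lower: "c0 \<le> cmod (ft \<phi>' x)" if "norm x < \<delta>0" for x
    using \<delta>0(2)[OF that] norm_triangle_ineq3[of "ft \<phi>' x" "ft \<phi>' 0"] unfolding c0_def by linarith
  have meas [measurable]: "\<Phi> \<in> borel_measurable borel" by measurable
  then have [measurable]: "\<Phi> \<in> borel_measurable lborel" by simp
  have [measurable]: "cball (0 :: real ^ 'd) r \<in> sets borel" for r by simp
  have "avg_small (2 * n) (\<Phi>)"
    unfolding avg_small_def
  proof (intro allI impI)
    fix e :: real assume "e > 0"
    then have "e * c0^2 > 0" using c0 by simp
    then obtain \<delta> where \<delta>: "\<delta> > 0" "\<And>R. 0 < R ==> R < \<delta> ==>
      (\<integral>\<^sup>+x. indicator (cball 0 R) x * (\<Phi> x * ennreal ((cmod (ft \<phi>' x))^2)) \<partial>lborel)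
        \<le> ennreal (e * c0^2 * (R powr (2 * n) * R ^ CARD('d)))"
      using A(2) unfolding avg_small_def by blast
    have "(\<integral>\<^sup>+x. indicator (cball 0 R) x * \<Phi> x \<partial>lborel) \<le> ennreal (e * (R powr (2 * n) * R ^ CARD('d)))"
      if R: "0 < R" "R < min \<delta> \<delta>0" for R
    proof -
      have "ennreal (c0^2) * (\<integral>\<^sup>+x. indicator (cball 0 R) x * \<Phi> x \<partial>lborel)
        = (\<integral>\<^sup>+x. ennreal (c0^2) * (indicator (cball 0 R) x * \<Phi> x) \<partial>lborel)"
        by (rule nn_integral_cmult[symmetric]) measurable
      also have "... \<le> (\<integral>\<^sup>+x. indicator (cball 0 R) x * (\<Phi> x * ennreal ((cmod (ft \<phi>' x))^2)) \<partial>lborel)"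
      proof (rule nn_integral_mono)
        fix x :: "real ^ 'd"
        show "ennreal (c0^2) * (indicator (cball 0 R) x * \<Phi> x) \<le> indicator (cball 0 R) x * (\<Phi> x * ennreal ((cmod (ft \<phi>' x))^2))"
        proof (cases "x \<in> cball 0 R")
          case True
          then have "c0^2 \<le> (cmod (ft \<phi>' x))^2" using R c0 by (intro power_mono lower) auto
          then have "\<Phi> x * ennreal (c0^2) \<le> \<Phi> x * ennreal ((cmod (ft \<phi>' x))^2)"
            by (intro mult_left_mono ennreal_leI) auto
          then show ?thesis using True by (simp add: mult.commute)
        qed simp
      qed
      also have "... \<le> ennreal (e * c0^2 * (R powr (2 * n) * R ^ CARD('d)))" using R by (intro \<delta>(2)) auto
      finally show ?thesis using c0 by (subst (asm) ennreal_mult_le_iff) auto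
    qed
    then show "\<exists>\<delta>>0. \<forall>R. 0 < R \<and> R < \<delta> \<longrightarrow> (\<integral>\<^sup>+x. indicator (cball 0 R) x * \<Phi> x \<partial>lborel) \<le> ennreal (e * (R powr (2 * n) * R ^ CARD('d)))"
      using \<delta>(1) \<delta>0(1) by (intro exI[of _ "min \<delta> \<delta>0"]) auto
  qed
  moreover obtain K where "K \<ge> 0" "\<And>S t h. norm h \<le> 1 ==>
    bracket S s (ft \<phi>) t \<le> ennreal K * ((\<Sum>i=1..N. bracket S s (ft \<phi>) (t + real i *\<^sub>R h)) + ennreal (norm h ^ (2 * N)))"
    by (rule difference_inequality_bracket) blast
  moreover note meas
  ultimately have "little_o (2 * n) (\<Phi>)"
    using little_o_of_average[of "\<Phi>" "2 * n" N K] n0(2) N by blast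
  with v show ?thesis unfolding origin_conditions_iff v_def by simp
qed

end

theorem theorem3p6:
  fixes M :: "int ^ 'd ^ 'd" and s :: nat and n :: real and \<phi> \<phi>' :: "'d distr"
  assumes "dilation_matrix M"
    and "\<phi> \<in> sobolev (real s)" and "\<phi>' \<in> sobolev (- real s)"
    and "compact (distr_support \<phi>)" and "compact (distr_support \<phi>')"
    and "n \<ge> real s"
  shows "(origin_conditions \<phi> \<phi>' s n \<longrightarrow> simultaneous_density_order M \<phi> \<phi>' s n) \<and>
         (isotropic M \<longrightarrow>
            (simultaneous_density_order M \<phi> \<phi>' s n \<longleftrightarrow> origin_conditions \<phi> \<phi>' s n))"
proof -
  interpret density M s n \<phi> \<phi>' by unfold_locales (fact assms)+
  show ?thesis using sufficiency necessity by blast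
qed

end
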